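(* Let $((\mathbf A_t,\mathbf B_t))_{t\in\mathbb Z}$ be an i.i.d. sequence with $$\mathbf A_t=\begin{pmatrix}A_{1,t}&A_{2,t}\\ 0&A_{4,t}\end{pmatrix},\qquad \mathbf B_t=\begin{pmatrix}B_{1,t}\\ B_{2,t}\end{pmatrix},$$ where $A_{1,t},A_{2,t},A_{4,t},B_{1,t},B_{2,t}>0$ a.s. Write $A_i,B_i$ for generic copies of $A_{i,t},B_{i,t}$. Assume that $\log A_1$ and $\log A_4$ are non-arithmetic and that there exist $\alpha_1>\alpha_2>0$ with $$\mathbb E A_1^{\alpha_1}=1,\quad \mathbb E A_1^{\alpha_1}\log^+A_1<\infty,\quad \mathbb E B_1^{\alpha_1}<\infty,$$ $$\mathbb E A_4^{\alpha_2}=1,\quad \mathbb E A_4^{\alpha_2}\log^+A_4<\infty,\quad \mathbb E B_2^{\alpha_2}<\infty,$$ and $\mathbb E A_2^{\alpha_2}<\infty$. Let $\mathbf W_t=(W_{1,t},W_{2,t})'$, $t\in\mathbb Z$, be the strictly stationary causal solution of $\mathbf W_t=\mathbf A_t\mathbf W_{t-1}+\mathbf B_t$. Then the bivariate strictly stationary series $(\mathbf W_t)$ is regularly varying with index $\alpha_2$ (in the time series sense defined in the context), and for every $h\ge1$, as $x\to\infty$, $$\mathbb P\big(x^{-1}(\mathbf W_1,\dots,\mathbf W_h)\in\cdot\ \big|\ |\mathbf W_0|>x\big)\ \xrightarrow{w}\ \mathbb P\big(Y(\boldsymbol\Pi_1\boldsymbol\Theta_0,\dots,\boldsymbol\Pi_h\boldsymbol\Theta_0)\in\cdot\big),$$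 where $\boldsymbol\Pi_t=\mathbf A_t\cdots\mathbf A_1$, $\mathbb P(Y>x)=x^{-\alpha_2}$ for $x>1$, $Y$ is independent of $(\boldsymbol\Theta_0,\boldsymbol\Pi_1,\dots,\boldsymbol\Pi_h)$, the distribution of $\boldsymbol\Theta_0$ is the spectral measure of $\mathbf W_0$, and $\boldsymbol\Theta_0$ and $(\boldsymbol\Pi_1,\dots,\boldsymbol\Pi_h)$ are independent.
   Context: The strictly stationary causal solution is the a.s. unique one, $\mathbf W_t=\sum_{i=-\infty}^t\boldsymbol\Pi_{t,i+1}\mathbf B_i$, where $\boldsymbol\Pi_{t,s}=\mathbf A_t\cdots\mathbf A_s$ for $t\ge s$ and the identity for $t<s$ (the series converges a.s. under the hypotheses). $|\cdot|$ is the Euclidean norm, $\log^+x=\max(\log x,0)$, and $\xrightarrow{w}$ is weak convergence. A random variable is non-arithmetic if its law is not supported on $h\mathbb Z$ for any $h\ge0$. Regular variation of a time series: an $\mathbb R^d$-valued strictly stationary series $(\mathbf X_t)$ is regularly varying with index $\alpha>0$ if for every $h\ge0$ there is a random vector $(\mathbf Y_0,\dots,\mathbf Y_h)$ with $$\mathbb P(x^{-1}(\mathbf X_0,\dots,\mathbf X_h)\in\cdot\mid|\mathbf X_0|>x)\xrightarrow{w}\mathbb P((\mathbf Y_0,\dots,\mathbf Y_h)\in\cdot),\quad x\to\infty,$$ where $(\mathbf Y_0,\dots,\mathbf Y_h)$ has the same law as $|\mathbf Y_0|(\boldsymbol\Theta_0,\dots,\boldsymbol\Theta_h)$, with $\mathbb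 P(|\mathbf Y_0|>y)=y^{-\alpha}$ for $y>1$ and $|\mathbf Y_0|$ independent of $(\boldsymbol\Theta_0,\dots,\boldsymbol\Theta_h)$. The law of $\boldsymbol\Theta_0$ (on the unit sphere) is called the spectral measure of $\mathbf X_0$; equivalently, it is the weak limit of $\mathbb P(\mathbf X_0/|\mathbf X_0|\in\cdot\mid|\mathbf X_0|>x)$ as $x\to\infty$. *)

theory Defs
  imports "HOL-Probability.Probability"
begin

definition iid :: "'a measure \<Rightarrow> ('i \<Rightarrow> 'a \<Rightarrow> 'b::topological_space) \<Rightarrow> bool" where
  "iid M X \<longleftrightarrow> prob_space.indep_vars M (\<lambda>_. borel) X UNIV \<and>
     (\<forall>s t. distr M borel (X s) = distr M borel (X t))"

definition strictly_stationary :: "'a measure \<Rightarrow> (int \<Rightarrow> 'a \<Rightarrow> 'v::topological_space) \<Rightarrow> bool" where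
  "strictly_stationary M X \<longleftrightarrow> (\<forall>t. X t \<in> borel_measurable M) \<and>
     (\<forall>I k. finite I \<longrightarrow>
        distr M (\<Pi>\<^sub>M i\<in>I. borel) (\<lambda>\<omega>. \<lambda>i\<in>I. X (i + k) \<omega>) =
        distr M (\<Pi>\<^sub>M i\<in>I. borel) (\<lambda>\<omega>. \<lambda>i\<in>I. X i \<omega>))"

text \<open>The value h = 0 is allowed, so a variable that vanishes almost surely is arithmetic.\<close>

definition non_arithmetic :: "'a measure \<Rightarrow> ('a \<Rightarrow> real) \<Rightarrow> bool" where
  "non_arithmetic M X \<longleftrightarrow>
     (\<forall>h\<ge>0. \<not> (AE x in distr M borel X. x \<in> range (\<lambda>k::int. h * of_int k)))"

text \<open>Weak convergence, along an arbitrary filter, of measures carried by the topological subspace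
  \<open>space \<nu>\<close>. For \<open>\<nu>\<close> on a finite product \<open>\<Pi>\<^sub>M i\<in>I. borel\<close> the functions in \<open>space \<nu>\<close> are
  constant outside \<open>I\<close>, so the subspace topology inherited from the function type is the product
  topology over \<open>I\<close>; vectors of varying length are represented in this way.\<close>

definition weakly_converges ::
    "('b \<Rightarrow> 'c::topological_space measure) \<Rightarrow> 'c measure \<Rightarrow> 'b filter \<Rightarrow> bool" where
  "weakly_converges \<mu> \<nu> F \<longleftrightarrow>
     (\<forall>f :: 'c \<Rightarrow> real. continuous_on (space \<nu>) f \<and> bounded (f ` space \<nu>) \<longrightarrow>
        ((\<lambda>x. \<integral>y. f y \<partial>\<mu> x) \<longlongrightarrow> (\<integral>y. f y \<partial>\<nu>)) F)"

text \<open>The law \<open>P(x\<^sup>-\<^sup>1 (X\<^sub>i)\<^sub>i\<^sub>\<in>\<^sub>I \<in> \<cdot> | |X\<^sub>0| > x)\<close>.\<close>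

definition exceedance_law ::
    "'a measure \<Rightarrow> (int \<Rightarrow> 'a \<Rightarrow> 'v::euclidean_space) \<Rightarrow> nat set \<Rightarrow> real \<Rightarrow> (nat \<Rightarrow> 'v) measure" where
  "exceedance_law M X I x =
     distr (uniform_measure M {\<omega> \<in> space M. norm (X 0 \<omega>) > x})
       (\<Pi>\<^sub>M i\<in>I. borel) (\<lambda>\<omega>. \<lambda>i\<in>I. inverse x *\<^sub>R X (int i) \<omega>)"

definition pareto_law :: "real \<Rightarrow> real measure \<Rightarrow> bool" where
  "pareto_law \<alpha> \<rho> \<longleftrightarrow> real_distribution \<rho> \<and> (\<forall>x>1. measure \<rho> {x<..} = x powr (- \<alpha>))"

text \<open>\<open>\<tau>\<close> is the law of \<open>(\<Theta>\<^sub>0, \<dots>, \<Theta>\<^sub>h)\<close> and \<open>\<nu>\<close> that of \<open>(Y\<^sub>0, \<dots>, Y\<^sub>h)\<close>; the last conjunct says that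
  the latter has the same law as \<open>|Y\<^sub>0| (\<Theta>\<^sub>0, \<dots>, \<Theta>\<^sub>h)\<close> with independent factors.\<close>

definition spectral_process_law ::
    "'a measure \<Rightarrow> (int \<Rightarrow> 'a \<Rightarrow> 'v::euclidean_space) \<Rightarrow> real \<Rightarrow> nat \<Rightarrow> (nat \<Rightarrow> 'v) measure \<Rightarrow> bool" where
  "spectral_process_law M X \<alpha> h \<tau> \<longleftrightarrow>
     prob_space \<tau> \<and> sets \<tau> = sets (\<Pi>\<^sub>M i\<in>{..h}. borel) \<and> (AE \<theta> in \<tau>. norm (\<theta> 0) = 1) \<and>
     (\<exists>\<nu>. prob_space \<nu> \<and> sets \<nu> = sets (\<Pi>\<^sub>M i\<in>{..h}. borel) \<and>
        weakly_converges (exceedance_law M X {..h}) \<nu> at_top \<and>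
        pareto_law \<alpha> (distr \<nu> borel (\<lambda>y. norm (y 0))) \<and>
        \<nu> = distr (distr \<nu> borel (\<lambda>y. norm (y 0)) \<Otimes>\<^sub>M \<tau>) (\<Pi>\<^sub>M i\<in>{..h}. borel)
              (\<lambda>(r, \<theta>). \<lambda>i\<in>{..h}. r *\<^sub>R \<theta> i))"

definition regularly_varying ::
    "'a measure \<Rightarrow> (int \<Rightarrow> 'a \<Rightarrow> 'v::euclidean_space) \<Rightarrow> real \<Rightarrow> bool" where
  "regularly_varying M X \<alpha> \<longleftrightarrow>
     strictly_stationary M X \<and> \<alpha> > 0 \<and> (\<forall>h. \<exists>\<tau>. spectral_process_law M X \<alpha> h \<tau>)"

text \<open>\<open>\<sigma>\<close> is the law of \<open>\<Theta>\<^sub>0\<close>. It is uniquely determined, but is kept as a relation to avoid a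
  choice operator.\<close>

definition spectral_measure ::
    "'a measure \<Rightarrow> (int \<Rightarrow> 'a \<Rightarrow> 'v::euclidean_space) \<Rightarrow> real \<Rightarrow> 'v measure \<Rightarrow> bool" where
  "spectral_measure M X \<alpha> \<sigma> \<longleftrightarrow>
     (\<exists>\<tau>. spectral_process_law M X \<alpha> 0 \<tau> \<and> \<sigma> = distr \<tau> borel (\<lambda>\<theta>. \<theta> 0))"

text \<open>\<open>\<Pi>\<^sub>t\<^sub>,\<^sub>s = A\<^sub>t \<cdots> A\<^sub>s\<close>, the identity for t < s.\<close>

definition matprod :: "(int \<Rightarrow> real^'n^'n) \<Rightarrow> int \<Rightarrow> int \<Rightarrow> real^'n^'n" where
  "matprod A t s = foldr (\<lambda>i P. A i ** P) (rev [s..t]) (mat 1)"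

text \<open>The series runs over the indices i = t - n. Its almost sure convergence is not assumed here.\<close>

definition causal_solution ::
    "'a measure \<Rightarrow> (int \<Rightarrow> 'a \<Rightarrow> real^'n^'n) \<Rightarrow> (int \<Rightarrow> 'a \<Rightarrow> real^'n) \<Rightarrow> (int \<Rightarrow> 'a \<Rightarrow> real^'n) \<Rightarrow> bool" where
  "causal_solution M A B W \<longleftrightarrow>
     (\<forall>t. W t \<in> borel_measurable M) \<and>
     (\<forall>t. AE \<omega> in M. W t \<omega> = A t \<omega> *v W (t - 1) \<omega> + B t \<omega>) \<and>
     (\<forall>t. AE \<omega> in M. W t \<omega> =
        (\<Sum>n. matprod (\<lambda>i. A i \<omega>) t (t - int n + 1) *v B (t - int n) \<omega>))"

end

theory Submission
  imports Defs
begin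

text \<open>Iterating the recursion gives \<open>W\<^sub>n = \<Pi>\<^sub>n W\<^sub>0 + rest\<^sub>n\<close> with \<open>(\<Pi>\<^sub>n, rest\<^sub>n)\<close> independent of \<open>W\<^sub>0\<close>. The second
  coordinate \<open>R\<close> is a one-dimensional perpetuity; by Goldie's implicit renewal argument its tail, multiplied by
  \<open>x\<^sup>\<alpha>\<close> and read on a logarithmic scale, solves a renewal equation for the exponentially tilted law of \<open>ln A\<^sub>4\<close>, whence
  \<open>P(R > x) \<sim> c x\<^sup>-\<^sup>\<alpha>\<close>. Since \<open>E A\<^sub>1\<^sup>\<alpha> = \<kappa> < 1\<close>, the vector \<open>W\<^sub>n\<close> is \<open>R\<close> times the second column of \<open>\<Pi>\<^sub>n\<close> up to an
  error with tail of order \<open>\<kappa>\<^sup>n x\<^sup>-\<^sup>\<alpha>\<close>. Breiman's argument describes the limit measure of this product for fixed \<open>n\<close>, and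
  Helly's selection theorem applied to the directions of the columns yields the spectral measure as \<open>n \<rightarrow> \<infinity>\<close>.
  The coefficients at positive times are independent of \<open>W\<^sub>0\<close>, so the limit of \<open>W\<^sub>0\<close> given \<open>|W\<^sub>0| > x\<close> determines that
  of the whole path, the terms \<open>rest\<^sub>n / x\<close> being negligible.\<close>

section \<open>A renewal theorem on the line\<close>

text \<open>The forcing term \<open>\<psi>\<close> is only known to be integrable, which is too weak
  for a pointwise key renewal theorem. Pointwise convergence is rescued by \<open>G_mono\<close>:
  \<open>G\<close> is an increasing exponential times a nonincreasing tail, so limits of its
  integrals over short windows pin down its values. Window integrals are Lipschitz, and for them the
  limit follows from a Choquet-Deny type argument on increments, which is where the nonarithmetic
  step law enters. The application takes \<beta> = \<alpha>, \<delta> = \<alpha> - s and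
  \<open>K\<close> from a tail bound of order s < \<alpha>; the strict inequality E a^s < 1 becomes
  \<open>exp_less\<close> and gives the steps a positive mean. In the plane the obstacle is the
  order of limits: x tends to infinity for fixed \<open>n\<close>, then \<open>n\<close> tends to
  infinity along a subsequence. This yields a genuine limit in x because the tail of
  \<open>W\<^sub>0\<close> does not involve \<open>n\<close>. The second column of
  \<open>\<Pi>\<^sub>n\<close> has \<alpha>-moment at least 1, which keeps mass in the limit, and
  nonnegativity of all entries bounds this mass from above.\<close>

locale renewal =
  fixes F :: "real measure" and G \<psi> :: "real \<Rightarrow> real" and \<beta> \<delta> K :: real
  assumes F: "real_distribution F"
    and G_meas [measurable]: "G \<in> borel_measurable borel"
    and \<psi>_meas [measurable]: "\<psi> \<in> borel_measurable borel"
    and G_nonneg: "\<And>t. 0 \<le> G t" and \<psi>_nonneg: "\<And>t. 0 \<le> \<psi> t"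
    and G_int: "\<And>t. integrable F (\<lambda>s. G (t - s))"
    and G_eq: "\<And>t. G t = (\<integral>s. G (t - s) \<partial>F) + \<psi> t"
    and G_mono: "\<And>t u. u \<le> t \<Longrightarrow> G t \<le> exp (\<beta> * (t - u)) * G u"
    and G_le: "\<And>t. G t \<le> K * exp (\<delta> * t)"
    and \<beta>: "0 < \<beta>" and \<delta>: "0 < \<delta>"
    and exp_int: "integrable F (\<lambda>s. exp (- \<delta> * s))" and exp_less: "(\<integral>s. exp (- \<delta> * s) \<partial>F) < 1"
    and \<psi>_int: "integrable lborel \<psi>"
    and F_int: "integrable F (\<lambda>s. s)"
    and F_nonar: "\<And>h. 0 \<le> h \<Longrightarrow> \<not> (AE s in F. s \<in> range (\<lambda>k::int. h * of_int k))"
begin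

sublocale F: real_distribution F by (rule F)

definition \<kappa> where "\<kappa> = (\<integral>s. exp (- \<delta> * s) \<partial>F)"
definition I where "I = (\<integral>t. \<psi> t \<partial>lborel)"
definition m where "m = (\<integral>s. s \<partial>F)"

lemma \<kappa>: "0 \<le> \<kappa>" "\<kappa> < 1"
  using exp_less by (auto simp: \<kappa>_def)

text \<open>A positive mean is forced by the strict exponential moment bound: integrate exp x \<ge>
  1 + x at x = -\<delta> s.\<close>

lemma m_pos: "0 < m"
proof -
  have "(\<integral>s. 1 - \<delta> * s \<partial>F) \<le> \<kappa>"
    unfolding \<kappa>_def
    by (rule integral_mono) (use exp_int F_int exp_ge_add_one_self[of "- \<delta> * s" for s] in auto)
  then have "1 - \<delta> * m \<le> \<kappa>"
    using F_int by (simp add: m_def F.prob_space[unfolded F.space_eq_univ])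
  then show ?thesis using \<kappa> \<delta>
    by (smt (verit) mult_nonneg_nonpos)
qed

lemma K_nonneg: "0 \<le> K"
  using G_le[of 0] G_nonneg[of 0] by simp

text \<open>The exponential is an eigenfunction of convolution with \<open>F\<close>, with
  eigenvalue \<kappa> < 1. This makes the iterations below converge geometrically.\<close>

lemma nn_exp: "(\<integral>\<^sup>+s. ennreal (exp (\<delta> * (t - s))) \<partial>F) = ennreal (\<kappa> * exp (\<delta> * t))"
proof -
  have "(\<integral>\<^sup>+s. ennreal (exp (\<delta> * (t - s))) \<partial>F) = (\<integral>\<^sup>+s. ennreal (exp (\<delta> * t)) * ennreal (exp (- \<delta> * s)) \<partial>F)"
    by (intro nn_integral_cong) (simp add: ennreal_mult' [symmetric] exp_add [symmetric] algebra_simps)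
  also have "\<dots> = ennreal (exp (\<delta> * t)) * (\<integral>\<^sup>+s. ennreal (exp (- \<delta> * s)) \<partial>F)"
    by (intro nn_integral_cmult) simp
  also have "(\<integral>\<^sup>+s. ennreal (exp (- \<delta> * s)) \<partial>F) = ennreal \<kappa>"
    unfolding \<kappa>_def by (intro nn_integral_eq_integral exp_int) simp
  finally show ?thesis using \<kappa> by (simp add: ennreal_mult' [symmetric] mult.commute)
qed

text \<open>\<open>V n t\<close> is the mean number of visits to \<open>[0, 1]\<close>, before time \<open>n\<close>, of the random walk started at \<open>t\<close> with steps
  \<open>-s\<close>, \<open>s\<close> distributed according to \<open>F\<close>. Off \<open>[0, 1]\<close> it is an average of its own values, so a bound on \<open>[0, 1]\<close> holds everywhere.\<close>

primrec V :: "nat \<Rightarrow> real \<Rightarrow> ennreal" where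
  "V 0 = (\<lambda>t. 0)"
| "V (Suc n) = (\<lambda>t. indicator {0..1} t + (\<integral>\<^sup>+s. V n (t - s) \<partial>F))"

lemma V_meas [measurable]: "V n \<in> borel_measurable borel"
  by (induction n) auto

text \<open>On [0, 1] the indicator is at most exp (\<delta> t), so each further step of the walk
  contributes one more power of the eigenvalue \<kappa>.\<close>

lemma V_le_exp: "V n t \<le> ennreal ((\<Sum>k<n. \<kappa> ^ k) * exp (\<delta> * t))"
proof (induction n arbitrary: t)
  case (Suc n)
  have "(\<integral>\<^sup>+s. V n (t - s) \<partial>F) \<le> (\<integral>\<^sup>+s. ennreal (\<Sum>k<n. \<kappa> ^ k) * ennreal (exp (\<delta> * (t - s))) \<partial>F)"
    using Suc.IH \<kappa> by (intro nn_integral_mono) (auto simp: ennreal_mult' [symmetric] sum_nonneg)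
  also have "\<dots> = ennreal (\<Sum>k<n. \<kappa> ^ k) * ennreal (\<kappa> * exp (\<delta> * t))"
    by (subst nn_integral_cmult) (auto simp: nn_exp)
  finally have 1: "(\<integral>\<^sup>+s. V n (t - s) \<partial>F) \<le> ennreal ((\<Sum>k<n. \<kappa> ^ k) * (\<kappa> * exp (\<delta> * t)))"
    using \<kappa> by (simp add: ennreal_mult' [symmetric] sum_nonneg)
  have 2: "indicator {0..1} t \<le> ennreal (exp (\<delta> * t))"
    using \<delta> by (auto simp: indicator_def)
  have "V (Suc n) t \<le> ennreal (exp (\<delta> * t)) + ennreal ((\<Sum>k<n. \<kappa> ^ k) * (\<kappa> * exp (\<delta> * t)))"
    using 1 2 by (auto intro: add_mono)
  also have "\<dots> = ennreal (exp (\<delta> * t) + (\<Sum>k<n. \<kappa> ^ k) * (\<kappa> * exp (\<delta> * t)))"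
    using \<kappa> by (subst ennreal_plus) (auto simp: sum_nonneg)
  also have "exp (\<delta> * t) + (\<Sum>k<n. \<kappa> ^ k) * (\<kappa> * exp (\<delta> * t)) = (\<Sum>k<Suc n. \<kappa> ^ k) * exp (\<delta> * t)"
    unfolding sum.lessThan_Suc_shift by (simp add: sum_distrib_right sum_distrib_left algebra_simps)
  finally show ?case .
qed simp

definition D where "D = exp \<delta> / (1 - \<kappa>)"

lemma V_le: "V n t \<le> ennreal D"
proof (induction n arbitrary: t)
  case (Suc n)
  show ?case
  proof (cases "t \<in> {0..1}")
    case True
    have "(\<Sum>k<Suc n. \<kappa> ^ k) \<le> 1 / (1 - \<kappa>)"
      using \<kappa> by (subst sum_gp_strict) (auto simp: divide_simps)
    then have "(\<Sum>k<Suc n. \<kappa> ^ k) * exp (\<delta> * t) \<le> 1 / (1 - \<kappa>) * exp \<delta>"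
      using True \<delta> \<kappa> by (intro mult_mono) (auto simp: sum_nonneg)
    then show ?thesis using V_le_exp[of "Suc n" t] by (auto simp: D_def intro: order_trans ennreal_leI)
  next
    case False
    have "(\<integral>\<^sup>+s. V n (t - s) \<partial>F) \<le> (\<integral>\<^sup>+s. ennreal D \<partial>F)"
      by (intro nn_integral_mono Suc.IH)
    then show ?thesis using False F.emeasure_space_1 by simp
  qed
qed simp

text \<open>\<open>J\<close> is the integral of \<open>G\<close> over the unit window [t - 1, t].
  \<open>Jn\<close> is its potential representation cut off after \<open>n\<close> steps: expected
  visits convolved with the forcing term.\<close>

definition J where "J t = (\<integral>\<^sup>+u. indicator {0..1} (t - u) * ennreal (G u) \<partial>lborel)"
definition Jn where "Jn n t = (\<integral>\<^sup>+v. V n (t - v) * ennreal (\<psi> v) \<partial>lborel)"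

text \<open>In nonnegative extended reals Tonelli's theorem applies without integrability
  conditions, so the equation is iterated in this form.\<close>

lemma nn_G: "ennreal (G t) = (\<integral>\<^sup>+s. ennreal (G (t - s)) \<partial>F) + ennreal (\<psi> t)"
proof -
  have "(\<integral>\<^sup>+s. ennreal (G (t - s)) \<partial>F) = ennreal (\<integral>s. G (t - s) \<partial>F)"
    by (intro nn_integral_eq_integral G_int) (auto simp: G_nonneg)
  then show ?thesis
    by (subst G_eq) (simp add: ennreal_plus \<psi>_nonneg G_nonneg)
qed

lemma conv_swap:
  assumes [measurable]: "f \<in> borel_measurable borel" "g \<in> borel_measurable borel"
  shows "(\<integral>\<^sup>+u. f (t - u) * (\<integral>\<^sup>+s. g (u - s) \<partial>F) \<partial>lborel) = (\<integral>\<^sup>+s. (\<integral>\<^sup>+u. f (t - s - u) * (g u :: ennreal) \<partial>lborel) \<partial>F)"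
proof -
  have "(\<integral>\<^sup>+u. f (t - u) * (\<integral>\<^sup>+s. g (u - s) \<partial>F) \<partial>lborel) = (\<integral>\<^sup>+u. (\<integral>\<^sup>+s. f (t - u) * g (u - s) \<partial>F) \<partial>lborel)"
    by (intro nn_integral_cong) (subst nn_integral_cmult, auto)
  also have "\<dots> = (\<integral>\<^sup>+s. (\<integral>\<^sup>+u. f (t - u) * g (u - s) \<partial>lborel) \<partial>F)"
  proof -
    interpret pair_sigma_finite F lborel ..
    show ?thesis by (intro Fubini') measurable
  qed
  also have "\<dots> = (\<integral>\<^sup>+s. (\<integral>\<^sup>+u. f (t - s - u) * g u \<partial>lborel) \<partial>F)"
  proof (rule nn_integral_cong)
    fix s
    show "(\<integral>\<^sup>+u. f (t - u) * g (u - s) \<partial>lborel) = (\<integral>\<^sup>+u. f (t - s - u) * g u \<partial>lborel)"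
      using nn_integral_real_affine[of "\<lambda>u. f (t - u) * g (u - s)" 1 s] by (simp add: algebra_simps)
  qed
  finally show ?thesis .
qed

lemma conv_swap':
  assumes [measurable]: "f \<in> borel_measurable borel" "g \<in> borel_measurable borel"
  shows "(\<integral>\<^sup>+u. (\<integral>\<^sup>+s. f (t - u - s) \<partial>F) * g u \<partial>lborel) = (\<integral>\<^sup>+s. (\<integral>\<^sup>+u. f (t - s - u) * (g u :: ennreal) \<partial>lborel) \<partial>F)"
proof -
  have "(\<integral>\<^sup>+u. (\<integral>\<^sup>+s. f (t - u - s) \<partial>F) * g u \<partial>lborel) = (\<integral>\<^sup>+u. (\<integral>\<^sup>+s. f (t - s - u) * g u \<partial>F) \<partial>lborel)"
    by (intro nn_integral_cong) (subst nn_integral_multc [symmetric], auto simp: algebra_simps)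
  also have "\<dots> = (\<integral>\<^sup>+s. (\<integral>\<^sup>+u. f (t - s - u) * g u \<partial>lborel) \<partial>F)"
  proof -
    interpret pair_sigma_finite F lborel ..
    show ?thesis by (intro Fubini') measurable
  qed
  finally show ?thesis .
qed

lemma J_eq: "J t = (\<integral>\<^sup>+u. indicator {0..1} (t - u) * ennreal (\<psi> u) \<partial>lborel) + (\<integral>\<^sup>+s. J (t - s) \<partial>F)"
proof -
  have "J t = (\<integral>\<^sup>+u. indicator {0..1} (t - u) * ennreal (\<psi> u) + indicator {0..1} (t - u) * (\<integral>\<^sup>+s. ennreal (G (u - s)) \<partial>F) \<partial>lborel)"
    unfolding J_def by (subst nn_G) (simp add: algebra_simps)
  also have "\<dots> = (\<integral>\<^sup>+u. indicator {0..1} (t - u) * ennreal (\<psi> u) \<partial>lborel) + (\<integral>\<^sup>+u. indicator {0..1} (t - u) * (\<integral>\<^sup>+s. ennreal (G (u - s)) \<partial>F) \<partial>lborel)"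
    by (intro nn_integral_add) measurable
  also have "(\<integral>\<^sup>+u. indicator {0..1} (t - u) * (\<integral>\<^sup>+s. ennreal (G (u - s)) \<partial>F) \<partial>lborel) = (\<integral>\<^sup>+s. J (t - s) \<partial>F)"
    unfolding J_def by (subst conv_swap) auto
  finally show ?thesis .
qed

lemma Jn_Suc: "Jn (Suc n) t = (\<integral>\<^sup>+u. indicator {0..1} (t - u) * ennreal (\<psi> u) \<partial>lborel) + (\<integral>\<^sup>+s. Jn n (t - s) \<partial>F)"
proof -
  have "Jn (Suc n) t = (\<integral>\<^sup>+u. indicator {0..1} (t - u) * ennreal (\<psi> u) \<partial>lborel) + (\<integral>\<^sup>+u. (\<integral>\<^sup>+s. V n (t - u - s) \<partial>F) * ennreal (\<psi> u) \<partial>lborel)"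
    unfolding Jn_def V.simps distrib_right by (intro nn_integral_add) measurable
  then show ?thesis unfolding Jn_def by (subst (asm) conv_swap') auto
qed

lemma J_meas [measurable]: "J \<in> borel_measurable borel" and Jn_meas [measurable]: "Jn n \<in> borel_measurable borel"
  unfolding J_def[abs_def] Jn_def[abs_def] by measurable

lemma J_le_exp: "J t \<le> ennreal (K * exp (\<delta> * t))"
proof -
  have "J t \<le> (\<integral>\<^sup>+u. ennreal (K * exp (\<delta> * t)) * indicator {t-1..t} u \<partial>lborel)"
    unfolding J_def
  proof (intro nn_integral_mono)
    fix u
    have "G u \<le> K * exp (\<delta> * t)" if "u \<le> t"
      using G_le[of u] that \<delta> K_nonneg by (smt (verit) exp_le_cancel_iff mult_left_mono mult_left_mono)
    then show "indicator {0..1} (t - u) * ennreal (G u) \<le> ennreal (K * exp (\<delta> * t)) * indicator {t-1..t} u"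
      by (auto simp: indicator_def ennreal_leI)
  qed
  then show ?thesis by (simp add: nn_integral_cmult_indicator)
qed

text \<open>Iterating the equation for \<open>J\<close> leaves an n-fold convolution of
  \<open>J\<close> with \<open>F\<close> as remainder; the a priori bound
  \<open>K * exp (\<delta> * t)\<close> shrinks by \<kappa> at each step.\<close>

lemma J_le_Jn: "J t \<le> Jn n t + ennreal (\<kappa> ^ n * (K * exp (\<delta> * t)))"
proof (induction n arbitrary: t)
  case 0
  then show ?case using J_le_exp[of t] by (simp add: Jn_def)
next
  case (Suc n)
  have "(\<integral>\<^sup>+s. J (t - s) \<partial>F) \<le> (\<integral>\<^sup>+s. Jn n (t - s) + ennreal (\<kappa> ^ n * K) * ennreal (exp (\<delta> * (t - s))) \<partial>F)"
    using Suc.IH \<kappa> K_nonneg by (intro nn_integral_mono) (auto simp: ennreal_mult' [symmetric] mult.assoc)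
  also have "\<dots> = (\<integral>\<^sup>+s. Jn n (t - s) \<partial>F) + ennreal (\<kappa> ^ n * K) * ennreal (\<kappa> * exp (\<delta> * t))"
    by (subst nn_integral_add) (auto simp: nn_integral_cmult nn_exp)
  also have "ennreal (\<kappa> ^ n * K) * ennreal (\<kappa> * exp (\<delta> * t)) = ennreal (\<kappa> ^ Suc n * (K * exp (\<delta> * t)))"
    using \<kappa> K_nonneg by (subst ennreal_mult' [symmetric]) (auto simp: algebra_simps)
  finally show ?case unfolding Jn_Suc J_eq[of t] by (simp add: add.assoc add_left_mono)
qed

lemma I_nonneg: "0 \<le> I" unfolding I_def by (simp add: \<psi>_nonneg)

lemma Jn_le: "Jn n t \<le> ennreal (D * I)"
proof -
  have "Jn n t \<le> (\<integral>\<^sup>+v. ennreal D * ennreal (\<psi> v) \<partial>lborel)"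
    unfolding Jn_def by (intro nn_integral_mono mult_right_mono V_le) simp
  also have "\<dots> = ennreal D * ennreal I"
    unfolding I_def by (subst nn_integral_cmult) (auto simp: nn_integral_eq_integral[OF \<psi>_int] \<psi>_nonneg)
  finally show ?thesis using \<kappa> I_nonneg by (simp add: ennreal_mult' [symmetric] D_def)
qed

text \<open>The remainder depends on t but vanishes for each fixed t, so the bound on
  \<open>Jn\<close>, which is uniform in n and t, passes to \<open>J\<close>.\<close>

lemma J_le: "J t \<le> ennreal (D * I)"
proof -
  have D0: "0 \<le> D * I" using \<kappa> I_nonneg by (simp add: D_def)
  have "J t \<le> ennreal (D * I + \<kappa> ^ n * (K * exp (\<delta> * t)))" for n
    using J_le_Jn[of t n] Jn_le[of n t] D0 \<kappa> K_nonneg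
    by (subst ennreal_plus) (auto intro: order_trans add_mono)
  moreover have "(\<lambda>n. ennreal (D * I + \<kappa> ^ n * (K * exp (\<delta> * t)))) \<longlonglongrightarrow> ennreal (D * I + 0 * (K * exp (\<delta> * t)))"
    using \<kappa> by (intro tendsto_intros LIMSEQ_realpow_zero) auto
  ultimately show ?thesis by (intro tendsto_lowerbound[where f="\<lambda>n. ennreal (D * I + \<kappa> ^ n * (K * exp (\<delta> * t)))" and F=sequentially]) auto
qed

definition Gm where "Gm = exp \<beta> * (D * I)"

text \<open>On [t - 1, t] near monotonicity keeps \<open>G\<close> above exp (-\<beta>) times
  \<open>G t\<close>, so a bounded window integral bounds the value at its right end.\<close>

lemma G_bound: "G t \<le> Gm"
proof -
  have "ennreal (exp (-\<beta>) * G t) = (\<integral>\<^sup>+u. ennreal (exp (-\<beta>) * G t) * indicator {t-1..t} u \<partial>lborel)"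
    by (simp add: nn_integral_cmult_indicator)
  also have "\<dots> \<le> J t"
    unfolding J_def
  proof (intro nn_integral_mono)
    fix u
    have "exp (-\<beta>) * G t \<le> G u" if u: "t - 1 \<le> u" "u \<le> t"
    proof -
      have "G t \<le> exp (\<beta> * (t - u)) * G u" using G_mono u by auto
      also have "\<dots> \<le> exp \<beta> * G u" using u \<beta> G_nonneg[of u]
        by (intro mult_right_mono) (auto simp: mult_le_cancel_left1)
      finally show ?thesis by (simp add: exp_minus divide_simps mult.commute)
    qed
    then show "ennreal (exp (-\<beta>) * G t) * indicator {t-1..t} u \<le> indicator {0..1} (t - u) * ennreal (G u)"
      by (auto simp: indicator_def ennreal_leI)
  qed
  also have "\<dots> \<le> ennreal (D * I)" by (rule J_le)
  finally have "exp (-\<beta>) * G t \<le> D * I" using \<kappa> I_nonneg by (subst (asm) ennreal_le_iff) (auto simp: D_def)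
  then show ?thesis by (simp add: Gm_def exp_minus divide_simps mult.commute)
qed

end

section \<open>Asymptotic periods of solutions of the renewal equation\<close>

lemma eventually_shift: "eventually P at_top \<Longrightarrow> eventually (\<lambda>t. P (t - a)) at_top" for a :: real
  unfolding eventually_at_top_linorder by (metis le_diff_eq)

lemma tendsto_shift: "(f \<longlongrightarrow> l) at_top \<Longrightarrow> ((\<lambda>t. f (t - a)) \<longlongrightarrow> l) at_top" for a :: real
  unfolding tendsto_def by (auto intro: eventually_shift)

lemma (in real_distribution) measure_tail_tendsto_0: "((\<lambda>x. measure M {x<..}) \<longlongrightarrow> 0) at_top"
proof -
  have "measure M {x<..} = 1 - cdf M x" for x
    using prob_compl[of "{..x}"] by (simp add: cdf_def space_eq_univ Compl_eq_Diff_UNIV [symmetric])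
  moreover have "((\<lambda>x. 1 - cdf M x) \<longlongrightarrow> 1 - 1) at_top"
    by (intro tendsto_intros cdf_lim_at_top_prob)
  ultimately show ?thesis by simp
qed

text \<open>If the increment \<open>g t = H t - H (t - a)\<close> were close to its positive upper limit \<open>M\<close> at some
  large \<open>t\<close>, averaging against \<open>F\<close> would force it to be close to \<open>M\<close> at \<open>t - a\<close>, \<open>t - 2a\<close>, \<dots> too, and
  adding up these increments contradicts the boundedness of \<open>H\<close>.\<close>

lemma increment_at_support_point:
  fixes H e :: "real \<Rightarrow> real"
  assumes F: "real_distribution F"
    and bd: "\<And>t. \<bar>H t\<bar> \<le> B" and lip: "\<And>t u. \<bar>H t - H u\<bar> \<le> L * \<bar>t - u\<bar>"
    and eq: "\<And>t. H t = (\<integral>s. H (t - s) \<partial>F) + e t"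
    and e: "(e \<longlongrightarrow> 0) at_top"
    and supp: "\<And>r. r > 0 \<Longrightarrow> measure F (ball a r) > 0"
    and \<epsilon>: "0 < \<epsilon>"
  shows "eventually (\<lambda>t. H t - H (t - a) < \<epsilon>) at_top"
proof -
  interpret F: real_distribution F by (rule F)
  define L1 where "L1 = \<bar>L\<bar> + 1"
  have L1: "L1 > 0" "\<And>t u. \<bar>H t - H u\<bar> \<le> L1 * \<bar>t - u\<bar>"
    using lip by (auto simp: L1_def intro!: order_trans[OF lip] mult_right_mono)
  have "continuous_on UNIV H"
  proof (rule continuous_onI)
    fix x e :: real assume "0 < e"
    then show "\<exists>d>0. \<forall>x'\<in>UNIV. dist x' x < d \<longrightarrow> dist (H x') (H x) \<le> e"
      using L1 by (intro exI[of _ "e / L1"])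
        (auto simp: dist_real_def field_simps intro: order_trans[OF L1(2)])
  qed
  then have [measurable]: "H \<in> borel_measurable borel"
    by (rule borel_measurable_continuous_onI)
  have B: "0 \<le> B" using bd[of 0] by simp
  define g where "g t = H t - H (t - a)" for t
  define e' where "e' t = e t - e (t - a)" for t
  have [measurable]: "g \<in> borel_measurable borel" unfolding g_def by measurable
  have g_bd: "\<bar>g t\<bar> \<le> 2 * B" for t using bd[of t] bd[of "t - a"] by (simp add: g_def)
  have g_lip: "\<bar>g t - g u\<bar> \<le> 2 * L1 * \<bar>t - u\<bar>" for t u
    using L1(2)[of t u] L1(2)[of "t - a" "u - a"] by (simp add: g_def)
  have Hint: "integrable F (\<lambda>s. H (t - s))" for t
    by (rule F.integrable_const_bound[of _ B]) (use bd in auto)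
  have gint: "integrable F (\<lambda>s. g (t - s))" for t
    by (rule F.integrable_const_bound[of _ "2 * B"]) (use g_bd in auto)
  have g_eq: "g t = (\<integral>s. g (t - s) \<partial>F) + e' t" for t
  proof -
    have "(\<integral>s. g (t - s) \<partial>F) = (\<integral>s. H (t - s) \<partial>F) - (\<integral>s. H (t - a - s) \<partial>F)"
      by (subst Bochner_Integration.integral_diff [symmetric, OF Hint Hint]) (simp add: g_def algebra_simps)
    then show ?thesis unfolding g_def e'_def using eq[of t] eq[of "t - a"] by simp
  qed
  have e': "(e' \<longlongrightarrow> 0) at_top"
    unfolding e'_def using tendsto_diff[OF e tendsto_shift[OF e, of a]] by simp
  \<comment> \<open>\<open>M\<close> is the upper limit of \<open>g\<close> at infinity, taken as
    the infimum of the eventual upper bounds.\<close>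
  define S where "S = {x. eventually (\<lambda>t. g t \<le> x) at_top}"
  define M where "M = Inf S"
  have S0: "2 * B \<in> S" using g_bd by (auto simp: S_def abs_le_iff)
  have S_lower: "- (2 * B) \<le> x" if "x \<in> S" for x
  proof -
    from that obtain t where "g t \<le> x" by (auto simp: S_def eventually_at_top_linorder)
    then show ?thesis using g_bd[of t] by simp
  qed
  have S_bdd: "bdd_below S" using S_lower by (rule bdd_belowI)
  have upper: "eventually (\<lambda>t. g t \<le> M + d) at_top" if "d > 0" for d
  proof -
    from that have "Inf S < M + d" by (simp add: M_def)
    then obtain x where "x \<in> S" "x < M + d" using cInf_lessD S0 by blast
    then show ?thesis unfolding S_def by (auto elim: eventually_mono)
  qed
  have lower: "\<not> eventually (\<lambda>t. g t \<le> M - d) at_top" if "d > 0" for d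
  proof
    assume "eventually (\<lambda>t. g t \<le> M - d) at_top"
    then have "M - d \<in> S" by (simp add: S_def)
    then have "M \<le> M - d" unfolding M_def by (rule cInf_lower[OF _ S_bdd])
    then show False using that by simp
  qed
  have step: "\<exists>d>0. eventually (\<lambda>t. M - d \<le> g t \<longrightarrow> M - d' \<le> g (t - a)) at_top" if d': "d' > 0" for d'
  proof -
    \<comment> \<open>On the ball of radius \<open>r\<close> the Lipschitz bound moves
      \<open>g\<close> by at most d' / 2. The choice of \<open>d\<close> gives d' / 2 * p = 8 d,
      which beats the errors of total size below 4 d collected at the end.\<close>
    define r where "r = d' / (4 * L1)"
    have r: "r > 0" using d' L1 by (simp add: r_def)
    define p where "p = measure F (ball a r)"
    have p: "p > 0" unfolding p_def using r by (rule supp)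
    define d where "d = p * d' / 16"
    have d: "d > 0" using p d' by (simp add: d_def)
    obtain T1 where T1: "\<And>t. T1 \<le> t \<Longrightarrow> g t \<le> M + d"
      using upper[OF d] by (auto simp: eventually_at_top_linorder)
    define C0 where "C0 = \<bar>M\<bar> + d + 2 * B"
    have C0: "C0 \<ge> 0" using d B by (simp add: C0_def)
    have "((\<lambda>t. C0 * measure F {t - T1<..}) \<longlongrightarrow> C0 * 0) at_top"
      by (intro tendsto_intros tendsto_shift[OF F.measure_tail_tendsto_0])
    then have ev1: "eventually (\<lambda>t. C0 * measure F {t - T1<..} < d) at_top"
      using d by (intro order_tendstoD) auto
    have ev2: "eventually (\<lambda>t. \<bar>e' t\<bar> < d) at_top"
      using tendstoD[OF e' d] by simp
    show ?thesis
    proof (intro exI conjI)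
      show "d > 0" by fact
      show "eventually (\<lambda>t. M - d \<le> g t \<longrightarrow> M - d' \<le> g (t - a)) at_top"
        using ev1 ev2
      proof eventually_elim
        case (elim t)
        show ?case
        proof (intro impI, rule ccontr)
          assume 1: "M - d \<le> g t" and "\<not> M - d' \<le> g (t - a)"
          then have 2: "g (t - a) < M - d'" by simp
          \<comment> \<open>Integrated against \<open>F\<close>, this says that a deficit of d' / 2
            on the ball pulls the average, and hence \<open>g t\<close>, below M - d.\<close>
          have pw: "d' / 2 * indicator (ball a r) s - C0 * indicator {t - T1<..} s \<le> M + d - g (t - s)" for s
          proof (cases "s \<in> ball a r")
            case True
            have "\<bar>g (t - s) - g (t - a)\<bar> \<le> 2 * L1 * \<bar>a - s\<bar>" using g_lip[of "t - s" "t - a"] by simp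
            also have "\<dots> \<le> 2 * L1 * r" using True L1 by (intro mult_left_mono) (auto simp: dist_real_def)
            also have "\<dots> = d' / 2" using L1 by (simp add: r_def)
            finally have "d' / 2 \<le> M + d - g (t - s)" using 2 d by linarith
            then show ?thesis using True C0 by (auto simp: indicator_def)
          next
            case False
            then show ?thesis
            proof (cases "s \<le> t - T1")
              case True
              then show ?thesis using False T1[of "t - s"] by (auto simp: indicator_def)
            next
              case s: False
              have "- C0 \<le> M + d - g (t - s)" using g_bd[of "t - s"] d unfolding C0_def by linarith
              then show ?thesis using s False by (auto simp: indicator_def)
            qed
          qed
          have i: "integrable F (\<lambda>s. d' / 2 * indicator (ball a r) s)" "integrable F (\<lambda>s. C0 * indicator {t - T1<..} s)"
            by (auto intro!: integrable_mult_right integrable_real_indicator simp: F.emeasure_eq_measure simp del: times_divide_eq_left)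
          have "(\<integral>s. d' / 2 * indicator (ball a r) s - C0 * indicator {t - T1<..} s \<partial>F) \<le> (\<integral>s. M + d - g (t - s) \<partial>F)"
            by (intro integral_mono pw Bochner_Integration.integrable_diff i gint) auto
          moreover have "(\<integral>s. d' / 2 * indicator (ball a r) s - C0 * indicator {t - T1<..} s \<partial>F) = d' / 2 * p - C0 * measure F {t - T1<..}"
            unfolding p_def by (subst Bochner_Integration.integral_diff[OF i]) simp
          moreover have "(\<integral>s. M + d - g (t - s) \<partial>F) = M + d - (g t - e' t)"
            using g_eq[of t] by (subst Bochner_Integration.integral_diff) (auto intro!: gint simp: F.prob_space[unfolded F.space_eq_univ])
          ultimately have "d' / 2 * p < 4 * d" using elim 1 by linarith
          then show False using p d' by (simp add: d_def)
        qed
      qed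
    qed
  qed
  \<comment> \<open>The closeness demanded at \<open>t\<close> shrinks as \<open>n\<close> grows, so
    the number of steps back has to be fixed before t tends to infinity.\<close>
  have iter: "\<exists>d>0. eventually (\<lambda>t. M - d \<le> g t \<longrightarrow> (\<forall>k\<le>n. M - d' \<le> g (t - real k * a))) at_top" if d': "d' > 0" for d' n
  proof (induction n)
    case 0
    show ?case using d' by (intro exI[of _ d']) auto
  next
    case (Suc n)
    then obtain d1 where d1: "d1 > 0" "eventually (\<lambda>t. M - d1 \<le> g t \<longrightarrow> (\<forall>k\<le>n. M - d' \<le> g (t - real k * a))) at_top" by auto
    obtain d2 where d2: "d2 > 0" "eventually (\<lambda>t. M - d2 \<le> g t \<longrightarrow> M - d1 \<le> g (t - a)) at_top"
      using step[OF d1(1)] by auto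
    show ?case
    proof (intro exI conjI)
      show "min d' d2 > 0" using d' d2 by simp
      show "eventually (\<lambda>t. M - min d' d2 \<le> g t \<longrightarrow> (\<forall>k\<le>Suc n. M - d' \<le> g (t - real k * a))) at_top"
        using d2(2) eventually_shift[OF d1(2), of a]
      proof eventually_elim
        case (elim t)
        show ?case
        proof (intro impI allI)
          fix k assume *: "M - min d' d2 \<le> g t" "k \<le> Suc n"
          show "M - d' \<le> g (t - real k * a)"
          proof (cases k)
            case 0 then show ?thesis using * by simp
          next
            case (Suc j)
            then have "M - d' \<le> g (t - a - real j * a)" using elim * by auto
            then show ?thesis by (simp add: Suc algebra_simps)
          qed
        qed
      qed
    qed
  qed
  have "M \<le> 0"
  proof (rule ccontr)
    assume "\<not> M \<le> 0"
    then have M: "M > 0" by simp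
    \<comment> \<open>For this \<open>n\<close> a sum of n increments of size M / 2 exceeds 2 B, the
      largest possible oscillation of \<open>H\<close>.\<close>
    obtain n :: nat where n: "real n > 4 * B / M" using reals_Archimedean2 by blast
    obtain d where d: "d > 0" "eventually (\<lambda>t. M - d \<le> g t \<longrightarrow> (\<forall>k\<le>n. M - M / 2 \<le> g (t - real k * a))) at_top"
      using iter[of "M / 2" n] M by auto
    have "\<exists>t. M - d \<le> g t \<and> (\<forall>k\<le>n. M / 2 \<le> g (t - real k * a))"
    proof (rule ccontr)
      assume c: "\<not> ?thesis"
      have "eventually (\<lambda>t. g t \<le> M - d) at_top"
        using d(2)
      proof eventually_elim
        case (elim t)
        show ?case
        proof (rule ccontr)
          assume "\<not> g t \<le> M - d"
          then have "M - d \<le> g t" by simp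
          with elim have "\<forall>k\<le>n. M / 2 \<le> g (t - real k * a)" by simp
          then show False using c \<open>M - d \<le> g t\<close> by blast
        qed
      qed
      then show False using lower[OF d(1)] by simp
    qed
    then obtain t where t: "\<And>k. k \<le> n \<Longrightarrow> M / 2 \<le> g (t - real k * a)" by auto
    have "real n * (M / 2) \<le> (\<Sum>k<n. g (t - real k * a))"
      using sum_mono[of "{..<n}" "\<lambda>_. M / 2" "\<lambda>k. g (t - real k * a)"] t by simp
    also have "\<dots> = (\<Sum>k<n. H (t - real k * a) - H (t - real (Suc k) * a))"
      by (simp add: g_def algebra_simps)
    also have "\<dots> = H t - H (t - real n * a)"
      by (subst sum_lessThan_telescope') simp
    also have "\<dots> \<le> 2 * B" using bd[of t] bd[of "t - real n * a"] by linarith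
    finally show False using n M by (simp add: field_simps)
  qed
  then show ?thesis using upper[of "\<epsilon> / 2"] \<epsilon> by (auto simp: g_def elim!: eventually_mono)
qed

text \<open>The hypotheses survive passing to -H, and this turns the upper bound on the increments
  into the lower one.\<close>

lemma increment_at_support_point_tendsto:
  fixes H e :: "real \<Rightarrow> real"
  assumes F: "real_distribution F"
    and bd: "\<And>t. \<bar>H t\<bar> \<le> B" and lip: "\<And>t u. \<bar>H t - H u\<bar> \<le> L * \<bar>t - u\<bar>"
    and eq: "\<And>t. H t = (\<integral>s. H (t - s) \<partial>F) + e t"
    and e: "(e \<longlongrightarrow> 0) at_top"
    and supp: "\<And>r. r > 0 \<Longrightarrow> measure F (ball a r) > 0"
  shows "((\<lambda>t. H t - H (t - a)) \<longlongrightarrow> 0) at_top"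
proof (rule tendstoI)
  fix \<epsilon> :: real assume \<epsilon>: "0 < \<epsilon>"
  have 1: "eventually (\<lambda>t. H t - H (t - a) < \<epsilon>) at_top"
    by (rule increment_at_support_point[OF F bd lip eq e supp \<epsilon>])
  have 2: "eventually (\<lambda>t. - H t - - H (t - a) < \<epsilon>) at_top"
  proof (rule increment_at_support_point[OF F, where H="\<lambda>t. - H t" and e="\<lambda>t. - e t" and B=B and L=L])
    show "((\<lambda>t. - e t) \<longlongrightarrow> 0) at_top" using tendsto_minus[OF e] by simp
    show "- H t = (\<integral>s. - H (t - s) \<partial>F) + - e t" for t using eq[of t] by simp
    show "\<bar>- H t - - H u\<bar> \<le> L * \<bar>t - u\<bar>" for t u using lip[of t u] by simp
  qed (use bd supp \<epsilon> in auto)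
  show "eventually (\<lambda>t. dist (H t - H (t - a)) 0 < \<epsilon>) at_top"
    using 1 2 by eventually_elim (auto simp: dist_real_def)
qed

text \<open>Everything is decided by the infimum of the positive elements. If it is 0, multiples of
  small elements are dense; if it is positive, closedness makes it an element, and division with
  remainder leaves nothing but its multiples. The trivial group is the lattice of mesh 0.\<close>

lemma closed_subgroup_real:
  fixes P :: "real set"
  assumes "closed P" and zero: "0 \<in> P" and diff: "\<And>a b. a \<in> P \<Longrightarrow> b \<in> P \<Longrightarrow> a - b \<in> P"
    and ne: "P \<noteq> UNIV"
  obtains h where "0 \<le> h" "P \<subseteq> range (\<lambda>k::int. h * of_int k)"
proof -
  have neg: "- a \<in> P" if "a \<in> P" for a using diff[OF zero that] by simp
  have add: "a + b \<in> P" if "a \<in> P" "b \<in> P" for a b using diff[OF that(1) neg[OF that(2)]] by simp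
  have natm: "real n * a \<in> P" if "a \<in> P" for n a
    by (induction n) (use zero add that in \<open>auto simp: distrib_right\<close>)
  have intm: "of_int k * a \<in> P" if "a \<in> P" for k a
  proof (cases "k \<ge> 0")
    case True then show ?thesis using natm[OF that, of "nat k"] by simp
  next
    case False then show ?thesis using neg[OF natm[OF that, of "nat (- k)"]] by simp
  qed
  define Q where "Q = {a \<in> P. 0 < a}"
  show thesis
  proof (cases "Q = {}")
    case True
    have "P \<subseteq> {0}"
    proof
      fix a assume "a \<in> P"
      then have "\<not> 0 < a" "\<not> 0 < - a" using True neg[of a] unfolding Q_def by blast+
      then show "a \<in> {0}" by simp
    qed
    then show thesis by (intro that[of 0]) auto
  next
    case False
    define h where "h = Inf Q"
    have bdd: "bdd_below Q" by (rule bdd_belowI[of _ 0]) (auto simp: Q_def)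
    have h0: "0 \<le> h" unfolding h_def using False by (intro cInf_greatest) (auto simp: Q_def)
    have hle: "h \<le> a" if "a \<in> P" "0 < a" for a
      unfolding h_def using that by (intro cInf_lower bdd) (auto simp: Q_def)
    show thesis
    proof (cases "h = 0")
      case True
      have "x \<in> P" for x
      proof -
        have "x \<in> closure P"
          unfolding closure_approachable
        proof (intro allI impI)
          fix e :: real assume e: "0 < e"
          then have "Inf Q < e" using True by (simp add: h_def)
          then obtain q where q: "q \<in> P" "0 < q" "q < e" using cInf_lessD[OF False] by (auto simp: Q_def)
          have "of_int \<lfloor>x / q\<rfloor> * q \<le> x"
            by (rule pos_le_divide_eq[OF q(2), THEN iffD1]) (rule of_int_floor_le)
          moreover have "x < (of_int \<lfloor>x / q\<rfloor> + 1) * q"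
            by (rule pos_divide_less_eq[OF q(2), THEN iffD1]) (rule floor_correct[THEN conjunct2, simplified])
          ultimately have "of_int \<lfloor>x / q\<rfloor> * q \<le> x" "x < of_int \<lfloor>x / q\<rfloor> * q + q"
            by (simp_all add: distrib_right)
          then have "\<bar>of_int \<lfloor>x / q\<rfloor> * q - x\<bar> < e" using q by linarith
          then show "\<exists>y\<in>P. dist y x < e" using intm[OF q(1)] by (intro bexI[of _ "of_int \<lfloor>x / q\<rfloor> * q"]) (auto simp: dist_real_def)
        qed
        then show ?thesis using \<open>closed P\<close> by simp
      qed
      then show thesis using ne by auto
    next
      case False': False
      then have h: "0 < h" using h0 by simp
      have hP: "h \<in> P"
      proof -
        have "Inf Q \<in> closure Q" using False bdd by (rule closure_contains_Inf)
        moreover have "closure Q \<subseteq> P" using \<open>closed P\<close> by (intro closure_minimal) (auto simp: Q_def)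
        ultimately show ?thesis by (auto simp: h_def)
      qed
      show thesis
      proof (intro that[of h] h0 subsetI)
        fix a assume a: "a \<in> P"
        define b where "b = a - of_int \<lfloor>a / h\<rfloor> * h"
        have "b \<in> P" unfolding b_def by (intro diff a intm hP)
        moreover have "of_int \<lfloor>a / h\<rfloor> * h \<le> a"
          by (rule pos_le_divide_eq[OF h, THEN iffD1]) (rule of_int_floor_le)
        moreover have "a < (of_int \<lfloor>a / h\<rfloor> + 1) * h"
          by (rule pos_divide_less_eq[OF h, THEN iffD1]) (rule floor_correct[THEN conjunct2, simplified])
        ultimately have "b = 0" using hle[of b] by (force simp: b_def distrib_right)
        then show "a \<in> range (\<lambda>k::int. h * of_int k)" by (auto simp: b_def mult.commute intro: range_eqI[of _ _ "\<lfloor>a / h\<rfloor>"])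
      qed
    qed
  qed
qed

text \<open>Every point off the support lies in a null interval with rational endpoints, and there
  are only countably many of these.\<close>

lemma (in real_distribution) AE_support: "AE s in M. \<forall>r>0. measure M (ball s r) > 0"
proof -
  define N where "N = {(p, q). p \<in> \<rat> \<and> q \<in> \<rat> \<and> measure M {p<..<q} = 0}"
  have "countable N" by (rule countable_subset[of _ "\<rat> \<times> \<rat>"]) (auto simp: N_def countable_rat)
  then have "AE s in M. \<forall>x\<in>N. s \<notin> {fst x<..<snd x}"
  proof (rule AE_ball_countable[THEN iffD2], intro ballI)
    fix x assume "x \<in> N"
    then have "{fst x<..<snd x} \<in> null_sets M"
      by (auto simp: N_def null_sets_def emeasure_eq_measure)
    then show "AE s in M. s \<notin> {fst x<..<snd x}" by (rule AE_not_in)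
  qed
  then show ?thesis
  proof eventually_elim
    case (elim s)
    show ?case
    proof (intro allI impI, rule ccontr)
      fix r :: real assume r: "r > 0" and "\<not> measure M (ball s r) > 0"
      then have z: "measure M (ball s r) = 0" by (simp add: zero_less_measure_iff)
      obtain p where p: "p \<in> \<rat>" "s - r < p" "p < s" using Rats_dense_in_real[of "s - r" s] r by auto
      obtain q where q: "q \<in> \<rat>" "s < q" "q < s + r" using Rats_dense_in_real[of s "s + r"] r by auto
      have "measure M {p<..<q} \<le> measure M (ball s r)"
        using p q by (intro finite_measure_mono) (auto simp: ball_eq_greaterThanLessThan)
      then have "(p, q) \<in> N" using z p q by (auto simp: N_def measure_le_0_iff)
      then show False using elim p q by force
    qed
  qed
qed

section \<open>Window integrals of the solution and the renewal limit\<close>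

context renewal
begin

text \<open>Integration from minus infinity is possible thanks to the bound of order exp (\<delta>
  u). The integral is Lipschitz even where \<open>G\<close> jumps, as the increment lemma
  requires.\<close>

definition Gc where "Gc x = (\<integral>u. indicator {..x} u * G u \<partial>lborel)"
definition \<Psi> where "\<Psi> x = (\<integral>u. indicator {..x} u * \<psi> u \<partial>lborel)"

lemma nn_exp_le: "(\<integral>\<^sup>+u. ennreal (indicator {..x} u * exp (\<delta> * u)) \<partial>lborel) = ennreal (exp (\<delta> * x) / \<delta>)"
proof -
  have "(\<integral>\<^sup>+u. ennreal (indicator {..x} u * exp (\<delta> * u)) \<partial>lborel) = (\<integral>\<^sup>+u. ennreal (exp (\<delta> * (x - u))) * indicator {0..} u \<partial>lborel)"
    using nn_integral_real_affine[of "\<lambda>u. ennreal (indicator {..x} u * exp (\<delta> * u))" "-1" x]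
    by (auto simp: indicator_def intro!: nn_integral_cong)
  also have "\<dots> = ennreal (0 - (- exp (\<delta> * (x - 0)) / \<delta>))"
  proof (rule nn_integral_FTC_atLeast)
    show "((\<lambda>u. - exp (\<delta> * (x - u)) / \<delta>) \<longlongrightarrow> 0) at_top"
      using \<delta> by real_asymp
  qed (use \<delta> in \<open>auto intro!: derivative_eq_intros\<close>)
  finally show ?thesis by simp
qed

lemma G_int': "integrable lborel (\<lambda>u. indicator {..x} u * G u)"
proof (rule Bochner_Integration.integrable_bound)
  have "integrable lborel (\<lambda>u. indicator {..x} u * exp (\<delta> * u))"
    by (rule integrableI_nonneg) (auto simp: nn_exp_le)
  then show "integrable lborel (\<lambda>u. K * (indicator {..x} u * exp (\<delta> * u)))" by simp
  show "AE u in lborel. norm (indicator {..x} u * G u) \<le> norm (K * (indicator {..x} u * exp (\<delta> * u)))"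
    using G_le G_nonneg K_nonneg by (auto simp: indicator_def abs_mult)
qed measurable

lemma \<psi>_int': "integrable lborel (\<lambda>u. indicator {..x} u * \<psi> u)"
  using integrable_mult_indicator[OF _ \<psi>_int, of "{..x}"] by simp

lemma Gc_diff: "x \<le> y \<Longrightarrow> Gc y - Gc x = (\<integral>u. indicator {x<..y} u * G u \<partial>lborel)"
  unfolding Gc_def
  by (subst Bochner_Integration.integral_diff [symmetric, OF G_int' G_int'])
    (auto intro!: Bochner_Integration.integral_cong simp: indicator_def)

lemma G_int_Ioc: "integrable lborel (\<lambda>u. indicator {x<..y} u * G u)"
  by (rule Bochner_Integration.integrable_bound[OF G_int'[of y]])
    (auto simp: indicator_def G_nonneg)

lemma Gc_mono: "x \<le> y \<Longrightarrow> Gc x \<le> Gc y"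
  using Gc_diff[of x y] by (smt (verit, best) G_nonneg integral_nonneg_AE AE_I2 indicator_pos_le mult_nonneg_nonneg)

lemma Gm_nonneg: "0 \<le> Gm" using G_bound[of 0] G_nonneg[of 0] by simp

lemma Gc_diff_le: "x \<le> y \<Longrightarrow> Gc y - Gc x \<le> Gm * (y - x)"
proof -
  assume xy: "x \<le> y"
  have "Gc y - Gc x \<le> (\<integral>u. indicator {x<..y} u * Gm \<partial>lborel)"
    unfolding Gc_diff[OF xy]
  proof (intro integral_mono G_int_Ioc)
    show "indicator {x<..y} u * G u \<le> indicator {x<..y} u * Gm" for u
      by (intro mult_left_mono G_bound) auto
  qed (use xy in simp)
  then show ?thesis using xy by (simp add: mult.commute)
qed

lemma Gc_lip: "\<bar>Gc x - Gc y\<bar> \<le> Gm * \<bar>x - y\<bar>"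
  using Gc_diff_le[of x y] Gc_diff_le[of y x] Gc_mono[of x y] Gc_mono[of y x]
  by (cases "x \<le> y") auto

lemma Gc_meas [measurable]: "Gc \<in> borel_measurable borel"
  by (rule borel_measurable_mono) (auto intro: monoI Gc_mono)

lemma Gc_int: "integrable F (\<lambda>s. Gc (x - s))"
proof (rule Bochner_Integration.integrable_bound)
  show "integrable F (\<lambda>s. \<bar>Gc x\<bar> + Gm * \<bar>s\<bar>)" using F_int by simp
  show "AE s in F. norm (Gc (x - s)) \<le> norm (\<bar>Gc x\<bar> + Gm * \<bar>s\<bar>)"
  proof (rule AE_I2)
    fix s
    show "norm (Gc (x - s)) \<le> norm (\<bar>Gc x\<bar> + Gm * \<bar>s\<bar>)"
      using Gc_lip[of x "x - s"] by simp
  qed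
qed measurable

lemma Gc_nn: "ennreal (Gc x) = (\<integral>\<^sup>+u. indicator {0..} (x - u) * ennreal (G u) \<partial>lborel)"
  unfolding Gc_def
  by (subst nn_integral_eq_integral [symmetric, OF G_int'])
    (auto simp: G_nonneg indicator_def intro!: nn_integral_cong)

lemma \<Psi>_nn: "ennreal (\<Psi> x) = (\<integral>\<^sup>+u. indicator {0..} (x - u) * ennreal (\<psi> u) \<partial>lborel)"
  unfolding \<Psi>_def
  by (subst nn_integral_eq_integral [symmetric, OF \<psi>_int'])
    (auto simp: \<psi>_nonneg indicator_def intro!: nn_integral_cong)

lemma Gc_nonneg: "0 \<le> Gc x" unfolding Gc_def by (simp add: G_nonneg)
lemma \<Psi>_nonneg: "0 \<le> \<Psi> x" unfolding \<Psi>_def by (simp add: \<psi>_nonneg)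

lemma Gc_eq: "Gc x = (\<integral>s. Gc (x - s) \<partial>F) + \<Psi> x"
proof -
  have "ennreal (Gc x) = (\<integral>\<^sup>+u. indicator {0..} (x - u) * ennreal (\<psi> u) + indicator {0..} (x - u) * (\<integral>\<^sup>+s. ennreal (G (u - s)) \<partial>F) \<partial>lborel)"
    unfolding Gc_nn by (subst nn_G) (simp add: algebra_simps)
  also have "\<dots> = ennreal (\<Psi> x) + (\<integral>\<^sup>+u. indicator {0..} (x - u) * (\<integral>\<^sup>+s. ennreal (G (u - s)) \<partial>F) \<partial>lborel)"
    unfolding \<Psi>_nn by (intro nn_integral_add) measurable
  also have "(\<integral>\<^sup>+u. indicator {0..} (x - u) * (\<integral>\<^sup>+s. ennreal (G (u - s)) \<partial>F) \<partial>lborel) = (\<integral>\<^sup>+s. ennreal (Gc (x - s)) \<partial>F)"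
    unfolding Gc_nn by (subst conv_swap) auto
  also have "\<dots> = ennreal (\<integral>s. Gc (x - s) \<partial>F)"
    by (intro nn_integral_eq_integral Gc_int) (auto simp: Gc_nonneg)
  finally show ?thesis
    by (simp add: ennreal_plus [symmetric] \<Psi>_nonneg Gc_nonneg del: ennreal_plus)
qed

lemma \<Psi>_lim: "(\<Psi> \<longlongrightarrow> I) at_top"
  unfolding \<Psi>_def[abs_def] I_def
proof (rule integral_dominated_convergence_at_top[where w=\<psi>])
  show "AE u in lborel. ((\<lambda>x. indicator {..x} u * \<psi> u) \<longlongrightarrow> \<psi> u) at_top"
  proof (rule AE_I2)
    fix u
    have "eventually (\<lambda>x. \<psi> u = indicator {..x} u * \<psi> u) at_top"
      using eventually_ge_at_top[of u] by eventually_elim auto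
    then show "((\<lambda>x. indicator {..x} u * \<psi> u) \<longlongrightarrow> \<psi> u) at_top"
      by (rule tendsto_eventually[OF eventually_mono]) auto
  qed
qed (auto simp: \<psi>_int \<psi>_nonneg indicator_def)

text \<open>The increment lemma also asks for a bounded function. \<open>Gc\<close> itself may grow
  linearly, but its differences over a fixed lag are bounded.\<close>

definition \<Delta> where "\<Delta> s x = Gc x - Gc (x - s)"

text \<open>The shifts a that are asymptotically invisible form a closed subgroup. It contains
  almost every step of \<open>F\<close> by the increment lemma, and a proper closed subgroup would
  be a lattice.\<close>

lemma \<Delta>_slow: "((\<lambda>x. \<Delta> s x - \<Delta> s (x - a)) \<longlongrightarrow> 0) at_top"
proof -
  have lip: "\<bar>\<Delta> s t - \<Delta> s u\<bar> \<le> 2 * Gm * \<bar>t - u\<bar>" for t u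
    using Gc_lip[of t u] Gc_lip[of "t - s" "u - s"] unfolding \<Delta>_def by simp
  have bd: "\<bar>\<Delta> s t\<bar> \<le> Gm * \<bar>s\<bar>" for t
    using Gc_lip[of t "t - s"] by (simp add: \<Delta>_def)
  have eq: "\<Delta> s t = (\<integral>v. \<Delta> s (t - v) \<partial>F) + (\<Psi> t - \<Psi> (t - s))" for t
  proof -
    have "(\<integral>v. \<Delta> s (t - v) \<partial>F) = (\<integral>v. Gc (t - v) \<partial>F) - (\<integral>v. Gc (t - s - v) \<partial>F)"
      by (subst Bochner_Integration.integral_diff [symmetric, OF Gc_int Gc_int]) (simp add: \<Delta>_def algebra_simps)
    then show ?thesis using Gc_eq[of t] Gc_eq[of "t - s"] by (simp add: \<Delta>_def)
  qed
  have e: "((\<lambda>t. \<Psi> t - \<Psi> (t - s)) \<longlongrightarrow> 0) at_top"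
    using tendsto_diff[OF \<Psi>_lim tendsto_shift[OF \<Psi>_lim, of s]] by simp
  define P where "P = {a. ((\<lambda>x. \<Delta> s x - \<Delta> s (x - a)) \<longlongrightarrow> 0) at_top}"
  have "P = UNIV"
  proof (rule ccontr)
    assume ne: "P \<noteq> UNIV"
    have cl: "closed P"
    proof -
      have "a \<in> P" if a: "a \<in> closure P" for a
        unfolding P_def
      proof (clarify, rule tendstoI)
        fix \<epsilon> :: real assume \<epsilon>: "0 < \<epsilon>"
        \<comment> \<open>\<open>2 * Gm\<close> is a Lipschitz constant of
          \<open>\<Delta> s\<close>; adding 1 avoids a division by zero.\<close>
        have "0 < \<epsilon> / 2 / (2 * Gm + 1)" using \<epsilon> Gm_nonneg by simp
        then obtain b where b: "b \<in> P" "dist b a < \<epsilon> / 2 / (2 * Gm + 1)" using a unfolding closure_approachable by blast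
        then have "((\<lambda>x. \<Delta> s x - \<Delta> s (x - b)) \<longlongrightarrow> 0) at_top" by (simp add: P_def)
        then have "eventually (\<lambda>x. dist (\<Delta> s x - \<Delta> s (x - b)) 0 < \<epsilon> / 2) at_top"
          using \<epsilon> by (intro tendstoD) auto
        then show "eventually (\<lambda>x. dist (\<Delta> s x - \<Delta> s (x - a)) 0 < \<epsilon>) at_top"
        proof eventually_elim
          case (elim x)
          have "\<bar>\<Delta> s (x - b) - \<Delta> s (x - a)\<bar> \<le> 2 * Gm * \<bar>b - a\<bar>" using lip[of "x - b" "x - a"] by (simp add: abs_minus_commute)
          also have "\<dots> \<le> (2 * Gm + 1) * \<bar>b - a\<bar>" by (intro mult_right_mono) auto
          also have "\<dots> \<le> \<epsilon> / 2" using b(2) Gm_nonneg by (simp add: dist_real_def field_simps)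
          finally show ?case using elim unfolding dist_real_def by linarith
        qed
      qed
      then show ?thesis using closure_subset_eq by blast
    qed
    obtain h where h: "0 \<le> h" "P \<subseteq> range (\<lambda>k::int. h * of_int k)"
    proof (rule closed_subgroup_real[OF cl _ _ ne])
      show "0 \<in> P" by (simp add: P_def)
      show "a - b \<in> P" if "a \<in> P" "b \<in> P" for a b
      proof -
        have 1: "((\<lambda>x. \<Delta> s x - \<Delta> s (x - a)) \<longlongrightarrow> 0) at_top" using that by (simp add: P_def)
        have 2: "((\<lambda>x. \<Delta> s x - \<Delta> s (x - b)) \<longlongrightarrow> 0) at_top" using that by (simp add: P_def)
        have "((\<lambda>x. (\<Delta> s x - \<Delta> s (x - a)) - (\<Delta> s (x - (a - b)) - \<Delta> s (x - (a - b) - b))) \<longlongrightarrow> 0 - 0) at_top"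
          by (intro tendsto_diff 1 tendsto_shift[OF 2])
        then show ?thesis by (simp add: P_def algebra_simps)
      qed
    qed
    have "AE v in F. v \<in> P"
      using F.AE_support
    proof eventually_elim
      case (elim v)
      then show ?case unfolding P_def
        using increment_at_support_point_tendsto[OF F bd lip eq e, of v] by simp
    qed
    then have "AE v in F. v \<in> range (\<lambda>k::int. h * of_int k)" by eventually_elim (use h in auto)
    then show False using F_nonar[OF h(1)] by simp
  qed
  then show ?thesis by (auto simp: P_def)
qed

text \<open>The increment over n lags is a sum of n shifted increments over one lag, and by
  \<open>\<Delta>_slow\<close> the shifts do not matter in the limit.\<close>

lemma \<Delta>_mult: "((\<lambda>x. \<Delta> (real n * s) x - real n * \<Delta> s x) \<longlongrightarrow> 0) at_top"
proof (induction n)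
  case (Suc n)
  have "((\<lambda>x. (\<Delta> (real n * s) x - real n * \<Delta> s x) - (\<Delta> s x - \<Delta> s (x - real n * s))) \<longlongrightarrow> 0 - 0) at_top"
    by (intro tendsto_diff Suc.IH \<Delta>_slow)
  then show ?case by (simp add: \<Delta>_def algebra_simps)
qed (simp add: \<Delta>_def)

text \<open>Additivity settles rational s, and the Lipschitz bound on \<open>Gc\<close> passes from
  rational to real s.\<close>

lemma \<Delta>_linear_pos:
  assumes s: "0 \<le> s"
  shows "((\<lambda>x. \<Delta> s x - s * \<Delta> 1 x) \<longlongrightarrow> 0) at_top"
proof (rule tendstoI)
  fix \<epsilon> :: real assume \<epsilon>: "0 < \<epsilon>"
  \<comment> \<open>\<open>p / q\<close> approximates \<open>s\<close> within 1 / q, so each of the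
    two replacements of s by p / q costs at most Gm / q, which is below \<epsilon> / 4.\<close>
  obtain q :: nat where q: "4 * (Gm + 1) / \<epsilon> < real q" using reals_Archimedean2 by blast
  have q0: "real q > 0" using q Gm_nonneg \<epsilon> by (smt (verit) divide_nonneg_nonneg)
  define p where "p = nat \<lfloor>s * real q\<rfloor>"
  define t where "t = real p / real q"
  have "real p \<le> s * real q" "s * real q < real p + 1"
    using s q0 by (auto simp: p_def)
  then have "\<bar>s * real q - real p\<bar> / real q \<le> 1 / real q" using q0 by (intro divide_right_mono) auto
  moreover have "s - t = (s * real q - real p) / real q" using q0 by (simp add: t_def field_simps)
  ultimately have st: "\<bar>s - t\<bar> \<le> 1 / real q" by simp
  have Gq: "(Gm + 1) / real q < \<epsilon> / 4" using q q0 \<epsilon> by (simp add: field_simps)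
  have d1: "\<bar>\<Delta> 1 x\<bar> \<le> Gm" for x using Gc_lip[of x "x - 1"] by (simp add: \<Delta>_def)
  have 1: "((\<lambda>x. \<Delta> (real p * (1 / real q)) x - real p * \<Delta> (1 / real q) x) \<longlongrightarrow> 0) at_top" by (rule \<Delta>_mult)
  have 2: "((\<lambda>x. \<Delta> (real q * (1 / real q)) x - real q * \<Delta> (1 / real q) x) \<longlongrightarrow> 0) at_top" by (rule \<Delta>_mult)
  have "((\<lambda>x. (\<Delta> (real p * (1 / real q)) x - real p * \<Delta> (1 / real q) x) - t * (\<Delta> (real q * (1 / real q)) x - real q * \<Delta> (1 / real q) x)) \<longlongrightarrow> 0 - t * 0) at_top"
    by (intro tendsto_diff tendsto_mult 1 2 tendsto_const)
  moreover have "(\<Delta> (real p * (1 / real q)) x - real p * \<Delta> (1 / real q) x) - t * (\<Delta> (real q * (1 / real q)) x - real q * \<Delta> (1 / real q) x) = \<Delta> t x - t * \<Delta> 1 x" for x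
    using q0 by (simp add: t_def field_simps)
  ultimately have "((\<lambda>x. \<Delta> t x - t * \<Delta> 1 x) \<longlongrightarrow> 0) at_top" by simp
  then have "eventually (\<lambda>x. dist (\<Delta> t x - t * \<Delta> 1 x) 0 < \<epsilon> / 2) at_top"
    using \<epsilon> by (intro tendstoD) auto
  then show "eventually (\<lambda>x. dist (\<Delta> s x - s * \<Delta> 1 x) 0 < \<epsilon>) at_top"
  proof eventually_elim
    case (elim x)
    have "\<bar>\<Delta> s x - \<Delta> t x\<bar> \<le> Gm * \<bar>s - t\<bar>" using Gc_lip[of "x - t" "x - s"] by (simp add: \<Delta>_def)
    also have "\<dots> \<le> Gm * (1 / real q)" using st Gm_nonneg by (intro mult_left_mono)
    finally have 3: "\<bar>\<Delta> s x - \<Delta> t x\<bar> \<le> Gm / real q" by simp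
    have "\<bar>s * \<Delta> 1 x - t * \<Delta> 1 x\<bar> = \<bar>s - t\<bar> * \<bar>\<Delta> 1 x\<bar>" by (simp add: abs_mult [symmetric] algebra_simps)
    also have "\<dots> \<le> 1 / real q * Gm" using st d1[of x] Gm_nonneg q0 by (intro mult_mono) auto
    finally have 4: "\<bar>s * \<Delta> 1 x - t * \<Delta> 1 x\<bar> \<le> Gm / real q" by simp
    have "Gm / real q \<le> (Gm + 1) / real q" using q0 by (simp add: divide_right_mono)
    then show ?case using 3 4 Gq elim unfolding dist_real_def by linarith
  qed
qed

lemma \<Delta>_linear: "((\<lambda>x. \<Delta> s x - s * \<Delta> 1 x) \<longlongrightarrow> 0) at_top"
proof (cases "0 \<le> s")
  case True then show ?thesis by (rule \<Delta>_linear_pos)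
next
  case False
  then have "((\<lambda>x. \<Delta> (- s) x - (- s) * \<Delta> 1 x) \<longlongrightarrow> 0) at_top" by (intro \<Delta>_linear_pos) auto
  \<comment> \<open>For s < 0 the increment is minus the increment over the positive lag -s, taken
    at the shifted point x - s.\<close>
  then have "((\<lambda>x. - (\<Delta> (- s) x - (- s) * \<Delta> 1 x) + (\<Delta> (-s) x - \<Delta> (- s) (x - s))) \<longlongrightarrow> - 0 + 0) at_top"
    by (intro tendsto_add tendsto_minus \<Delta>_slow)
  then show ?thesis by (simp add: \<Delta>_def algebra_simps)
qed

text \<open>Integrating the renewal equation over \<open>]-\<infinity>, x]\<close> gives \<open>\<Psi> x = \<integral>s. \<Delta> s x \<partial>F\<close>, which identifies the limit
  because \<open>\<Delta> s x\<close> is asymptotically \<open>s * \<Delta> 1 x\<close>.\<close>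

lemma \<Delta>_1_lim: "(\<Delta> 1 \<longlongrightarrow> I / m) at_top"
proof -
  have d1: "\<bar>\<Delta> s x\<bar> \<le> Gm * \<bar>s\<bar>" for s x using Gc_lip[of x "x - s"] by (simp add: \<Delta>_def)
  have int: "integrable F (\<lambda>s. \<Delta> s x)" for x
    unfolding \<Delta>_def by (intro Bochner_Integration.integrable_diff Gc_int) auto
  have "\<Psi> x = (\<integral>s. \<Delta> s x \<partial>F)" for x
    unfolding \<Delta>_def using Gc_eq[of x] Gc_int[of x]
    by (subst Bochner_Integration.integral_diff) (auto simp: F.prob_space[unfolded F.space_eq_univ])
  then have eq: "(\<integral>s. \<Delta> s x - s * \<Delta> 1 x \<partial>F) = \<Psi> x - m * \<Delta> 1 x" for x
    by (subst Bochner_Integration.integral_diff) (auto simp: int F_int m_def)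
  have "((\<lambda>x. \<integral>s. \<Delta> s x - s * \<Delta> 1 x \<partial>F) \<longlongrightarrow> (\<integral>s. 0 \<partial>F)) at_top"
  proof (rule integral_dominated_convergence_at_top[where w="\<lambda>s. 2 * Gm * \<bar>s\<bar>"])
    show "AE s in F. ((\<lambda>x. \<Delta> s x - s * \<Delta> 1 x) \<longlongrightarrow> 0) at_top" by (intro AE_I2 \<Delta>_linear)
    show "eventually (\<lambda>x. AE s in F. norm (\<Delta> s x - s * \<Delta> 1 x) \<le> 2 * Gm * \<bar>s\<bar>) at_top"
    proof (intro always_eventually allI AE_I2)
      fix s x
      have "\<bar>s * \<Delta> 1 x\<bar> \<le> \<bar>s\<bar> * Gm" using d1[of 1 x] by (simp add: abs_mult mult_left_mono)
      then show "norm (\<Delta> s x - s * \<Delta> 1 x) \<le> 2 * Gm * \<bar>s\<bar>" using d1[of s x] by (simp add: algebra_simps)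
    qed
    show "integrable F (\<lambda>s. 2 * Gm * \<bar>s\<bar>)" using F_int by simp
    show "(\<lambda>s. \<Delta> s x - s * \<Delta> 1 x) \<in> borel_measurable F" for x
      unfolding \<Delta>_def by measurable
  qed auto
  then have "((\<lambda>x. (\<Psi> x - (\<Psi> x - m * \<Delta> 1 x)) / m) \<longlongrightarrow> (I - 0) / m) at_top"
    unfolding eq using m_pos by (intro tendsto_intros \<Psi>_lim) auto
  then show ?thesis using m_pos by simp
qed

lemma \<Delta>_lim: "(\<Delta> s \<longlongrightarrow> s * (I / m)) at_top"
proof -
  have "((\<lambda>x. (\<Delta> s x - s * \<Delta> 1 x) + s * \<Delta> 1 x) \<longlongrightarrow> 0 + s * (I / m)) at_top"
    by (intro tendsto_intros \<Delta>_linear \<Delta>_1_lim)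
  then show ?thesis by simp
qed

text \<open>Together with \<open>G_lower\<close> this brackets a value of \<open>G\<close> between
  averages over windows of length \<eta> just before and just after it, up to factors that tend to 1
  as \<eta> tends to 0.\<close>

lemma G_upper: "0 < \<eta> \<Longrightarrow> G t \<le> exp (\<beta> * \<eta>) * (\<Delta> \<eta> t / \<eta>)"
proof -
  assume \<eta>: "0 < \<eta>"
  have "(\<integral>u. indicator {t-\<eta><..t} u * (exp (- \<beta> * \<eta>) * G t) \<partial>lborel) \<le> (\<integral>u. indicator {t-\<eta><..t} u * G u \<partial>lborel)"
  proof (intro integral_mono G_int_Ioc)
    fix u
    have "exp (- \<beta> * \<eta>) * G t \<le> G u" if u: "t - \<eta> < u" "u \<le> t"
    proof -
      have "G t \<le> exp (\<beta> * (t - u)) * G u" using G_mono u by auto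
      also have "\<dots> \<le> exp (\<beta> * \<eta>) * G u" using u \<beta> G_nonneg[of u]
        by (intro mult_right_mono) (auto)
      finally show ?thesis by (simp add: exp_minus divide_simps mult.commute)
    qed
    then show "indicator {t-\<eta><..t} u * (exp (- \<beta> * \<eta>) * G t) \<le> indicator {t-\<eta><..t} u * G u"
      by (auto simp: indicator_def)
  qed (use \<eta> in simp)
  also have "\<dots> = \<Delta> \<eta> t" unfolding \<Delta>_def using \<eta> by (subst Gc_diff) auto
  finally show ?thesis using \<eta> by (simp add: exp_minus field_simps)
qed

lemma G_lower: "0 < \<eta> \<Longrightarrow> exp (- \<beta> * \<eta>) * (\<Delta> \<eta> (t + \<eta>) / \<eta>) \<le> G t"
proof -
  assume \<eta>: "0 < \<eta>"
  have "\<Delta> \<eta> (t + \<eta>) = (\<integral>u. indicator {t<..t+\<eta>} u * G u \<partial>lborel)" unfolding \<Delta>_def using \<eta> Gc_diff[of t "t + \<eta>"] by simp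
  also have "\<dots> \<le> (\<integral>u. indicator {t<..t+\<eta>} u * (exp (\<beta> * \<eta>) * G t) \<partial>lborel)"
  proof (intro integral_mono G_int_Ioc)
    fix u
    have "G u \<le> exp (\<beta> * \<eta>) * G t" if u: "t < u" "u \<le> t + \<eta>"
    proof -
      have "G u \<le> exp (\<beta> * (u - t)) * G t" using G_mono u by auto
      also have "\<dots> \<le> exp (\<beta> * \<eta>) * G t" using u \<beta> G_nonneg[of t]
        by (intro mult_right_mono) (auto)
      finally show ?thesis .
    qed
    then show "indicator {t<..t+\<eta>} u * G u \<le> indicator {t<..t+\<eta>} u * (exp (\<beta> * \<eta>) * G t)"
      by (auto simp: indicator_def)
  qed (use \<eta> in simp)
  finally show ?thesis using \<eta> by (simp add: exp_minus field_simps)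
qed

theorem renewal_limit: "(G \<longlongrightarrow> I / m) at_top"
proof -
  define c where "c = I / m"
  have c: "0 \<le> c" using I_nonneg m_pos by (simp add: c_def)
  have up: "((\<lambda>t. exp (\<beta> * \<eta>) * (\<Delta> \<eta> t / \<eta>)) \<longlongrightarrow> exp (\<beta> * \<eta>) * c) at_top" if "0 < \<eta>" for \<eta>
    using that unfolding c_def by (auto intro!: tendsto_eq_intros \<Delta>_lim)
  have lo: "((\<lambda>t. exp (- \<beta> * \<eta>) * (\<Delta> \<eta> (t + \<eta>) / \<eta>)) \<longlongrightarrow> exp (- \<beta> * \<eta>) * c) at_top" if "0 < \<eta>" for \<eta>
    using that tendsto_shift[OF \<Delta>_lim[of \<eta>], of "-\<eta>"] unfolding c_def by (auto intro!: tendsto_eq_intros)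
  show ?thesis
    unfolding c_def [symmetric]
  proof (rule order_tendstoI)
    fix y assume y: "c < y"
    have "((\<lambda>\<eta>. exp (\<beta> * \<eta>) * c) \<longlongrightarrow> exp (\<beta> * 0) * c) (at_right 0)" by (intro tendsto_intros)
    then have "eventually (\<lambda>\<eta>. exp (\<beta> * \<eta>) * c < y) (at_right 0)" using y by (intro order_tendstoD) auto
    then have "eventually (\<lambda>\<eta>. exp (\<beta> * \<eta>) * c < y \<and> 0 < \<eta>) (at_right 0)"
      using eventually_at_right_less by eventually_elim auto
    then obtain \<eta> where \<eta>: "0 < \<eta>" "exp (\<beta> * \<eta>) * c < y"
      using eventually_happens'[OF trivial_limit_at_right_real] by blast
    have "eventually (\<lambda>t. exp (\<beta> * \<eta>) * (\<Delta> \<eta> t / \<eta>) < y) at_top"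
      by (rule order_tendstoD[OF up]) (use \<eta> in auto)
    then show "eventually (\<lambda>t. G t < y) at_top"
      by eventually_elim (use G_upper[OF \<eta>(1)] in \<open>auto intro: order_le_less_trans\<close>)
  next
    fix y assume y: "y < c"
    have "((\<lambda>\<eta>. exp (- \<beta> * \<eta>) * c) \<longlongrightarrow> exp (- \<beta> * 0) * c) (at_right 0)" by (intro tendsto_intros)
    then have "eventually (\<lambda>\<eta>. y < exp (- \<beta> * \<eta>) * c) (at_right 0)" using y by (intro order_tendstoD) auto
    then have "eventually (\<lambda>\<eta>. y < exp (- \<beta> * \<eta>) * c \<and> 0 < \<eta>) (at_right 0)"
      using eventually_at_right_less by eventually_elim auto
    then obtain \<eta> where \<eta>: "0 < \<eta>" "y < exp (- \<beta> * \<eta>) * c"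
      using eventually_happens'[OF trivial_limit_at_right_real] by blast
    have "eventually (\<lambda>t. y < exp (- \<beta> * \<eta>) * (\<Delta> \<eta> (t + \<eta>) / \<eta>)) at_top"
      by (rule order_tendstoD[OF lo]) (use \<eta> in auto)
    then show "eventually (\<lambda>t. y < G t) at_top"
      by eventually_elim (use G_lower[OF \<eta>(1)] in \<open>auto intro: order_less_le_trans\<close>)
  qed
qed

end

section \<open>Independence and power tails\<close>

context prob_space
begin

text \<open>The library's \<open>indep_var\<close> needs both variables to have the same type.\<close>

definition indep_pair :: "'b measure \<Rightarrow> ('a \<Rightarrow> 'b) \<Rightarrow> 'c measure \<Rightarrow> ('a \<Rightarrow> 'c) \<Rightarrow> bool" where
  "indep_pair S X T Y \<longleftrightarrow> X \<in> measurable M S \<and> Y \<in> measurable M T \<and>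
     distr M S X \<Otimes>\<^sub>M distr M T Y = distr M (S \<Otimes>\<^sub>M T) (\<lambda>\<omega>. (X \<omega>, Y \<omega>))"

lemma indep_pair_iff_indep_var: "indep_pair S X T Y \<longleftrightarrow> indep_var S X T Y"
  by (simp add: indep_pair_def indep_var_distribution_eq)

lemma indep_pair_compose:
  assumes ind: "indep_pair S X T Y" and f [measurable]: "f \<in> measurable S S'" and g [measurable]: "g \<in> measurable T T'"
  shows "indep_pair S' (\<lambda>\<omega>. f (X \<omega>)) T' (\<lambda>\<omega>. g (Y \<omega>))"
proof -
  have X [measurable]: "X \<in> measurable M S" and Y [measurable]: "Y \<in> measurable M T"
    and eq: "distr M S X \<Otimes>\<^sub>M distr M T Y = distr M (S \<Otimes>\<^sub>M T) (\<lambda>\<omega>. (X \<omega>, Y \<omega>))"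
    using ind by (auto simp: indep_pair_def)
  interpret Y: prob_space "distr M T Y" by (rule prob_space_distr) fact
  interpret gY: prob_space "distr (distr M T Y) T' g" by (rule Y.prob_space_distr) simp
  have "distr M S' (\<lambda>\<omega>. f (X \<omega>)) \<Otimes>\<^sub>M distr M T' (\<lambda>\<omega>. g (Y \<omega>)) = distr (distr M S X) S' f \<Otimes>\<^sub>M distr (distr M T Y) T' g"
    by (simp add: distr_distr comp_def)
  also have "\<dots> = distr (distr M S X \<Otimes>\<^sub>M distr M T Y) (S' \<Otimes>\<^sub>M T') (\<lambda>(x, y). (f x, g y))"
    by (rule pair_measure_distr) (auto intro: gY.sigma_finite_measure_axioms)
  also have "\<dots> = distr M (S' \<Otimes>\<^sub>M T') (\<lambda>\<omega>. (f (X \<omega>), g (Y \<omega>)))"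
    unfolding eq by (subst distr_distr) (auto simp: comp_def)
  finally show ?thesis by (simp add: indep_pair_def)
qed

lemma indep_pair_sym:
  assumes ind: "indep_pair S X T Y"
  shows "indep_pair T Y S X"
proof -
  have X [measurable]: "X \<in> measurable M S" and Y [measurable]: "Y \<in> measurable M T"
    and eq: "distr M S X \<Otimes>\<^sub>M distr M T Y = distr M (S \<Otimes>\<^sub>M T) (\<lambda>\<omega>. (X \<omega>, Y \<omega>))"
    using ind by (auto simp: indep_pair_def)
  interpret X: prob_space "distr M S X" by (rule prob_space_distr) fact
  interpret Y: prob_space "distr M T Y" by (rule prob_space_distr) fact
  interpret pair_sigma_finite "distr M T Y" "distr M S X" ..
  have "distr M T Y \<Otimes>\<^sub>M distr M S X = distr (distr M S X \<Otimes>\<^sub>M distr M T Y) (T \<Otimes>\<^sub>M S) (\<lambda>(x, y). (y, x))"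
    by (subst distr_pair_swap) (auto intro!: distr_cong)
  also have "\<dots> = distr M (T \<Otimes>\<^sub>M S) (\<lambda>\<omega>. (Y \<omega>, X \<omega>))"
    unfolding eq by (subst distr_distr) (auto simp: comp_def)
  finally show ?thesis by (simp add: indep_pair_def)
qed

text \<open>The inner integral samples the second variable from an independent copy of the space.
  Later proofs can thus fix the first variable and stay on \<open>M\<close> without naming marginal
  laws.\<close>

lemma indep_integral:
  fixes f :: "_ \<Rightarrow> real"
  assumes "indep_pair S X T Y" and f: "f \<in> borel_measurable (S \<Otimes>\<^sub>M T)" and bd: "\<And>z. \<bar>f z\<bar> \<le> B"
  shows "(\<integral>\<omega>. f (X \<omega>, Y \<omega>) \<partial>M) = (\<integral>\<omega>. (\<integral>\<omega>'. f (X \<omega>, Y \<omega>') \<partial>M) \<partial>M)"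
proof -
  have X [measurable]: "X \<in> measurable M S" and Y [measurable]: "Y \<in> measurable M T"
    and eq: "distr M S X \<Otimes>\<^sub>M distr M T Y = distr M (S \<Otimes>\<^sub>M T) (\<lambda>\<omega>. (X \<omega>, Y \<omega>))"
    using assms(1) by (auto simp: indep_pair_def)
  note f [measurable]
  interpret X: prob_space "distr M S X" by (rule prob_space_distr) fact
  interpret Y: prob_space "distr M T Y" by (rule prob_space_distr) fact
  interpret pair_prob_space "distr M S X" "distr M T Y" ..
  have "(\<integral>\<omega>. f (X \<omega>, Y \<omega>) \<partial>M) = (\<integral>z. f z \<partial>(distr M S X \<Otimes>\<^sub>M distr M T Y))"
    unfolding eq by (subst integral_distr) auto
  also have "\<dots> = (\<integral>x. \<integral>y. f (x, y) \<partial>distr M T Y \<partial>distr M S X)"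
    by (subst integral_fst') (auto intro!: P.integrable_const_bound[of _ B] simp: bd)
  also have "\<dots> = (\<integral>\<omega>. (\<integral>y. f (X \<omega>, y) \<partial>distr M T Y) \<partial>M)"
    by (subst integral_distr) auto
  also have "\<dots> = (\<integral>\<omega>. (\<integral>\<omega>'. f (X \<omega>, Y \<omega>') \<partial>M) \<partial>M)"
    by (intro Bochner_Integration.integral_cong integral_distr) (auto intro: measurable_Pair2[OF f] dest: measurable_space[OF X])
  finally show ?thesis .
qed

lemma indep_prob:
  assumes "indep_pair S X T Y" and [measurable]: "Measurable.pred (S \<Otimes>\<^sub>M T) (\<lambda>z. Q (fst z) (snd z))"
  shows "prob {\<omega>\<in>space M. Q (X \<omega>) (Y \<omega>)} = (\<integral>\<omega>. prob {\<omega>'\<in>space M. Q (X \<omega>) (Y \<omega>')} \<partial>M)"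
proof -
  have X [measurable]: "X \<in> measurable M S" and Y [measurable]: "Y \<in> measurable M T"
    using assms(1) by (auto simp: indep_pair_def)
  have *: "Measurable.pred M (\<lambda>\<omega>'. Q (X \<omega>) (Y \<omega>'))" if "\<omega> \<in> space M" for \<omega>
  proof -
    have "(\<lambda>\<omega>'. (X \<omega>, Y \<omega>')) \<in> measurable M (S \<Otimes>\<^sub>M T)"
      using measurable_space[OF X that] by simp
    from measurable_compose[OF this assms(2)] show ?thesis by simp
  qed
  have Qm: "Measurable.pred M (\<lambda>\<omega>. Q (X \<omega>) (Y \<omega>))"
    using measurable_compose[OF measurable_Pair[OF X Y] assms(2)] by simp
  have "prob {\<omega>\<in>space M. Q (X \<omega>) (Y \<omega>)} = (\<integral>\<omega>. of_bool (Q (X \<omega>) (Y \<omega>)) \<partial>M)"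
    using Qm by (subst Bochner_Integration.integral_cong[OF refl, of _ _ "indicator {\<omega>\<in>space M. Q (X \<omega>) (Y \<omega>)}"]) (auto simp: indicator_def)
  also have "\<dots> = (\<integral>\<omega>. \<integral>\<omega>'. of_bool (Q (X \<omega>) (Y \<omega>')) \<partial>M \<partial>M)"
    using indep_integral[OF assms(1), of "\<lambda>z. of_bool (Q (fst z) (snd z))" 1] by simp
  also have "\<dots> = (\<integral>\<omega>. prob {\<omega>'\<in>space M. Q (X \<omega>) (Y \<omega>')} \<partial>M)"
    by (intro Bochner_Integration.integral_cong refl, subst Bochner_Integration.integral_cong[OF refl, of _ _ "indicator {\<omega>'\<in>space M. Q (X _) (Y \<omega>')}"])
      (auto simp: indicator_def of_bool_def * intro!: arg_cong[where f=prob])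
  finally show ?thesis .
qed

text \<open>As a function of y = x^\<alpha>, the power x^s is strictly concave and lies below its
  tangent at y = 1, touching it only at x = 1. The tangent has expectation 1, so equality would
  force the variable to be 1 almost surely.\<close>

lemma powr_moment_less:
  fixes a :: "'a \<Rightarrow> real"
  assumes [measurable]: "a \<in> borel_measurable M" and pos: "AE \<omega> in M. a \<omega> > 0"
    and s: "0 < s" "s < \<alpha>" and int: "integrable M (\<lambda>\<omega>. a \<omega> powr \<alpha>)"
    and one: "(\<integral>\<omega>. a \<omega> powr \<alpha> \<partial>M) = 1" and ne: "\<not> (AE \<omega> in M. a \<omega> = 1)"
  shows "integrable M (\<lambda>\<omega>. a \<omega> powr s)" "(\<integral>\<omega>. a \<omega> powr s \<partial>M) < 1"
proof -
  define \<theta> where "\<theta> = s / \<alpha>"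
  have \<theta>: "0 < \<theta>" "\<theta> < 1" using s by (auto simp: \<theta>_def)
  have key: "x powr s \<le> 1 + \<theta> * (x powr \<alpha> - 1)" "x powr s = 1 + \<theta> * (x powr \<alpha> - 1) \<Longrightarrow> x = 1"
    if x: "x > 0" for x
  proof -
    define y where "y = x powr \<alpha>"
    have y: "y > 0" using x by (simp add: y_def)
    \<comment> \<open>\<open>w\<close> is the tangent, that is the mean of y and 1 with weights
      \<theta> and 1 - \<theta>. The estimate is the weighted AM-GM inequality, derived from ln u
      \<le> u - 1 at u = y / w and u = 1 / w so that the case of equality stays visible.\<close>
    define w where "w = 1 + \<theta> * (y - 1)"
    have w: "w > 0"
    proof -
      have "w = \<theta> * y + (1 - \<theta>)" by (simp add: w_def algebra_simps)
      then show ?thesis using \<theta> y by (simp add: add_pos_pos)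
    qed
    have l1: "ln (y / w) \<le> y / w - 1" using y w by (intro ln_le_minus_one) simp
    have l2: "ln (1 / w) \<le> 1 / w - 1" using w by (intro ln_le_minus_one) simp
    have z: "\<theta> * (y / w - 1) + (1 - \<theta>) * (1 / w - 1) = 0"
    proof -
      have "\<theta> * (y / w - 1) + (1 - \<theta>) * (1 / w - 1) = (\<theta> * y + (1 - \<theta>)) / w - 1"
        using w by (simp add: field_simps)
      also have "\<theta> * y + (1 - \<theta>) = w" by (simp add: w_def algebra_simps)
      finally show ?thesis using w by simp
    qed
    have lin: "\<theta> * ln (y / w) + (1 - \<theta>) * ln (1 / w) = \<theta> * ln y - ln w"
      using y w by (simp add: ln_div algebra_simps)
    have xs: "ln (x powr s) = \<theta> * ln y" using x s by (simp add: y_def \<theta>_def ln_powr)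
    have "\<theta> * ln y \<le> ln w"
      using mult_left_mono[OF l1, of \<theta>] mult_left_mono[OF l2, of "1 - \<theta>"] \<theta> z lin by linarith
    then have "ln (x powr s) \<le> ln w" by (simp only: xs)
    then have "x powr s \<le> w" using x w by (subst (asm) ln_le_cancel_iff) auto
    then show "x powr s \<le> 1 + \<theta> * (x powr \<alpha> - 1)" by (simp add: w_def y_def)
    assume "x powr s = 1 + \<theta> * (x powr \<alpha> - 1)"
    then have "\<theta> * ln y = ln w" using xs by (simp add: w_def y_def)
    then have "\<theta> * ln (y / w) + (1 - \<theta>) * ln (1 / w) = \<theta> * (y / w - 1) + (1 - \<theta>) * (1 / w - 1)"
      using lin z by simp
    then have "\<theta> * ln (y / w) = \<theta> * (y / w - 1)" "(1 - \<theta>) * ln (1 / w) = (1 - \<theta>) * (1 / w - 1)"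
      using mult_left_mono[OF l1, of \<theta>] mult_left_mono[OF l2, of "1 - \<theta>"] \<theta> by linarith+
    then have "ln (y / w) = y / w - 1" "ln (1 / w) = 1 / w - 1" using \<theta> by auto
    then have "y / w = 1" "1 / w = 1" using y w by (auto dest!: ln_eq_minus_one[rotated] simp only: divide_pos_pos zero_less_one)
    then have "y = 1" by simp
    moreover have "ln y = \<alpha> * ln x" using x by (simp add: y_def ln_powr)
    ultimately show "x = 1" using x s by simp
  qed
  show i: "integrable M (\<lambda>\<omega>. a \<omega> powr s)"
  proof (rule Bochner_Integration.integrable_bound)
    show "integrable M (\<lambda>\<omega>. 1 + \<theta> * (a \<omega> powr \<alpha> - 1))" using int by simp
    show "AE \<omega> in M. norm (a \<omega> powr s) \<le> norm (1 + \<theta> * (a \<omega> powr \<alpha> - 1))"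
      using pos
    proof eventually_elim
      case (elim \<omega>)
      then show ?case using key(1)[of "a \<omega>"] by simp
    qed
  qed measurable
  have i2: "integrable M (\<lambda>\<omega>. 1 + \<theta> * (a \<omega> powr \<alpha> - 1) - a \<omega> powr s)" using int i by simp
  have e: "(\<integral>\<omega>. 1 + \<theta> * (a \<omega> powr \<alpha> - 1) - a \<omega> powr s \<partial>M) = 1 - (\<integral>\<omega>. a \<omega> powr s \<partial>M)"
    using int i by (simp add: one prob_space)
  have n: "AE \<omega> in M. 0 \<le> 1 + \<theta> * (a \<omega> powr \<alpha> - 1) - a \<omega> powr s"
    using pos by eventually_elim (use key(1) in fastforce)
  have "(\<integral>\<omega>. a \<omega> powr s \<partial>M) \<le> 1" using integral_nonneg_AE[OF n] e by simp
  moreover have "(\<integral>\<omega>. a \<omega> powr s \<partial>M) \<noteq> 1"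
  proof
    assume "(\<integral>\<omega>. a \<omega> powr s \<partial>M) = 1"
    then have "AE \<omega> in M. 1 + \<theta> * (a \<omega> powr \<alpha> - 1) - a \<omega> powr s = 0"
      using integral_nonneg_eq_0_iff_AE[OF i2 n] e by simp
    then have "AE \<omega> in M. a \<omega> = 1" using pos by eventually_elim (use key(2) in fastforce)
    then show False using ne by simp
  qed
  ultimately show "(\<integral>\<omega>. a \<omega> powr s \<partial>M) < 1" by simp
qed

text \<open>A weak moment of order \<open>s\<close>. Unlike the moment itself it remains finite at
  the critical exponent, where the tail has exactly the order y^(-s).\<close>

definition tail_bd :: "('a \<Rightarrow> real) \<Rightarrow> real \<Rightarrow> real \<Rightarrow> bool" where
  "tail_bd X C s \<longleftrightarrow> (\<forall>y>0. prob {\<omega>\<in>space M. X \<omega> > y} \<le> C * y powr (- s))"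

lemma tail_bdD: "tail_bd X C s \<Longrightarrow> y > 0 \<Longrightarrow> prob {\<omega>\<in>space M. X \<omega> > y} \<le> C * y powr (- s)"
  by (simp add: tail_bd_def)

lemma tail_bd_nonneg: "tail_bd X C s \<Longrightarrow> 0 \<le> C"
  using tail_bdD[of X C s 1] by (auto intro: order_trans[OF measure_nonneg])

lemma tail_bd_moment:
  assumes [measurable]: "X \<in> borel_measurable M" and s: "0 < s" and int: "integrable M (\<lambda>\<omega>. X \<omega> powr s)"
  shows "tail_bd X (\<integral>\<omega>. X \<omega> powr s \<partial>M) s"
  unfolding tail_bd_def
proof (intro allI impI)
  fix y :: real assume y: "0 < y"
  have "{\<omega>\<in>space M. X \<omega> > y} \<subseteq> {\<omega>\<in>space M. y powr s \<le> X \<omega> powr s}"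
    using y s by (auto intro!: powr_mono2)
  then have "prob {\<omega>\<in>space M. X \<omega> > y} \<le> prob {\<omega>\<in>space M. y powr s \<le> X \<omega> powr s}"
    by (intro finite_measure_mono) auto
  also have "\<dots> \<le> (\<integral>\<omega>. X \<omega> powr s \<partial>M) / y powr s"
    by (intro integral_Markov_inequality_measure[where A="{}"] int) (use y in auto)
  finally show "prob {\<omega>\<in>space M. X \<omega> > y} \<le> (\<integral>\<omega>. X \<omega> powr s \<partial>M) * y powr (- s)"
    by (simp add: powr_minus divide_inverse)
qed

text \<open>Conditioning on \<open>a\<close> replaces the threshold y by y / a, and the power bound
  lets a^s factor out.\<close>

lemma tail_bd_mult:
  assumes ind: "indep_pair borel a borel X" and X: "tail_bd X C s"
    and pos: "AE \<omega> in M. a \<omega> > 0" and int: "integrable M (\<lambda>\<omega>. a \<omega> powr s)"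
  shows "tail_bd (\<lambda>\<omega>. a \<omega> * X \<omega>) (C * (\<integral>\<omega>. a \<omega> powr s \<partial>M)) s"
  unfolding tail_bd_def
proof (intro allI impI)
  fix y :: real assume y: "0 < y"
  have [measurable]: "a \<in> borel_measurable M" "X \<in> borel_measurable M"
    using ind by (auto simp: indep_pair_def)
  have "prob {\<omega>\<in>space M. y < a \<omega> * X \<omega>} = (\<integral>\<omega>. prob {\<omega>'\<in>space M. y < a \<omega> * X \<omega>'} \<partial>M)"
    by (rule indep_prob[OF ind]) measurable
  also have "\<dots> \<le> (\<integral>\<omega>. C * y powr (- s) * a \<omega> powr s \<partial>M)"
  proof (rule integral_mono_AE)
    show "AE \<omega> in M. prob {\<omega>'\<in>space M. y < a \<omega> * X \<omega>'} \<le> C * y powr (- s) * a \<omega> powr s"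
      using pos
    proof eventually_elim
      case (elim \<omega>)
      have "{\<omega>'\<in>space M. y < a \<omega> * X \<omega>'} = {\<omega>'\<in>space M. y / a \<omega> < X \<omega>'}"
        using elim by (auto simp: field_simps)
      moreover have "(y / a \<omega>) powr (- s) = y powr (- s) * a \<omega> powr s"
        using elim y by (simp add: powr_divide powr_minus_divide)
      ultimately show ?case using tail_bdD[OF X, of "y / a \<omega>"] elim y by simp
    qed
    show "integrable M (\<lambda>\<omega>. prob {\<omega>'\<in>space M. y < a \<omega> * X \<omega>'})"
      by (rule integrable_const_bound[of _ 1]) auto
  qed (use int in simp)
  finally show "prob {\<omega>\<in>space M. y < a \<omega> * X \<omega>} \<le> C * (\<integral>\<omega>. a \<omega> powr s \<partial>M) * y powr (- s)"
    by (simp add: algebra_simps)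
qed

lemma prob_add_gt_le:
  fixes X Y :: "'a \<Rightarrow> real"
  assumes [measurable]: "X \<in> borel_measurable M" "Y \<in> borel_measurable M"
  shows "prob {\<omega>\<in>space M. X \<omega> + Y \<omega> > u + v} \<le> prob {\<omega>\<in>space M. X \<omega> > u} + prob {\<omega>\<in>space M. Y \<omega> > v}"
proof -
  have "prob {\<omega>\<in>space M. X \<omega> + Y \<omega> > u + v} \<le> prob ({\<omega>\<in>space M. X \<omega> > u} \<union> {\<omega>\<in>space M. Y \<omega> > v})"
    by (intro finite_measure_mono) auto
  also have "\<dots> \<le> prob {\<omega>\<in>space M. X \<omega> > u} + prob {\<omega>\<in>space M. Y \<omega> > v}"
    by (intro measure_Un_le) auto
  finally show ?thesis .
qed

text \<open>The summands may be dependent: the threshold is split in the proportions 1 - \<epsilon>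
  and \<epsilon>. For small \<epsilon> the first constant grows by a factor close to 1, which
  preserves a strict contraction.\<close>

lemma tail_bd_add:
  assumes [measurable]: "X \<in> borel_measurable M" "Y \<in> borel_measurable M"
    and X: "tail_bd X C s" and Y: "tail_bd Y D s" and \<epsilon>: "0 < \<epsilon>" "\<epsilon> < 1"
  shows "tail_bd (\<lambda>\<omega>. X \<omega> + Y \<omega>) (C * (1 - \<epsilon>) powr (- s) + D * \<epsilon> powr (- s)) s"
  unfolding tail_bd_def
proof (intro allI impI)
  fix y :: real assume y: "0 < y"
  have "prob {\<omega>\<in>space M. y < X \<omega> + Y \<omega>} \<le> prob {\<omega>\<in>space M. X \<omega> > (1 - \<epsilon>) * y} + prob {\<omega>\<in>space M. Y \<omega> > \<epsilon> * y}"
    using prob_add_gt_le[OF assms(1,2), of "(1 - \<epsilon>) * y" "\<epsilon> * y"] by (simp add: algebra_simps)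
  also have "\<dots> \<le> C * ((1 - \<epsilon>) * y) powr (- s) + D * (\<epsilon> * y) powr (- s)"
    using y \<epsilon> by (intro add_mono tail_bdD X Y) auto
  finally show "prob {\<omega>\<in>space M. y < X \<omega> + Y \<omega>} \<le> (C * (1 - \<epsilon>) powr (- s) + D * \<epsilon> powr (- s)) * y powr (- s)"
    using y \<epsilon> powr_mult[of "1 - \<epsilon>" y "- s"] powr_mult[of \<epsilon> y "- s"]
    by (simp only: distrib_right mult.assoc)
qed

text \<open>Dyadic layers: for 2^k < X \<le> 2^(k+1) the integrand is at most 2^((k+1) p), while X >
  2^k has probability of order 2^(-k s). A geometric series with ratio 2^(p - s) remains.\<close>

lemma tail_bd_integrable:
  assumes [measurable]: "X \<in> borel_measurable M" and X: "tail_bd X C s" and nn: "AE \<omega> in M. 0 \<le> X \<omega>"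
    and p: "0 \<le> p" "p < s"
  shows "integrable M (\<lambda>\<omega>. X \<omega> powr p)"
proof (rule integrableI_nonneg)
  define q where "q = 2 powr (p - s)"
  have q: "0 < q" "q < 1" using p by (auto simp: q_def powr_less_one)
  have C: "0 \<le> C" using X by (rule tail_bd_nonneg)
  have dom: "ennreal (X \<omega> powr p) \<le> 1 + (\<Sum>k. ennreal (2 powr (real (Suc k) * p)) * indicator {\<omega>\<in>space M. X \<omega> > 2 ^ k} \<omega>)"
    if "0 \<le> X \<omega>" "\<omega> \<in> space M" for \<omega>
  proof (cases "X \<omega> \<le> 1")
    case True
    then have "X \<omega> powr p \<le> 1" using that p powr_mono2[of p "X \<omega>" 1] by simp
    then have "ennreal (X \<omega> powr p) \<le> 1 + 0" by simp
    then show ?thesis by (rule order_trans) (intro add_left_mono, simp)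
  next
    case False
    obtain n where n: "X \<omega> < 2 ^ n" using real_arch_pow[of 2 "X \<omega>"] by auto
    define j where "j = (LEAST n. X \<omega> \<le> 2 ^ n)"
    have j: "X \<omega> \<le> 2 ^ j" unfolding j_def by (rule LeastI[of _ n]) (use n in simp)
    have "j \<noteq> 0" using j False by (auto intro: ccontr)
    then obtain k where k: "j = Suc k" by (cases j) auto
    have "\<not> X \<omega> \<le> 2 ^ k" using not_less_Least[of k "\<lambda>n. X \<omega> \<le> 2 ^ n"] k unfolding j_def by simp
    then have k1: "X \<omega> > 2 ^ k" by simp
    have "X \<omega> powr p \<le> (2 ^ Suc k) powr p" using j k that p by (intro powr_mono2) auto
    also have "\<dots> = 2 powr (real (Suc k) * p)" by (subst powr_realpow [symmetric], simp, simp add: powr_powr del: of_nat_Suc)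
    finally have "ennreal (X \<omega> powr p) \<le> ennreal (2 powr (real (Suc k) * p)) * indicator {\<omega>\<in>space M. X \<omega> > 2 ^ k} \<omega>"
      using k1 that by (simp add: ennreal_leI)
    also have "\<dots> \<le> (\<Sum>k. ennreal (2 powr (real (Suc k) * p)) * indicator {\<omega>\<in>space M. X \<omega> > 2 ^ k} \<omega>)"
      using sum_le_suminf[OF summableI, of "{k}" "\<lambda>k. ennreal (2 powr (real (Suc k) * p)) * indicator {\<omega>\<in>space M. X \<omega> > 2 ^ k} \<omega>"]
      by (simp only: sum.insert finite.emptyI empty_iff not_False_eq_True sum.empty add_0_right finite.insertI) auto
    finally show ?thesis by (simp add: add_increasing)
  qed
  have "(\<integral>\<^sup>+\<omega>. ennreal (X \<omega> powr p) \<partial>M) \<le> (\<integral>\<^sup>+\<omega>. 1 + (\<Sum>k. ennreal (2 powr (real (Suc k) * p)) * indicator {\<omega>\<in>space M. X \<omega> > 2 ^ k} \<omega>) \<partial>M)"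
  proof (rule nn_integral_mono_AE)
    show "AE \<omega> in M. ennreal (X \<omega> powr p) \<le> 1 + (\<Sum>k. ennreal (2 powr (real (Suc k) * p)) * indicator {\<omega>\<in>space M. X \<omega> > 2 ^ k} \<omega>)"
      using nn AE_space by eventually_elim (rule dom)
  qed
  also have "\<dots> = 1 + (\<Sum>k. \<integral>\<^sup>+\<omega>. ennreal (2 powr (real (Suc k) * p)) * indicator {\<omega>\<in>space M. X \<omega> > 2 ^ k} \<omega> \<partial>M)"
    by (subst nn_integral_add, simp, measurable, subst nn_integral_suminf, measurable, simp add: emeasure_space_1)
  also have "\<dots> \<le> 1 + (\<Sum>k. ennreal (C * 2 powr p * q ^ k))"
  proof (intro add_left_mono suminf_le summableI)
    fix k
    have "(\<integral>\<^sup>+\<omega>. ennreal (2 powr (real (Suc k) * p)) * indicator {\<omega>\<in>space M. X \<omega> > 2 ^ k} \<omega> \<partial>M)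
      = ennreal (2 powr (real (Suc k) * p) * prob {\<omega>\<in>space M. X \<omega> > 2 ^ k})"
      by (subst nn_integral_cmult_indicator) (auto simp: emeasure_eq_measure ennreal_mult')
    also have "\<dots> \<le> ennreal (2 powr (real (Suc k) * p) * (C * (2 ^ k) powr (- s)))"
      by (intro ennreal_leI mult_left_mono tail_bdD X) auto
    also have "(2 ^ k) powr (- s) = 2 powr (- s * real k)"
      by (simp add: powr_realpow [symmetric] powr_powr mult.commute)
    also have "2 powr (real (Suc k) * p) * (C * 2 powr (- s * real k)) = C * 2 powr p * q ^ k"
      by (simp add: q_def powr_realpow [symmetric] powr_powr powr_add [symmetric] algebra_simps)
    finally show "(\<integral>\<^sup>+\<omega>. ennreal (2 powr (real (Suc k) * p)) * indicator {\<omega>\<in>space M. X \<omega> > 2 ^ k} \<omega> \<partial>M) \<le> ennreal (C * 2 powr p * q ^ k)" .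
  qed
  also have "(\<Sum>k. ennreal (C * 2 powr p * q ^ k)) = ennreal (\<Sum>k. C * 2 powr p * q ^ k)"
    using q C by (intro suminf_ennreal2 summable_mult summable_geometric) auto
  finally show "(\<integral>\<^sup>+\<omega>. ennreal (X \<omega> powr p) \<partial>M) < \<infinity>"
    by (rule order_le_less_trans) simp
qed auto

end

section \<open>The Kesten--Goldie theorem\<close>

text \<open>Used at x = a R, where both terms on the right have finite mean: the second involves
  \<open>R\<close> only through its power \<alpha> - 1. The two powers on the left need not have
  finite mean separately, so the cancellation has to take place before expectations are
  formed.\<close>

lemma powr_add_diff_le:
  fixes x b \<alpha> :: real
  assumes x: "0 \<le> x" and b: "0 < b" and \<alpha>: "0 < \<alpha>"
  shows "(x + b) powr \<alpha> - x powr \<alpha> \<le> (2 powr \<alpha> + \<alpha>) * b powr \<alpha> + (if 1 < \<alpha> then \<alpha> * 2 powr (\<alpha> - 1) * (b * x powr (\<alpha> - 1)) else 0)"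
proof (cases "x < b")
  case True
  have "(x + b) powr \<alpha> \<le> (2 * b) powr \<alpha>" using True x \<alpha> by (intro powr_mono2) auto
  also have "\<dots> = 2 powr \<alpha> * b powr \<alpha>" using b by (simp add: powr_mult)
  finally have "(x + b) powr \<alpha> - x powr \<alpha> \<le> 2 powr \<alpha> * b powr \<alpha>" using powr_ge_zero[of x \<alpha>] by linarith
  also have "\<dots> \<le> (2 powr \<alpha> + \<alpha>) * b powr \<alpha>" using \<alpha> by (intro mult_right_mono) auto
  finally show ?thesis using \<alpha> b by (auto intro: order_trans)
next
  case False
  then have x0: "0 < x" "b \<le> x" using b by auto
  \<comment> \<open>As b \<le> x here, the intermediate point satisfies b < z < 2 x. The upper bound
    serves when z^(\<alpha> - 1) increases in z, the lower one when it decreases.\<close>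
  have "\<exists>z. x < z \<and> z < x + b \<and> (x + b) powr \<alpha> - x powr \<alpha> = (x + b - x) * (\<alpha> * z powr (\<alpha> - 1))"
    using x0 b by (intro MVT2) (auto intro!: derivative_eq_intros)
  then obtain z where z: "x < z" "z < x + b" "(x + b) powr \<alpha> - x powr \<alpha> = b * (\<alpha> * z powr (\<alpha> - 1))" by auto
  show ?thesis
  proof (cases "1 < \<alpha>")
    case True
    have "z powr (\<alpha> - 1) \<le> (2 * x) powr (\<alpha> - 1)" using z x0 True by (intro powr_mono2) auto
    also have "\<dots> = 2 powr (\<alpha> - 1) * x powr (\<alpha> - 1)" using x0 by (simp add: powr_mult)
    finally have "b * (\<alpha> * z powr (\<alpha> - 1)) \<le> b * (\<alpha> * (2 powr (\<alpha> - 1) * x powr (\<alpha> - 1)))"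
      using b \<alpha> by (intro mult_left_mono) auto
    also have "\<dots> = \<alpha> * 2 powr (\<alpha> - 1) * (b * x powr (\<alpha> - 1))" by (simp add: algebra_simps)
    finally show ?thesis using z True \<alpha> by (simp add: add_increasing)
  next
    case False
    have "z powr (\<alpha> - 1) \<le> b powr (\<alpha> - 1)" using z x0 b False by (intro powr_mono2') auto
    then have "b * (\<alpha> * z powr (\<alpha> - 1)) \<le> b * (\<alpha> * b powr (\<alpha> - 1))" using b \<alpha> by (intro mult_left_mono) auto
    also have "\<dots> = \<alpha> * (b powr 1 * b powr (\<alpha> - 1))" using b by simp
    also have "\<dots> = \<alpha> * b powr \<alpha>" by (subst powr_add [symmetric]) simp
    also have "\<dots> \<le> (2 powr \<alpha> + \<alpha>) * b powr \<alpha>" by (intro mult_right_mono) auto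
    finally show ?thesis using z False by simp
  qed
qed

text \<open>Replacing the smaller of a and b by the larger one leaves a single power of order
  \<alpha>.\<close>

lemma mult_powr_le_sum:
  fixes a b \<alpha> :: real
  assumes "0 < a" "0 < b" "1 \<le> \<alpha>"
  shows "b * a powr (\<alpha> - 1) \<le> a powr \<alpha> + b powr \<alpha>"
proof -
  have e: "c * c powr (\<alpha> - 1) = c powr \<alpha>" if "0 < c" for c :: real
    using that by (metis add.commute diff_add_cancel powr_add powr_one less_imp_le)
  show ?thesis
  proof (cases "a \<le> b")
    case True
    then have "b * a powr (\<alpha> - 1) \<le> b * b powr (\<alpha> - 1)" using assms by (intro mult_left_mono powr_mono2) auto
    then show ?thesis using e[OF assms(2)] by (simp add: add_increasing)
  next
    case False
    then have "b * a powr (\<alpha> - 1) \<le> a * a powr (\<alpha> - 1)" using assms by (intro mult_right_mono) auto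
    then show ?thesis using e[OF assms(1)] by (simp add: add_increasing2)
  qed
qed

text \<open>The set is the half-line below ln y, which is empty for y = 0. This converts integrals
  over the logarithmic level t into powers.\<close>

lemma nn_integral_exp_less:
  fixes \<alpha> y :: real
  assumes \<alpha>: "0 < \<alpha>" and y: "0 \<le> y"
  shows "(\<integral>\<^sup>+t. ennreal (exp (\<alpha> * t)) * indicator {t. exp t < y} t \<partial>lborel) = ennreal (y powr \<alpha> / \<alpha>)"
proof (cases "y = 0")
  case True then show ?thesis by (simp add: not_less[THEN iffD2])
next
  case False
  then have y: "0 < y" using y by simp
  define x where "x = ln y"
  have yx: "y = exp x" using y by (simp add: x_def)
  have "(\<integral>\<^sup>+t. ennreal (exp (\<alpha> * t)) * indicator {t. exp t < y} t \<partial>lborel) = (\<integral>\<^sup>+u. ennreal (exp (\<alpha> * (x - u))) * indicator {0<..} u \<partial>lborel)"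
    using nn_integral_real_affine[of "\<lambda>t. ennreal (exp (\<alpha> * t)) * indicator {t. exp t < y} t" "-1" x]
    by (auto simp: indicator_def yx intro!: nn_integral_cong)
  also have "\<dots> = (\<integral>\<^sup>+u. ennreal (exp (\<alpha> * (x - u))) * indicator {0..} u \<partial>lborel)"
    using AE_lborel_singleton[of 0] by (intro nn_integral_cong_AE) (auto elim!: eventually_mono simp: indicator_def)
  also have "\<dots> = ennreal (0 - (- exp (\<alpha> * (x - 0)) / \<alpha>))"
  proof (rule nn_integral_FTC_atLeast)
    show "((\<lambda>u. - exp (\<alpha> * (x - u)) / \<alpha>) \<longlongrightarrow> 0) at_top"
      using \<alpha> by real_asymp
  qed (use \<alpha> in \<open>auto intro!: derivative_eq_intros\<close>)
  finally show ?thesis by (simp add: powr_def yx mult.commute)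
qed

text \<open>The proof produces Goldie's constant I / m with I = E ((a R + b)^\<alpha> - (a
  R)^\<alpha>) / \<alpha> and m = E a^\<alpha> ln a. It is positive because \<open>b\<close>
  is.\<close>

theorem (in prob_space) kesten_goldie:
  fixes a b R :: "'a \<Rightarrow> real" and \<alpha> :: real
  assumes ind: "indep_pair (borel \<Otimes>\<^sub>M borel) (\<lambda>\<omega>. (a \<omega>, b \<omega>)) borel R"
    and law: "distr M borel (\<lambda>\<omega>. a \<omega> * R \<omega> + b \<omega>) = distr M borel R"
    and a0: "AE \<omega> in M. 0 < a \<omega>" and b0: "AE \<omega> in M. 0 < b \<omega>" and R0: "AE \<omega> in M. 0 \<le> R \<omega>"
    and \<alpha>: "0 < \<alpha>"
    and a_int: "integrable M (\<lambda>\<omega>. a \<omega> powr \<alpha>)" and a_one: "(\<integral>\<omega>. a \<omega> powr \<alpha> \<partial>M) = 1"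
    and a_log: "integrable M (\<lambda>\<omega>. a \<omega> powr \<alpha> * max (ln (a \<omega>)) 0)"
    and b_int: "integrable M (\<lambda>\<omega>. b \<omega> powr \<alpha>)"
    and nonar: "\<And>h. 0 \<le> h \<Longrightarrow> \<not> (AE \<omega> in M. ln (a \<omega>) \<in> range (\<lambda>k::int. h * of_int k))"
    and tail: "\<And>s. 0 < s \<Longrightarrow> s < \<alpha> \<Longrightarrow> \<exists>C. tail_bd R C s"
  shows "\<exists>c>0. ((\<lambda>x. x powr \<alpha> * prob {\<omega>\<in>space M. R \<omega> > x}) \<longlongrightarrow> c) at_top"
proof -
  have ab: "(\<lambda>\<omega>. (a \<omega>, b \<omega>)) \<in> measurable M (borel \<Otimes>\<^sub>M borel)" and Rm [measurable]: "R \<in> borel_measurable M"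
    using ind by (auto simp: indep_pair_def)
  have am [measurable]: "a \<in> borel_measurable M" and bm [measurable]: "b \<in> borel_measurable M"
    using measurable_compose[OF ab measurable_fst] measurable_compose[OF ab measurable_snd] by (simp_all add: comp_def)
  have ind_a: "indep_pair borel a borel R"
    using indep_pair_compose[OF ind measurable_fst measurable_ident] by (simp add: comp_def)
  \<comment> \<open>\<open>s\<close> has to lie in (0, \<alpha>), so that E a^s < 1, and above
    \<alpha> - 1, so that a tail bound of order s gives \<open>R\<close> a moment of order \<alpha>
    - 1 when \<alpha> > 1.\<close>
  define s where "s = max (\<alpha> / 2) (\<alpha> - 1 / 2)"
  define \<delta> where "\<delta> = \<alpha> - s"
  have s: "0 < s" "s < \<alpha>" "\<alpha> - 1 < s" and \<delta>: "0 < \<delta>" using \<alpha> by (auto simp: s_def \<delta>_def max_def)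
  obtain C where C: "tail_bd R C s" using tail s by blast
  have ne: "\<not> (AE \<omega> in M. a \<omega> = 1)"
  proof
    assume "AE \<omega> in M. a \<omega> = 1"
    then have "AE \<omega> in M. ln (a \<omega>) \<in> range (\<lambda>k::int. 0 * of_int k)" by eventually_elim auto
    then show False using nonar[of 0] by simp
  qed
  have as: "integrable M (\<lambda>\<omega>. a \<omega> powr s)" "(\<integral>\<omega>. a \<omega> powr s \<partial>M) < 1"
    by (rule powr_moment_less[OF am a0 s(1,2) a_int a_one ne])+
  \<comment> \<open>Tilting by a^\<alpha>, which has mean 1, absorbs the factor exp (\<alpha> ln a)
    that arises when exp (\<alpha> t) P(a R > exp t) is expressed through \<open>G\<close> at t - ln
    a.\<close>
  define Q where "Q = density M (\<lambda>\<omega>. ennreal (a \<omega> powr \<alpha>))"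
  define F where "F = distr Q borel (\<lambda>\<omega>. ln (a \<omega>))"
  have Q: "prob_space Q"
  proof
    have "emeasure Q (space Q) = (\<integral>\<^sup>+\<omega>. ennreal (a \<omega> powr \<alpha>) \<partial>M)"
      by (simp add: Q_def emeasure_density cong: nn_integral_cong)
    also have "\<dots> = 1" by (subst nn_integral_eq_integral[OF a_int]) (auto simp: a_one)
    finally show "emeasure Q (space Q) = 1" .
  qed
  have lnm [measurable]: "(\<lambda>\<omega>. ln (a \<omega>)) \<in> borel_measurable Q" by (simp add: Q_def)
  have F: "real_distribution F"
    unfolding F_def by (intro prob_space.real_distribution_distr[OF Q] lnm)
  interpret F: real_distribution F by (rule F)
  have Fint: "integrable F f \<longleftrightarrow> integrable M (\<lambda>\<omega>. a \<omega> powr \<alpha> * f (ln (a \<omega>)))"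
      "(\<integral>v. f v \<partial>F) = (\<integral>\<omega>. a \<omega> powr \<alpha> * f (ln (a \<omega>)) \<partial>M)" if [measurable]: "f \<in> borel_measurable borel" for f :: "real \<Rightarrow> real"
  proof -
    show "integrable F f \<longleftrightarrow> integrable M (\<lambda>\<omega>. a \<omega> powr \<alpha> * f (ln (a \<omega>)))"
      unfolding F_def by (subst integrable_distr_eq) (auto simp: Q_def integrable_density)
    show "(\<integral>v. f v \<partial>F) = (\<integral>\<omega>. a \<omega> powr \<alpha> * f (ln (a \<omega>)) \<partial>M)"
      unfolding F_def by (subst integral_distr) (auto simp: Q_def integral_density)
  qed
  define T where "T x = prob {\<omega>\<in>space M. R \<omega> > x}" for x
  have T01: "0 \<le> T x" "T x \<le> 1" for x by (auto simp: T_def)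
  have T_anti: "x \<le> y \<Longrightarrow> T y \<le> T x" for x y
    unfolding T_def by (intro finite_measure_mono) auto
  have Tm [measurable]: "T \<in> borel_measurable borel"
  proof -
    have "(\<lambda>x. - T x) \<in> borel_measurable borel"
      by (rule borel_measurable_mono) (auto intro!: monoI T_anti)
    then show ?thesis by simp
  qed
  define G where "G t = exp (\<alpha> * t) * T (exp t)" for t
  have Gm [measurable]: "G \<in> borel_measurable borel" unfolding G_def by measurable
  \<comment> \<open>The level exp t is exceeded either by a R alone or only thanks to b. The first
    event gives the convolution, the second the forcing term.\<close>
  define P1 where "P1 t = prob {\<omega>\<in>space M. exp t < a \<omega> * R \<omega>}" for t
  define P2 where "P2 t = prob {\<omega>\<in>space M. a \<omega> * R \<omega> \<le> exp t \<and> exp t < a \<omega> * R \<omega> + b \<omega>}" for t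
  define \<psi> where "\<psi> t = exp (\<alpha> * t) * P2 t" for t
  have P2m [measurable]: "P2 \<in> borel_measurable borel"
    unfolding P2_def by measurable
  have \<psi>m [measurable]: "\<psi> \<in> borel_measurable borel" unfolding \<psi>_def by measurable
  have T_split: "T (exp t) = P1 t + P2 t" for t
  proof -
    have "T (exp t) = measure (distr M borel R) {exp t<..}"
      unfolding T_def by (subst measure_distr) (auto intro!: arg_cong[where f=prob])
    also have "\<dots> = prob {\<omega>\<in>space M. exp t < a \<omega> * R \<omega> + b \<omega>}"
      unfolding law [symmetric] by (subst measure_distr) (auto intro!: arg_cong[where f=prob])
    also have "\<dots> = prob ({\<omega>\<in>space M. exp t < a \<omega> * R \<omega>} \<union> {\<omega>\<in>space M. a \<omega> * R \<omega> \<le> exp t \<and> exp t < a \<omega> * R \<omega> + b \<omega>})"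
      by (rule finite_measure_eq_AE) (use b0 in \<open>auto elim!: eventually_mono\<close>)
    also have "\<dots> = P1 t + P2 t"
      unfolding P1_def P2_def by (intro finite_measure_Union) auto
    finally show ?thesis .
  qed
  have P1_eq: "AE \<omega> in M. prob {\<omega>'\<in>space M. exp t < a \<omega> * R \<omega>'} = T (exp (t - ln (a \<omega>)))" for t
    using a0
  proof eventually_elim
    case (elim \<omega>)
    then show ?case
      unfolding T_def by (auto intro!: arg_cong[where f=prob] simp: exp_diff field_simps)
  qed
  have P1i: "P1 t = (\<integral>\<omega>. T (exp (t - ln (a \<omega>))) \<partial>M)" for t
  proof -
    have "P1 t = (\<integral>\<omega>. prob {\<omega>'\<in>space M. exp t < a \<omega> * R \<omega>'} \<partial>M)"
      unfolding P1_def by (rule indep_prob[OF ind_a]) measurable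
    also have "\<dots> = (\<integral>\<omega>. T (exp (t - ln (a \<omega>))) \<partial>M)"
      by (rule integral_cong_AE) (use P1_eq in auto)
    finally show ?thesis .
  qed
  have aG: "AE \<omega> in M. a \<omega> powr \<alpha> * G (t - ln (a \<omega>)) = exp (\<alpha> * t) * T (exp (t - ln (a \<omega>)))" for t
    using a0
  proof eventually_elim
    case (elim \<omega>)
    have "a \<omega> powr \<alpha> * exp (\<alpha> * (t - ln (a \<omega>))) = exp (\<alpha> * t)"
      using elim by (simp add: powr_def exp_add [symmetric] algebra_simps)
    then show ?case by (simp add: G_def mult.assoc [symmetric])
  qed
  have iT: "integrable M (\<lambda>\<omega>. exp (\<alpha> * t) * T (exp (t - ln (a \<omega>))))" for t
    by (intro integrable_mult_right integrable_const_bound[of _ 1]) (auto simp: T01)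
  have iG: "integrable M (\<lambda>\<omega>. a \<omega> powr \<alpha> * G (t - ln (a \<omega>)))" for t
    by (rule integrable_cong_AE_imp[OF iT[of t]]) (use aG[of t] in auto)
  have G_int: "integrable F (\<lambda>v. G (t - v))" for t
    by (subst Fint) (use iG[of t] in auto)
  have "(\<integral>v. G (t - v) \<partial>F) = exp (\<alpha> * t) * P1 t" for t
  proof -
    have "(\<integral>v. G (t - v) \<partial>F) = (\<integral>\<omega>. a \<omega> powr \<alpha> * G (t - ln (a \<omega>)) \<partial>M)" by (rule Fint) measurable
    also have "\<dots> = (\<integral>\<omega>. exp (\<alpha> * t) * T (exp (t - ln (a \<omega>))) \<partial>M)"
      by (rule integral_cong_AE) (use aG[of t] in auto)
    also have "\<dots> = exp (\<alpha> * t) * P1 t" by (simp add: P1i)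
    finally show ?thesis .
  qed
  moreover have "G t = exp (\<alpha> * t) * P1 t + \<psi> t" for t
    by (simp add: G_def T_split \<psi>_def distrib_left)
  ultimately have G_eq: "G t = (\<integral>v. G (t - v) \<partial>F) + \<psi> t" for t by simp
  define q where "q t \<omega> = (if a \<omega> * R \<omega> \<le> exp t \<and> exp t < a \<omega> * R \<omega> + b \<omega> then ennreal (exp (\<alpha> * t)) else 0)" for t \<omega>
  \<comment> \<open>Integrate over t first: for fixed \<omega> the forcing event is an interval of
    levels exp t from a R up to a R + b, and exp (\<alpha> t) integrates over it to a difference of
    powers.\<close>
  have nn_\<psi>: "(\<integral>\<^sup>+t. ennreal (\<psi> t) \<partial>lborel) = (\<integral>\<^sup>+\<omega>. ennreal (((a \<omega> * R \<omega> + b \<omega>) powr \<alpha> - (a \<omega> * R \<omega>) powr \<alpha>) / \<alpha>) \<partial>M)"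
  proof -
    have "(\<integral>\<^sup>+t. ennreal (\<psi> t) \<partial>lborel) = (\<integral>\<^sup>+t. (\<integral>\<^sup>+\<omega>. q t \<omega> \<partial>M) \<partial>lborel)"
    proof (rule nn_integral_cong)
      fix t :: real
      have "ennreal (\<psi> t) = ennreal (exp (\<alpha> * t)) * emeasure M {\<omega>\<in>space M. a \<omega> * R \<omega> \<le> exp t \<and> exp t < a \<omega> * R \<omega> + b \<omega>}"
        by (simp add: \<psi>_def P2_def ennreal_mult' emeasure_eq_measure)
      also have "\<dots> = (\<integral>\<^sup>+\<omega>. ennreal (exp (\<alpha> * t)) * indicator {\<omega>\<in>space M. a \<omega> * R \<omega> \<le> exp t \<and> exp t < a \<omega> * R \<omega> + b \<omega>} \<omega> \<partial>M)"
        by (subst nn_integral_cmult_indicator) auto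
      finally show "ennreal (\<psi> t) = (\<integral>\<^sup>+\<omega>. q t \<omega> \<partial>M)"
        by (auto simp: q_def indicator_def intro!: nn_integral_cong)
    qed
    also have "\<dots> = (\<integral>\<^sup>+\<omega>. (\<integral>\<^sup>+t. q t \<omega> \<partial>lborel) \<partial>M)"
    proof -
      interpret pair_sigma_finite M lborel ..
      show ?thesis unfolding q_def by (rule Fubini') measurable
    qed
    also have "\<dots> = (\<integral>\<^sup>+\<omega>. ennreal (((a \<omega> * R \<omega> + b \<omega>) powr \<alpha> - (a \<omega> * R \<omega>) powr \<alpha>) / \<alpha>) \<partial>M)"
    proof (rule nn_integral_cong_AE)
      show "AE \<omega> in M. (\<integral>\<^sup>+t. q t \<omega> \<partial>lborel) = ennreal (((a \<omega> * R \<omega> + b \<omega>) powr \<alpha> - (a \<omega> * R \<omega>) powr \<alpha>) / \<alpha>)"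
        using a0 b0 R0 AE_space
      proof eventually_elim
        case (elim \<omega>)
        define x where "x = a \<omega> * R \<omega>"
        have x: "0 \<le> x" using elim by (simp add: x_def)
        let ?L = "\<integral>\<^sup>+t. ennreal (exp (\<alpha> * t)) * indicator {t. x \<le> exp t \<and> exp t < x + b \<omega>} t \<partial>lborel"
        have "?L + ennreal (x powr \<alpha> / \<alpha>) = ?L + (\<integral>\<^sup>+t. ennreal (exp (\<alpha> * t)) * indicator {t. exp t < x} t \<partial>lborel)"
          using x \<alpha> by (subst nn_integral_exp_less) auto
        also have "\<dots> = (\<integral>\<^sup>+t. ennreal (exp (\<alpha> * t)) * indicator {t. exp t < x + b \<omega>} t \<partial>lborel)"
          using elim by (subst nn_integral_add [symmetric]) (auto intro!: nn_integral_cong simp: indicator_def)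
        also have "\<dots> = ennreal ((x + b \<omega>) powr \<alpha> / \<alpha>)"
          using x \<alpha> elim by (subst nn_integral_exp_less) auto
        finally have "?L = ennreal ((x + b \<omega>) powr \<alpha> / \<alpha>) - ennreal (x powr \<alpha> / \<alpha>)"
          by (metis ennreal_add_diff_cancel_right ennreal_neq_top)
        also have "\<dots> = ennreal (((x + b \<omega>) powr \<alpha> - x powr \<alpha>) / \<alpha>)"
          using \<alpha> by (subst ennreal_minus) (auto simp: diff_divide_distrib)
        moreover have "(\<integral>\<^sup>+t. q t \<omega> \<partial>lborel) = ?L"
          by (auto simp: q_def x_def indicator_def intro!: nn_integral_cong)
        ultimately show ?case by (simp add: x_def)
      qed
    qed
    finally show ?thesis .
  qed
  define g where "g \<omega> = ((a \<omega> * R \<omega> + b \<omega>) powr \<alpha> - (a \<omega> * R \<omega>) powr \<alpha>) / \<alpha>" for \<omega>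
  have gm [measurable]: "g \<in> borel_measurable M" unfolding g_def by measurable
  have g_pos: "AE \<omega> in M. 0 < g \<omega>"
    using a0 b0 R0
  proof eventually_elim
    case (elim \<omega>)
    then show ?case using \<alpha> by (auto simp: g_def intro!: divide_pos_pos powr_less_mono2)
  qed
  have g_int: "integrable M g"
  proof -
    define h where "h \<omega> = ((2 powr \<alpha> + \<alpha>) * b \<omega> powr \<alpha> + (if 1 < \<alpha> then \<alpha> * 2 powr (\<alpha> - 1) * ((b \<omega> * a \<omega> powr (\<alpha> - 1)) * R \<omega> powr (\<alpha> - 1)) else 0)) / \<alpha>" for \<omega>
    have "integrable M h"
    proof (cases "1 < \<alpha>")
      case True
      have 1: "integrable M (\<lambda>\<omega>. b \<omega> * a \<omega> powr (\<alpha> - 1))"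
      proof (rule Bochner_Integration.integrable_bound)
        show "integrable M (\<lambda>\<omega>. a \<omega> powr \<alpha> + b \<omega> powr \<alpha>)" using a_int b_int by simp
        show "AE \<omega> in M. norm (b \<omega> * a \<omega> powr (\<alpha> - 1)) \<le> norm (a \<omega> powr \<alpha> + b \<omega> powr \<alpha>)"
          using a0 b0 by eventually_elim (use True in \<open>auto intro!: mult_powr_le_sum simp: abs_mult\<close>)
      qed measurable
      have 2: "integrable M (\<lambda>\<omega>. R \<omega> powr (\<alpha> - 1))"
        using True s by (intro tail_bd_integrable[OF Rm C R0]) auto
      \<comment> \<open>The cross term b (a R)^(\<alpha> - 1) separates into independent factors:
        one is dominated by a^\<alpha> + b^\<alpha>, the other is a subcritical power of
        \<open>R\<close>.\<close>
      have "indep_var borel (\<lambda>\<omega>. b \<omega> * a \<omega> powr (\<alpha> - 1)) borel (\<lambda>\<omega>. R \<omega> powr (\<alpha> - 1))"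
        using indep_pair_compose[OF ind, of "\<lambda>z. snd z * fst z powr (\<alpha> - 1)" borel "\<lambda>r. r powr (\<alpha> - 1)" borel]
        by (simp add: indep_pair_iff_indep_var)
      then have "integrable M (\<lambda>\<omega>. (b \<omega> * a \<omega> powr (\<alpha> - 1)) * R \<omega> powr (\<alpha> - 1))"
        by (rule indep_var_integrable[OF _ 1 2])
      then show ?thesis unfolding h_def using b_int True by simp
    next
      case False then show ?thesis unfolding h_def using b_int by simp
    qed
    then show ?thesis
    proof (rule Bochner_Integration.integrable_bound)
      show "AE \<omega> in M. norm (g \<omega>) \<le> norm (h \<omega>)"
        using a0 b0 R0 g_pos
      proof eventually_elim
        case (elim \<omega>)
        have "(a \<omega> * R \<omega>) powr (\<alpha> - 1) = a \<omega> powr (\<alpha> - 1) * R \<omega> powr (\<alpha> - 1)" using elim by (simp add: powr_mult)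
        then have "g \<omega> \<le> h \<omega>"
          unfolding g_def h_def using \<alpha> elim powr_add_diff_le[of "a \<omega> * R \<omega>" "b \<omega>" \<alpha>]
          by (intro divide_right_mono) (auto simp: mult.assoc)
        then show ?case using elim by simp
      qed
    qed measurable
  qed
  have nn_g: "(\<integral>\<^sup>+t. ennreal (\<psi> t) \<partial>lborel) = ennreal (\<integral>\<omega>. g \<omega> \<partial>M)"
    unfolding nn_\<psi> g_def [symmetric] using g_pos by (intro nn_integral_eq_integral g_int) (auto elim: eventually_mono)
  have \<psi>0: "0 \<le> \<psi> t" for t by (simp add: \<psi>_def P2_def)
  have G0: "0 \<le> G t" for t by (simp add: G_def T01)
  have \<psi>_int: "integrable lborel \<psi>"
    by (rule integrableI_nonneg) (auto simp: nn_g \<psi>0)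
  have F_nonar: "\<not> (AE v in F. v \<in> range (\<lambda>k::int. h * of_int k))" if h: "0 \<le> h" for h
  proof
    define N where "N = range (\<lambda>k::int. h * of_int k)"
    assume "AE v in F. v \<in> range (\<lambda>k::int. h * of_int k)"
    then have 1: "AE v in F. v \<in> N" by (simp only: N_def)
    have N [measurable]: "N \<in> sets borel"
      unfolding N_def by (rule sets.countable) auto
    have 2: "AE \<omega> in Q. ln (a \<omega>) \<in> N"
      by (rule AE_distrD[OF lnm 1[unfolded F_def]])
    \<comment> \<open>The tilting density is positive almost surely, so a lattice that carries ln a
      after tilting carries it before.\<close>
    have "AE \<omega> in M. 0 < ennreal (a \<omega> powr \<alpha>) \<longrightarrow> ln (a \<omega>) \<in> N"
      using 2 unfolding Q_def by (subst (asm) AE_density) simp_all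
    then have "AE \<omega> in M. ln (a \<omega>) \<in> N"
      using a0 by eventually_elim simp
    then show False using nonar[OF h] by (simp only: N_def)
  qed
  interpret renewal F G \<psi> \<alpha> \<delta> C
  proof (unfold_locales, goal_cases)
    case (7 t u)
    then have "T (exp t) \<le> T (exp u)" by (intro T_anti) simp
    then have "exp (\<alpha> * t) * T (exp t) \<le> exp (\<alpha> * t) * T (exp u)" by (intro mult_left_mono) auto
    moreover have "exp (\<alpha> * (t - u)) * exp (\<alpha> * u) = exp (\<alpha> * t)" by (simp add: exp_add [symmetric] algebra_simps)
    ultimately show ?case unfolding G_def mult.assoc [symmetric] by simp
  next
    case (8 t)
    have "G t \<le> exp (\<alpha> * t) * (C * exp t powr (- s))"
      unfolding G_def T_def by (intro mult_left_mono tail_bdD C) auto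
    also have "\<dots> = C * exp (\<delta> * t)"
      by (simp add: powr_def \<delta>_def exp_add [symmetric] algebra_simps)
    finally show ?case .
  next
    case 11
    show ?case
    proof (subst Fint)
      show "integrable M (\<lambda>\<omega>. a \<omega> powr \<alpha> * exp (- \<delta> * ln (a \<omega>)))"
      proof (rule integrable_cong_AE_imp[OF as(1)])
        show "AE \<omega> in M. a \<omega> powr s = a \<omega> powr \<alpha> * exp (- \<delta> * ln (a \<omega>))"
          using a0 by eventually_elim (simp add: powr_def exp_add [symmetric] \<delta>_def algebra_simps)
      qed measurable
    qed measurable
  next
    case 12
    have "(\<integral>v. exp (- \<delta> * v) \<partial>F) = (\<integral>\<omega>. a \<omega> powr s \<partial>M)"
      by (subst Fint, measurable, rule integral_cong_AE)
        (use a0 in \<open>auto elim!: eventually_mono simp: powr_def exp_add [symmetric] \<delta>_def algebra_simps\<close>)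
    then show ?case using as by simp
  next
    case 14
    have "integrable M (\<lambda>\<omega>. a \<omega> powr \<alpha> * ln (a \<omega>))"
    proof (rule Bochner_Integration.integrable_bound)
      show "integrable M (\<lambda>\<omega>. a \<omega> powr \<alpha> * max (ln (a \<omega>)) 0 + 1 / \<alpha>)" using a_log by simp
      show "AE \<omega> in M. norm (a \<omega> powr \<alpha> * ln (a \<omega>)) \<le> norm (a \<omega> powr \<alpha> * max (ln (a \<omega>)) 0 + 1 / \<alpha>)"
        using a0
      proof eventually_elim
        case (elim \<omega>)
        show ?case
        proof (cases "0 \<le> ln (a \<omega>)")
          case True then show ?thesis using \<alpha> by (simp add: abs_mult)
        next
          case False
          \<comment> \<open>Where ln a < 0, the absolute value of the integrand is u exp (-u) /
            \<alpha>, and u exp (-u) is at most 1.\<close>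
          define u where "u = - \<alpha> * ln (a \<omega>)"
          have u: "0 < u" using False \<alpha> by (simp add: u_def mult_pos_neg)
          have "u \<le> exp u" using exp_ge_add_one_self[of u] by linarith
          then have "u * exp (- u) \<le> exp u * exp (- u)" by (intro mult_right_mono) auto
          then have "u * exp (- u) \<le> 1" by (simp add: exp_minus)
          then have "a \<omega> powr \<alpha> * (- ln (a \<omega>)) \<le> 1 / \<alpha>"
            using \<alpha> elim by (simp add: u_def powr_def field_simps)
          then show ?thesis using False \<alpha> by (simp add: abs_mult max_def)
        qed
      qed
    qed measurable
    then show ?case using Fint(1)[OF measurable_ident_sets[OF refl]] by blast
    qed (fact F Gm \<psi>m G0 \<psi>0 G_int G_eq \<alpha> \<delta> \<psi>_int F_nonar)+
  have I: "I = (\<integral>\<omega>. g \<omega> \<partial>M)"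
  proof -
    have "ennreal I = ennreal (\<integral>\<omega>. g \<omega> \<partial>M)"
      unfolding I_def nn_g [symmetric] by (rule nn_integral_eq_integral [symmetric, OF \<psi>_int]) (simp add: \<psi>0)
    moreover have "0 \<le> (\<integral>\<omega>. g \<omega> \<partial>M)" using g_pos by (intro integral_nonneg_AE) (auto elim: eventually_mono)
    ultimately show ?thesis using I_nonneg by simp
  qed
  \<comment> \<open>\<open>g\<close> is positive almost surely because \<open>b\<close> is, so its
    mean cannot vanish.\<close>
  have "I \<noteq> 0"
  proof
    assume "I = 0"
    then have "AE \<omega> in M. g \<omega> = 0"
    proof (subst integral_nonneg_eq_0_iff_AE[OF g_int, symmetric])
      show "AE \<omega> in M. 0 \<le> g \<omega>" using g_pos by eventually_elim simp
    qed (use I in simp)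
    then have "AE \<omega> in M. False" using g_pos by eventually_elim auto
    then show False by simp
  qed
  then have "0 < I / m" using I_nonneg m_pos by simp
  moreover have "((\<lambda>x. x powr \<alpha> * T x) \<longlongrightarrow> I / m) at_top"
  proof (rule Lim_transform_eventually)
    show "((\<lambda>x. G (ln x)) \<longlongrightarrow> I / m) at_top"
      by (rule filterlim_compose[OF renewal_limit ln_at_top])
    show "eventually (\<lambda>x. G (ln x) = x powr \<alpha> * T x) at_top"
      using eventually_gt_at_top[of 0] by eventually_elim (simp add: G_def powr_def)
  qed
  ultimately show ?thesis unfolding T_def by blast
qed

section \<open>Tails of perpetuities\<close>

context prob_space
begin

lemma law_prob_eq:
  fixes X Y :: "'a \<Rightarrow> real"
  assumes [measurable]: "X \<in> borel_measurable M" "Y \<in> borel_measurable M" "Measurable.pred borel P"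
    and eq: "distr M borel X = distr M borel Y"
  shows "prob {\<omega>\<in>space M. P (X \<omega>)} = prob {\<omega>\<in>space M. P (Y \<omega>)}"
proof -
  have "prob {\<omega>\<in>space M. P (X \<omega>)} = measure (distr M borel X) {x. P x}"
    by (subst measure_distr) (auto intro!: arg_cong[where f=prob])
  also have "\<dots> = prob {\<omega>\<in>space M. P (Y \<omega>)}"
    unfolding eq by (subst measure_distr) (auto intro!: arg_cong[where f=prob])
  finally show ?thesis .
qed

lemma prob_gt_tendsto_0:
  fixes X :: "'a \<Rightarrow> real"
  assumes [measurable]: "X \<in> borel_measurable M"
  shows "((\<lambda>x. prob {\<omega>\<in>space M. x < X \<omega>}) \<longlongrightarrow> 0) at_top"
proof -
  interpret D: real_distribution "distr M borel X" by (rule real_distribution_distr) simp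
  have "measure (distr M borel X) {x<..} = prob {\<omega>\<in>space M. x < X \<omega>}" for x
    by (subst measure_distr) (auto intro!: arg_cong[where f=prob])
  then show ?thesis using D.measure_tail_tendsto_0 by simp
qed

lemma tail_bd_law:
  assumes "X \<in> borel_measurable M" "Y \<in> borel_measurable M" "distr M borel X = distr M borel Y" "tail_bd X C s"
  shows "tail_bd Y C s"
  unfolding tail_bd_def
proof (intro allI impI)
  fix y :: real assume "0 < y"
  moreover have "prob {\<omega>\<in>space M. y < X \<omega>} = prob {\<omega>\<in>space M. y < Y \<omega>}"
    by (rule law_prob_eq[OF assms(1,2) _ assms(3)]) measurable
  ultimately show "prob {\<omega>\<in>space M. y < Y \<omega>} \<le> C * y powr (- s)"
    using tail_bdD[OF assms(4), of y] by linarith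
qed

lemma powr_integrable_mono:
  fixes b :: "'a \<Rightarrow> real"
  assumes [measurable]: "b \<in> borel_measurable M" and "integrable M (\<lambda>\<omega>. b \<omega> powr \<alpha>)" "AE \<omega> in M. 0 \<le> b \<omega>" "0 \<le> s" "s \<le> \<alpha>"
  shows "integrable M (\<lambda>\<omega>. b \<omega> powr s)"
proof (rule Bochner_Integration.integrable_bound)
  show "integrable M (\<lambda>\<omega>. 1 + b \<omega> powr \<alpha>)" using assms by simp
  show "AE \<omega> in M. norm (b \<omega> powr s) \<le> norm (1 + b \<omega> powr \<alpha>)"
    using assms(3)
  proof eventually_elim
    case (elim \<omega>)
    show ?case
    proof (cases "b \<omega> \<le> 1")
      case True
      then have "b \<omega> powr s \<le> 1 powr s" using elim assms by (intro powr_mono2) auto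
      then show ?thesis by (simp add: add_increasing2)
    next
      case False
      then have "b \<omega> powr s \<le> b \<omega> powr \<alpha>" using assms by (intro powr_mono) auto
      then show ?thesis by (simp add: add_increasing)
    qed
  qed
qed measurable

text \<open>The product \<open>p n\<close> contracts, so p n X 0 tends to 0 in probability and the
  law of \<open>X 0\<close> is approximated by those of the nonnegative perpetuities
  \<open>S n\<close>, whose tails are bounded uniformly in \<open>n\<close>. The driving terms
  \<open>Z\<close> may depend on the past; the first coordinate of the recursion requires this,
  since it is driven by the second.\<close>

lemma perpetuity_tail:
  fixes a Z S p X :: "nat \<Rightarrow> 'a \<Rightarrow> real"
  assumes am [measurable]: "\<And>n. a (Suc n) \<in> borel_measurable M"
    and Zm [measurable]: "\<And>n. Z (Suc n) \<in> borel_measurable M" and Xm [measurable]: "\<And>n. X n \<in> borel_measurable M"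
    and S0: "\<And>\<omega>. S 0 \<omega> = 0" and SS: "\<And>n \<omega>. S (Suc n) \<omega> = a (Suc n) \<omega> * S n \<omega> + Z (Suc n) \<omega>"
    and p0: "\<And>\<omega>. p 0 \<omega> = 1" and pS: "\<And>n \<omega>. p (Suc n) \<omega> = a (Suc n) \<omega> * p n \<omega>"
    and indS: "\<And>n. indep_pair borel (a (Suc n)) borel (S n)"
    and indp: "\<And>n. indep_pair borel (a (Suc n)) borel (p n)"
    and a0: "\<And>n. AE \<omega> in M. 0 < a (Suc n) \<omega>" and Z0: "\<And>n. AE \<omega> in M. 0 \<le> Z (Suc n) \<omega>"
    and s: "0 < s" and aint: "\<And>n. integrable M (\<lambda>\<omega>. a (Suc n) \<omega> powr s)"
    and a\<kappa>: "\<And>n. (\<integral>\<omega>. a (Suc n) \<omega> powr s \<partial>M) = \<kappa>" and \<kappa>: "\<kappa> < 1"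
    and Zt: "\<And>n. tail_bd (Z (Suc n)) K s"
    and law: "\<And>n. distr M borel (X n) = distr M borel (X 0)"
    and X: "\<And>n. AE \<omega> in M. X n \<omega> = p n \<omega> * X 0 \<omega> + S n \<omega>"
  shows "AE \<omega> in M. 0 \<le> X 0 \<omega>" and "\<exists>C. tail_bd (X 0) C s"
    and "\<And>n. tail_bd (p n) (\<kappa> ^ n) s"
proof -
  have Sm [measurable]: "S n \<in> borel_measurable M" for n
    by (induction n) (simp_all add: S0 SS cong: measurable_cong)
  have pm [measurable]: "p n \<in> borel_measurable M" for n
    by (induction n) (simp_all add: p0 pS cong: measurable_cong)
  have S_nn: "AE \<omega> in M. 0 \<le> S n \<omega>" for n
  proof (induction n)
    case (Suc n)
    then show ?case using a0[of n] Z0[of n] by eventually_elim (simp add: SS)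
  qed (simp add: S0)
  have p_pos: "AE \<omega> in M. 0 < p n \<omega>" for n
  proof (induction n)
    case (Suc n)
    then show ?case using a0[of n] by eventually_elim (simp add: pS)
  qed (simp add: p0)
  have \<kappa>0: "0 \<le> \<kappa>" unfolding a\<kappa>[of 0, symmetric] by simp
  show ptail: "tail_bd (p n) (\<kappa> ^ n) s" for n
  proof (induction n)
    case 0
    have "prob {\<omega> \<in> space M. y < p 0 \<omega>} \<le> y powr (- s)" if "0 < y" for y
    proof (cases "y < 1")
      case True
      have "y powr s \<le> 1 powr s" using True that s by (intro powr_mono2) auto
      then have "1 \<le> y powr (- s)" using that by (simp add: powr_minus one_le_inverse)
      then show ?thesis using prob_le_1 order_trans by blast
    qed (simp add: p0)
    then show ?case by (simp add: tail_bd_def)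
  next
    case (Suc n)
    have "tail_bd (\<lambda>\<omega>. a (Suc n) \<omega> * p n \<omega>) (\<kappa> ^ n * (\<integral>\<omega>. a (Suc n) \<omega> powr s \<partial>M)) s"
      by (rule tail_bd_mult[OF indp Suc.IH a0 aint])
    moreover have "p (Suc n) = (\<lambda>\<omega>. a (Suc n) \<omega> * p n \<omega>)" by (rule ext) (rule pS)
    ultimately show ?case by (simp only: a\<kappa> power_Suc2)
  qed
  \<comment> \<open>\<open>X 0\<close> is one fixed random variable, hence at most \<open>k\<close>
    in absolute value up to probability r / 2. On that event only the tail of \<open>p n\<close>
    counts.\<close>
  have small: "(\<lambda>n. prob {\<omega>\<in>space M. e < \<bar>p n \<omega> * X 0 \<omega>\<bar>}) \<longlonglongrightarrow> 0" if e: "0 < e" for e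
  proof (rule LIMSEQ_I)
    fix r :: real assume r: "0 < r"
    have "eventually (\<lambda>k. prob {\<omega>\<in>space M. k < \<bar>X 0 \<omega>\<bar>} < r / 2) at_top"
      using r by (intro order_tendstoD[OF prob_gt_tendsto_0]) auto
    then have "eventually (\<lambda>k. prob {\<omega>\<in>space M. k < \<bar>X 0 \<omega>\<bar>} < r / 2 \<and> 0 < k) at_top"
      using eventually_gt_at_top[of 0] by eventually_elim auto
    then obtain k where k: "0 < k" "prob {\<omega>\<in>space M. k < \<bar>X 0 \<omega>\<bar>} < r / 2"
      using eventually_happens'[OF trivial_limit_at_top_linorder] by blast
    have "(\<lambda>n. \<kappa> ^ n * (e / k) powr (- s)) \<longlonglongrightarrow> 0 * (e / k) powr (- s)"
      using \<kappa> \<kappa>0 by (intro tendsto_intros LIMSEQ_realpow_zero) auto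
    then have "eventually (\<lambda>n. \<kappa> ^ n * (e / k) powr (- s) < r / 2) sequentially"
      using r by (intro order_tendstoD) auto
    then obtain N where N: "\<And>n. n \<ge> N \<Longrightarrow> \<kappa> ^ n * (e / k) powr (- s) < r / 2" by (auto simp: eventually_sequentially)
    show "\<exists>N. \<forall>n\<ge>N. norm (prob {\<omega>\<in>space M. e < \<bar>p n \<omega> * X 0 \<omega>\<bar>} - 0) < r"
    proof (intro exI allI impI)
      fix n assume n: "N \<le> n"
      have "prob {\<omega>\<in>space M. e < \<bar>p n \<omega> * X 0 \<omega>\<bar>} \<le> prob ({\<omega>\<in>space M. e / k < p n \<omega>} \<union> {\<omega>\<in>space M. k < \<bar>X 0 \<omega>\<bar>})"
      proof (rule finite_measure_mono_AE)
        show "AE \<omega> in M. \<omega> \<in> {\<omega>\<in>space M. e < \<bar>p n \<omega> * X 0 \<omega>\<bar>} \<longrightarrow> \<omega> \<in> {\<omega>\<in>space M. e / k < p n \<omega>} \<union> {\<omega>\<in>space M. k < \<bar>X 0 \<omega>\<bar>}"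
          using p_pos[of n]
        proof eventually_elim
          case (elim \<omega>)
          show ?case
          proof (intro impI, rule ccontr)
            assume 1: "\<omega> \<in> {\<omega>\<in>space M. e < \<bar>p n \<omega> * X 0 \<omega>\<bar>}"
              and "\<omega> \<notin> {\<omega>\<in>space M. e / k < p n \<omega>} \<union> {\<omega>\<in>space M. k < \<bar>X 0 \<omega>\<bar>}"
            then have "p n \<omega> \<le> e / k" "\<bar>X 0 \<omega>\<bar> \<le> k" by auto
            then have "p n \<omega> * \<bar>X 0 \<omega>\<bar> \<le> e / k * k" using elim k e by (intro mult_mono) auto
            then show False using 1 elim k by (simp add: abs_mult)
          qed
        qed
      qed auto
      also have "\<dots> \<le> prob {\<omega>\<in>space M. e / k < p n \<omega>} + prob {\<omega>\<in>space M. k < \<bar>X 0 \<omega>\<bar>}"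
        by (intro measure_Un_le) auto
      also have "\<dots> < r / 2 + r / 2"
        using tail_bdD[OF ptail[of n], of "e / k"] N[OF n] k e by (intro add_strict_mono) auto
      finally show "norm (prob {\<omega>\<in>space M. e < \<bar>p n \<omega> * X 0 \<omega>\<bar>} - 0) < r" by simp
    qed
  qed
  show "AE \<omega> in M. 0 \<le> X 0 \<omega>"
  proof -
    have z: "prob {\<omega>\<in>space M. X 0 \<omega> < - e} = 0" if e: "0 < e" for e
    proof -
      have "prob {\<omega>\<in>space M. X 0 \<omega> < - e} \<le> prob {\<omega>\<in>space M. e < \<bar>p n \<omega> * X 0 \<omega>\<bar>}" for n
      proof -
        have "prob {\<omega>\<in>space M. X 0 \<omega> < - e} = prob {\<omega>\<in>space M. X n \<omega> < - e}"
          using law_prob_eq[OF Xm Xm _ law, of "\<lambda>x. x < -e" n] by simp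
        also have "\<dots> \<le> prob {\<omega>\<in>space M. e < \<bar>p n \<omega> * X 0 \<omega>\<bar>}"
        proof (rule finite_measure_mono_AE)
          show "AE \<omega> in M. \<omega> \<in> {\<omega>\<in>space M. X n \<omega> < - e} \<longrightarrow> \<omega> \<in> {\<omega>\<in>space M. e < \<bar>p n \<omega> * X 0 \<omega>\<bar>}"
            using X[of n] S_nn[of n] by eventually_elim auto
        qed auto
        finally show ?thesis .
      qed
      then have "prob {\<omega>\<in>space M. X 0 \<omega> < - e} \<le> 0"
        by (intro LIMSEQ_le_const[OF small[OF e]]) auto
      then show ?thesis by (simp add: measure_le_0_iff)
    qed
    have "AE \<omega> in M. \<forall>k::nat. \<not> X 0 \<omega> < - (1 / real (Suc k))"
    proof (subst AE_all_countable, intro allI)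
      fix k :: nat
      have "{\<omega>\<in>space M. X 0 \<omega> < - (1 / real (Suc k))} \<in> null_sets M"
        using z[of "1 / real (Suc k)"] by (simp add: null_sets_def emeasure_eq_measure)
      then show "AE \<omega> in M. \<not> X 0 \<omega> < - (1 / real (Suc k))"
        by (rule AE_I') auto
    qed
    then show ?thesis
    proof eventually_elim
      case (elim \<omega>)
      show ?case
      proof (rule ccontr)
        assume "\<not> 0 \<le> X 0 \<omega>"
        then obtain k where "inverse (real (Suc k)) < - X 0 \<omega>" using reals_Archimedean[of "- X 0 \<omega>"] by auto
        then show False using elim[rule_format, of k] by (simp add: inverse_eq_divide)
      qed
    qed
  qed
  have K0: "0 \<le> K" using Zt by (rule tail_bd_nonneg)
  \<comment> \<open>\<open>e\<close> is taken so small that splitting off the driving term keeps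
    \<rho> = \<kappa> (1 - e)^(-s) below 1. The constant \<open>C\<close> below is then the fixed
    point of the map taking C to \<rho> C + K e^(-s), which makes the induction close.\<close>
  have "((\<lambda>e. \<kappa> * (1 - e) powr (- s)) \<longlongrightarrow> \<kappa> * (1 - 0) powr (- s)) (at_right 0)"
    by (intro tendsto_intros) auto
  then have "eventually (\<lambda>e. \<kappa> * (1 - e) powr (- s) < 1) (at_right 0)"
    using \<kappa> by (intro order_tendstoD) auto
  moreover have "eventually (\<lambda>e. e < 1) (at_right (0::real))" by (rule eventually_at_right_field[THEN iffD2]) (auto intro: exI[of _ 1])
  ultimately have "eventually (\<lambda>e. \<kappa> * (1 - e) powr (- s) < 1 \<and> 0 < e \<and> e < 1) (at_right 0)"
    using eventually_at_right_less[of 0] by eventually_elim auto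
  then obtain e where e: "0 < e" "e < 1" "\<kappa> * (1 - e) powr (- s) < 1"
    using eventually_happens'[OF trivial_limit_at_right_real] by blast
  define \<rho> where "\<rho> = \<kappa> * (1 - e) powr (- s)"
  define C where "C = K * e powr (- s) / (1 - \<rho>)"
  have C0: "0 \<le> C" using K0 e by (simp add: C_def \<rho>_def)
  have St: "tail_bd (S n) C s" for n
  proof (induction n)
    case 0
    then show ?case using C0 by (auto simp: tail_bd_def S0)
  next
    case (Suc n)
    have "tail_bd (\<lambda>\<omega>. a (Suc n) \<omega> * S n \<omega>) (C * (\<integral>\<omega>. a (Suc n) \<omega> powr s \<partial>M)) s"
      by (rule tail_bd_mult[OF indS Suc.IH a0 aint])
    then have "tail_bd (\<lambda>\<omega>. a (Suc n) \<omega> * S n \<omega> + Z (Suc n) \<omega>) (C * (\<integral>\<omega>. a (Suc n) \<omega> powr s \<partial>M) * (1 - e) powr (- s) + K * e powr (- s)) s"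
      by (intro tail_bd_add Zt e) auto
    moreover have "C * (\<integral>\<omega>. a (Suc n) \<omega> powr s \<partial>M) * (1 - e) powr (- s) + K * e powr (- s) = C"
      using e by (simp add: a\<kappa> C_def \<rho>_def field_simps)
    ultimately show ?case by (simp add: SS[abs_def])
  qed
  \<comment> \<open>Half of the threshold is left to p n X 0, whose share vanishes as n grows; the
    other half produces the factor 2^s.\<close>
  have "tail_bd (X 0) (C * 2 powr s) s"
    unfolding tail_bd_def
  proof (intro allI impI)
    fix y :: real assume y: "0 < y"
    have "prob {\<omega>\<in>space M. y < X 0 \<omega>} \<le> prob {\<omega>\<in>space M. y / 2 < \<bar>p n \<omega> * X 0 \<omega>\<bar>} + C * (y / 2) powr (- s)" for n
    proof -
      have "prob {\<omega>\<in>space M. y < X 0 \<omega>} = prob {\<omega>\<in>space M. y < X n \<omega>}"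
        using law_prob_eq[OF Xm Xm _ law, of "\<lambda>x. y < x" n] by simp
      also have "\<dots> \<le> prob {\<omega>\<in>space M. y / 2 + y / 2 < \<bar>p n \<omega> * X 0 \<omega>\<bar> + S n \<omega>}"
      proof (rule finite_measure_mono_AE)
        show "AE \<omega> in M. \<omega> \<in> {\<omega>\<in>space M. y < X n \<omega>} \<longrightarrow> \<omega> \<in> {\<omega>\<in>space M. y / 2 + y / 2 < \<bar>p n \<omega> * X 0 \<omega>\<bar> + S n \<omega>}"
          using X[of n] by eventually_elim auto
      qed auto
      also have "\<dots> \<le> prob {\<omega>\<in>space M. y / 2 < \<bar>p n \<omega> * X 0 \<omega>\<bar>} + prob {\<omega>\<in>space M. y / 2 < S n \<omega>}"
        by (rule prob_add_gt_le) auto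
      also have "\<dots> \<le> prob {\<omega>\<in>space M. y / 2 < \<bar>p n \<omega> * X 0 \<omega>\<bar>} + C * (y / 2) powr (- s)"
        using y by (intro add_left_mono tail_bdD St) auto
      finally show ?thesis .
    qed
    moreover have "(\<lambda>n. prob {\<omega>\<in>space M. y / 2 < \<bar>p n \<omega> * X 0 \<omega>\<bar>} + C * (y / 2) powr (- s)) \<longlonglongrightarrow> 0 + C * (y / 2) powr (- s)"
      using y by (intro tendsto_intros small) auto
    ultimately have "prob {\<omega>\<in>space M. y < X 0 \<omega>} \<le> 0 + C * (y / 2) powr (- s)"
      by (intro LIMSEQ_le_const) auto
    also have "\<dots> = C * 2 powr s * y powr (- s)" using y by (simp add: powr_divide powr_minus_divide)
    finally show "prob {\<omega>\<in>space M. y < X 0 \<omega>} \<le> C * 2 powr s * y powr (- s)" .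
  qed
  then show "\<exists>C. tail_bd (X 0) C s" by blast
qed

text \<open>Unrolling the recursion displays \<open>Y n\<close> as a function of a finite block of
  inputs, the form in which independence of disjoint blocks applies.\<close>

lemma adapted_factor:
  fixes C :: "nat \<Rightarrow> 'a \<Rightarrow> 'b::topological_space"
  assumes \<phi>: "\<phi> \<in> measurable borel T" and g [measurable]: "g \<in> measurable (borel \<Otimes>\<^sub>M T) T"
    and Y0: "\<And>\<omega>. Y 0 \<omega> = \<phi> (C k \<omega>)" and YS: "\<And>n \<omega>. Y (Suc n) \<omega> = g (C (Suc (k + n)) \<omega>, Y n \<omega>)"
  shows "\<exists>\<psi>\<in>measurable (PiM {k..k + n} (\<lambda>_. borel)) T. \<forall>\<omega>. Y n \<omega> = \<psi> (\<lambda>i\<in>{k..k + n}. C i \<omega>)"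
proof (induction n)
  case 0
  show ?case
  proof (rule bexI[of _ "\<lambda>f. \<phi> (f k)"])
    have "(\<lambda>f. f k) \<in> measurable (PiM {k..k + 0} (\<lambda>_. borel :: 'b measure)) borel"
      by (rule measurable_component_singleton) simp
    from measurable_compose[OF this \<phi>]
    show "(\<lambda>f. \<phi> (f k)) \<in> measurable (PiM {k..k + 0} (\<lambda>_. borel)) T" .
  qed (simp add: Y0)
next
  case (Suc n)
  from Suc.IH obtain \<psi> where \<psi> [measurable]: "\<psi> \<in> measurable (PiM {k..k + n} (\<lambda>_. borel)) T"
    and eq: "\<forall>\<omega>. Y n \<omega> = \<psi> (\<lambda>i\<in>{k..k + n}. C i \<omega>)" by (rule bexE)
  show ?case
  proof (rule bexI[of _ "\<lambda>f. g (f (Suc (k + n)), \<psi> (restrict f {k..k + n}))"])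
    have [measurable]: "(\<lambda>f. restrict f {k..k + n}) \<in> measurable (PiM {k..k + Suc n} (\<lambda>_. borel)) (PiM {k..k + n} (\<lambda>_. borel))"
      by (rule measurable_restrict_subset) auto
    have [measurable]: "(\<lambda>f. f (Suc (k + n))) \<in> measurable (PiM {k..k + Suc n} (\<lambda>_. borel :: 'b measure)) borel"
      by (rule measurable_component_singleton) auto
    show "(\<lambda>f. g (f (Suc (k + n)), \<psi> (restrict f {k..k + n}))) \<in> measurable (PiM {k..k + Suc n} (\<lambda>_. borel)) T"
      by measurable
    show "\<forall>\<omega>. Y (Suc n) \<omega> = g ((\<lambda>i\<in>{k..k + Suc n}. C i \<omega>) (Suc (k + n)), \<psi> (restrict (\<lambda>i\<in>{k..k + Suc n}. C i \<omega>) {k..k + n}))"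
    proof
      fix \<omega>
      have "restrict (\<lambda>i\<in>{k..k + Suc n}. C i \<omega>) {k..k + n} = (\<lambda>i\<in>{k..k + n}. C i \<omega>)"
        by (auto simp: restrict_def fun_eq_iff)
      then show "Y (Suc n) \<omega> = g ((\<lambda>i\<in>{k..k + Suc n}. C i \<omega>) (Suc (k + n)), \<psi> (restrict (\<lambda>i\<in>{k..k + Suc n}. C i \<omega>) {k..k + n}))"
        by (simp add: YS eq[rule_format, of \<omega>])
    qed
  qed
qed

lemma adapted_indep:
  fixes C :: "nat \<Rightarrow> 'a \<Rightarrow> 'b::topological_space"
  assumes ind: "indep_vars (\<lambda>_. borel) C UNIV"
    and \<phi>: "\<phi> \<in> measurable borel T" and g: "g \<in> measurable (borel \<Otimes>\<^sub>M T) T"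
    and Y0: "\<And>\<omega>. Y 0 \<omega> = \<phi> (C 0 \<omega>)" and YS: "\<And>n \<omega>. Y (Suc n) \<omega> = g (C (Suc n) \<omega>, Y n \<omega>)"
  shows "indep_pair borel (C (Suc n)) T (Y n)"
proof -
  obtain \<psi> where \<psi>: "\<psi> \<in> measurable (PiM {0..0 + n} (\<lambda>_. borel)) T"
    and eq: "\<And>\<omega>. Y n \<omega> = \<psi> (\<lambda>i\<in>{0..0 + n}. C i \<omega>)"
    using adapted_factor[of \<phi> T g Y C 0 n] \<phi> g Y0 YS by auto
  have "indep_pair (PiM {Suc n} (\<lambda>_. borel)) (\<lambda>\<omega>. \<lambda>i\<in>{Suc n}. C i \<omega>) (PiM {0..0 + n} (\<lambda>_. borel)) (\<lambda>\<omega>. \<lambda>i\<in>{0..0 + n}. C i \<omega>)"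
    unfolding indep_pair_iff_indep_var by (rule indep_var_restrict[OF ind]) auto
  from indep_pair_compose[OF this measurable_component_singleton[of "Suc n"] \<psi>]
  have "indep_pair borel (C (Suc n)) T (\<lambda>\<omega>. \<psi> (\<lambda>i\<in>{0..0 + n}. C i \<omega>))" by simp
  moreover have "Y n = (\<lambda>\<omega>. \<psi> (\<lambda>i\<in>{0..0 + n}. C i \<omega>))" by (rule ext) (rule eq)
  ultimately show ?thesis by (simp only:)
qed

end

section \<open>Matrix norms, measurability, and tails from moments\<close>

lemma norm_mult_vec_le: "norm (A *v x) \<le> norm A * norm x" for A :: "real^'n^'m"
proof -
  have "norm (A *v x) = L2_set (\<lambda>i. \<bar>A $ i \<bullet> x\<bar>) UNIV"
    by (simp add: norm_vec_def[of "A *v x"] matrix_vector_mul_component)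
  also have "\<dots> \<le> L2_set (\<lambda>i. norm (A $ i) * norm x) UNIV"
    by (intro L2_set_mono) (auto simp: Cauchy_Schwarz_ineq2)
  also have "\<dots> = norm A * norm x"
    by (simp add: L2_set_left_distrib norm_vec_def[of A])
  finally show ?thesis .
qed

lemma norm_transpose: "norm (transpose A) = norm A" for A :: "real^'n^'m"
  unfolding norm_eq_sqrt_inner inner_vec_def
  by (subst sum.swap) (simp add: transpose_def)

text \<open>The norm on matrices is the Frobenius norm. Submultiplicativity is the vector bound
  applied to each column of \<open>P\<close>, which the transposes make accessible as rows.\<close>

lemma norm_mult_mat_le: "norm (A ** P) \<le> norm A * norm P" for A :: "real^'n^'m" and P :: "real^'k^'n"
proof -
  have "norm (A ** P) = norm (transpose (A ** P))" by (simp add: norm_transpose)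
  also have "\<dots> = L2_set (\<lambda>j. norm (A *v (transpose P $ j))) UNIV"
    unfolding norm_vec_def[of "transpose (A ** P)"]
    by (intro arg_cong[where f="\<lambda>f. L2_set f UNIV"] ext arg_cong[where f=norm])
      (simp add: vec_eq_iff transpose_def matrix_matrix_mult_def matrix_vector_mult_def)
  also have "\<dots> \<le> L2_set (\<lambda>j. norm A * norm (transpose P $ j)) UNIV"
    by (intro L2_set_mono) (auto intro: norm_mult_vec_le)
  also have "\<dots> = norm A * norm (transpose P)"
    by (simp add: L2_set_right_distrib norm_vec_def[of "transpose P"])
  finally show ?thesis by (simp add: norm_transpose)
qed

lemma continuous_matrix_vector_mult [continuous_intros]:
  fixes f :: "'x::topological_space \<Rightarrow> real^'n^'m"
  assumes "continuous_on S f" "continuous_on S g"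
  shows "continuous_on S (\<lambda>x. f x *v g x)"
  unfolding matrix_vector_mult_def by (intro continuous_intros continuous_on_vec_lambda assms)

lemma continuous_matrix_mult [continuous_intros]:
  fixes f :: "'x::topological_space \<Rightarrow> real^'n^'m" and g :: "'x \<Rightarrow> real^'k^'n"
  assumes "continuous_on S f" "continuous_on S g"
  shows "continuous_on S (\<lambda>x. f x ** g x)"
  unfolding matrix_matrix_mult_def by (intro continuous_intros continuous_on_vec_lambda assms)

lemma measurable_matrix_vector_mult [measurable (raw)]:
  fixes f :: "'x \<Rightarrow> real^'n^'m"
  assumes "f \<in> borel_measurable M" "g \<in> borel_measurable M"
  shows "(\<lambda>x. f x *v g x) \<in> borel_measurable M"
  by (rule borel_measurable_continuous_Pair[OF assms]) (intro continuous_intros)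

lemma measurable_matrix_mult [measurable (raw)]:
  fixes f :: "'x \<Rightarrow> real^'n^'m" and g :: "'x \<Rightarrow> real^'k^'n"
  assumes "f \<in> borel_measurable M" "g \<in> borel_measurable M"
  shows "(\<lambda>x. f x ** g x) \<in> borel_measurable M"
  by (rule borel_measurable_continuous_Pair[OF assms]) (intro continuous_intros)

lemma measurable_vec_component [measurable (raw)]:
  fixes f :: "'x \<Rightarrow> 'b::real_normed_vector^'n"
  assumes "f \<in> borel_measurable M"
  shows "(\<lambda>x. f x $ i) \<in> borel_measurable M"
  by (rule borel_measurable_continuous_on[OF _ assms]) (intro continuous_intros)

text \<open>The norm is at most the dimension times the largest component, and the power of a
  maximum is at most the sum of the powers. This covers exponents below 1 as well.\<close>

lemma norm_powr_integrable:
  fixes f :: "'a \<Rightarrow> 'b::euclidean_space^'n"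
  assumes [measurable]: "f \<in> borel_measurable M" and \<alpha>: "0 < \<alpha>"
    and int: "\<And>i. integrable M (\<lambda>\<omega>. norm (f \<omega> $ i) powr \<alpha>)"
  shows "integrable M (\<lambda>\<omega>. norm (f \<omega>) powr \<alpha>)"
proof (rule Bochner_Integration.integrable_bound)
  show "integrable M (\<lambda>\<omega>. real CARD('n) powr \<alpha> * (\<Sum>i\<in>UNIV. norm (f \<omega> $ i) powr \<alpha>))"
    using int by simp
  show "AE \<omega> in M. norm (norm (f \<omega>) powr \<alpha>) \<le> norm (real CARD('n) powr \<alpha> * (\<Sum>i\<in>UNIV. norm (f \<omega> $ i) powr \<alpha>))"
  proof (rule AE_I2)
    fix \<omega>
    define m where "m = Max (range (\<lambda>i. norm (f \<omega> $ i)))"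
    have "m \<in> range (\<lambda>i. norm (f \<omega> $ i))" unfolding m_def by (intro Max_in) auto
    then obtain j where j: "m = norm (f \<omega> $ j)" by auto
    have "norm (f \<omega>) \<le> (\<Sum>i\<in>UNIV. norm (f \<omega> $ i))" unfolding norm_vec_def by (rule L2_set_le_sum) simp
    also have "\<dots> \<le> (\<Sum>i\<in>(UNIV::'n set). m)" unfolding m_def by (intro sum_mono Max_ge) auto
    finally have "norm (f \<omega>) \<le> real CARD('n) * m" by simp
    then have "norm (f \<omega>) powr \<alpha> \<le> (real CARD('n) * m) powr \<alpha>" using \<alpha> by (intro powr_mono2) auto
    also have "\<dots> = real CARD('n) powr \<alpha> * m powr \<alpha>" using j by (intro powr_mult)
    also have "m powr \<alpha> \<le> (\<Sum>i\<in>UNIV. norm (f \<omega> $ i) powr \<alpha>)"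
      unfolding j by (rule member_le_sum) auto
    finally show "norm (norm (f \<omega>) powr \<alpha>) \<le> norm (real CARD('n) powr \<alpha> * (\<Sum>i\<in>UNIV. norm (f \<omega> $ i) powr \<alpha>))"
      by (simp add: mult_left_mono sum_nonneg)
  qed
qed measurable

lemma powr_sum_le: "0 \<le> x \<Longrightarrow> 0 \<le> y \<Longrightarrow> 0 < \<alpha> \<Longrightarrow> (x + y) powr \<alpha> \<le> 2 powr \<alpha> * (x powr \<alpha> + y powr \<alpha>)" for x y \<alpha> :: real
proof -
  assume h: "0 \<le> x" "0 \<le> y" "0 < \<alpha>"
  have "(x + y) powr \<alpha> \<le> (2 * max x y) powr \<alpha>" using h by (intro powr_mono2) auto
  also have "\<dots> = 2 powr \<alpha> * (max x y) powr \<alpha>" using h by (intro powr_mult)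
  also have "(max x y) powr \<alpha> \<le> x powr \<alpha> + y powr \<alpha>" by (auto simp: max_def)
  finally show ?thesis by simp
qed

text \<open>Markov's inequality on the event X > x leaves the truncated moment, which tends to 0.
  Hence variables with finite \<alpha>-moment are invisible at the scale x^(-\<alpha>).\<close>

lemma (in prob_space) tail_o_of_moment:
  fixes X :: "'a \<Rightarrow> real"
  assumes [measurable]: "X \<in> borel_measurable M" and nn: "\<And>\<omega>. 0 \<le> X \<omega>" and \<alpha>: "0 < \<alpha>"
    and int: "integrable M (\<lambda>\<omega>. X \<omega> powr \<alpha>)"
  shows "((\<lambda>x. x powr \<alpha> * prob {\<omega>\<in>space M. x < X \<omega>}) \<longlongrightarrow> 0) at_top"
proof (rule Lim_null_comparison)
  show "((\<lambda>x. \<integral>\<omega>. X \<omega> powr \<alpha> * indicator {\<omega>\<in>space M. x < X \<omega>} \<omega> \<partial>M) \<longlongrightarrow> 0) at_top"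
  proof -
    have "((\<lambda>x. \<integral>\<omega>. X \<omega> powr \<alpha> * indicator {\<omega>\<in>space M. x < X \<omega>} \<omega> \<partial>M) \<longlongrightarrow> (\<integral>\<omega>. 0 \<partial>M)) at_top"
    proof (rule integral_dominated_convergence_at_top[OF _ _ int])
      show "AE \<omega> in M. ((\<lambda>x. X \<omega> powr \<alpha> * indicator {\<omega>\<in>space M. x < X \<omega>} \<omega>) \<longlongrightarrow> 0) at_top"
      proof (rule AE_I2)
        fix \<omega>
        show "((\<lambda>x. X \<omega> powr \<alpha> * indicator {\<omega>\<in>space M. x < X \<omega>} \<omega>) \<longlongrightarrow> 0) at_top"
          by (rule tendsto_eventually) (use eventually_ge_at_top[of "X \<omega>"] in \<open>eventually_elim, auto\<close>)
      qed
    qed (auto simp: indicator_def)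
    then show ?thesis by simp
  qed
  show "eventually (\<lambda>x. norm (x powr \<alpha> * prob {\<omega>\<in>space M. x < X \<omega>}) \<le> (\<integral>\<omega>. X \<omega> powr \<alpha> * indicator {\<omega>\<in>space M. x < X \<omega>} \<omega> \<partial>M)) at_top"
    using eventually_gt_at_top[of 0]
  proof eventually_elim
    case (elim x)
    have "x powr \<alpha> * prob {\<omega>\<in>space M. x < X \<omega>} = (\<integral>\<omega>. x powr \<alpha> * indicator {\<omega>\<in>space M. x < X \<omega>} \<omega> \<partial>M)"
      by simp
    also have "\<dots> \<le> (\<integral>\<omega>. X \<omega> powr \<alpha> * indicator {\<omega>\<in>space M. x < X \<omega>} \<omega> \<partial>M)"
    proof (rule integral_mono)
      show "integrable M (\<lambda>\<omega>. X \<omega> powr \<alpha> * indicator {\<omega>\<in>space M. x < X \<omega>} \<omega>)"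
        by (rule Bochner_Integration.integrable_bound[OF int]) (auto simp: indicator_def)
      show "x powr \<alpha> * indicator {\<omega>\<in>space M. x < X \<omega>} \<omega> \<le> X \<omega> powr \<alpha> * indicator {\<omega>\<in>space M. x < X \<omega>} \<omega>" for \<omega>
        using elim \<alpha> by (auto simp: indicator_def intro!: powr_mono2)
    qed (intro integrable_mult_right integrable_real_indicator, auto simp: emeasure_eq_measure)
    finally show ?case by simp
  qed
qed

text \<open>Below the level where the limit takes over, the trivial bound of a probability by 1 is
  absorbed into the constant.\<close>

lemma (in prob_space) tail_bd_of_limit:
  assumes [measurable]: "X \<in> borel_measurable M"
    and lim: "((\<lambda>x. x powr \<alpha> * prob {\<omega>\<in>space M. x < X \<omega>}) \<longlongrightarrow> c) at_top" and \<alpha>: "0 < \<alpha>"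
  shows "\<exists>C. tail_bd X C \<alpha>"
proof -
  have "eventually (\<lambda>x. x powr \<alpha> * prob {\<omega>\<in>space M. x < X \<omega>} < c + 1) at_top"
    by (rule order_tendstoD[OF lim]) simp
  then obtain x0 where x0: "\<And>x. x0 \<le> x \<Longrightarrow> x powr \<alpha> * prob {\<omega>\<in>space M. x < X \<omega>} < c + 1" by (auto simp: eventually_at_top_linorder)
  define C where "C = max (c + 1) (\<bar>x0\<bar> powr \<alpha>)"
  have "tail_bd X C \<alpha>"
    unfolding tail_bd_def
  proof (intro allI impI)
    fix y :: real assume y: "0 < y"
    have "y powr \<alpha> * prob {\<omega>\<in>space M. y < X \<omega>} \<le> C"
    proof (cases "x0 \<le> y")
      case True then show ?thesis using x0[of y] by (simp add: C_def)
    next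
      case False
      have "y powr \<alpha> * prob {\<omega>\<in>space M. y < X \<omega>} \<le> \<bar>x0\<bar> powr \<alpha> * 1"
        using False y \<alpha> by (intro mult_mono powr_mono2) auto
      then show ?thesis by (simp add: C_def)
    qed
    then show "prob {\<omega>\<in>space M. y < X \<omega>} \<le> C * y powr (- \<alpha>)"
      using y by (simp add: powr_minus_divide field_simps)
  qed
  then show ?thesis by blast
qed

section \<open>The triangular recursion\<close>

lemma fst_borel [measurable]: "fst \<in> borel_measurable (borel :: ((real^2^2) \<times> (real^2)) measure)"
  and snd_borel [measurable]: "snd \<in> borel_measurable (borel :: ((real^2^2) \<times> (real^2)) measure)"
  unfolding borel_prod [symmetric] by measurable

text \<open>\<open>C 0\<close> carries the initial state in its vector component, so that the
  initial state and the later inputs form one independent family. Its law differs from that of the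
  inputs, which is why \<open>same\<close> starts at index 1. Here \<alpha> is the exponent of the
  second coordinate, and the matrix entries 11, 12, 22 are \<open>A\<^sub>1\<close>,
  \<open>A\<^sub>2\<close>, \<open>A\<^sub>4\<close>.\<close>

locale triangular_recursion = prob_space M
  for M :: "'a measure" +
  fixes C :: "nat \<Rightarrow> 'a \<Rightarrow> (real^2^2) \<times> (real^2)" and W :: "nat \<Rightarrow> 'a \<Rightarrow> real^2" and \<alpha>1 \<alpha> :: real
  assumes ind: "indep_vars (\<lambda>_. borel) C UNIV"
    and same: "\<And>n. distr M borel (C (Suc n)) = distr M borel (C 1)"
    and W0: "\<And>\<omega>. W 0 \<omega> = snd (C 0 \<omega>)"
    and WS: "\<And>n \<omega>. W (Suc n) \<omega> = fst (C (Suc n) \<omega>) *v W n \<omega> + snd (C (Suc n) \<omega>)"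
    and W_law: "\<And>n. distr M borel (W n) = distr M borel (W 0)"
    and tri: "AE \<omega> in M. fst (C 1 \<omega>) $ 2 $ 1 = 0"
    and A_pos: "AE \<omega> in M. fst (C 1 \<omega>) $ 1 $ 1 > 0 \<and> fst (C 1 \<omega>) $ 1 $ 2 > 0 \<and> fst (C 1 \<omega>) $ 2 $ 2 > 0"
    and B_pos: "AE \<omega> in M. snd (C 1 \<omega>) $ 1 > 0 \<and> snd (C 1 \<omega>) $ 2 > 0"
    and na1: "\<not> (AE \<omega> in M. fst (C 1 \<omega>) $ 1 $ 1 = 1)"
    and na4: "\<And>h. 0 \<le> h \<Longrightarrow> \<not> (AE \<omega> in M. ln (fst (C 1 \<omega>) $ 2 $ 2) \<in> range (\<lambda>k::int. h * of_int k))"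
    and \<alpha>1: "\<alpha> < \<alpha>1" and \<alpha>: "0 < \<alpha>"
    and A1_int: "integrable M (\<lambda>\<omega>. (fst (C 1 \<omega>) $ 1 $ 1) powr \<alpha>1)"
    and A1_one: "(\<integral>\<omega>. (fst (C 1 \<omega>) $ 1 $ 1) powr \<alpha>1 \<partial>M) = 1"
    and B1_int: "integrable M (\<lambda>\<omega>. (snd (C 1 \<omega>) $ 1) powr \<alpha>1)"
    and A4_int: "integrable M (\<lambda>\<omega>. (fst (C 1 \<omega>) $ 2 $ 2) powr \<alpha>)"
    and A4_one: "(\<integral>\<omega>. (fst (C 1 \<omega>) $ 2 $ 2) powr \<alpha> \<partial>M) = 1"
    and A4_log: "integrable M (\<lambda>\<omega>. (fst (C 1 \<omega>) $ 2 $ 2) powr \<alpha> * max (ln (fst (C 1 \<omega>) $ 2 $ 2)) 0)"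
    and B2_int: "integrable M (\<lambda>\<omega>. (snd (C 1 \<omega>) $ 2) powr \<alpha>)"
    and A2_int: "integrable M (\<lambda>\<omega>. (fst (C 1 \<omega>) $ 1 $ 2) powr \<alpha>)"
begin

abbreviation A where "A n \<omega> \<equiv> fst (C n \<omega>)"
abbreviation B where "B n \<omega> \<equiv> snd (C n \<omega>)"

lemma Cm [measurable]: "C n \<in> borel_measurable M"
  using ind by (auto simp: indep_vars_def)

lemma Am [measurable]: "A n \<in> borel_measurable M" and Bm [measurable]: "B n \<in> borel_measurable M"
  using measurable_compose[OF Cm[unfolded borel_prod [symmetric]] measurable_fst]
    measurable_compose[OF Cm[unfolded borel_prod [symmetric]] measurable_snd] by simp_all

lemma Wm [measurable]: "W n \<in> borel_measurable M"
proof (induction n)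
  case 0
  have "W 0 = (\<lambda>\<omega>. B 0 \<omega>)" by (rule ext) (rule W0)
  then show ?case by simp
next
  case (Suc n)
  then have [measurable]: "W n \<in> borel_measurable M" .
  have "W (Suc n) = (\<lambda>\<omega>. A (Suc n) \<omega> *v W n \<omega> + B (Suc n) \<omega>)" by (rule ext) (rule WS)
  moreover have "(\<lambda>\<omega>. A (Suc n) \<omega> *v W n \<omega> + B (Suc n) \<omega>) \<in> borel_measurable M" by measurable
  ultimately show ?case by simp
qed

lemma AE_C:
  assumes P: "Measurable.pred borel P" and "AE \<omega> in M. P (C 1 \<omega>)"
  shows "AE \<omega> in M. P (C (Suc n) \<omega>)"
proof -
  have set: "{x \<in> space borel. P x} \<in> sets borel" using P by (simp add: pred_def)
  have "AE x in distr M borel (C 1). P x" using assms(2) by (subst AE_distr_iff[OF Cm set])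
  then have "AE x in distr M borel (C (Suc n)). P x" by (simp only: same)
  then show ?thesis by (subst (asm) AE_distr_iff[OF Cm set])
qed

lemma integrable_C:
  fixes f :: "_ \<Rightarrow> real"
  assumes f: "f \<in> borel_measurable borel" and "integrable M (\<lambda>\<omega>. f (C 1 \<omega>))"
  shows "integrable M (\<lambda>\<omega>. f (C (Suc n) \<omega>))"
proof -
  have "integrable (distr M borel (C 1)) f" using assms(2) by (subst integrable_distr_eq[OF Cm f])
  then have "integrable (distr M borel (C (Suc n))) f" by (simp only: same)
  then show ?thesis by (subst (asm) integrable_distr_eq[OF Cm f])
qed

lemma integral_C:
  fixes f :: "_ \<Rightarrow> real"
  assumes f: "f \<in> borel_measurable borel"
  shows "(\<integral>\<omega>. f (C (Suc n) \<omega>) \<partial>M) = (\<integral>\<omega>. f (C 1 \<omega>) \<partial>M)"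
  using integral_distr[OF Cm f, of "Suc n"] integral_distr[OF Cm f, of 1] by (simp only: same)

lemma entries:
  "AE \<omega> in M. A (Suc n) \<omega> $ 2 $ 1 = 0 \<and> A (Suc n) \<omega> $ 1 $ 1 > 0 \<and> A (Suc n) \<omega> $ 1 $ 2 > 0 \<and> A (Suc n) \<omega> $ 2 $ 2 > 0
    \<and> B (Suc n) \<omega> $ 1 > 0 \<and> B (Suc n) \<omega> $ 2 > 0"
proof -
  let ?P = "\<lambda>c :: (real^2^2) \<times> (real^2). fst c $ 2 $ 1 \<in> {0 :: real} \<and> fst c $ 1 $ 1 > (0::real) \<and> fst c $ 1 $ 2 > (0::real) \<and> fst c $ 2 $ 2 > (0::real) \<and> snd c $ 1 > (0::real) \<and> snd c $ 2 > (0::real)"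
  have "Measurable.pred borel ?P" by measurable
  moreover have "AE \<omega> in M. ?P (C 1 \<omega>)" using tri A_pos B_pos by eventually_elim auto
  ultimately have "AE \<omega> in M. ?P (C (Suc n) \<omega>)" by (rule AE_C)
  then show ?thesis by eventually_elim auto
qed

lemma A1_int': "integrable M (\<lambda>\<omega>. (A 1 \<omega> $ 1 $ 1) powr \<alpha>)" and A1_less: "(\<integral>\<omega>. (A 1 \<omega> $ 1 $ 1) powr \<alpha> \<partial>M) < 1"
proof -
  have "AE \<omega> in M. A 1 \<omega> $ 1 $ 1 > 0" using A_pos by eventually_elim auto
  from powr_moment_less[OF _ this \<alpha> \<alpha>1 A1_int A1_one na1]
  show "integrable M (\<lambda>\<omega>. (A 1 \<omega> $ 1 $ 1) powr \<alpha>)" "(\<integral>\<omega>. (A 1 \<omega> $ 1 $ 1) powr \<alpha> \<partial>M) < 1"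
    by simp_all
qed

lemma B1_int': "integrable M (\<lambda>\<omega>. (B 1 \<omega> $ 1) powr \<alpha>)"
  by (rule powr_integrable_mono[OF _ B1_int]) (use B_pos \<alpha> \<alpha>1 in \<open>auto elim: eventually_mono\<close>)

lemma A_norm_int: "integrable M (\<lambda>\<omega>. norm (A 1 \<omega>) powr \<alpha>)"
proof (rule norm_powr_integrable[OF Am \<alpha>])
  fix i :: 2
  have j: "integrable M (\<lambda>\<omega>. norm (A 1 \<omega> $ i $ j) powr \<alpha>)" for i j
  proof -
    consider "i = 1" "j = 1" | "i = 1" "j = 2" | "i = 2" "j = 1" | "i = 2" "j = 2"
      using exhaust_2 by metis
    then show ?thesis
    proof cases
      case 1
      show ?thesis by (rule integrable_cong_AE_imp[OF A1_int']) (use 1 A_pos in \<open>auto elim: eventually_mono\<close>)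
    next
      case 2
      show ?thesis by (rule integrable_cong_AE_imp[OF A2_int]) (use 2 A_pos in \<open>auto elim: eventually_mono\<close>)
    next
      case 3
      have "integrable M (\<lambda>\<omega>. 0 :: real)" by simp
      then show ?thesis by (rule integrable_cong_AE_imp) (use 3 tri in \<open>auto elim: eventually_mono\<close>)
    next
      case 4
      show ?thesis by (rule integrable_cong_AE_imp[OF A4_int]) (use 4 A_pos in \<open>auto elim: eventually_mono\<close>)
    qed
  qed
  show "integrable M (\<lambda>\<omega>. norm (A 1 \<omega> $ i) powr \<alpha>)"
    by (rule norm_powr_integrable[OF _ \<alpha> j]) measurable
qed

lemma B_norm_int: "integrable M (\<lambda>\<omega>. norm (B 1 \<omega>) powr \<alpha>)"
proof (rule norm_powr_integrable[OF Bm \<alpha>])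
  fix i :: 2
  consider "i = 1" | "i = 2" using exhaust_2 by metis
  then show "integrable M (\<lambda>\<omega>. norm (B 1 \<omega> $ i) powr \<alpha>)"
  proof cases
    case 1
    show ?thesis by (rule integrable_cong_AE_imp[OF B1_int']) (use 1 B_pos in \<open>auto elim: eventually_mono\<close>)
  next
    case 2
    show ?thesis by (rule integrable_cong_AE_imp[OF B2_int]) (use 2 B_pos in \<open>auto elim: eventually_mono\<close>)
  qed
qed

primrec S2 :: "nat \<Rightarrow> 'a \<Rightarrow> real" where
  "S2 0 \<omega> = 0"
| "S2 (Suc n) \<omega> = A (Suc n) \<omega> $ 2 $ 2 * S2 n \<omega> + B (Suc n) \<omega> $ 2"

primrec p2 :: "nat \<Rightarrow> 'a \<Rightarrow> real" where
  "p2 0 \<omega> = 1"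
| "p2 (Suc n) \<omega> = A (Suc n) \<omega> $ 2 $ 2 * p2 n \<omega>"

primrec p1 :: "nat \<Rightarrow> 'a \<Rightarrow> real" where
  "p1 0 \<omega> = 1"
| "p1 (Suc n) \<omega> = A (Suc n) \<omega> $ 1 $ 1 * p1 n \<omega>"

text \<open>The driving term of the first coordinate, seen as a scalar perpetuity. It contains the
  previous value of the second coordinate and thus depends on the past.\<close>

definition Z1 :: "nat \<Rightarrow> 'a \<Rightarrow> real" where
  "Z1 n \<omega> = A n \<omega> $ 1 $ 2 * W (n - 1) \<omega> $ 2 + B n \<omega> $ 1"

primrec S1 :: "nat \<Rightarrow> 'a \<Rightarrow> real" where
  "S1 0 \<omega> = 0"
| "S1 (Suc n) \<omega> = A (Suc n) \<omega> $ 1 $ 1 * S1 n \<omega> + Z1 (Suc n) \<omega>"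

primrec Pi :: "nat \<Rightarrow> 'a \<Rightarrow> real^2^2" where
  "Pi 0 \<omega> = mat 1"
| "Pi (Suc n) \<omega> = A (Suc n) \<omega> ** Pi n \<omega>"

primrec rest :: "nat \<Rightarrow> 'a \<Rightarrow> real^2" where
  "rest 0 \<omega> = 0"
| "rest (Suc n) \<omega> = A (Suc n) \<omega> *v rest n \<omega> + B (Suc n) \<omega>"

lemma W_eq: "W n \<omega> = Pi n \<omega> *v W 0 \<omega> + rest n \<omega>"
  by (induction n) (simp_all add: WS matrix_vector_right_distrib matrix_vector_mul_assoc)

lemma W2_Suc: "AE \<omega> in M. W (Suc n) \<omega> $ 2 = A (Suc n) \<omega> $ 2 $ 2 * W n \<omega> $ 2 + B (Suc n) \<omega> $ 2"
  using entries[of n] by eventually_elim (simp add: WS matrix_vector_mult_def sum_2)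

lemma W1_Suc: "W (Suc n) \<omega> $ 1 = A (Suc n) \<omega> $ 1 $ 1 * W n \<omega> $ 1 + Z1 (Suc n) \<omega>"
  by (simp add: WS matrix_vector_mult_def sum_2 Z1_def)

lemma W2_eq: "AE \<omega> in M. W n \<omega> $ 2 = p2 n \<omega> * W 0 \<omega> $ 2 + S2 n \<omega>"
proof (induction n)
  case (Suc n)
  then show ?case using W2_Suc[of n] by eventually_elim (simp add: algebra_simps)
qed simp

lemma W1_eq: "W n \<omega> $ 1 = p1 n \<omega> * W 0 \<omega> $ 1 + S1 n \<omega>"
  by (induction n) (simp_all add: W1_Suc algebra_simps)

text \<open>One state vector carrying all the recursions above, so that \<open>adapted_indep\<close> applies to them at once.\<close>

definition state where
  "state n \<omega> = (W n \<omega>, Pi n \<omega>, rest n \<omega>, S1 n \<omega>, S2 n \<omega>, p1 n \<omega>, p2 n \<omega>)"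

definition step :: "((real^2^2) \<times> (real^2)) \<times> (real^2) \<times> (real^2^2) \<times> (real^2) \<times> real \<times> real \<times> real \<times> real \<Rightarrow>
    (real^2) \<times> (real^2^2) \<times> (real^2) \<times> real \<times> real \<times> real \<times> real" where
  "step = (\<lambda>(c, w, P, r, s1, s2, q1, q2). (fst c *v w + snd c, fst c ** P, fst c *v r + snd c,
     fst c $ 1 $ 1 * s1 + (fst c $ 1 $ 2 * w $ 2 + snd c $ 1), fst c $ 2 $ 2 * s2 + snd c $ 2, fst c $ 1 $ 1 * q1, fst c $ 2 $ 2 * q2))"

abbreviation stateM :: "((real^2) \<times> (real^2^2) \<times> (real^2) \<times> real \<times> real \<times> real \<times> real) measure" where
  "stateM \<equiv> borel \<Otimes>\<^sub>M borel \<Otimes>\<^sub>M borel \<Otimes>\<^sub>M borel \<Otimes>\<^sub>M borel \<Otimes>\<^sub>M borel \<Otimes>\<^sub>M borel"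

lemma state_indep: "indep_pair borel (C (Suc n)) stateM (state n)"
proof (rule adapted_indep[OF ind, where \<phi>="\<lambda>c. (snd c, mat 1, 0, 0, 0, 1, 1)" and g=step])
  show "(\<lambda>c :: (real^2^2) \<times> (real^2). (snd c, mat 1 :: real^2^2, 0 :: real^2, 0 :: real, 0 :: real, 1 :: real, 1 :: real)) \<in> measurable borel stateM"
    by measurable
  show "step \<in> measurable (borel \<Otimes>\<^sub>M stateM) stateM"
    unfolding step_def by measurable
  show "state 0 \<omega> = (snd (C 0 \<omega>), mat 1, 0, 0, 0, 1, 1)" for \<omega>
    by (simp add: state_def W0)
  show "state (Suc n) \<omega> = step (C (Suc n) \<omega>, state n \<omega>)" for n \<omega>
    by (simp add: state_def step_def WS Z1_def)
qed

lemma indep_state: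
  assumes "f \<in> measurable borel S" "g \<in> measurable stateM T"
  shows "indep_pair S (\<lambda>\<omega>. f (C (Suc n) \<omega>)) T (\<lambda>\<omega>. g (state n \<omega>))"
  using indep_pair_compose[OF state_indep assms] .

lemma indep_next:
  assumes f: "f \<in> measurable borel S"
  shows "indep_pair S (\<lambda>\<omega>. f (C (Suc n) \<omega>)) borel (\<lambda>\<omega>. W n \<omega> $ i)"
    and "indep_pair S (\<lambda>\<omega>. f (C (Suc n) \<omega>)) borel (S1 n)" and "indep_pair S (\<lambda>\<omega>. f (C (Suc n) \<omega>)) borel (S2 n)"
    and "indep_pair S (\<lambda>\<omega>. f (C (Suc n) \<omega>)) borel (p1 n)" and "indep_pair S (\<lambda>\<omega>. f (C (Suc n) \<omega>)) borel (p2 n)"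
    and "indep_pair S (\<lambda>\<omega>. f (C (Suc n) \<omega>)) borel (Pi n)" and "indep_pair S (\<lambda>\<omega>. f (C (Suc n) \<omega>)) borel (rest n)"
proof -
  have [measurable]: "(\<lambda>z. fst z $ i) \<in> borel_measurable stateM" by measurable
  note * = indep_state[OF f, of _ _ n, unfolded state_def]
  show "indep_pair S (\<lambda>\<omega>. f (C (Suc n) \<omega>)) borel (\<lambda>\<omega>. W n \<omega> $ i)"
    using *[of "\<lambda>z. fst z $ i" borel] by simp
  have [measurable]: "(\<lambda>z. fst (snd z)) \<in> borel_measurable stateM" "(\<lambda>z. fst (snd (snd z))) \<in> borel_measurable stateM"
    "(\<lambda>z. fst (snd (snd (snd z)))) \<in> borel_measurable stateM" "(\<lambda>z. fst (snd (snd (snd (snd z))))) \<in> borel_measurable stateM"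
    "(\<lambda>z. fst (snd (snd (snd (snd (snd z)))))) \<in> borel_measurable stateM"
    "(\<lambda>z. snd (snd (snd (snd (snd (snd z)))))) \<in> borel_measurable stateM"
    by (simp_all)
  show "indep_pair S (\<lambda>\<omega>. f (C (Suc n) \<omega>)) borel (Pi n)"
    using *[of "\<lambda>z. fst (snd z)" borel] by simp
  show "indep_pair S (\<lambda>\<omega>. f (C (Suc n) \<omega>)) borel (rest n)"
    using *[of "\<lambda>z. fst (snd (snd z))" borel] by simp
  show "indep_pair S (\<lambda>\<omega>. f (C (Suc n) \<omega>)) borel (S1 n)"
    using *[of "\<lambda>z. fst (snd (snd (snd z)))" borel] by simp
  show "indep_pair S (\<lambda>\<omega>. f (C (Suc n) \<omega>)) borel (S2 n)"
    using *[of "\<lambda>z. fst (snd (snd (snd (snd z))))" borel] by simp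
  show "indep_pair S (\<lambda>\<omega>. f (C (Suc n) \<omega>)) borel (p1 n)"
    using *[of "\<lambda>z. fst (snd (snd (snd (snd (snd z)))))" borel] by simp
  show "indep_pair S (\<lambda>\<omega>. f (C (Suc n) \<omega>)) borel (p2 n)"
    using *[of "\<lambda>z. snd (snd (snd (snd (snd (snd z)))))" borel] by simp
qed

lemma W2_law: "distr M borel (\<lambda>\<omega>. W n \<omega> $ i) = distr M borel (\<lambda>\<omega>. W 0 \<omega> $ i)"
proof -
  have "distr M borel (\<lambda>\<omega>. W n \<omega> $ i) = distr (distr M borel (W n)) borel (\<lambda>w. w $ i)" for n
    by (subst distr_distr) (auto simp: comp_def)
  from this[of n] this[of 0] show ?thesis using W_law[of n] by simp
qed

text \<open>At \<alpha> itself the multiplier has moment 1 and nothing contracts, so the perpetuity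
  bound is applied at exponents strictly below. This is the a priori tail on which Goldie's argument
  rests.\<close>

lemma A4_tail_props:
  assumes s: "0 < s" "s < \<alpha>"
  shows "AE \<omega> in M. 0 \<le> W 0 \<omega> $ 2" "\<exists>K. tail_bd (\<lambda>\<omega>. W 0 \<omega> $ 2) K s"
proof -
  have ne: "\<not> (AE \<omega> in M. A 1 \<omega> $ 2 $ 2 = 1)"
  proof
    assume "AE \<omega> in M. A 1 \<omega> $ 2 $ 2 = 1"
    then have "AE \<omega> in M. ln (A 1 \<omega> $ 2 $ 2) \<in> range (\<lambda>k::int. 0 * of_int k)" by eventually_elim auto
    then show False using na4[of 0] by simp
  qed
  have "AE \<omega> in M. A 1 \<omega> $ 2 $ 2 > 0" using A_pos by eventually_elim auto
  from powr_moment_less[OF _ this s A4_int A4_one ne]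
  have A4s: "integrable M (\<lambda>\<omega>. (A 1 \<omega> $ 2 $ 2) powr s)" "(\<integral>\<omega>. (A 1 \<omega> $ 2 $ 2) powr s \<partial>M) < 1" by simp_all
  have B2s: "integrable M (\<lambda>\<omega>. (B 1 \<omega> $ 2) powr s)"
    by (rule powr_integrable_mono[OF _ B2_int]) (use B_pos s in \<open>auto elim: eventually_mono\<close>)
  define K where "K = (\<integral>\<omega>. (B 1 \<omega> $ 2) powr s \<partial>M)"
  have Kt: "tail_bd (\<lambda>\<omega>. B (Suc n) \<omega> $ 2) K s" for n
  proof -
    have "integrable M (\<lambda>\<omega>. (B (Suc n) \<omega> $ 2) powr s)"
      by (rule integrable_C[where f="\<lambda>c. (snd c $ 2) powr s", OF _ B2s]) measurable
    moreover have "(\<integral>\<omega>. (B (Suc n) \<omega> $ 2) powr s \<partial>M) = K"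
      unfolding K_def by (rule integral_C[where f="\<lambda>c. (snd c $ 2) powr s"]) measurable
    ultimately show ?thesis using tail_bd_moment[of "\<lambda>\<omega>. B (Suc n) \<omega> $ 2" s] s by simp
  qed
  have aint: "integrable M (\<lambda>\<omega>. (A (Suc n) \<omega> $ 2 $ 2) powr s)" for n
    by (rule integrable_C[where f="\<lambda>c. (fst c $ 2 $ 2) powr s", OF _ A4s(1)]) measurable
  have ak: "(\<integral>\<omega>. (A (Suc n) \<omega> $ 2 $ 2) powr s \<partial>M) = (\<integral>\<omega>. (A 1 \<omega> $ 2 $ 2) powr s \<partial>M)" for n
    by (rule integral_C[where f="\<lambda>c. (fst c $ 2 $ 2) powr s"]) measurable
  have iS: "indep_pair borel (\<lambda>\<omega>. A (Suc n) \<omega> $ 2 $ 2) borel (S2 n)" for n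
    by (rule indep_next(3)[where f="\<lambda>c. fst c $ 2 $ 2"]) measurable
  have ip: "indep_pair borel (\<lambda>\<omega>. A (Suc n) \<omega> $ 2 $ 2) borel (p2 n)" for n
    by (rule indep_next(5)[where f="\<lambda>c. fst c $ 2 $ 2"]) measurable
  have a0: "AE \<omega> in M. 0 < A (Suc n) \<omega> $ 2 $ 2" for n using entries[of n] by eventually_elim auto
  have Z0: "AE \<omega> in M. 0 \<le> B (Suc n) \<omega> $ 2" for n using entries[of n] by eventually_elim auto
  note pt = perpetuity_tail[where a="\<lambda>n \<omega>. A n \<omega> $ 2 $ 2" and Z="\<lambda>n \<omega>. B n \<omega> $ 2" and X="\<lambda>n \<omega>. W n \<omega> $ 2" and S=S2 and p=p2 and s=s
      and \<kappa>="\<integral>\<omega>. (A 1 \<omega> $ 2 $ 2) powr s \<partial>M" and K=K, OF _ _ _ S2.simps p2.simps iS ip a0 Z0 s(1) aint ak A4s(2) Kt W2_law W2_eq]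
  show "AE \<omega> in M. 0 \<le> W 0 \<omega> $ 2" by (rule pt(1)) measurable
  show "\<exists>K. tail_bd (\<lambda>\<omega>. W 0 \<omega> $ 2) K s" by (rule pt(2)) measurable
qed

lemma W2_nonneg: "AE \<omega> in M. 0 \<le> W 0 \<omega> $ 2"
  using A4_tail_props(1)[of "\<alpha> / 2"] \<alpha> by simp

lemma W2_tail: "\<exists>c>0. ((\<lambda>x. x powr \<alpha> * prob {\<omega>\<in>space M. x < W 0 \<omega> $ 2}) \<longlongrightarrow> c) at_top"
proof (rule kesten_goldie[where a="\<lambda>\<omega>. A 1 \<omega> $ 2 $ 2" and b="\<lambda>\<omega>. B 1 \<omega> $ 2"])
  show "indep_pair (borel \<Otimes>\<^sub>M borel) (\<lambda>\<omega>. (A 1 \<omega> $ 2 $ 2, B 1 \<omega> $ 2)) borel (\<lambda>\<omega>. W 0 \<omega> $ 2)"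
    using indep_next(1)[where f="\<lambda>c. (fst c $ 2 $ 2, snd c $ 2)" and n=0 and i=2 and S="borel \<Otimes>\<^sub>M borel"] by simp
  have "distr M borel (\<lambda>\<omega>. A 1 \<omega> $ 2 $ 2 * W 0 \<omega> $ 2 + B 1 \<omega> $ 2) = distr M borel (\<lambda>\<omega>. W 1 \<omega> $ 2)"
    by (rule distr_cong_AE) (use W2_Suc[of 0] in \<open>auto elim: eventually_mono\<close>)
  also have "\<dots> = distr M borel (\<lambda>\<omega>. W 0 \<omega> $ 2)" by (rule W2_law)
  finally show "distr M borel (\<lambda>\<omega>. A 1 \<omega> $ 2 $ 2 * W 0 \<omega> $ 2 + B 1 \<omega> $ 2) = distr M borel (\<lambda>\<omega>. W 0 \<omega> $ 2)" .
  show "AE \<omega> in M. 0 < A 1 \<omega> $ 2 $ 2" using A_pos by eventually_elim auto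
  show "AE \<omega> in M. 0 < B 1 \<omega> $ 2" using B_pos by eventually_elim auto
  show "\<exists>K. tail_bd (\<lambda>\<omega>. W 0 \<omega> $ 2) K s" if "0 < s" "s < \<alpha>" for s
    by (rule A4_tail_props(2)[OF that])
qed (fact W2_nonneg \<alpha> A4_int A4_one A4_log B2_int na4)+

text \<open>As \<alpha> < \<open>\<alpha>1\<close>, the multiplier of the first coordinate contracts
  at \<alpha>. The driving term inherits the \<alpha>-tail of the second coordinate, multiplied by
  an independent entry with finite \<alpha>-moment, so the perpetuity bound is available at \<alpha>
  itself.\<close>

lemma W1_props:
  shows W1_nonneg: "AE \<omega> in M. 0 \<le> W 0 \<omega> $ 1" and W1_tail: "\<exists>K. tail_bd (\<lambda>\<omega>. W 0 \<omega> $ 1) K \<alpha>"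
    and p1_pos: "AE \<omega> in M. 0 \<le> p1 n \<omega>"
proof -
  obtain K2 where "tail_bd (\<lambda>\<omega>. W 0 \<omega> $ 2) K2 \<alpha>"
    using W2_tail tail_bd_of_limit[OF _ _ \<alpha>, of "\<lambda>\<omega>. W 0 \<omega> $ 2"] by fastforce
  then have t2: "tail_bd (\<lambda>\<omega>. W n \<omega> $ 2) K2 \<alpha>" for n
    by (rule tail_bd_law[rotated 3]) (simp_all add: W2_law[of n])
  define mA where "mA = (\<integral>\<omega>. (A 1 \<omega> $ 1 $ 2) powr \<alpha> \<partial>M)"
  define mB where "mB = (\<integral>\<omega>. (B 1 \<omega> $ 1) powr \<alpha> \<partial>M)"
  define K where "K = K2 * mA * (1 - 1 / 2) powr (- \<alpha>) + mB * (1 / 2) powr (- \<alpha>)"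
  have Kt: "tail_bd (Z1 (Suc n)) K \<alpha>" for n
  proof -
    have 1: "integrable M (\<lambda>\<omega>. (B (Suc n) \<omega> $ 1) powr \<alpha>)"
      by (rule integrable_C[where f="\<lambda>c. (snd c $ 1) powr \<alpha>", OF _ B1_int']) measurable
    have 2: "(\<integral>\<omega>. (B (Suc n) \<omega> $ 1) powr \<alpha> \<partial>M) = mB"
      unfolding mB_def by (rule integral_C[where f="\<lambda>c. (snd c $ 1) powr \<alpha>"]) measurable
    have 3: "tail_bd (\<lambda>\<omega>. B (Suc n) \<omega> $ 1) mB \<alpha>" using tail_bd_moment[OF _ \<alpha> 1] 2 by simp
    have 4: "integrable M (\<lambda>\<omega>. (A (Suc n) \<omega> $ 1 $ 2) powr \<alpha>)"
      by (rule integrable_C[where f="\<lambda>c. (fst c $ 1 $ 2) powr \<alpha>", OF _ A2_int]) measurable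
    have 5: "(\<integral>\<omega>. (A (Suc n) \<omega> $ 1 $ 2) powr \<alpha> \<partial>M) = mA"
      unfolding mA_def by (rule integral_C[where f="\<lambda>c. (fst c $ 1 $ 2) powr \<alpha>"]) measurable
    have 6: "indep_pair borel (\<lambda>\<omega>. A (Suc n) \<omega> $ 1 $ 2) borel (\<lambda>\<omega>. W n \<omega> $ 2)"
      by (rule indep_next(1)[where f="\<lambda>c. fst c $ 1 $ 2"]) measurable
    have 7: "AE \<omega> in M. 0 < A (Suc n) \<omega> $ 1 $ 2" using entries[of n] by eventually_elim auto
    have "tail_bd (\<lambda>\<omega>. A (Suc n) \<omega> $ 1 $ 2 * W n \<omega> $ 2) (K2 * mA) \<alpha>"
      using tail_bd_mult[OF 6 t2 7 4] 5 by simp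
    then have "tail_bd (\<lambda>\<omega>. A (Suc n) \<omega> $ 1 $ 2 * W n \<omega> $ 2 + B (Suc n) \<omega> $ 1) K \<alpha>"
      unfolding K_def by (intro tail_bd_add 3) auto
    then show ?thesis by (simp add: Z1_def[abs_def])
  qed
  have aint: "integrable M (\<lambda>\<omega>. (A (Suc n) \<omega> $ 1 $ 1) powr \<alpha>)" for n
    by (rule integrable_C[where f="\<lambda>c. (fst c $ 1 $ 1) powr \<alpha>", OF _ A1_int']) measurable
  have ak: "(\<integral>\<omega>. (A (Suc n) \<omega> $ 1 $ 1) powr \<alpha> \<partial>M) = (\<integral>\<omega>. (A 1 \<omega> $ 1 $ 1) powr \<alpha> \<partial>M)" for n
    by (rule integral_C[where f="\<lambda>c. (fst c $ 1 $ 1) powr \<alpha>"]) measurable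
  have iS: "indep_pair borel (\<lambda>\<omega>. A (Suc n) \<omega> $ 1 $ 1) borel (S1 n)" for n
    by (rule indep_next(2)[where f="\<lambda>c. fst c $ 1 $ 1"]) measurable
  have ip: "indep_pair borel (\<lambda>\<omega>. A (Suc n) \<omega> $ 1 $ 1) borel (p1 n)" for n
    by (rule indep_next(4)[where f="\<lambda>c. fst c $ 1 $ 1"]) measurable
  have a0: "AE \<omega> in M. 0 < A (Suc n) \<omega> $ 1 $ 1" for n using entries[of n] by eventually_elim auto
  have W2n: "AE \<omega> in M. 0 \<le> W n \<omega> $ 2" for n
  proof -
    have "AE x in distr M borel (\<lambda>\<omega>. W 0 \<omega> $ 2). 0 \<le> x" by (subst AE_distr_iff) (use W2_nonneg in auto)
    then have "AE x in distr M borel (\<lambda>\<omega>. W n \<omega> $ 2). 0 \<le> x" by (subst W2_law)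
    then show ?thesis by (subst (asm) AE_distr_iff) auto
  qed
  have Z0: "AE \<omega> in M. 0 \<le> Z1 (Suc n) \<omega>" for n
    using entries[of n] W2n[of n] by eventually_elim (simp add: Z1_def)
  have W1e: "AE \<omega> in M. W n \<omega> $ 1 = p1 n \<omega> * W 0 \<omega> $ 1 + S1 n \<omega>" for n by (intro AE_I2 W1_eq)
  have Z1m: "Z1 (Suc n) \<in> borel_measurable M" for n unfolding Z1_def by measurable
  note pt = perpetuity_tail[where a="\<lambda>n \<omega>. A n \<omega> $ 1 $ 1" and Z=Z1 and X="\<lambda>n \<omega>. W n \<omega> $ 1" and S=S1 and p=p1 and s=\<alpha>
      and \<kappa>="\<integral>\<omega>. (A 1 \<omega> $ 1 $ 1) powr \<alpha> \<partial>M" and K=K, OF _ Z1m _ S1.simps p1.simps iS ip a0 Z0 \<alpha> aint ak A1_less Kt W2_law W1e]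
  show "AE \<omega> in M. 0 \<le> W 0 \<omega> $ 1" by (rule pt(1)) measurable
  show "\<exists>K. tail_bd (\<lambda>\<omega>. W 0 \<omega> $ 1) K \<alpha>" by (rule pt(2)) measurable
  show "AE \<omega> in M. 0 \<le> p1 n \<omega>"
  proof (induction n)
    case (Suc n)
    then show ?case using a0[of n] by eventually_elim simp
  qed simp
qed

end

section \<open>Independence, signs and moments of the matrix products\<close>

context triangular_recursion
begin

text \<open>One block {1..h} serves all n up to h, so that these pairs can later be collected into a
  single random element independent of \<open>W 0\<close>.\<close>

lemma Pi_rest_factor:
  assumes "n \<le> h"
  shows "\<exists>\<psi>\<in>measurable (PiM {1..h} (\<lambda>_. borel)) (borel \<Otimes>\<^sub>M borel). \<forall>\<omega>. (Pi n \<omega>, rest n \<omega>) = \<psi> (\<lambda>i\<in>{1..h}. C i \<omega>)"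
  using assms
proof (induction n)
  case 0
  show ?case by (rule bexI[of _ "\<lambda>_. (mat 1, 0)"]) auto
next
  case (Suc n)
  have "\<exists>\<psi>\<in>measurable (PiM {1..h} (\<lambda>_. borel)) (borel \<Otimes>\<^sub>M borel). \<forall>\<omega>. (Pi n \<omega>, rest n \<omega>) = \<psi> (\<lambda>i\<in>{1..h}. C i \<omega>)"
    by (rule Suc.IH[OF Suc_leD[OF Suc.prems]])
  then obtain \<psi> where \<psi>: "\<psi> \<in> measurable (PiM {1..h} (\<lambda>_. borel)) (borel \<Otimes>\<^sub>M borel)"
    and eq: "\<forall>\<omega>. (Pi n \<omega>, rest n \<omega>) = \<psi> (\<lambda>i\<in>{1..h}. C i \<omega>)" by (rule bexE)
  have [measurable]: "(\<lambda>f. fst (\<psi> f)) \<in> measurable (PiM {1..h} (\<lambda>_. borel)) borel" "(\<lambda>f. snd (\<psi> f)) \<in> measurable (PiM {1..h} (\<lambda>_. borel)) borel"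
    using measurable_compose[OF \<psi> measurable_fst] measurable_compose[OF \<psi> measurable_snd] by simp_all
  have [measurable]: "(\<lambda>f. f (Suc n)) \<in> measurable (PiM {1..h} (\<lambda>_. borel :: ((real^2^2) \<times> (real^2)) measure)) borel"
    using Suc.prems by (intro measurable_component_singleton) auto
  show ?case
  proof (rule bexI[of _ "\<lambda>f. (fst (f (Suc n)) ** fst (\<psi> f), fst (f (Suc n)) *v snd (\<psi> f) + snd (f (Suc n)))"])
    show "\<forall>\<omega>. (Pi (Suc n) \<omega>, rest (Suc n) \<omega>) = (fst ((\<lambda>i\<in>{1..h}. C i \<omega>) (Suc n)) ** fst (\<psi> (\<lambda>i\<in>{1..h}. C i \<omega>)),
        fst ((\<lambda>i\<in>{1..h}. C i \<omega>) (Suc n)) *v snd (\<psi> (\<lambda>i\<in>{1..h}. C i \<omega>)) + snd ((\<lambda>i\<in>{1..h}. C i \<omega>) (Suc n)))"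
      unfolding eq[rule_format, symmetric] using Suc.prems by simp
  qed measurable
qed

lemma W0_indep: "indep_pair borel (W 0) (PiM {1..h} (\<lambda>_. borel)) (\<lambda>\<omega>. \<lambda>i\<in>{1..h}. C i \<omega>)"
proof -
  have "indep_pair (PiM {0} (\<lambda>_. borel)) (\<lambda>\<omega>. \<lambda>i\<in>{0}. C i \<omega>) (PiM {1..h} (\<lambda>_. borel)) (\<lambda>\<omega>. \<lambda>i\<in>{1..h}. C i \<omega>)"
    unfolding indep_pair_iff_indep_var by (rule indep_var_restrict[OF ind]) auto
  moreover have "(\<lambda>f. snd (f 0)) \<in> measurable (PiM {0::nat} (\<lambda>_. borel :: ((real^2^2) \<times> (real^2)) measure)) borel"
    by (rule measurable_compose[where f="\<lambda>f. f 0", OF _ snd_borel]) (rule measurable_component_singleton, simp)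
  ultimately have "indep_pair borel (\<lambda>\<omega>. snd ((\<lambda>i\<in>{0}. C i \<omega>) 0)) (PiM {1..h} (\<lambda>_. borel)) (\<lambda>\<omega>. \<lambda>i\<in>{1..h}. C i \<omega>)"
    by (rule indep_pair_compose[where g="\<lambda>x. x"]) simp
  moreover have "(\<lambda>\<omega>. snd ((\<lambda>i\<in>{0}. C i \<omega>) 0)) = W 0" by (simp add: W0 fun_eq_iff)
  ultimately show ?thesis by (simp only:)
qed

lemma W0_indep_Pi: "indep_pair borel (W 0) (borel \<Otimes>\<^sub>M borel) (\<lambda>\<omega>. (Pi n \<omega>, rest n \<omega>))"
proof -
  obtain \<psi> where \<psi>: "\<psi> \<in> measurable (PiM {1..n} (\<lambda>_. borel)) (borel \<Otimes>\<^sub>M borel)"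
    and eq: "\<forall>\<omega>. (Pi n \<omega>, rest n \<omega>) = \<psi> (\<lambda>i\<in>{1..n}. C i \<omega>)" using Pi_rest_factor[of n n] by blast
  have "indep_pair borel (\<lambda>\<omega>. W 0 \<omega>) (borel \<Otimes>\<^sub>M borel) (\<lambda>\<omega>. \<psi> (\<lambda>i\<in>{1..n}. C i \<omega>))"
    by (rule indep_pair_compose[OF W0_indep _ \<psi>, where f="\<lambda>x. x"]) simp
  then show ?thesis by (simp only: eq)
qed

lemma Pim [measurable]: "Pi n \<in> borel_measurable M" and restm [measurable]: "rest n \<in> borel_measurable M"
proof -
  have "(\<lambda>\<omega>. (Pi n \<omega>, rest n \<omega>)) \<in> measurable M (borel \<Otimes>\<^sub>M borel)"
    using W0_indep_Pi[of n] by (simp add: indep_pair_def)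
  from measurable_compose[OF this measurable_fst] measurable_compose[OF this measurable_snd]
  show "Pi n \<in> borel_measurable M" "rest n \<in> borel_measurable M" by simp_all
qed

text \<open>The signs are recorded with the entries because nonnegativity of each contribution to
  \<open>W n\<close> is what makes the main term smaller than \<open>W n\<close> in norm.\<close>

lemma Pi_entries: "AE \<omega> in M. Pi n \<omega> $ 2 $ 1 = 0 \<and> Pi n \<omega> $ 1 $ 1 = p1 n \<omega> \<and> Pi n \<omega> $ 2 $ 2 = p2 n \<omega> \<and>
    0 \<le> p1 n \<omega> \<and> 0 \<le> Pi n \<omega> $ 1 $ 2 \<and> 0 < p2 n \<omega> \<and> 0 \<le> rest n \<omega> $ 1 \<and> 0 \<le> rest n \<omega> $ 2"
proof (induction n)
  case 0
  show ?case by (simp add: mat_def)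
next
  case (Suc n)
  then show ?case
    using entries[of n]
    by eventually_elim (simp add: matrix_matrix_mult_def matrix_vector_mult_def sum_2)
qed

lemma indep_powr_mult:
  assumes [measurable]: "X \<in> borel_measurable M" and X0: "\<And>\<omega>. (0::real) \<le> X \<omega>" and Y0: "\<And>\<omega>. (0::real) \<le> Y \<omega>"
    and ind: "indep_pair borel X borel Y"
    and X: "integrable M (\<lambda>\<omega>. X \<omega> powr \<alpha>)" and Y: "integrable M (\<lambda>\<omega>. Y \<omega> powr \<alpha>)"
  shows "integrable M (\<lambda>\<omega>. (X \<omega> * Y \<omega>) powr \<alpha>)"
proof -
  have "indep_pair borel (\<lambda>\<omega>. X \<omega> powr \<alpha>) borel (\<lambda>\<omega>. Y \<omega> powr \<alpha>)"
    by (rule indep_pair_compose[OF ind, where f="\<lambda>x. x powr \<alpha>" and g="\<lambda>x. x powr \<alpha>"]) measurable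
  then have "integrable M (\<lambda>\<omega>. X \<omega> powr \<alpha> * Y \<omega> powr \<alpha>)"
    unfolding indep_pair_iff_indep_var by (rule indep_var_integrable[OF _ X Y])
  then show ?thesis by (simp add: powr_mult X0 Y0)
qed

lemma A_norm_int': "integrable M (\<lambda>\<omega>. norm (A (Suc n) \<omega>) powr \<alpha>)"
  by (rule integrable_C[where f="\<lambda>c. norm (fst c) powr \<alpha>", OF _ A_norm_int]) measurable

lemma B_norm_int': "integrable M (\<lambda>\<omega>. norm (B (Suc n) \<omega>) powr \<alpha>)"
  by (rule integrable_C[where f="\<lambda>c. norm (snd c) powr \<alpha>", OF _ B_norm_int]) measurable

lemma Pi_norm_int: "integrable M (\<lambda>\<omega>. norm (Pi n \<omega>) powr \<alpha>)"
proof (induction n)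
  case (Suc n)
  have "indep_pair borel (\<lambda>\<omega>. norm (A (Suc n) \<omega>)) borel (\<lambda>\<omega>. norm (Pi n \<omega>))"
    by (rule indep_pair_compose[OF indep_next(6)[OF fst_borel], where f=norm and g=norm]) measurable
  from indep_powr_mult[OF _ _ _ this A_norm_int' Suc.IH]
  have *: "integrable M (\<lambda>\<omega>. (norm (A (Suc n) \<omega>) * norm (Pi n \<omega>)) powr \<alpha>)" by simp
  show ?case
    by (rule Bochner_Integration.integrable_bound[OF *]) (use \<alpha> in \<open>auto intro!: powr_mono2 norm_mult_mat_le\<close>)
qed simp

text \<open>No uniformity in \<open>n\<close> is claimed: E norm (A)^\<alpha> is at least 1. For the
  error estimate \<open>n\<close> stays fixed while x tends to infinity.\<close>

lemma rest_norm_int: "integrable M (\<lambda>\<omega>. norm (rest n \<omega>) powr \<alpha>)"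
proof (induction n)
  case (Suc n)
  have "indep_pair borel (\<lambda>\<omega>. norm (A (Suc n) \<omega>)) borel (\<lambda>\<omega>. norm (rest n \<omega>))"
    by (rule indep_pair_compose[OF indep_next(7)[OF fst_borel], where f=norm and g=norm]) measurable
  from indep_powr_mult[OF _ _ _ this A_norm_int' Suc.IH]
  have *: "integrable M (\<lambda>\<omega>. (norm (A (Suc n) \<omega>) * norm (rest n \<omega>)) powr \<alpha>)" by simp
  show ?case
  proof (rule Bochner_Integration.integrable_bound)
    show "integrable M (\<lambda>\<omega>. 2 powr \<alpha> * ((norm (A (Suc n) \<omega>) * norm (rest n \<omega>)) powr \<alpha> + norm (B (Suc n) \<omega>) powr \<alpha>))"
      using * B_norm_int'[of n] by (intro integrable_mult_right Bochner_Integration.integrable_add)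
    show "AE \<omega> in M. norm (norm (rest (Suc n) \<omega>) powr \<alpha>) \<le> norm (2 powr \<alpha> * ((norm (A (Suc n) \<omega>) * norm (rest n \<omega>)) powr \<alpha> + norm (B (Suc n) \<omega>) powr \<alpha>))"
    proof (rule AE_I2)
      fix \<omega>
      have "norm (rest (Suc n) \<omega>) \<le> norm (A (Suc n) \<omega>) * norm (rest n \<omega>) + norm (B (Suc n) \<omega>)"
        using norm_triangle_ineq[of "A (Suc n) \<omega> *v rest n \<omega>" "B (Suc n) \<omega>"] norm_mult_vec_le[of "A (Suc n) \<omega>" "rest n \<omega>"] by simp
      then have "norm (rest (Suc n) \<omega>) powr \<alpha> \<le> (norm (A (Suc n) \<omega>) * norm (rest n \<omega>) + norm (B (Suc n) \<omega>)) powr \<alpha>"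
        using \<alpha> by (intro powr_mono2) auto
      also have "\<dots> \<le> 2 powr \<alpha> * ((norm (A (Suc n) \<omega>) * norm (rest n \<omega>)) powr \<alpha> + norm (B (Suc n) \<omega>) powr \<alpha>)"
        using \<alpha> by (intro powr_sum_le) auto
      finally show "norm (norm (rest (Suc n) \<omega>) powr \<alpha>) \<le> norm (2 powr \<alpha> * ((norm (A (Suc n) \<omega>) * norm (rest n \<omega>)) powr \<alpha> + norm (B (Suc n) \<omega>) powr \<alpha>))"
        by simp
    qed
  qed measurable
qed simp

lemma p12_meas [measurable]: "p1 n \<in> borel_measurable M" "p2 n \<in> borel_measurable M"
  using indep_next(4)[OF fst_borel, of n] indep_next(5)[OF fst_borel, of n] by (simp_all add: indep_pair_def)

text \<open>Moments multiply along independent factors. The first diagonal entry of the matrix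
  product thus has geometrically decaying \<alpha>-moment, the second one \<alpha>-moment exactly
  1.\<close>

lemma product_moment:
  assumes f [measurable]: "f \<in> borel_measurable borel" and int: "integrable M (\<lambda>\<omega>. f (C 1 \<omega>) powr \<alpha>)"
    and pos: "\<And>n. AE \<omega> in M. 0 < f (C (Suc n) \<omega>)" and p_nn: "\<And>n. AE \<omega> in M. 0 \<le> p n \<omega>"
    and p: "\<And>\<omega>. p 0 \<omega> = 1" "\<And>n \<omega>. p (Suc n) \<omega> = f (C (Suc n) \<omega>) * p n \<omega>"
    and pm [measurable]: "\<And>n. p n \<in> borel_measurable M"
    and ind: "\<And>n. indep_pair borel (\<lambda>\<omega>. f (C (Suc n) \<omega>) powr \<alpha>) borel (p n)"
  shows "integrable M (\<lambda>\<omega>. p n \<omega> powr \<alpha>) \<and> (\<integral>\<omega>. p n \<omega> powr \<alpha> \<partial>M) = (\<integral>\<omega>. f (C 1 \<omega>) powr \<alpha> \<partial>M) ^ n"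
proof (induction n)
  case 0
  show ?case by (simp add: prob_space p)
next
  case (Suc n)
  have a: "integrable M (\<lambda>\<omega>. f (C (Suc n) \<omega>) powr \<alpha>)"
    by (rule integrable_C[where f="\<lambda>c. f c powr \<alpha>", OF _ int]) measurable
  have ak: "(\<integral>\<omega>. f (C (Suc n) \<omega>) powr \<alpha> \<partial>M) = (\<integral>\<omega>. f (C 1 \<omega>) powr \<alpha> \<partial>M)"
    by (rule integral_C[where f="\<lambda>c. f c powr \<alpha>"]) measurable
  have i: "indep_var borel (\<lambda>\<omega>. f (C (Suc n) \<omega>) powr \<alpha>) borel (\<lambda>\<omega>. p n \<omega> powr \<alpha>)"
    using indep_pair_compose[OF ind measurable_ident, of "\<lambda>x. x powr \<alpha>" borel n] by (simp add: indep_pair_iff_indep_var)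
  have e: "AE \<omega> in M. f (C (Suc n) \<omega>) powr \<alpha> * p n \<omega> powr \<alpha> = p (Suc n) \<omega> powr \<alpha>"
    using pos[of n] p_nn[of n] by eventually_elim (simp add: p powr_mult)
  have 1: "integrable M (\<lambda>\<omega>. f (C (Suc n) \<omega>) powr \<alpha> * p n \<omega> powr \<alpha>)"
    using Suc.IH by (intro indep_var_integrable[OF i a]) simp
  have 2: "(\<integral>\<omega>. f (C (Suc n) \<omega>) powr \<alpha> * p n \<omega> powr \<alpha> \<partial>M) = (\<integral>\<omega>. f (C 1 \<omega>) powr \<alpha> \<partial>M) ^ Suc n"
    using Suc.IH by (subst indep_var_lebesgue_integral[OF i a]) (simp_all add: ak)
  have "(\<integral>\<omega>. p (Suc n) \<omega> powr \<alpha> \<partial>M) = (\<integral>\<omega>. f (C (Suc n) \<omega>) powr \<alpha> * p n \<omega> powr \<alpha> \<partial>M)"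
    by (rule integral_cong_AE) (use e Cm[of "Suc n"] in \<open>auto elim: eventually_mono\<close>)
  moreover have "integrable M (\<lambda>\<omega>. p (Suc n) \<omega> powr \<alpha>)"
    by (rule integrable_cong_AE_imp[OF 1]) (use e in \<open>auto elim: eventually_mono\<close>)
  ultimately show ?case using 2 by simp
qed

lemma p1_moment: "integrable M (\<lambda>\<omega>. p1 n \<omega> powr \<alpha>) \<and> (\<integral>\<omega>. p1 n \<omega> powr \<alpha> \<partial>M) = (\<integral>\<omega>. (A 1 \<omega> $ 1 $ 1) powr \<alpha> \<partial>M) ^ n"
proof (rule product_moment[where f="\<lambda>c. fst c $ 1 $ 1", OF _ A1_int' _ p1_pos p1.simps])
  show "indep_pair borel (\<lambda>\<omega>. (A (Suc n) \<omega> $ 1 $ 1) powr \<alpha>) borel (p1 n)" for n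
    by (rule indep_next(4)[where f="\<lambda>c. (fst c $ 1 $ 1) powr \<alpha>"]) measurable
  show "AE \<omega> in M. 0 < A (Suc n) \<omega> $ 1 $ 1" for n using entries[of n] by eventually_elim simp
qed measurable

lemma p2_moment: "integrable M (\<lambda>\<omega>. p2 n \<omega> powr \<alpha>) \<and> (\<integral>\<omega>. p2 n \<omega> powr \<alpha> \<partial>M) = 1"
proof -
  have "integrable M (\<lambda>\<omega>. p2 n \<omega> powr \<alpha>) \<and> (\<integral>\<omega>. p2 n \<omega> powr \<alpha> \<partial>M) = (\<integral>\<omega>. (A 1 \<omega> $ 2 $ 2) powr \<alpha> \<partial>M) ^ n"
  proof (rule product_moment[where f="\<lambda>c. fst c $ 2 $ 2", OF _ A4_int _ _ p2.simps])
    show "indep_pair borel (\<lambda>\<omega>. (A (Suc n) \<omega> $ 2 $ 2) powr \<alpha>) borel (p2 n)" for n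
      by (rule indep_next(5)[where f="\<lambda>c. (fst c $ 2 $ 2) powr \<alpha>"]) measurable
    show "AE \<omega> in M. 0 < A (Suc n) \<omega> $ 2 $ 2" for n using entries[of n] by eventually_elim simp
    show "AE \<omega> in M. 0 \<le> p2 n \<omega>" for n using Pi_entries[of n] by eventually_elim simp
  qed measurable
  then show ?thesis by (simp only: A4_one power_one)
qed

end

section \<open>Regular variation on the plane\<close>

definition pareto :: "real \<Rightarrow> real measure" where
  "pareto \<alpha> = density lborel (\<lambda>y. ennreal (indicator {1<..} y * (\<alpha> * y powr (- \<alpha> - 1))))"

lemma sets_pareto [simp, measurable_cong]: "sets (pareto \<alpha>) = sets borel"
  by (simp add: pareto_def)

lemma space_pareto [simp]: "space (pareto \<alpha>) = UNIV"
  by (simp add: pareto_def)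

context
  fixes \<alpha> :: real
  assumes \<alpha>: "0 < \<alpha>"
begin

lemma emeasure_pareto: "1 \<le> x \<Longrightarrow> emeasure (pareto \<alpha>) {x<..} = ennreal (x powr (- \<alpha>))"
proof -
  assume x: "1 \<le> x"
  have "emeasure (pareto \<alpha>) {x<..} = (\<integral>\<^sup>+y. ennreal (\<alpha> * y powr (- \<alpha> - 1)) * indicator {x<..} y \<partial>lborel)"
    unfolding pareto_def using x by (subst emeasure_density) (auto intro!: nn_integral_cong simp: indicator_def)
  also have "\<dots> = (\<integral>\<^sup>+y. ennreal (\<alpha> * y powr (- \<alpha> - 1)) * indicator {x..} y \<partial>lborel)"
    using AE_lborel_singleton[of x] by (intro nn_integral_cong_AE) (auto elim!: eventually_mono simp: indicator_def)
  also have "\<dots> = ennreal (0 - (- (x powr (- \<alpha>))))"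
  proof (rule nn_integral_FTC_atLeast)
    show "((\<lambda>y. - (y powr (- \<alpha>))) \<longlongrightarrow> 0) at_top"
      using \<alpha> by real_asymp
  qed (use \<alpha> x in \<open>auto intro!: derivative_eq_intros\<close>)
  finally show ?thesis by simp
qed

lemma prob_space_pareto: "prob_space (pareto \<alpha>)"
proof
  have "emeasure (pareto \<alpha>) (space (pareto \<alpha>)) = emeasure (pareto \<alpha>) {1<..}"
    unfolding pareto_def by (subst (1 2) emeasure_density) (auto intro!: nn_integral_cong simp: indicator_def)
  then show "emeasure (pareto \<alpha>) (space (pareto \<alpha>)) = 1" by (simp add: emeasure_pareto)
qed

interpretation P: prob_space "pareto \<alpha>" by (rule prob_space_pareto)

lemma real_distribution_pareto: "real_distribution (pareto \<alpha>)"
  by unfold_locales (simp_all add: pareto_def)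

lemma measure_pareto: "1 \<le> x \<Longrightarrow> measure (pareto \<alpha>) {x<..} = x powr (- \<alpha>)"
  using emeasure_pareto[of x] by (simp add: measure_def)

lemma AE_pareto: "AE y in pareto \<alpha>. 1 < y"
proof -
  have "measure (pareto \<alpha>) {1<..} = 1" by (simp add: measure_pareto)
  then have "AE y in pareto \<alpha>. y \<in> {1<..}" by (intro P.AE_in_set_eq_1[THEN iffD2]) auto
  then show ?thesis by simp
qed

lemma cdf_pareto: "cdf (pareto \<alpha>) y = (if y \<le> 1 then 0 else 1 - y powr (- \<alpha>))"
proof (cases "y \<le> 1")
  case True
  have "AE z in pareto \<alpha>. z \<notin> {..y}" using AE_pareto by eventually_elim (use True in auto)
  then have "measure (pareto \<alpha>) {..y} = 0" by (subst P.prob_eq_0) auto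
  then show ?thesis using True by (simp add: cdf_def)
next
  case False
  have "measure (pareto \<alpha>) (space (pareto \<alpha>) - {y<..}) = 1 - measure (pareto \<alpha>) {y<..}"
    by (rule P.prob_compl) simp
  moreover have "space (pareto \<alpha>) - {y<..} = {..y}" by auto
  ultimately show ?thesis using False by (simp add: cdf_def measure_pareto)
qed

end

lemma (in prob_space) uniform_measure_integral:
  fixes f :: "'a \<Rightarrow> real"
  assumes A [measurable]: "A \<in> events" and pos: "0 < prob A" and f [measurable]: "f \<in> borel_measurable M"
  shows "(\<integral>\<omega>. f \<omega> \<partial>uniform_measure M A) = (\<integral>\<omega>. f \<omega> * indicator A \<omega> \<partial>M) / prob A"
proof -
  have "uniform_measure M A = density M (\<lambda>\<omega>. ennreal (indicator A \<omega> / prob A))"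
    unfolding uniform_measure_def using pos
    by (intro density_cong) (auto simp: indicator_def emeasure_eq_measure divide_ennreal[symmetric] simp flip: ennreal_1)
  then have "(\<integral>\<omega>. f \<omega> \<partial>uniform_measure M A) = (\<integral>\<omega>. (indicator A \<omega> / prob A) * f \<omega> \<partial>M)"
    by (simp add: integral_density)
  also have "\<dots> = (\<integral>\<omega>. (f \<omega> * indicator A \<omega>) / prob A \<partial>M)"
    by (intro Bochner_Integration.integral_cong) auto
  finally show ?thesis by simp
qed

lemma filterlim_mult_pos_at_top: "0 < d \<Longrightarrow> filterlim X at_top F \<Longrightarrow> filterlim (\<lambda>k. d * X k) at_top F" for d :: real
  by (rule filterlim_tendsto_pos_mult_at_top[OF tendsto_const])

text \<open>Given R > \<delta> x, the distribution function of R / (\<delta> x) is expressed by a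
  quotient of tails, hence converges to that of the Pareto law; this is weak convergence. The factor
  c \<delta>^(-\<alpha>) is the limit of x^\<alpha> P(R > \<delta> x).\<close>

lemma (in prob_space) regular_tail_integral:
  fixes R :: "'a \<Rightarrow> real" and g :: "real \<Rightarrow> real"
  assumes R [measurable]: "R \<in> borel_measurable M" and \<alpha>: "0 < \<alpha>" and c: "0 < c"
    and lim: "((\<lambda>x. x powr \<alpha> * prob {\<omega>\<in>space M. x < R \<omega>}) \<longlongrightarrow> c) at_top"
    and g: "continuous_on UNIV g" and B: "\<And>y. \<bar>g y\<bar> \<le> B" and \<delta>: "0 < \<delta>"
  shows "((\<lambda>x. x powr \<alpha> * (\<integral>\<omega>. g (R \<omega> / x) * indicator {\<omega>\<in>space M. \<delta> * x < R \<omega>} \<omega> \<partial>M)) \<longlongrightarrow> c * \<delta> powr (- \<alpha>) * (\<integral>y. g (\<delta> * y) \<partial>pareto \<alpha>)) at_top"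
proof (rule tendsto_at_topI_sequentially)
  fix X :: "nat \<Rightarrow> real" assume X: "filterlim X at_top sequentially"
  have gm [measurable]: "g \<in> borel_measurable borel" using g by (rule borel_measurable_continuous_onI)
  define T where "T x = prob {\<omega>\<in>space M. x < R \<omega>}" for x
  have lim': "((\<lambda>x. x powr \<alpha> * T x) \<longlongrightarrow> c) at_top" using lim by (simp add: T_def)
  have limd: "(\<lambda>k. (d * X k) powr \<alpha> * T (d * X k)) \<longlonglongrightarrow> c" if "0 < d" for d
    by (rule filterlim_compose[OF lim' filterlim_mult_pos_at_top[OF that X]])
  have limd': "(\<lambda>k. X k powr \<alpha> * T (d * X k)) \<longlonglongrightarrow> c * d powr (- \<alpha>)" if "0 < d" for d
  proof (rule Lim_transform_eventually)
    show "(\<lambda>k. (d * X k) powr \<alpha> * T (d * X k) * d powr (- \<alpha>)) \<longlonglongrightarrow> c * d powr (- \<alpha>)"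
      by (intro tendsto_intros limd that)
    have "eventually (\<lambda>k. 0 < X k) sequentially" using X by (simp add: filterlim_at_top_dense)
    then show "eventually (\<lambda>k. (d * X k) powr \<alpha> * T (d * X k) * d powr (- \<alpha>) = X k powr \<alpha> * T (d * X k)) sequentially"
      by eventually_elim (use that in \<open>simp add: powr_mult powr_minus field_simps\<close>)
  qed
  have Tpos: "eventually (\<lambda>k. 0 < T (\<delta> * X k) \<and> 0 < X k) sequentially"
  proof -
    have "eventually (\<lambda>k. 0 < X k powr \<alpha> * T (\<delta> * X k)) sequentially"
      using c \<delta> by (intro order_tendstoD(1)[OF limd'[OF \<delta>]]) auto
    moreover have "eventually (\<lambda>k. 0 < X k) sequentially" using X by (simp add: filterlim_at_top_dense)
    ultimately show ?thesis by eventually_elim (simp add: zero_less_mult_iff)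
  qed
  then obtain N where N: "\<And>k. k \<ge> N \<Longrightarrow> 0 < T (\<delta> * X k) \<and> 0 < X k" by (auto simp: eventually_sequentially)
  \<comment> \<open>Dropping finitely many indices gives every conditioning event positive
    probability.\<close>
  define Y where "Y k = X (k + N)" for k
  have Ypos: "0 < T (\<delta> * Y k)" "0 < Y k" for k using N[of "k + N"] by (auto simp: Y_def)
  define Ak where "Ak k = {\<omega>\<in>space M. \<delta> * Y k < R \<omega>}" for k
  have Akm [measurable]: "Ak k \<in> events" for k unfolding Ak_def by measurable
  have Akp: "prob (Ak k) = T (\<delta> * Y k)" for k by (simp add: Ak_def T_def)
  define \<mu> where "\<mu> k = distr (uniform_measure M (Ak k)) borel (\<lambda>\<omega>. R \<omega> / (\<delta> * Y k))" for k
  have Um [measurable]: "(\<lambda>\<omega>. R \<omega> / (\<delta> * Y k)) \<in> borel_measurable (uniform_measure M (Ak k))" for k by simp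
  have Up: "prob_space (uniform_measure M (Ak k))" for k
    by (rule prob_space_uniform_measure) (use Ypos(1)[of k] in \<open>simp_all add: emeasure_eq_measure Akp ennreal_eq_0_iff not_le\<close>)
  have \<mu>d: "real_distribution (\<mu> k)" for k
    unfolding \<mu>_def by (intro prob_space.real_distribution_distr Up Um)
  have pd: "real_distribution (pareto \<alpha>)" by (rule real_distribution_pareto[OF \<alpha>])
  have cdf: "cdf (\<mu> k) y = (if y \<le> 1 then 0 else 1 - T (y * (\<delta> * Y k)) / T (\<delta> * Y k))" for k y
  proof -
    have "cdf (\<mu> k) y = measure (uniform_measure M (Ak k)) {\<omega>\<in>space M. R \<omega> / (\<delta> * Y k) \<le> y}"
      unfolding cdf_def \<mu>_def by (subst measure_distr) (auto intro!: arg_cong[where f="measure _"])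
    also have "\<dots> = prob (Ak k \<inter> {\<omega>\<in>space M. R \<omega> / (\<delta> * Y k) \<le> y}) / prob (Ak k)"
      by (rule measure_uniform_measure) (use Ypos(1)[of k] in \<open>simp_all add: emeasure_eq_measure Akp ennreal_eq_0_iff not_le\<close>)
    also have "\<dots> = (if y \<le> 1 then 0 else 1 - T (y * (\<delta> * Y k)) / T (\<delta> * Y k))"
    proof (cases "y \<le> 1")
      case True
      have "Ak k \<inter> {\<omega>\<in>space M. R \<omega> / (\<delta> * Y k) \<le> y} = {}"
      proof -
        have "y * (\<delta> * Y k) \<le> 1 * (\<delta> * Y k)" using True Ypos[of k] \<delta> by (intro mult_right_mono) auto
        moreover have "0 < \<delta> * Y k" using Ypos[of k] \<delta> by simp
        ultimately have "\<not> R \<omega> / (\<delta> * Y k) \<le> y" if "\<delta> * Y k < R \<omega>" for \<omega>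
          using that by (simp only: pos_divide_le_eq)
        then show ?thesis by (auto simp only: Ak_def)
      qed
      then show ?thesis using True by simp
    next
      case False
      define D where "D = {\<omega>\<in>space M. y * (\<delta> * Y k) < R \<omega>}"
      have [measurable]: "D \<in> events" unfolding D_def by measurable
      have "1 * (\<delta> * Y k) \<le> y * (\<delta> * Y k)" using False Ypos[of k] \<delta> by (intro mult_right_mono) auto
      then have "D \<subseteq> Ak k" by (auto simp: D_def Ak_def)
      moreover have "Ak k \<inter> {\<omega>\<in>space M. R \<omega> / (\<delta> * Y k) \<le> y} = Ak k - D"
        using Ypos[of k] \<delta> by (auto simp: Ak_def D_def pos_divide_le_eq)
      ultimately have "prob (Ak k \<inter> {\<omega>\<in>space M. R \<omega> / (\<delta> * Y k) \<le> y}) = T (\<delta> * Y k) - T (y * (\<delta> * Y k))"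
        using finite_measure_Diff[of "Ak k" D] by (simp add: Akp) (simp add: D_def T_def)
      then show ?thesis using False Ypos[of k] by (simp add: Akp diff_divide_distrib)
    qed
    finally show ?thesis .
  qed
  have Ylim: "(\<lambda>k. Y k powr \<alpha> * T (d * Y k)) \<longlonglongrightarrow> c * d powr (- \<alpha>)" if "0 < d" for d
    unfolding Y_def by (rule LIMSEQ_ignore_initial_segment[OF limd'[OF that]])
  have wc: "weak_conv_m \<mu> (pareto \<alpha>)"
    unfolding weak_conv_m_def weak_conv_def
  proof (intro allI impI)
    fix y
    show "(\<lambda>k. cdf (\<mu> k) y) \<longlonglongrightarrow> cdf (pareto \<alpha>) y"
    proof (cases "y \<le> 1")
      case True then show ?thesis by (simp add: cdf cdf_pareto[OF \<alpha>])
    next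
      case False
      have "(\<lambda>k. 1 - (Y k powr \<alpha> * T ((y * \<delta>) * Y k)) / (Y k powr \<alpha> * T (\<delta> * Y k))) \<longlonglongrightarrow> 1 - (c * (y * \<delta>) powr (- \<alpha>)) / (c * \<delta> powr (- \<alpha>))"
        using False \<delta> c by (intro tendsto_intros Ylim) auto
      moreover have "(c * (y * \<delta>) powr (- \<alpha>)) / (c * \<delta> powr (- \<alpha>)) = y powr (- \<alpha>)"
        using False \<delta> c by (simp add: powr_mult)
      moreover have "(Y k powr \<alpha> * T ((y * \<delta>) * Y k)) / (Y k powr \<alpha> * T (\<delta> * Y k)) = T (y * (\<delta> * Y k)) / T (\<delta> * Y k)" for k
        using Ypos[of k] by (simp add: mult.assoc)
      ultimately show ?thesis using False by (simp add: cdf cdf_pareto[OF \<alpha>])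
    qed
  qed
  have gc: "isCont (\<lambda>y. g (\<delta> * y)) y" for y
    using g by (intro continuous_on_interior[of UNIV]) (auto intro!: continuous_on_compose2[OF g] continuous_intros)
  have "(\<lambda>k. \<integral>y. g (\<delta> * y) \<partial>\<mu> k) \<longlonglongrightarrow> (\<integral>y. g (\<delta> * y) \<partial>pareto \<alpha>)"
    by (rule weak_conv_imp_integral_bdd_continuous_conv[OF \<mu>d pd wc gc]) (use B in auto)
  moreover have "(\<integral>y. g (\<delta> * y) \<partial>\<mu> k) = (\<integral>\<omega>. g (R \<omega> / Y k) * indicator (Ak k) \<omega> \<partial>M) / T (\<delta> * Y k)" for k
  proof -
    have "(\<integral>y. g (\<delta> * y) \<partial>\<mu> k) = (\<integral>\<omega>. g (\<delta> * (R \<omega> / (\<delta> * Y k))) \<partial>uniform_measure M (Ak k))"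
      unfolding \<mu>_def by (rule integral_distr[OF Um]) measurable
    also have "\<dots> = (\<integral>\<omega>. g (R \<omega> / Y k) \<partial>uniform_measure M (Ak k))" using \<delta> by simp
    also have "\<dots> = (\<integral>\<omega>. g (R \<omega> / Y k) * indicator (Ak k) \<omega> \<partial>M) / prob (Ak k)"
      by (rule uniform_measure_integral) (use Ypos Akp in auto)
    finally show ?thesis by (simp add: Akp)
  qed
  ultimately have "(\<lambda>k. (\<integral>\<omega>. g (R \<omega> / Y k) * indicator (Ak k) \<omega> \<partial>M) / T (\<delta> * Y k)) \<longlonglongrightarrow> (\<integral>y. g (\<delta> * y) \<partial>pareto \<alpha>)" by simp
  from tendsto_mult[OF Ylim[OF \<delta>] this]
  have "(\<lambda>k. Y k powr \<alpha> * (\<integral>\<omega>. g (R \<omega> / Y k) * indicator (Ak k) \<omega> \<partial>M)) \<longlonglongrightarrow> c * \<delta> powr (- \<alpha>) * (\<integral>y. g (\<delta> * y) \<partial>pareto \<alpha>)"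
    using Ypos by (simp add: less_imp_neq[THEN not_sym])
  then have "(\<lambda>k. X (k + N) powr \<alpha> * (\<integral>\<omega>. g (R \<omega> / X (k + N)) * indicator {\<omega>\<in>space M. \<delta> * X (k + N) < R \<omega>} \<omega> \<partial>M)) \<longlonglongrightarrow> c * \<delta> powr (- \<alpha>) * (\<integral>y. g (\<delta> * y) \<partial>pareto \<alpha>)"
    by (simp only: Y_def Ak_def)
  from LIMSEQ_offset[where f="\<lambda>k. X k powr \<alpha> * (\<integral>\<omega>. g (R \<omega> / X k) * indicator {\<omega>\<in>space M. \<delta> * X k < R \<omega>} \<omega> \<partial>M)", OF this]
  show "(\<lambda>k. X k powr \<alpha> * (\<integral>\<omega>. g (R \<omega> / X k) * indicator {\<omega>\<in>space M. \<delta> * X k < R \<omega>} \<omega> \<partial>M)) \<longlonglongrightarrow> c * \<delta> powr (- \<alpha>) * (\<integral>y. g (\<delta> * y) \<partial>pareto \<alpha>)" .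
qed

text \<open>Directions in the quadrant are coded by the share s of the first coordinate, so that
  Helly's theorem for laws on the line can be used. The coordinates of (s, 1 - s) sum to 1, so the
  vector never vanishes and the code makes sense, continuously, for every real s.\<close>

definition dir :: "real \<Rightarrow> real^2" where
  "dir s = inverse (norm (vector [s, 1 - s] :: real^2)) *\<^sub>R vector [s, 1 - s]"

lemma vector_dir_nonzero: "(vector [s, 1 - s] :: real^2) \<noteq> 0" for s :: real
  by (auto simp: vec_eq_iff forall_2)

lemma norm_dir [simp]: "norm (dir s) = 1"
  using vector_dir_nonzero[of s] by (simp add: dir_def)

lemma continuous_vector2: "continuous_on UNIV (\<lambda>s. vector [s, 1 - s] :: real^2)"
proof -
  have "(\<lambda>s. vector [s, 1 - s] :: real^2) = (\<lambda>s. s *\<^sub>R axis 1 1 + (1 - s) *\<^sub>R axis 2 1)"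
    by (auto simp: vec_eq_iff forall_2 axis_def)
  then show ?thesis by (simp only:) (intro continuous_intros)
qed

lemma continuous_dir: "continuous_on UNIV dir"
  unfolding dir_def using vector_dir_nonzero by (intro continuous_intros continuous_vector2) auto

lemma dir_quotient:
  assumes "0 \<le> v $ 1" "0 < v $ 2"
  shows "dir (v $ 1 / (v $ 1 + v $ 2)) = inverse (norm v) *\<^sub>R v"
proof -
  define k where "k = inverse (v $ 1 + v $ 2)"
  have k: "0 < k" using assms by (simp add: k_def)
  have "vector [v $ 1 / (v $ 1 + v $ 2), 1 - v $ 1 / (v $ 1 + v $ 2)] = k *\<^sub>R v"
  proof -
    have "v $ 1 + v $ 2 \<noteq> 0" using assms by simp
    then have "1 - v $ 1 / (v $ 1 + v $ 2) = v $ 2 / (v $ 1 + v $ 2)" by (simp add: diff_divide_eq_iff)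
    then show ?thesis by (simp add: vec_eq_iff forall_2 k_def divide_inverse mult.commute)
  qed
  then show ?thesis using k by (simp add: dir_def)
qed

context prob_space
begin

text \<open>For a fixed value u of \<open>v\<close> the limit comes from
  \<open>regular_tail_integral\<close>, and rescaling by norm u contributes the factor norm
  u^\<alpha>. The bound B K norm u^\<alpha> dominates all of these expressions, so integration over
  \<open>v\<close> commutes with the limit.\<close>

lemma breiman:
  fixes R :: "'a \<Rightarrow> real" and v :: "'a \<Rightarrow> real^2" and f :: "real^2 \<Rightarrow> real"
  assumes ind: "indep_pair borel v borel R" and \<alpha>: "0 < \<alpha>" and c: "0 < c"
    and lim: "((\<lambda>x. x powr \<alpha> * prob {\<omega>\<in>space M. x < R \<omega>}) \<longlongrightarrow> c) at_top"
    and R0: "AE \<omega> in M. 0 \<le> R \<omega>" and vint: "integrable M (\<lambda>\<omega>. norm (v \<omega>) powr \<alpha>)"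
    and f: "continuous_on UNIV f" and B: "\<And>w. \<bar>f w\<bar> \<le> B" and f0: "\<And>w. norm w \<le> 1 \<Longrightarrow> f w = 0"
  shows "((\<lambda>x. x powr \<alpha> * (\<integral>\<omega>. f ((R \<omega> / x) *\<^sub>R v \<omega>) \<partial>M)) \<longlongrightarrow>
      c * (\<integral>\<omega>. norm (v \<omega>) powr \<alpha> * (\<integral>y. f (y *\<^sub>R (inverse (norm (v \<omega>)) *\<^sub>R v \<omega>)) \<partial>pareto \<alpha>) \<partial>M)) at_top"
proof -
  have [measurable]: "v \<in> borel_measurable M" "R \<in> borel_measurable M" using ind by (auto simp: indep_pair_def)
  have fm [measurable]: "f \<in> borel_measurable borel" using f by (rule borel_measurable_continuous_onI)
  have B0: "0 \<le> B" using B[of 0] by simp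
  obtain K where K: "tail_bd R K \<alpha>" using tail_bd_of_limit[OF _ lim \<alpha>] by auto
  have pt: "((\<lambda>x. x powr \<alpha> * (\<integral>\<omega>'. f ((R \<omega>' / x) *\<^sub>R u) \<partial>M)) \<longlongrightarrow> c * (norm u powr \<alpha> * (\<integral>y. f (y *\<^sub>R (inverse (norm u) *\<^sub>R u)) \<partial>pareto \<alpha>))) at_top" for u
  proof (cases "u = 0")
    case True then show ?thesis by (simp add: f0)
  next
    case False
    \<comment> \<open>As \<open>f\<close> vanishes on the unit ball, f ((R / x) u) can be nonzero
      only if R norm u > x, that is R > \<delta> x for this \<delta>.\<close>
    define \<delta> where "\<delta> = inverse (norm u)"
    have \<delta>: "0 < \<delta>" using False by (simp add: \<delta>_def)
    have "((\<lambda>x. x powr \<alpha> * (\<integral>\<omega>. f ((R \<omega> / x) *\<^sub>R u) * indicator {\<omega>\<in>space M. \<delta> * x < R \<omega>} \<omega> \<partial>M)) \<longlongrightarrow> c * \<delta> powr (- \<alpha>) * (\<integral>y. f ((\<delta> * y) *\<^sub>R u) \<partial>pareto \<alpha>)) at_top"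
      by (rule regular_tail_integral[OF _ \<alpha> c lim, where g="\<lambda>y. f (y *\<^sub>R u)", OF _ _ B \<delta>])
        (auto intro!: continuous_on_compose2[OF f] continuous_intros)
    moreover have "\<delta> powr (- \<alpha>) = norm u powr \<alpha>" using False by (simp add: \<delta>_def powr_def ln_inverse)
    moreover have "(\<delta> * y) *\<^sub>R u = y *\<^sub>R (inverse (norm u) *\<^sub>R u)" for y by (simp add: \<delta>_def mult.commute)
    moreover have "eventually (\<lambda>x. x powr \<alpha> * (\<integral>\<omega>. f ((R \<omega> / x) *\<^sub>R u) * indicator {\<omega>\<in>space M. \<delta> * x < R \<omega>} \<omega> \<partial>M) = x powr \<alpha> * (\<integral>\<omega>'. f ((R \<omega>' / x) *\<^sub>R u) \<partial>M)) at_top"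
      using eventually_gt_at_top[of 0]
    proof eventually_elim
      case (elim x)
      have "(\<integral>\<omega>. f ((R \<omega> / x) *\<^sub>R u) * indicator {\<omega>\<in>space M. \<delta> * x < R \<omega>} \<omega> \<partial>M) = (\<integral>\<omega>'. f ((R \<omega>' / x) *\<^sub>R u) \<partial>M)"
      proof (rule integral_cong_AE)
        show "AE \<omega> in M. f ((R \<omega> / x) *\<^sub>R u) * indicator {\<omega>\<in>space M. \<delta> * x < R \<omega>} \<omega> = f ((R \<omega> / x) *\<^sub>R u)"
          using R0 AE_space
        proof eventually_elim
          case (elim \<omega>)
          show ?case
          proof (cases "\<delta> * x < R \<omega>")
            case True then show ?thesis using elim by simp
          next
            case f: False
            have "R \<omega> / x * norm u \<le> \<delta> * norm u" using f \<open>0 < x\<close> by (intro mult_right_mono) (auto simp: field_simps)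
            also have "\<dots> = 1" using False by (simp add: \<delta>_def)
            finally have "f ((R \<omega> / x) *\<^sub>R u) = 0" using elim \<open>0 < x\<close> by (intro f0) simp
            then show ?thesis by simp
          qed
        qed
      qed measurable
      then show ?case by simp
    qed
    ultimately show ?thesis by (simp add: Lim_transform_eventually mult.assoc)
  qed
  have bd: "\<bar>x powr \<alpha> * (\<integral>\<omega>'. f ((R \<omega>' / x) *\<^sub>R u) \<partial>M)\<bar> \<le> B * K * norm u powr \<alpha>" if x: "0 < x" for x u
  proof (cases "u = 0")
    case True then show ?thesis by (simp add: f0)
  next
    case False
    have "\<bar>\<integral>\<omega>'. f ((R \<omega>' / x) *\<^sub>R u) \<partial>M\<bar> \<le> (\<integral>\<omega>'. \<bar>f ((R \<omega>' / x) *\<^sub>R u)\<bar> \<partial>M)" by (rule integral_abs_bound)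
    also have "\<dots> \<le> (\<integral>\<omega>'. B * indicator {\<omega>\<in>space M. x / norm u < R \<omega>} \<omega>' \<partial>M)"
    proof (rule integral_mono_AE)
      show "integrable M (\<lambda>\<omega>'. \<bar>f ((R \<omega>' / x) *\<^sub>R u)\<bar>)" by (rule integrable_const_bound[of _ B]) (use B in auto)
      show "integrable M (\<lambda>\<omega>'. B * indicator {\<omega>\<in>space M. x / norm u < R \<omega>} \<omega>')"
        by (intro integrable_mult_right integrable_real_indicator) (auto simp: emeasure_eq_measure)
      show "AE \<omega>' in M. \<bar>f ((R \<omega>' / x) *\<^sub>R u)\<bar> \<le> B * indicator {\<omega>\<in>space M. x / norm u < R \<omega>} \<omega>'"
        using R0 AE_space
      proof eventually_elim
        case (elim \<omega>)
        show ?case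
        proof (cases "x / norm u < R \<omega>")
          case True then show ?thesis using elim B by simp
        next
          case f: False
          have "norm ((R \<omega> / x) *\<^sub>R u) \<le> 1" using f x False elim by (simp add: field_simps not_less)
          then show ?thesis using f f0 B0 by simp
        qed
      qed
    qed
    also have "\<dots> = B * prob {\<omega>\<in>space M. x / norm u < R \<omega>}" by simp
    also have "\<dots> \<le> B * (K * (x / norm u) powr (- \<alpha>))"
      using x False B0 by (intro mult_left_mono tail_bdD[OF K]) auto
    finally have "x powr \<alpha> * \<bar>\<integral>\<omega>'. f ((R \<omega>' / x) *\<^sub>R u) \<partial>M\<bar> \<le> x powr \<alpha> * (B * (K * (x / norm u) powr (- \<alpha>)))"
      by (intro mult_left_mono) auto
    also have "\<dots> = B * K * norm u powr \<alpha>"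
      using x False by (simp add: powr_divide powr_minus_divide)
    finally show ?thesis by (simp add: abs_mult)
  qed
  have eq: "x powr \<alpha> * (\<integral>\<omega>. f ((R \<omega> / x) *\<^sub>R v \<omega>) \<partial>M) = (\<integral>\<omega>. x powr \<alpha> * (\<integral>\<omega>'. f ((R \<omega>' / x) *\<^sub>R v \<omega>) \<partial>M) \<partial>M)" for x
    using indep_integral[OF ind, of "\<lambda>z. f ((snd z / x) *\<^sub>R fst z)" B] B by simp
  have m1: "(\<lambda>\<omega>. x powr \<alpha> * (\<integral>\<omega>'. f ((R \<omega>' / x) *\<^sub>R v \<omega>) \<partial>M)) \<in> borel_measurable M" for x
    by measurable
  interpret P: prob_space "pareto \<alpha>" by (rule prob_space_pareto[OF \<alpha>])
  have m2: "(\<lambda>\<omega>. c * (norm (v \<omega>) powr \<alpha> * (\<integral>y. f (y *\<^sub>R (inverse (norm (v \<omega>)) *\<^sub>R v \<omega>)) \<partial>pareto \<alpha>))) \<in> borel_measurable M"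
    by measurable
  have "((\<lambda>x. \<integral>\<omega>. x powr \<alpha> * (\<integral>\<omega>'. f ((R \<omega>' / x) *\<^sub>R v \<omega>) \<partial>M) \<partial>M) \<longlongrightarrow>
      (\<integral>\<omega>. c * (norm (v \<omega>) powr \<alpha> * (\<integral>y. f (y *\<^sub>R (inverse (norm (v \<omega>)) *\<^sub>R v \<omega>)) \<partial>pareto \<alpha>)) \<partial>M)) at_top"
  proof (rule integral_dominated_convergence_at_top[OF m2 m1, where w="\<lambda>\<omega>. B * K * norm (v \<omega>) powr \<alpha>"])
    show "integrable M (\<lambda>\<omega>. B * K * norm (v \<omega>) powr \<alpha>)" using vint by simp
    show "eventually (\<lambda>x. AE \<omega> in M. norm (x powr \<alpha> * (\<integral>\<omega>'. f ((R \<omega>' / x) *\<^sub>R v \<omega>) \<partial>M)) \<le> B * K * norm (v \<omega>) powr \<alpha>) at_top"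
      using eventually_gt_at_top[of 0] by eventually_elim (use bd in auto)
  qed (use pt in auto)
  then show ?thesis unfolding eq by simp
qed

end

text \<open>\<open>V n\<close> is a copy of \<open>W\<close> that equals R times \<open>v n\<close>
  up to the error \<open>E n\<close>. For each \<open>n\<close> Breiman's limit is described by a
  total mass and a tilted law of directions; both range over relatively compact sets, so a
  subsequence converges. The law of \<open>V n\<close> does not involve \<open>n\<close>, which lets
  the error bound turn this into convergence in x.\<close>

lemma (in prob_space) spectral_limit:
  fixes W :: "'a \<Rightarrow> real^2" and R :: "'a \<Rightarrow> real" and v V E :: "nat \<Rightarrow> 'a \<Rightarrow> real^2"
  assumes Wm [measurable]: "W \<in> borel_measurable M" and Vm [measurable]: "\<And>n. V n \<in> borel_measurable M" and Em [measurable]: "\<And>n. E n \<in> borel_measurable M"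
    and law: "\<And>n. distr M borel (V n) = distr M borel W"
    and V_eq: "\<And>n. AE \<omega> in M. V n \<omega> = R \<omega> *\<^sub>R v n \<omega> + E n \<omega>"
    and dom: "\<And>n. AE \<omega> in M. norm (R \<omega> *\<^sub>R v n \<omega>) \<le> norm (V n \<omega>)"
    and ind: "\<And>n. indep_pair borel (v n) borel R"
    and v0: "\<And>n. AE \<omega> in M. 0 \<le> v n \<omega> $ 1 \<and> 0 < v n \<omega> $ 2"
    and vint: "\<And>n. integrable M (\<lambda>\<omega>. norm (v n \<omega>) powr \<alpha>)"
    and vge: "\<And>n. 1 \<le> (\<integral>\<omega>. norm (v n \<omega>) powr \<alpha> \<partial>M)"
    and tailW: "tail_bd (\<lambda>\<omega>. norm (W \<omega>)) K \<alpha>"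
    and err: "\<And>n \<epsilon>. 0 < \<epsilon> \<Longrightarrow> eventually (\<lambda>x. x powr \<alpha> * prob {\<omega>\<in>space M. \<epsilon> * x < norm (E n \<omega>)} \<le> D * \<epsilon> powr (- \<alpha>) * \<kappa> ^ n) at_top"
    and \<kappa>: "0 \<le> \<kappa>" "\<kappa> < 1" and \<alpha>: "0 < \<alpha>" and c: "0 < c"
    and lim: "((\<lambda>x. x powr \<alpha> * prob {\<omega>\<in>space M. x < R \<omega>}) \<longlongrightarrow> c) at_top"
    and R0: "AE \<omega> in M. 0 \<le> R \<omega>"
  shows "\<exists>\<sigma> L. 0 < L \<and> prob_space \<sigma> \<and> sets \<sigma> = sets borel \<and> (AE \<theta> in \<sigma>. norm \<theta> = 1) \<and>
    ((\<lambda>x. x powr \<alpha> * prob {\<omega>\<in>space M. x < norm (W \<omega>)}) \<longlongrightarrow> L) at_top \<and>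
    (\<forall>f :: real^2 \<Rightarrow> real. continuous_on UNIV f \<longrightarrow> (\<exists>B. \<forall>w. \<bar>f w\<bar> \<le> B) \<longrightarrow>
      ((\<lambda>x. x powr \<alpha> * (\<integral>\<omega>. f (inverse x *\<^sub>R W \<omega>) * indicator {\<omega>\<in>space M. x < norm (W \<omega>)} \<omega> \<partial>M)) \<longlongrightarrow>
        L * (\<integral>\<theta>. (\<integral>y. f (y *\<^sub>R \<theta>) \<partial>pareto \<alpha>) \<partial>\<sigma>)) at_top)"
proof -
  interpret P: prob_space "pareto \<alpha>" by (rule prob_space_pareto[OF \<alpha>])
  have vm [measurable]: "v n \<in> borel_measurable M" for n using ind[of n] by (simp add: indep_pair_def)
  have Rm [measurable]: "R \<in> borel_measurable M" using ind[of 0] by (simp add: indep_pair_def)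
  have K0: "0 \<le> K" using tailW by (rule tail_bd_nonneg)
  have Wtail: "x powr \<alpha> * prob {\<omega>\<in>space M. t * x < norm (W \<omega>)} \<le> K * t powr (- \<alpha>)" if "0 < x" "0 < t" for x t
  proof -
    have "x powr \<alpha> * prob {\<omega>\<in>space M. t * x < norm (W \<omega>)} \<le> x powr \<alpha> * (K * (t * x) powr (- \<alpha>))"
      using that by (intro mult_left_mono tail_bdD[OF tailW]) auto
    also have "\<dots> = K * t powr (- \<alpha>)" using that by (simp add: powr_mult powr_minus field_simps)
    finally show ?thesis .
  qed
  have Vlaw: "prob {\<omega>\<in>space M. t < norm (V n \<omega>)} = prob {\<omega>\<in>space M. t < norm (W \<omega>)}" for n t
  proof -
    have "prob {\<omega>\<in>space M. t < norm (V n \<omega>)} = measure (distr M borel (V n)) {w. t < norm w}"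
      by (subst measure_distr) (auto intro!: arg_cong[where f=prob])
    also have "\<dots> = prob {\<omega>\<in>space M. t < norm (W \<omega>)}"
      unfolding law by (subst measure_distr) (auto intro!: arg_cong[where f=prob])
    finally show ?thesis .
  qed
  define Kn where "Kn n = (\<integral>\<omega>. norm (v n \<omega>) powr \<alpha> \<partial>M)" for n
  have Kn1: "1 \<le> Kn n" for n using vge by (simp add: Kn_def)
  \<comment> \<open>\<open>q n\<close> codes the direction of \<open>v n\<close> through
    \<open>dir\<close>. \<open>N n\<close> is the law of the code after tilting by norm (v
    n)^\<alpha>, normalised by the mass \<open>Kn n\<close>.\<close>
  define q where "q n \<omega> = v n \<omega> $ 1 / (v n \<omega> $ 1 + v n \<omega> $ 2)" for n \<omega>
  have qm [measurable]: "q n \<in> borel_measurable M" for n unfolding q_def by measurable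
  define Q where "Q n = density M (\<lambda>\<omega>. ennreal (norm (v n \<omega>) powr \<alpha> / Kn n))" for n
  define N where "N n = distr (Q n) borel (q n)" for n
  have Qp: "prob_space (Q n)" for n
  proof
    have "emeasure (Q n) (space (Q n)) = (\<integral>\<^sup>+\<omega>. ennreal (norm (v n \<omega>) powr \<alpha> / Kn n) \<partial>M)"
      by (simp add: Q_def emeasure_density cong: nn_integral_cong)
    also have "\<dots> = ennreal (\<integral>\<omega>. norm (v n \<omega>) powr \<alpha> / Kn n \<partial>M)"
      using Kn1[of n] vint[of n] by (intro nn_integral_eq_integral) auto
    also have "\<dots> = 1" using Kn1[of n] by (simp add: Kn_def[symmetric])
    finally show "emeasure (Q n) (space (Q n)) = 1" .
  qed
  have qQ [measurable]: "q n \<in> borel_measurable (Q n)" for n by (simp add: Q_def)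
  have Nd: "real_distribution (N n)" for n
    unfolding N_def by (intro prob_space.real_distribution_distr Qp qQ)
  define G where "G f s = (\<integral>y. f (y *\<^sub>R dir s) \<partial>pareto \<alpha>)" for f :: "real^2 \<Rightarrow> real" and s
  define \<Lambda> where "\<Lambda> n f = (\<integral>\<omega>. norm (v n \<omega>) powr \<alpha> * (\<integral>y. f (y *\<^sub>R (inverse (norm (v n \<omega>)) *\<^sub>R v n \<omega>)) \<partial>pareto \<alpha>) \<partial>M)" for n and f :: "real^2 \<Rightarrow> real"
  have dirm [measurable]: "dir \<in> borel_measurable borel" using continuous_dir by (rule borel_measurable_continuous_onI)
  have Gm: "G f \<in> borel_measurable borel" if [measurable]: "f \<in> borel_measurable borel" for f
    unfolding G_def by measurable
  have \<Lambda>_eq: "\<Lambda> n f = Kn n * (\<integral>s. G f s \<partial>N n)" if [measurable]: "f \<in> borel_measurable borel" for n f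
  proof -
    note Gm[OF that, measurable]
    have "(\<integral>s. G f s \<partial>N n) = (\<integral>\<omega>. G f (q n \<omega>) \<partial>Q n)"
      unfolding N_def by (rule integral_distr[OF qQ]) measurable
    also have "\<dots> = (\<integral>\<omega>. (norm (v n \<omega>) powr \<alpha> / Kn n) * G f (q n \<omega>) \<partial>M)"
      unfolding Q_def using Kn1[of n] by (subst integral_density) auto
    also have "\<dots> = (\<integral>\<omega>. (norm (v n \<omega>) powr \<alpha> * G f (q n \<omega>)) / Kn n \<partial>M)" by simp
    also have "\<dots> = (\<integral>\<omega>. norm (v n \<omega>) powr \<alpha> * G f (q n \<omega>) \<partial>M) / Kn n" by (rule integral_divide_zero)
    also have "(\<integral>\<omega>. norm (v n \<omega>) powr \<alpha> * G f (q n \<omega>) \<partial>M) = \<Lambda> n f"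
      unfolding \<Lambda>_def
    proof (rule integral_cong_AE)
      show "AE \<omega> in M. norm (v n \<omega>) powr \<alpha> * G f (q n \<omega>) = norm (v n \<omega>) powr \<alpha> * (\<integral>y. f (y *\<^sub>R (inverse (norm (v n \<omega>)) *\<^sub>R v n \<omega>)) \<partial>pareto \<alpha>)"
        using v0[of n] by eventually_elim (simp add: G_def q_def dir_quotient)
    qed measurable
    finally show ?thesis using Kn1[of n] by simp
  qed
  have step: "((\<lambda>x. x powr \<alpha> * (\<integral>\<omega>. f ((R \<omega> / x) *\<^sub>R v n \<omega>) \<partial>M)) \<longlongrightarrow> c * \<Lambda> n f) at_top"
    if "continuous_on UNIV f" "\<And>w. \<bar>f w\<bar> \<le> B" "\<And>w. norm w \<le> 1 \<Longrightarrow> f w = 0" for f n B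
    unfolding \<Lambda>_def by (rule breiman[OF ind \<alpha> c lim R0 vint that])
  \<comment> \<open>A continuous substitute for the indicator of norm w > 1: zero on the unit ball,
    one from radius 1 + \<eta> on. Along a unit vector its Pareto average lies between (1 +
    \<eta>)^(-\<alpha>) and 1.\<close>
  define \<phi> where "\<phi> \<eta> w = max 0 (min 1 ((norm w - 1) / \<eta>))" for \<eta> and w :: "real^2"
  have \<phi>c: "continuous_on UNIV (\<phi> \<eta>)" for \<eta> unfolding \<phi>_def divide_inverse by (intro continuous_intros)
  have \<phi>b: "0 \<le> \<phi> \<eta> w" "\<phi> \<eta> w \<le> 1" for \<eta> w by (auto simp: \<phi>_def)
  have \<phi>0: "\<phi> \<eta> w = 0" if "norm w \<le> 1" "0 < \<eta>" for \<eta> w using that by (auto simp: \<phi>_def divide_nonpos_pos)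
  have \<phi>1: "\<phi> \<eta> w = 1" if "1 + \<eta> \<le> norm w" "0 < \<eta>" for \<eta> w
  proof -
    have "1 \<le> (norm w - 1) / \<eta>" using that by (simp add: le_divide_eq)
    then show ?thesis by (auto simp: \<phi>_def)
  qed
  have \<phi>m [measurable]: "\<phi> \<eta> \<in> borel_measurable borel" for \<eta> using \<phi>c by (rule borel_measurable_continuous_onI)
  have P\<phi>: "(1 + \<eta>) powr (- \<alpha>) \<le> (\<integral>y. \<phi> \<eta> (y *\<^sub>R u) \<partial>pareto \<alpha>)" if \<eta>: "0 < \<eta>" and u: "norm u = 1" for \<eta> u
  proof -
    have "(1 + \<eta>) powr (- \<alpha>) = (\<integral>y. indicator {1 + \<eta><..} y \<partial>pareto \<alpha>)"
      using \<eta> by (simp add: measure_pareto[OF \<alpha>])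
    also have "\<dots> \<le> (\<integral>y. \<phi> \<eta> (y *\<^sub>R u) \<partial>pareto \<alpha>)"
    proof (rule integral_mono)
      show "integrable (pareto \<alpha>) (\<lambda>y. \<phi> \<eta> (y *\<^sub>R u))" by (rule P.integrable_const_bound[of _ 1]) (use \<phi>b in auto)
      show "indicator {1 + \<eta><..} y \<le> \<phi> \<eta> (y *\<^sub>R u)" for y using \<phi>b \<phi>1[of \<eta> "y *\<^sub>R u"] u \<eta> by (auto simp: indicator_def)
    qed (auto intro!: integrable_real_indicator simp: P.emeasure_eq_measure)
    finally show ?thesis .
  qed
  have P\<phi>1: "(\<integral>y. \<phi> \<eta> (y *\<^sub>R u) \<partial>pareto \<alpha>) \<le> 1" for \<eta> u
    by (rule P.integral_le_const) (use \<phi>b in \<open>auto intro!: P.integrable_const_bound[of _ 1]\<close>)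
  \<comment> \<open>Since R times \<open>v n\<close> is dominated by \<open>V n\<close>, Breiman's
    limit for the cutoff is at most the tail constant of \<open>W\<close>. The cutoff reaches 1 only
    at radius 2, which costs the factor 2^\<alpha>. Without such a bound the masses could diverge as
    \<open>n\<close> grows.\<close>
  have Kn_le: "Kn n \<le> K * 2 powr \<alpha> / c" for n
  proof -
    have "c * \<Lambda> n (\<phi> 1) \<le> K"
    proof (rule tendsto_upperbound[OF step[OF \<phi>c, of 1 1 n]])
      show "\<bar>\<phi> 1 w\<bar> \<le> 1" for w using \<phi>b by auto
      show "\<phi> 1 w = 0" if "norm w \<le> 1" for w using \<phi>0[OF that] by simp
      show "eventually (\<lambda>x. x powr \<alpha> * (\<integral>\<omega>. \<phi> 1 ((R \<omega> / x) *\<^sub>R v n \<omega>) \<partial>M) \<le> K) at_top"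
        using eventually_gt_at_top[of 0]
      proof eventually_elim
        case (elim x)
        have "(\<integral>\<omega>. \<phi> 1 ((R \<omega> / x) *\<^sub>R v n \<omega>) \<partial>M) \<le> (\<integral>\<omega>. indicator {\<omega>\<in>space M. x < norm (V n \<omega>)} \<omega> \<partial>M)"
        proof (rule integral_mono_AE)
          show "integrable M (\<lambda>\<omega>. \<phi> 1 ((R \<omega> / x) *\<^sub>R v n \<omega>))" by (rule integrable_const_bound[of _ 1]) (use \<phi>b in auto)
          show "AE \<omega> in M. \<phi> 1 ((R \<omega> / x) *\<^sub>R v n \<omega>) \<le> indicator {\<omega>\<in>space M. x < norm (V n \<omega>)} \<omega>"
            using dom[of n] AE_space
          proof eventually_elim
            case (elim \<omega>)
            show ?case
            proof (cases "x < norm (V n \<omega>)")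
              case True then show ?thesis using elim \<phi>b by auto
            next
              case False
              have "norm ((R \<omega> / x) *\<^sub>R v n \<omega>) = norm (R \<omega> *\<^sub>R v n \<omega>) / x" using \<open>0 < x\<close> by simp
              also have "\<dots> \<le> 1" using elim False \<open>0 < x\<close> by simp
              finally show ?thesis using \<phi>0[of _ 1] by simp
            qed
          qed
        qed (auto intro!: integrable_real_indicator simp: emeasure_eq_measure)
        also have "\<dots> = prob {\<omega>\<in>space M. 1 * x < norm (W \<omega>)}" by (simp add: Vlaw)
        finally have "x powr \<alpha> * (\<integral>\<omega>. \<phi> 1 ((R \<omega> / x) *\<^sub>R v n \<omega>) \<partial>M) \<le> x powr \<alpha> * prob {\<omega>\<in>space M. 1 * x < norm (W \<omega>)}"
          by (rule mult_left_mono) simp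
        also have "\<dots> \<le> K" using Wtail[OF elim, of 1] by simp
        finally show ?case .
      qed
    qed simp
    moreover have "2 powr (- \<alpha>) * Kn n \<le> \<Lambda> n (\<phi> 1)"
    proof -
      interpret Nn: real_distribution "N n" by (rule Nd)
      have "(\<integral>s. 2 powr (- \<alpha>) \<partial>N n) \<le> (\<integral>s. G (\<phi> 1) s \<partial>N n)"
      proof (rule integral_mono)
        show "integrable (N n) (G (\<phi> 1))"
        proof (rule Nn.integrable_const_bound[of _ 1])
          show "AE s in N n. norm (G (\<phi> 1) s) \<le> 1"
            using P\<phi>1 \<phi>b by (auto simp: G_def abs_of_nonneg)
        qed (use Gm[OF \<phi>m] in simp)
        show "2 powr (- \<alpha>) \<le> G (\<phi> 1) s" for s using P\<phi>[of 1 "dir s"] by (simp add: G_def)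
      qed simp
      then have "2 powr (- \<alpha>) \<le> (\<integral>s. G (\<phi> 1) s \<partial>N n)" using Nn.prob_space by simp
      then show ?thesis using Kn1[of n] by (simp add: \<Lambda>_eq mult.commute mult_left_mono)
    qed
    ultimately have "c * (2 powr (- \<alpha>) * Kn n) \<le> K" using c by (meson mult_left_mono less_imp_le order_trans)
    then show ?thesis using c by (simp add: powr_minus field_simps)
  qed
  have tight: "tight N"
    unfolding tight_def
  proof (intro conjI allI impI Nd)
    fix e :: real assume e: "0 < e"
    have "measure (N n) {-1<..2} = 1" for n
    proof -
      have "AE \<omega> in M. 0 < ennreal (norm (v n \<omega>) powr \<alpha> / Kn n) \<longrightarrow> -1 < q n \<omega> \<and> q n \<omega> \<le> 2"
        using v0[of n]
      proof eventually_elim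
        case (elim \<omega>)
        have "0 \<le> q n \<omega>" "q n \<omega> \<le> 1" using elim by (auto simp: q_def divide_le_eq)
        then show ?case by simp
      qed
      then have "AE \<omega> in Q n. -1 < q n \<omega> \<and> q n \<omega> \<le> 2" unfolding Q_def by (subst AE_density) auto
      then have *: "AE s in N n. -1 < s \<and> s \<le> 2" unfolding N_def by (subst AE_distr_iff[OF qQ]) auto
      interpret Nn: real_distribution "N n" by (rule Nd)
      show ?thesis using * by (intro Nn.prob_eq_1[THEN iffD2]) auto
    qed
    then show "\<exists>a b. a < b \<and> (\<forall>n. 1 - e < measure (N n) {a<..b})" using e by (intro exI[of _ "-1"] exI[of _ 2]) auto
  qed
  have "compact {1..K * 2 powr \<alpha> / c}" by simp
  then have "seq_compact {1..K * 2 powr \<alpha> / c}" by (simp add: compact_eq_seq_compact_metric)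
  then obtain Kl r1 where Kl: "Kl \<in> {1..K * 2 powr \<alpha> / c}" and r1: "strict_mono r1" and Kr1: "(Kn \<circ> r1) \<longlonglongrightarrow> Kl"
    by (rule seq_compactE[of _ Kn]) (use Kn1 Kn_le in auto)
  obtain r2 Nlim where r2: "strict_mono r2" and Nl: "real_distribution Nlim" and wc: "weak_conv_m (N \<circ> r1 \<circ> r2) Nlim"
    using tight_imp_convergent_subsubsequence[OF tight r1] by auto
  interpret Nl: real_distribution Nlim by (rule Nl)
  define r where "r = r1 \<circ> r2"
  have r: "strict_mono r" using r1 r2 by (simp add: r_def strict_mono_o)
  have Kr: "(\<lambda>j. Kn (r j)) \<longlonglongrightarrow> Kl" using LIMSEQ_subseq_LIMSEQ[OF Kr1 r2] by (simp add: r_def comp_def)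
  have Gc: "isCont (G f) s" if f: "continuous_on UNIV f" and B: "\<And>w. \<bar>f w\<bar> \<le> B" for f s B
    unfolding continuous_at_sequentially
  proof (intro allI impI)
    fix X :: "nat \<Rightarrow> real" assume X: "X \<longlonglongrightarrow> s"
    have [measurable]: "f \<in> borel_measurable borel" using f by (rule borel_measurable_continuous_onI)
    have dX: "(\<lambda>n. dir (X n)) \<longlonglongrightarrow> dir s"
      by (rule continuous_on_tendsto_compose[OF continuous_dir X]) auto
    show "(G f \<circ> X) \<longlonglongrightarrow> G f s"
      unfolding G_def comp_def
    proof (rule integral_dominated_convergence[where w="\<lambda>_. B"])
      show "AE y in pareto \<alpha>. (\<lambda>n. f (y *\<^sub>R dir (X n))) \<longlonglongrightarrow> f (y *\<^sub>R dir s)"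
        by (intro AE_I2 continuous_on_tendsto_compose[OF f] tendsto_intros dX) auto
    qed (use B in auto)
  qed
  have Gb: "\<bar>G f s\<bar> \<le> B" if "f \<in> borel_measurable borel" and B: "\<And>w. \<bar>f w\<bar> \<le> B" for f s B
  proof -
    have [measurable]: "f \<in> borel_measurable borel" by fact
    have i: "integrable (pareto \<alpha>) (\<lambda>y. f (y *\<^sub>R dir s))" by (rule P.integrable_const_bound[of _ B]) (use B in auto)
    have "(\<integral>y. f (y *\<^sub>R dir s) \<partial>pareto \<alpha>) \<le> B" by (rule P.integral_le_const[OF i]) (use B in \<open>auto simp: abs_le_iff\<close>)
    moreover have "- B \<le> (\<integral>y. f (y *\<^sub>R dir s) \<partial>pareto \<alpha>)" by (rule P.integral_ge_const[OF i]) (use B in \<open>auto simp: abs_le_iff minus_le_iff\<close>)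
    ultimately show ?thesis by (simp add: G_def)
  qed
  \<comment> \<open>Every \<open>Kn n\<close> is at least 1, hence so is \<open>Kl\<close>: no mass
    is lost along the subsequence and \<open>L\<close> is positive.\<close>
  define L where "L = c * Kl"
  have L: "0 < L" using c Kl by (simp add: L_def)
  define \<Gamma> where "\<Gamma> f = (\<integral>s. G f s \<partial>Nlim)" for f
  have \<Lambda>lim: "(\<lambda>j. c * \<Lambda> (r j) f) \<longlonglongrightarrow> L * \<Gamma> f" if f: "continuous_on UNIV f" and B: "\<And>w. \<bar>f w\<bar> \<le> B" for f B
  proof -
    have fm: "f \<in> borel_measurable borel" using f by (rule borel_measurable_continuous_onI)
    have "(\<lambda>j. \<integral>s. G f s \<partial>(N \<circ> r1 \<circ> r2) j) \<longlonglongrightarrow> (\<integral>s. G f s \<partial>Nlim)"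
      by (rule weak_conv_imp_integral_bdd_continuous_conv[OF _ Nl wc Gc[OF f B]]) (use Nd Gb[OF fm B] in auto)
    then have "(\<lambda>j. \<integral>s. G f s \<partial>N (r j)) \<longlonglongrightarrow> \<Gamma> f" by (simp add: r_def \<Gamma>_def comp_def)
    then have "(\<lambda>j. c * (Kn (r j) * (\<integral>s. G f s \<partial>N (r j)))) \<longlonglongrightarrow> c * (Kl * \<Gamma> f)"
      by (intro tendsto_intros Kr)
    then show ?thesis by (simp add: \<Lambda>_eq[OF fm] L_def mult.assoc)
  qed
  \<comment> \<open>The integrands can differ only where norm (V n) > x. There the difference is
    small by uniform continuity, apart from values beyond t x and errors above \<epsilon> x. Each of
    the three contributions receives a third of \<open>e\<close>, and only the last one requires
    \<open>n\<close> to be large.\<close>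
  have approx: "\<exists>n0. \<forall>n\<ge>n0. eventually (\<lambda>x. \<bar>x powr \<alpha> * (\<integral>\<omega>. f (inverse x *\<^sub>R W \<omega>) \<partial>M) - x powr \<alpha> * (\<integral>\<omega>. f ((R \<omega> / x) *\<^sub>R v n \<omega>) \<partial>M)\<bar> \<le> e) at_top"
    if f: "continuous_on UNIV f" and B: "\<And>w. \<bar>f w\<bar> \<le> B" and f0: "\<And>w. norm w \<le> 1 \<Longrightarrow> f w = 0" and e: "0 < e" for f B e
  proof -
    have fm [measurable]: "f \<in> borel_measurable borel" using f by (rule borel_measurable_continuous_onI)
    have B0: "0 \<le> B" using B[of 0] by simp
    define \<epsilon>1 where "\<epsilon>1 = e / (3 * (K + 1))"
    have \<epsilon>1: "0 < \<epsilon>1" "\<epsilon>1 * K \<le> e / 3" using K0 e by (auto simp: \<epsilon>1_def field_simps)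
    have "((\<lambda>t. 2 * B * (K * t powr (- \<alpha>))) \<longlongrightarrow> 2 * B * (K * 0)) at_top"
      using \<alpha> by (intro tendsto_intros tendsto_neg_powr filterlim_ident) auto
    then have "eventually (\<lambda>t. 2 * B * (K * t powr (- \<alpha>)) < e / 3 \<and> 0 < t) at_top"
      using e by (intro eventually_conj eventually_gt_at_top order_tendstoD(2)) auto
    then obtain t where t: "0 < t" "2 * B * (K * t powr (- \<alpha>)) < e / 3"
      using eventually_happens'[OF trivial_limit_at_top_linorder] by blast
    have "uniformly_continuous_on (cball 0 t) f"
      by (rule compact_uniformly_continuous) (auto intro: continuous_on_subset[OF f])
    then obtain d where d: "0 < d" "\<And>w w'. w \<in> cball 0 t \<Longrightarrow> w' \<in> cball 0 t \<Longrightarrow> dist w' w < d \<Longrightarrow> dist (f w') (f w) < \<epsilon>1"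
      unfolding uniformly_continuous_on_def using \<epsilon>1(1) by metis
    define \<epsilon> where "\<epsilon> = d / 2"
    have \<epsilon>: "0 < \<epsilon>" "\<epsilon> < d" using d by (auto simp: \<epsilon>_def)
    have "(\<lambda>n. 2 * B * (D * \<epsilon> powr (- \<alpha>) * \<kappa> ^ n)) \<longlonglongrightarrow> 2 * B * (D * \<epsilon> powr (- \<alpha>) * 0)"
      using \<kappa> by (intro tendsto_intros LIMSEQ_realpow_zero) auto
    then have "eventually (\<lambda>n. 2 * B * (D * \<epsilon> powr (- \<alpha>) * \<kappa> ^ n) < e / 3) sequentially"
      using e by (intro order_tendstoD(2)) auto
    then obtain n0 where n0: "\<And>n. n \<ge> n0 \<Longrightarrow> 2 * B * (D * \<epsilon> powr (- \<alpha>) * \<kappa> ^ n) < e / 3" by (auto simp: eventually_sequentially)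
    show ?thesis
    proof (intro exI allI impI)
      fix n assume n: "n0 \<le> n"
      show "eventually (\<lambda>x. \<bar>x powr \<alpha> * (\<integral>\<omega>. f (inverse x *\<^sub>R W \<omega>) \<partial>M) - x powr \<alpha> * (\<integral>\<omega>. f ((R \<omega> / x) *\<^sub>R v n \<omega>) \<partial>M)\<bar> \<le> e) at_top"
        using err[OF \<epsilon>(1), of n] eventually_gt_at_top[of 0]
      proof eventually_elim
        case (elim x)
        define A1 where "A1 = {\<omega>\<in>space M. x < norm (V n \<omega>)}"
        define A2 where "A2 = {\<omega>\<in>space M. t * x < norm (V n \<omega>)}"
        define A3 where "A3 = {\<omega>\<in>space M. \<epsilon> * x < norm (E n \<omega>)}"
        have [measurable]: "A1 \<in> events" "A2 \<in> events" "A3 \<in> events" unfolding A1_def A2_def A3_def by measurable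
        have fi: "integrable M (\<lambda>\<omega>. f (h \<omega>))" if [measurable]: "h \<in> borel_measurable M" for h
          by (rule integrable_const_bound[of _ B]) (use B in auto)
        have WV: "(\<integral>\<omega>. f (inverse x *\<^sub>R W \<omega>) \<partial>M) = (\<integral>\<omega>. f (inverse x *\<^sub>R V n \<omega>) \<partial>M)"
          using integral_distr[OF Wm, of "\<lambda>w. f (inverse x *\<^sub>R w)"] integral_distr[OF Vm[of n], of "\<lambda>w. f (inverse x *\<^sub>R w)"] law[of n] by simp
        have "\<bar>(\<integral>\<omega>. f (inverse x *\<^sub>R V n \<omega>) \<partial>M) - (\<integral>\<omega>. f ((R \<omega> / x) *\<^sub>R v n \<omega>) \<partial>M)\<bar>
            = \<bar>\<integral>\<omega>. f (inverse x *\<^sub>R V n \<omega>) - f ((R \<omega> / x) *\<^sub>R v n \<omega>) \<partial>M\<bar>"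
          by (subst Bochner_Integration.integral_diff) (auto intro!: fi)
        also have "\<dots> \<le> (\<integral>\<omega>. \<bar>f (inverse x *\<^sub>R V n \<omega>) - f ((R \<omega> / x) *\<^sub>R v n \<omega>)\<bar> \<partial>M)" by (rule integral_abs_bound)
        also have "\<dots> \<le> (\<integral>\<omega>. \<epsilon>1 * indicator A1 \<omega> + (2 * B * indicator A2 \<omega> + 2 * B * indicator A3 \<omega>) \<partial>M)"
        proof (rule integral_mono_AE)
          show "AE \<omega> in M. \<bar>f (inverse x *\<^sub>R V n \<omega>) - f ((R \<omega> / x) *\<^sub>R v n \<omega>)\<bar> \<le> \<epsilon>1 * indicator A1 \<omega> + (2 * B * indicator A2 \<omega> + 2 * B * indicator A3 \<omega>)"
            using dom[of n] V_eq[of n] AE_space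
          proof eventually_elim
            case (elim \<omega>)
            define w where "w = inverse x *\<^sub>R V n \<omega>"
            define u where "u = (R \<omega> / x) *\<^sub>R v n \<omega>"
            have nw: "norm w = norm (V n \<omega>) / x" using \<open>0 < x\<close> by (simp add: w_def divide_inverse mult.commute)
            have nu: "norm u = norm (R \<omega> *\<^sub>R v n \<omega>) / x" using \<open>0 < x\<close> by (simp add: u_def)
            have uw: "norm u \<le> norm w" using elim \<open>0 < x\<close> by (simp only: nu nw) (rule divide_right_mono, auto)
            have bd: "\<bar>f w - f u\<bar> \<le> 2 * B" using B[of w] B[of u] by linarith
            have diff: "w - u = inverse x *\<^sub>R E n \<omega>" using elim by (simp add: w_def u_def scaleR_add_right divide_inverse mult.commute)
            consider "\<omega> \<notin> A1" | "\<omega> \<in> A2 \<or> \<omega> \<in> A3" | "\<omega> \<in> A1" "\<omega> \<notin> A2" "\<omega> \<notin> A3" by blast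
            then have "\<bar>f w - f u\<bar> \<le> \<epsilon>1 * indicator A1 \<omega> + (2 * B * indicator A2 \<omega> + 2 * B * indicator A3 \<omega>)"
            proof cases
              case 1
              then have "norm w \<le> 1" using elim \<open>0 < x\<close> by (simp add: nw A1_def)
              then have "f w = 0" "f u = 0" using f0 uw by auto
              then show ?thesis using \<epsilon>1 B0 by simp
            next
              case 2
              then show ?thesis using bd \<epsilon>1 B0 by (auto simp: indicator_def)
            next
              case 3
              then have "norm w \<le> t" using elim \<open>0 < x\<close> by (simp add: nw A2_def divide_le_eq)
              moreover have "norm (w - u) \<le> \<epsilon>"
              proof -
                have "norm (w - u) = norm (E n \<omega>) / x" using \<open>0 < x\<close> by (simp add: diff divide_inverse mult.commute)
                moreover have "norm (E n \<omega>) \<le> \<epsilon> * x" using 3 elim by (simp add: A3_def)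
                ultimately show ?thesis using \<open>0 < x\<close> by (simp only: pos_divide_le_eq)
              qed
              ultimately have "dist (f w) (f u) < \<epsilon>1"
                using uw \<epsilon> by (intro d(2)) (auto simp: dist_norm)
              then show ?thesis using 3 by (simp add: dist_real_def)
            qed
            then show ?case by (simp add: w_def u_def)
          qed
        qed (auto intro!: Bochner_Integration.integrable_diff integrable_abs fi Bochner_Integration.integrable_add integrable_mult_right integrable_real_indicator simp: emeasure_eq_measure)
        also have "\<dots> = \<epsilon>1 * prob A1 + (2 * B * prob A2 + 2 * B * prob A3)"
          by (subst Bochner_Integration.integral_add, (auto intro!: Bochner_Integration.integrable_add integrable_mult_right integrable_real_indicator simp: emeasure_eq_measure)[2])+ simp
        finally have 1: "\<bar>(\<integral>\<omega>. f (inverse x *\<^sub>R V n \<omega>) \<partial>M) - (\<integral>\<omega>. f ((R \<omega> / x) *\<^sub>R v n \<omega>) \<partial>M)\<bar> \<le> \<epsilon>1 * prob A1 + (2 * B * prob A2 + 2 * B * prob A3)" .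
        have "\<bar>x powr \<alpha> * (\<integral>\<omega>. f (inverse x *\<^sub>R W \<omega>) \<partial>M) - x powr \<alpha> * (\<integral>\<omega>. f ((R \<omega> / x) *\<^sub>R v n \<omega>) \<partial>M)\<bar>
            = x powr \<alpha> * \<bar>(\<integral>\<omega>. f (inverse x *\<^sub>R V n \<omega>) \<partial>M) - (\<integral>\<omega>. f ((R \<omega> / x) *\<^sub>R v n \<omega>) \<partial>M)\<bar>"
          by (simp add: WV abs_mult right_diff_distrib[symmetric])
        also have "\<dots> \<le> x powr \<alpha> * (\<epsilon>1 * prob A1 + (2 * B * prob A2 + 2 * B * prob A3))"
          by (intro mult_left_mono 1) simp
        also have "\<dots> = \<epsilon>1 * (x powr \<alpha> * prob A1) + (2 * B * (x powr \<alpha> * prob A2) + 2 * B * (x powr \<alpha> * prob A3))"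
          by (simp add: algebra_simps)
        also have "\<dots> \<le> \<epsilon>1 * K + (2 * B * (K * t powr (- \<alpha>)) + 2 * B * (D * \<epsilon> powr (- \<alpha>) * \<kappa> ^ n))"
          using Wtail[of x 1] Wtail[of x t] elim t \<epsilon>1 B0
          by (intro add_mono mult_left_mono) (auto simp: A1_def A2_def A3_def Vlaw)
        also have "\<dots> \<le> e" using \<epsilon>1 t n0[OF n] by linarith
        finally show ?case .
      qed
    qed
  qed
  \<comment> \<open>For a given accuracy one large index of the subsequence suffices. The expression
    in x does not involve that index, so its limit in x holds without restriction.\<close>
  have main: "((\<lambda>x. x powr \<alpha> * (\<integral>\<omega>. f (inverse x *\<^sub>R W \<omega>) \<partial>M)) \<longlongrightarrow> L * \<Gamma> f) at_top"
    if f: "continuous_on UNIV f" and B: "\<And>w. \<bar>f w\<bar> \<le> B" and f0: "\<And>w. norm w \<le> 1 \<Longrightarrow> f w = 0" for f B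
  proof (rule tendstoI)
    fix e :: real assume e: "0 < e"
    obtain n0 where n0: "\<And>n. n \<ge> n0 \<Longrightarrow> eventually (\<lambda>x. \<bar>x powr \<alpha> * (\<integral>\<omega>. f (inverse x *\<^sub>R W \<omega>) \<partial>M) - x powr \<alpha> * (\<integral>\<omega>. f ((R \<omega> / x) *\<^sub>R v n \<omega>) \<partial>M)\<bar> \<le> e / 4) at_top"
      using approx[OF f B f0, of "e / 4"] e by auto
    have "eventually (\<lambda>j. dist (c * \<Lambda> (r j) f) (L * \<Gamma> f) < e / 4) sequentially"
      using e by (intro tendstoD \<Lambda>lim[OF f B]) auto
    then have "eventually (\<lambda>j. dist (c * \<Lambda> (r j) f) (L * \<Gamma> f) < e / 4 \<and> n0 \<le> j) sequentially"
      using eventually_ge_at_top[of n0] by eventually_elim auto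
    then obtain j where j: "dist (c * \<Lambda> (r j) f) (L * \<Gamma> f) < e / 4" "n0 \<le> j"
      using eventually_happens'[OF sequentially_bot] by blast
    have "n0 \<le> r j" using j(2) seq_suble[OF r, of j] by simp
    note * = n0[OF this]
    have "((\<lambda>x. x powr \<alpha> * (\<integral>\<omega>. f ((R \<omega> / x) *\<^sub>R v (r j) \<omega>) \<partial>M)) \<longlongrightarrow> c * \<Lambda> (r j) f) at_top"
      by (rule step[OF f B f0])
    then have "eventually (\<lambda>x. dist (x powr \<alpha> * (\<integral>\<omega>. f ((R \<omega> / x) *\<^sub>R v (r j) \<omega>) \<partial>M)) (c * \<Lambda> (r j) f) < e / 4) at_top"
      using e by (intro tendstoD) auto
    with *
    show "eventually (\<lambda>x. dist (x powr \<alpha> * (\<integral>\<omega>. f (inverse x *\<^sub>R W \<omega>) \<partial>M)) (L * \<Gamma> f) < e) at_top"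
    proof eventually_elim
      case (elim x)
      then show ?case using j e unfolding dist_real_def by linarith
    qed
  qed
  have \<Gamma>\<phi>: "(1 + \<eta>) powr (- \<alpha>) \<le> \<Gamma> (\<phi> \<eta>)" "\<Gamma> (\<phi> \<eta>) \<le> 1" if \<eta>: "0 < \<eta>" for \<eta>
  proof -
    have i: "integrable Nlim (G (\<phi> \<eta>))"
    proof (rule Nl.integrable_const_bound[of _ 1])
      show "AE s in Nlim. norm (G (\<phi> \<eta>) s) \<le> 1" using Gb[OF \<phi>m, of \<eta> 1] \<phi>b by auto
    qed (use Gm[OF \<phi>m] in simp)
    show "(1 + \<eta>) powr (- \<alpha>) \<le> \<Gamma> (\<phi> \<eta>)" unfolding \<Gamma>_def
      by (rule Nl.integral_ge_const[OF i]) (use P\<phi>[OF \<eta>] in \<open>auto simp: G_def\<close>)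
    show "\<Gamma> (\<phi> \<eta>) \<le> 1" unfolding \<Gamma>_def
      by (rule Nl.integral_le_const[OF i]) (use P\<phi>1 in \<open>auto simp: G_def\<close>)
  qed
  define T where "T x = x powr \<alpha> * prob {\<omega>\<in>space M. x < norm (W \<omega>)}" for x
  have \<phi>main: "((\<lambda>x. x powr \<alpha> * (\<integral>\<omega>. \<phi> \<eta> (inverse x *\<^sub>R W \<omega>) \<partial>M)) \<longlongrightarrow> L * \<Gamma> (\<phi> \<eta>)) at_top" if "0 < \<eta>" for \<eta>
    by (rule main[OF \<phi>c, of _ 1]) (use \<phi>b \<phi>0 that in auto)
  have indi: "integrable M (indicator A :: 'a \<Rightarrow> real)" if "A \<in> events" for A
    using that by (auto intro!: integrable_real_indicator simp: emeasure_eq_measure)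
  have \<phi>i: "integrable M (\<lambda>\<omega>. \<phi> \<eta> (inverse x *\<^sub>R W \<omega>))" for \<eta> x
    by (rule integrable_const_bound[of _ 1]) (use \<phi>b in auto)
  have nW: "norm (inverse x *\<^sub>R w) = norm w / x" if "0 < x" for x and w :: "real^2"
    using that by (simp add: divide_inverse mult.commute)
  have T_ge: "x powr \<alpha> * (\<integral>\<omega>. \<phi> \<eta> (inverse x *\<^sub>R W \<omega>) \<partial>M) \<le> T x" if "0 < x" "0 < \<eta>" for x \<eta>
  proof -
    have "(\<integral>\<omega>. \<phi> \<eta> (inverse x *\<^sub>R W \<omega>) \<partial>M) \<le> (\<integral>\<omega>. indicator {\<omega>\<in>space M. x < norm (W \<omega>)} \<omega> \<partial>M)"
    proof (rule integral_mono[OF \<phi>i indi])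
      fix \<omega> assume \<omega>: "\<omega> \<in> space M"
      show "\<phi> \<eta> (inverse x *\<^sub>R W \<omega>) \<le> indicator {\<omega>\<in>space M. x < norm (W \<omega>)} \<omega>"
      proof (cases "x < norm (W \<omega>)")
        case True then show ?thesis using \<omega> \<phi>b by simp
      next
        case False
        then have "norm (inverse x *\<^sub>R W \<omega>) \<le> 1" using that by (simp only: nW) simp
        then show ?thesis using \<phi>0 that by simp
      qed
    qed simp
    then show ?thesis unfolding T_def by (intro mult_left_mono) auto
  qed
  have T_le: "x powr \<alpha> * prob {\<omega>\<in>space M. (1 + \<eta>) * x < norm (W \<omega>)} \<le> x powr \<alpha> * (\<integral>\<omega>. \<phi> \<eta> (inverse x *\<^sub>R W \<omega>) \<partial>M)" if "0 < x" "0 < \<eta>" for x \<eta>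
  proof -
    have "(\<integral>\<omega>. indicator {\<omega>\<in>space M. (1 + \<eta>) * x < norm (W \<omega>)} \<omega> \<partial>M) \<le> (\<integral>\<omega>. \<phi> \<eta> (inverse x *\<^sub>R W \<omega>) \<partial>M)"
    proof (rule integral_mono[OF indi \<phi>i])
      fix \<omega> assume \<omega>: "\<omega> \<in> space M"
      show "indicator {\<omega>\<in>space M. (1 + \<eta>) * x < norm (W \<omega>)} \<omega> \<le> \<phi> \<eta> (inverse x *\<^sub>R W \<omega>)"
      proof (cases "(1 + \<eta>) * x < norm (W \<omega>)")
        case True
        then have "1 + \<eta> \<le> norm (inverse x *\<^sub>R W \<omega>)" using that by (simp only: nW) (simp add: le_divide_eq)
        then show ?thesis using \<phi>1 that by (simp add: indicator_def)
      next
        case False then show ?thesis using \<phi>b by (simp add: indicator_def)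
      qed
    qed simp
    then show ?thesis by (intro mult_left_mono) auto
  qed
  have ptend: "((\<lambda>\<eta>. L * (1 + \<eta>) powr p) \<longlongrightarrow> L) (at_right 0)" for p :: real
  proof -
    have "((\<lambda>\<eta>. L * (1 + \<eta>) powr p) \<longlongrightarrow> L * (1 + 0) powr p) (at_right 0)" by (intro tendsto_intros) auto
    then show ?thesis by simp
  qed
  \<comment> \<open>The lower bound uses the cutoff at scale x, the upper bound the cutoff at scale
    x / (1 + \<eta>), whose rescaling costs (1 + \<eta>)^\<alpha>. Both correction factors tend to 1
    with \<eta>.\<close>
  have Tlim: "(T \<longlongrightarrow> L) at_top"
  proof (rule order_tendstoI)
    fix y assume y: "y < L"
    have "eventually (\<lambda>\<eta>. y < L * (1 + \<eta>) powr (- \<alpha>)) (at_right 0)" by (rule order_tendstoD(1)[OF ptend y])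
    then have "eventually (\<lambda>\<eta>. y < L * (1 + \<eta>) powr (- \<alpha>) \<and> 0 < \<eta>) (at_right 0)" using eventually_at_right_less by eventually_elim auto
    then obtain \<eta> where \<eta>: "0 < \<eta>" "y < L * (1 + \<eta>) powr (- \<alpha>)" using eventually_happens'[OF trivial_limit_at_right_real] by blast
    have "y < L * \<Gamma> (\<phi> \<eta>)" using \<eta>(2) \<Gamma>\<phi>(1)[OF \<eta>(1)] L by (meson less_le_trans less_imp_le mult_left_mono)
    then have "eventually (\<lambda>x. y < x powr \<alpha> * (\<integral>\<omega>. \<phi> \<eta> (inverse x *\<^sub>R W \<omega>) \<partial>M)) at_top" by (rule order_tendstoD(1)[OF \<phi>main[OF \<eta>(1)]])
    then show "eventually (\<lambda>x. y < T x) at_top"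
      using eventually_gt_at_top[of 0] by eventually_elim (use T_ge \<eta> in \<open>auto intro: less_le_trans\<close>)
  next
    fix y assume y: "L < y"
    have "eventually (\<lambda>\<eta>. L * (1 + \<eta>) powr \<alpha> < y) (at_right 0)" by (rule order_tendstoD(2)[OF ptend y])
    then have "eventually (\<lambda>\<eta>. L * (1 + \<eta>) powr \<alpha> < y \<and> 0 < \<eta>) (at_right 0)" using eventually_at_right_less by eventually_elim auto
    then obtain \<eta> where \<eta>: "0 < \<eta>" "L * (1 + \<eta>) powr \<alpha> < y" using eventually_happens'[OF trivial_limit_at_right_real] by blast
    have "L * \<Gamma> (\<phi> \<eta>) * (1 + \<eta>) powr \<alpha> \<le> L * 1 * (1 + \<eta>) powr \<alpha>" using \<Gamma>\<phi>(2)[OF \<eta>(1)] L by (intro mult_right_mono mult_left_mono) auto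
    then have "L * \<Gamma> (\<phi> \<eta>) * (1 + \<eta>) powr \<alpha> < y" using \<eta> by simp
    moreover have "filterlim (\<lambda>x. inverse (1 + \<eta>) * x) at_top at_top"
      using \<eta> by (intro filterlim_mult_pos_at_top filterlim_ident) auto
    from filterlim_compose[OF \<phi>main[OF \<eta>(1)] this]
    have "((\<lambda>x. (inverse (1 + \<eta>) * x) powr \<alpha> * (\<integral>\<omega>. \<phi> \<eta> (inverse (inverse (1 + \<eta>) * x) *\<^sub>R W \<omega>) \<partial>M) * (1 + \<eta>) powr \<alpha>) \<longlongrightarrow> L * \<Gamma> (\<phi> \<eta>) * (1 + \<eta>) powr \<alpha>) at_top"
      by (rule tendsto_mult_right)
    ultimately have "eventually (\<lambda>x. (inverse (1 + \<eta>) * x) powr \<alpha> * (\<integral>\<omega>. \<phi> \<eta> (inverse (inverse (1 + \<eta>) * x) *\<^sub>R W \<omega>) \<partial>M) * (1 + \<eta>) powr \<alpha> < y) at_top"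
      by (intro order_tendstoD)
    then show "eventually (\<lambda>x. T x < y) at_top"
      using eventually_gt_at_top[of 0]
    proof eventually_elim
      case (elim x)
      define z where "z = inverse (1 + \<eta>) * x"
      have z: "0 < z" "x = (1 + \<eta>) * z" using elim \<eta> by (auto simp: z_def field_simps)
      have "T x = (1 + \<eta>) powr \<alpha> * (z powr \<alpha> * prob {\<omega>\<in>space M. (1 + \<eta>) * z < norm (W \<omega>)})"
        unfolding T_def using z(1) \<eta> by (simp only: z(2)) (simp add: powr_mult)
      also have "\<dots> \<le> (1 + \<eta>) powr \<alpha> * (z powr \<alpha> * (\<integral>\<omega>. \<phi> \<eta> (inverse z *\<^sub>R W \<omega>) \<partial>M))"
        by (intro mult_left_mono[OF T_le[OF z(1) \<eta>(1)]]) simp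
      also have "\<dots> < y" using elim by (simp add: z_def mult_ac)
      finally show ?case .
    qed
  qed
  define \<sigma> where "\<sigma> = distr Nlim borel dir"
  have dm [measurable]: "dir \<in> borel_measurable Nlim" by simp
  have \<sigma>p: "prob_space \<sigma>" unfolding \<sigma>_def by (rule Nl.prob_space_distr) simp
  have \<sigma>1: "AE \<theta> in \<sigma>. norm \<theta> = 1" unfolding \<sigma>_def by (subst AE_distr_iff) auto
  have \<sigma>int: "(\<integral>\<theta>. (\<integral>y. f (y *\<^sub>R \<theta>) \<partial>pareto \<alpha>) \<partial>\<sigma>) = \<Gamma> f" if [measurable]: "f \<in> borel_measurable borel" for f
    unfolding \<sigma>_def \<Gamma>_def G_def by (rule integral_distr[OF dm]) measurable
  \<comment> \<open>Replacing the indicator by the cutoff costs at most B times the mass between the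
    two. \<open>d1\<close> measures this for finite x, \<open>d2\<close> in the limit, and a small
    \<eta> controls both.\<close>
  have final: "((\<lambda>x. x powr \<alpha> * (\<integral>\<omega>. f (inverse x *\<^sub>R W \<omega>) * indicator {\<omega>\<in>space M. x < norm (W \<omega>)} \<omega> \<partial>M)) \<longlongrightarrow>
        L * (\<integral>\<theta>. (\<integral>y. f (y *\<^sub>R \<theta>) \<partial>pareto \<alpha>) \<partial>\<sigma>)) at_top"
    if f: "continuous_on UNIV f" and B: "\<And>w. \<bar>f w\<bar> \<le> B" for f :: "real^2 \<Rightarrow> real" and B
  proof -
    have fm [measurable]: "f \<in> borel_measurable borel" using f by (rule borel_measurable_continuous_onI)
    have B0: "0 \<le> B" using B[of 0] by simp
    have \<phi>fb: "\<bar>f w * \<phi> \<eta> w\<bar> \<le> B" for \<eta> w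
      using mult_mono[OF B[of w] \<phi>b(2)[of \<eta> w]] \<phi>b(1)[of \<eta> w] B0 by (simp add: abs_mult)
    have l: "((\<lambda>x. x powr \<alpha> * (\<integral>\<omega>. f (inverse x *\<^sub>R W \<omega>) * \<phi> \<eta> (inverse x *\<^sub>R W \<omega>) \<partial>M)) \<longlongrightarrow> L * \<Gamma> (\<lambda>w. f w * \<phi> \<eta> w)) at_top" if "0 < \<eta>" for \<eta>
      by (rule main[OF _ \<phi>fb]) (use \<phi>0 that in \<open>auto intro!: continuous_intros f \<phi>c\<close>)
    have d1: "\<bar>x powr \<alpha> * (\<integral>\<omega>. f (inverse x *\<^sub>R W \<omega>) * indicator {\<omega>\<in>space M. x < norm (W \<omega>)} \<omega> \<partial>M) - x powr \<alpha> * (\<integral>\<omega>. f (inverse x *\<^sub>R W \<omega>) * \<phi> \<eta> (inverse x *\<^sub>R W \<omega>) \<partial>M)\<bar>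
        \<le> B * (T x - x powr \<alpha> * (\<integral>\<omega>. \<phi> \<eta> (inverse x *\<^sub>R W \<omega>) \<partial>M))" if x: "0 < x" and \<eta>: "0 < \<eta>" for x \<eta>
    proof -
      let ?A = "{\<omega>\<in>space M. x < norm (W \<omega>)}"
      have i1: "integrable M (\<lambda>\<omega>. f (inverse x *\<^sub>R W \<omega>) * indicator ?A \<omega>)"
        by (rule integrable_const_bound[of _ B]) (use B B0 in \<open>auto simp: indicator_def\<close>)
      have i2: "integrable M (\<lambda>\<omega>. f (inverse x *\<^sub>R W \<omega>) * \<phi> \<eta> (inverse x *\<^sub>R W \<omega>))"
        by (rule integrable_const_bound[of _ B]) (use \<phi>fb in auto)
      have "\<bar>(\<integral>\<omega>. f (inverse x *\<^sub>R W \<omega>) * indicator ?A \<omega> \<partial>M) - (\<integral>\<omega>. f (inverse x *\<^sub>R W \<omega>) * \<phi> \<eta> (inverse x *\<^sub>R W \<omega>) \<partial>M)\<bar>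
          = \<bar>\<integral>\<omega>. f (inverse x *\<^sub>R W \<omega>) * indicator ?A \<omega> - f (inverse x *\<^sub>R W \<omega>) * \<phi> \<eta> (inverse x *\<^sub>R W \<omega>) \<partial>M\<bar>"
        by (subst Bochner_Integration.integral_diff[OF i1 i2]) simp
      also have "\<dots> \<le> (\<integral>\<omega>. \<bar>f (inverse x *\<^sub>R W \<omega>) * indicator ?A \<omega> - f (inverse x *\<^sub>R W \<omega>) * \<phi> \<eta> (inverse x *\<^sub>R W \<omega>)\<bar> \<partial>M)" by (rule integral_abs_bound)
      also have "\<dots> \<le> (\<integral>\<omega>. B * (indicator ?A \<omega> - \<phi> \<eta> (inverse x *\<^sub>R W \<omega>)) \<partial>M)"
      proof (rule integral_mono)
        fix \<omega> assume \<omega>: "\<omega> \<in> space M"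
        let ?w = "inverse x *\<^sub>R W \<omega>"
        have "\<phi> \<eta> ?w \<le> indicator ?A \<omega>"
        proof (cases "x < norm (W \<omega>)")
          case True then show ?thesis using \<omega> \<phi>b by simp
        next
          case False
          then have "norm ?w \<le> 1" using x by (simp only: nW) simp
          then show ?thesis using \<phi>0 \<eta> by simp
        qed
        then have "\<bar>f ?w\<bar> * (indicator ?A \<omega> - \<phi> \<eta> ?w) \<le> B * (indicator ?A \<omega> - \<phi> \<eta> ?w)" using B by (intro mult_right_mono) auto
        moreover have "\<bar>f ?w * indicator ?A \<omega> - f ?w * \<phi> \<eta> ?w\<bar> = \<bar>f ?w\<bar> * (indicator ?A \<omega> - \<phi> \<eta> ?w)"
          using \<open>\<phi> \<eta> ?w \<le> indicator ?A \<omega>\<close> by (simp add: right_diff_distrib[symmetric] abs_mult)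
        ultimately show "\<bar>f ?w * indicator ?A \<omega> - f ?w * \<phi> \<eta> ?w\<bar> \<le> B * (indicator ?A \<omega> - \<phi> \<eta> ?w)" by simp
      qed (auto intro!: integrable_abs Bochner_Integration.integrable_diff i1 i2 integrable_mult_right indi \<phi>i)
      also have "\<dots> = B * (prob ?A - (\<integral>\<omega>. \<phi> \<eta> (inverse x *\<^sub>R W \<omega>) \<partial>M))"
        by (simp only: integral_mult_right_zero, subst Bochner_Integration.integral_diff[OF indi \<phi>i]) auto
      finally have "x powr \<alpha> * \<bar>(\<integral>\<omega>. f (inverse x *\<^sub>R W \<omega>) * indicator ?A \<omega> \<partial>M) - (\<integral>\<omega>. f (inverse x *\<^sub>R W \<omega>) * \<phi> \<eta> (inverse x *\<^sub>R W \<omega>) \<partial>M)\<bar>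
          \<le> x powr \<alpha> * (B * (prob ?A - (\<integral>\<omega>. \<phi> \<eta> (inverse x *\<^sub>R W \<omega>) \<partial>M)))" by (rule mult_left_mono) simp
      moreover have "x powr \<alpha> * (B * (prob ?A - (\<integral>\<omega>. \<phi> \<eta> (inverse x *\<^sub>R W \<omega>) \<partial>M))) = B * (T x - x powr \<alpha> * (\<integral>\<omega>. \<phi> \<eta> (inverse x *\<^sub>R W \<omega>) \<partial>M))"
        by (simp add: T_def algebra_simps)
      ultimately show ?thesis by (simp add: abs_mult right_diff_distrib[symmetric])
    qed
    have d2: "\<bar>\<Gamma> f - \<Gamma> (\<lambda>w. f w * \<phi> \<eta> w)\<bar> \<le> B * (1 - (1 + \<eta>) powr (- \<alpha>))" if \<eta>: "0 < \<eta>" for \<eta>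
    proof -
      have ff: "(\<lambda>w. f w * \<phi> \<eta> w) \<in> borel_measurable borel" by measurable
      have i1: "integrable Nlim (G f)" by (rule Nl.integrable_const_bound[of _ B]) (use Gb[OF fm B] Gm[OF fm] in auto)
      have i2: "integrable Nlim (G (\<lambda>w. f w * \<phi> \<eta> w))" by (rule Nl.integrable_const_bound[of _ B]) (use Gb[OF ff \<phi>fb] Gm[OF ff] in auto)
      have pt: "\<bar>G f s - G (\<lambda>w. f w * \<phi> \<eta> w) s\<bar> \<le> B * (1 - (1 + \<eta>) powr (- \<alpha>))" for s
      proof -
        have j1: "integrable (pareto \<alpha>) (\<lambda>y. f (y *\<^sub>R dir s))" by (rule P.integrable_const_bound[of _ B]) (use B in auto)
        have j2: "integrable (pareto \<alpha>) (\<lambda>y. f (y *\<^sub>R dir s) * \<phi> \<eta> (y *\<^sub>R dir s))" by (rule P.integrable_const_bound[of _ B]) (use \<phi>fb in auto)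
        have j3: "integrable (pareto \<alpha>) (\<lambda>y. \<phi> \<eta> (y *\<^sub>R dir s))" by (rule P.integrable_const_bound[of _ 1]) (use \<phi>b in auto)
        have "\<bar>G f s - G (\<lambda>w. f w * \<phi> \<eta> w) s\<bar> = \<bar>\<integral>y. f (y *\<^sub>R dir s) - f (y *\<^sub>R dir s) * \<phi> \<eta> (y *\<^sub>R dir s) \<partial>pareto \<alpha>\<bar>"
          unfolding G_def by (subst Bochner_Integration.integral_diff[OF j1 j2]) simp
        also have "\<dots> \<le> (\<integral>y. \<bar>f (y *\<^sub>R dir s) - f (y *\<^sub>R dir s) * \<phi> \<eta> (y *\<^sub>R dir s)\<bar> \<partial>pareto \<alpha>)" by (rule integral_abs_bound)
        also have "\<dots> \<le> (\<integral>y. B * (1 - \<phi> \<eta> (y *\<^sub>R dir s)) \<partial>pareto \<alpha>)"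
        proof (rule integral_mono)
          fix y
          let ?w = "y *\<^sub>R dir s"
          have "\<bar>f ?w - f ?w * \<phi> \<eta> ?w\<bar> = \<bar>f ?w * (1 - \<phi> \<eta> ?w)\<bar>" by (simp add: algebra_simps)
          also have "\<dots> = \<bar>f ?w\<bar> * (1 - \<phi> \<eta> ?w)" using \<phi>b by (simp add: abs_mult)
          also have "\<dots> \<le> B * (1 - \<phi> \<eta> ?w)" using \<phi>b B by (intro mult_right_mono) auto
          finally show "\<bar>f ?w - f ?w * \<phi> \<eta> ?w\<bar> \<le> B * (1 - \<phi> \<eta> ?w)" .
        qed (auto intro!: integrable_abs Bochner_Integration.integrable_diff j1 j2 j3 integrable_mult_right)
        also have "\<dots> = B * (1 - (\<integral>y. \<phi> \<eta> (y *\<^sub>R dir s) \<partial>pareto \<alpha>))"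
          by (simp only: integral_mult_right_zero, subst Bochner_Integration.integral_diff[OF _ j3]) (auto simp: P.prob_space[unfolded space_pareto])
        also have "\<dots> \<le> B * (1 - (1 + \<eta>) powr (- \<alpha>))" using P\<phi>[OF \<eta> norm_dir] B0 by (intro mult_left_mono) auto
        finally show ?thesis .
      qed
      have "\<bar>\<Gamma> f - \<Gamma> (\<lambda>w. f w * \<phi> \<eta> w)\<bar> = \<bar>\<integral>s. G f s - G (\<lambda>w. f w * \<phi> \<eta> w) s \<partial>Nlim\<bar>"
        unfolding \<Gamma>_def by (subst Bochner_Integration.integral_diff[OF i1 i2]) simp
      also have "\<dots> \<le> (\<integral>s. \<bar>G f s - G (\<lambda>w. f w * \<phi> \<eta> w) s\<bar> \<partial>Nlim)" by (rule integral_abs_bound)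
      also have "\<dots> \<le> B * (1 - (1 + \<eta>) powr (- \<alpha>))"
        by (rule Nl.integral_le_const) (use pt in \<open>auto intro!: integrable_abs Bochner_Integration.integrable_diff i1 i2\<close>)
      finally show ?thesis .
    qed
    show ?thesis
      unfolding \<sigma>int[OF fm]
    proof (rule tendstoI)
      fix e :: real assume e: "0 < e"
      have "((\<lambda>\<eta>. B * (L - L * (1 + \<eta>) powr (- \<alpha>))) \<longlongrightarrow> B * (L - L)) (at_right 0)"
        by (intro tendsto_intros ptend)
      then have "eventually (\<lambda>\<eta>. B * (L - L * (1 + \<eta>) powr (- \<alpha>)) < e / 4) (at_right 0)"
        using e by (intro order_tendstoD) auto
      then have "eventually (\<lambda>\<eta>. B * (L - L * (1 + \<eta>) powr (- \<alpha>)) < e / 4 \<and> 0 < \<eta>) (at_right 0)" using eventually_at_right_less by eventually_elim auto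
      then obtain \<eta> where \<eta>: "0 < \<eta>" "B * (L - L * (1 + \<eta>) powr (- \<alpha>)) < e / 4" using eventually_happens'[OF trivial_limit_at_right_real] by blast
      have G1: "B * (L - L * \<Gamma> (\<phi> \<eta>)) \<le> B * (L - L * (1 + \<eta>) powr (- \<alpha>))" using \<Gamma>\<phi>[OF \<eta>(1)] L B0 by (intro mult_left_mono diff_left_mono) auto
      have "((\<lambda>x. B * (T x - x powr \<alpha> * (\<integral>\<omega>. \<phi> \<eta> (inverse x *\<^sub>R W \<omega>) \<partial>M))) \<longlongrightarrow> B * (L - L * \<Gamma> (\<phi> \<eta>))) at_top"
        by (intro tendsto_intros Tlim \<phi>main \<eta>)
      then have ev1: "eventually (\<lambda>x. B * (T x - x powr \<alpha> * (\<integral>\<omega>. \<phi> \<eta> (inverse x *\<^sub>R W \<omega>) \<partial>M)) < e / 4) at_top"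
        by (rule order_tendstoD(2)) (use G1 \<eta> in linarith)
      have ev2: "eventually (\<lambda>x. dist (x powr \<alpha> * (\<integral>\<omega>. f (inverse x *\<^sub>R W \<omega>) * \<phi> \<eta> (inverse x *\<^sub>R W \<omega>) \<partial>M)) (L * \<Gamma> (\<lambda>w. f w * \<phi> \<eta> w)) < e / 4) at_top"
        using e by (intro tendstoD l \<eta>) auto
      have "\<bar>L * \<Gamma> f - L * \<Gamma> (\<lambda>w. f w * \<phi> \<eta> w)\<bar> = L * \<bar>\<Gamma> f - \<Gamma> (\<lambda>w. f w * \<phi> \<eta> w)\<bar>" using L by (simp add: right_diff_distrib[symmetric] abs_mult)
      also have "\<dots> \<le> L * (B * (1 - (1 + \<eta>) powr (- \<alpha>)))" using L d2[OF \<eta>(1)] by (intro mult_left_mono) auto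
      also have "\<dots> = B * (L - L * (1 + \<eta>) powr (- \<alpha>))" by (simp add: algebra_simps)
      finally have g: "\<bar>L * \<Gamma> f - L * \<Gamma> (\<lambda>w. f w * \<phi> \<eta> w)\<bar> < e / 4" using \<eta> by simp
      show "eventually (\<lambda>x. dist (x powr \<alpha> * (\<integral>\<omega>. f (inverse x *\<^sub>R W \<omega>) * indicator {\<omega>\<in>space M. x < norm (W \<omega>)} \<omega> \<partial>M)) (L * \<Gamma> f) < e) at_top"
        using ev1 ev2 eventually_gt_at_top[of 0]
      proof eventually_elim
        case (elim x)
        then show ?case using d1[OF elim(3) \<eta>(1)] g e unfolding dist_real_def by linarith
      qed
    qed
  qed
  show ?thesis
  proof (intro exI conjI allI impI)
    show "0 < L" by (rule L)
    show "prob_space \<sigma>" by (rule \<sigma>p)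
    show "sets \<sigma> = sets borel" by (simp add: \<sigma>_def)
    show "AE \<theta> in \<sigma>. norm \<theta> = 1" by (rule \<sigma>1)
    show "((\<lambda>x. x powr \<alpha> * prob {\<omega>\<in>space M. x < norm (W \<omega>)}) \<longlongrightarrow> L) at_top" using Tlim by (simp add: T_def[abs_def])
    fix f :: "real^2 \<Rightarrow> real" assume f: "continuous_on UNIV f" "\<exists>B. \<forall>w. \<bar>f w\<bar> \<le> B"
    then obtain B where "\<forall>w. \<bar>f w\<bar> \<le> B" by blast
    then show "((\<lambda>x. x powr \<alpha> * (\<integral>\<omega>. f (inverse x *\<^sub>R W \<omega>) * indicator {\<omega>\<in>space M. x < norm (W \<omega>)} \<omega> \<partial>M)) \<longlongrightarrow>
        L * (\<integral>\<theta>. (\<integral>y. f (y *\<^sub>R \<theta>) \<partial>pareto \<alpha>) \<partial>\<sigma>)) at_top" by (intro final[OF f(1)]) auto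
  qed
qed

lemma (in prob_space) tail_bd_mono_AE:
  assumes [measurable]: "X \<in> borel_measurable M" "Y \<in> borel_measurable M" and le: "AE \<omega> in M. X \<omega> \<le> Y \<omega>" and Y: "tail_bd Y K s"
  shows "tail_bd X K s"
  unfolding tail_bd_def
proof (intro allI impI)
  fix y :: real assume "0 < y"
  have "prob {\<omega>\<in>space M. y < X \<omega>} \<le> prob {\<omega>\<in>space M. y < Y \<omega>}"
    by (rule finite_measure_mono_AE) (use le in \<open>auto elim!: eventually_mono\<close>)
  also have "\<dots> \<le> K * y powr (- s)" by (rule tail_bdD[OF Y \<open>0 < y\<close>])
  finally show "prob {\<omega>\<in>space M. y < X \<omega>} \<le> K * y powr (- s)" .
qed

lemma norm_le_2: "norm w \<le> \<bar>w $ 1\<bar> + \<bar>w $ 2\<bar>" for w :: "real^2"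
  using norm_le_l1_cart[of w] by (simp add: sum_2)

section \<open>The spectral limit for the triangular recursion\<close>

context triangular_recursion
begin

definition col :: "nat \<Rightarrow> 'a \<Rightarrow> real^2" where "col n \<omega> = (\<chi> i. Pi n \<omega> $ i $ 2)"

lemma col_eq: "col n \<omega> = transpose (Pi n \<omega>) $ 2"
  by (simp add: col_def transpose_def vec_eq_iff)

lemma colm: "(\<lambda>P :: real^2^2. transpose P $ 2) \<in> borel_measurable borel"
proof (rule borel_measurable_continuous_onI)
  show "continuous_on UNIV (\<lambda>P :: real^2^2. transpose P $ 2)"
    unfolding transpose_def by (intro continuous_intros continuous_on_vec_lambda)
qed

lemma col_indep: "indep_pair borel (col n) borel (\<lambda>\<omega>. W 0 \<omega> $ 2)"
proof -
  have "indep_pair (borel \<Otimes>\<^sub>M borel) (\<lambda>\<omega>. (Pi n \<omega>, rest n \<omega>)) borel (W 0)"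
    by (rule indep_pair_sym[OF W0_indep_Pi])
  then have "indep_pair borel (\<lambda>\<omega>. transpose (fst (Pi n \<omega>, rest n \<omega>)) $ 2) borel (\<lambda>\<omega>. W 0 \<omega> $ 2)"
    by (rule indep_pair_compose[where f="\<lambda>z. transpose (fst z) $ 2" and g="\<lambda>w. w $ 2"])
      (auto intro: measurable_compose[OF measurable_fst colm])
  then show ?thesis by (simp add: col_eq[abs_def])
qed

lemma colm' [measurable]: "col n \<in> borel_measurable M"
  using col_indep by (simp add: indep_pair_def)

lemma col_norm_int: "integrable M (\<lambda>\<omega>. norm (col n \<omega>) powr \<alpha>)"
proof (rule Bochner_Integration.integrable_bound[OF Pi_norm_int[of n]])
  have "norm (col n \<omega>) \<le> norm (Pi n \<omega>)" for \<omega>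
    using Finite_Cartesian_Product.norm_nth_le[of "transpose (Pi n \<omega>)" 2] by (simp add: col_eq norm_transpose)
  then show "AE \<omega> in M. norm (norm (col n \<omega>) powr \<alpha>) \<le> norm (norm (Pi n \<omega>) powr \<alpha>)"
    using \<alpha> by (auto intro!: powr_mono2)
qed measurable

text \<open>The lower entry of the column is the product of the diagonal entries
  \<open>A\<^sub>4\<close>, whose \<alpha>-moment is exactly 1.\<close>

lemma col_norm_ge: "1 \<le> (\<integral>\<omega>. norm (col n \<omega>) powr \<alpha> \<partial>M)"
proof -
  have "1 = (\<integral>\<omega>. p2 n \<omega> powr \<alpha> \<partial>M)" using p2_moment by simp
  also have "\<dots> \<le> (\<integral>\<omega>. norm (col n \<omega>) powr \<alpha> \<partial>M)"
  proof (rule integral_mono_AE)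
    show "AE \<omega> in M. p2 n \<omega> powr \<alpha> \<le> norm (col n \<omega>) powr \<alpha>"
      using Pi_entries[of n]
    proof eventually_elim
      case (elim \<omega>)
      have "p2 n \<omega> \<le> norm (col n \<omega>)" using component_le_norm_cart[of "col n \<omega>" 2] elim by (simp add: col_def)
      then show ?case using elim \<alpha> by (intro powr_mono2) auto
    qed
  qed (use p2_moment col_norm_int in auto)
  finally show ?thesis .
qed

lemma W0_norm_tail: "\<exists>K. tail_bd (\<lambda>\<omega>. norm (W 0 \<omega>)) K \<alpha>"
proof -
  obtain K1 where K1: "tail_bd (\<lambda>\<omega>. W 0 \<omega> $ 1) K1 \<alpha>" using W1_tail by blast
  obtain K2 where K2: "tail_bd (\<lambda>\<omega>. W 0 \<omega> $ 2) K2 \<alpha>"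
    using W2_tail tail_bd_of_limit[OF _ _ \<alpha>, of "\<lambda>\<omega>. W 0 \<omega> $ 2"] by fastforce
  have "tail_bd (\<lambda>\<omega>. W 0 \<omega> $ 1 + W 0 \<omega> $ 2) (K1 * (1 - 1 / 2) powr (- \<alpha>) + K2 * (1 / 2) powr (- \<alpha>)) \<alpha>"
    by (intro tail_bd_add K1 K2) auto
  then have "tail_bd (\<lambda>\<omega>. norm (W 0 \<omega>)) (K1 * (1 - 1 / 2) powr (- \<alpha>) + K2 * (1 / 2) powr (- \<alpha>)) \<alpha>"
  proof (rule tail_bd_mono_AE[rotated 3])
    show "AE \<omega> in M. norm (W 0 \<omega>) \<le> W 0 \<omega> $ 1 + W 0 \<omega> $ 2"
      using W1_nonneg W2_nonneg
    proof eventually_elim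
      case (elim \<omega>) then show ?case using norm_le_2[of "W 0 \<omega>"] by simp
    qed
  qed measurable
  then show ?thesis by blast
qed

text \<open>By triangularity the first coordinate of \<open>W 0\<close> enters only through the
  entry 11 of the product. Removing the second column leaves this term and
  \<open>rest\<close>.\<close>

lemma err_norm: "AE \<omega> in M. norm (W n \<omega> - W 0 \<omega> $ 2 *\<^sub>R col n \<omega>) \<le> Pi n \<omega> $ 1 $ 1 * W 0 \<omega> $ 1 + norm (rest n \<omega>)"
  using Pi_entries[of n] W1_nonneg
proof eventually_elim
  case (elim \<omega>)
  define u :: "real^2" where "u = (Pi n \<omega> $ 1 $ 1 * W 0 \<omega> $ 1) *\<^sub>R axis 1 1"
  have "W n \<omega> - W 0 \<omega> $ 2 *\<^sub>R col n \<omega> = u + rest n \<omega>"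
    using elim W_eq[of n \<omega>] by (simp add: vec_eq_iff forall_2 u_def axis_def col_def matrix_vector_mult_def sum_2)
  also have "norm \<dots> \<le> norm u + norm (rest n \<omega>)" by (rule norm_triangle_ineq)
  also have "norm u = Pi n \<omega> $ 1 $ 1 * W 0 \<omega> $ 1"
    using elim by (simp add: u_def)
  finally show ?case .
qed

text \<open>All contributions to each coordinate are nonnegative, so omitting some of them can only
  decrease the norm.\<close>

lemma dominated: "AE \<omega> in M. norm (W 0 \<omega> $ 2 *\<^sub>R col n \<omega>) \<le> norm (W n \<omega>)"
  using Pi_entries[of n] W1_nonneg W2_nonneg
proof eventually_elim
  case (elim \<omega>)
  have c: "\<bar>W 0 \<omega> $ 2 * Pi n \<omega> $ i $ 2\<bar> \<le> \<bar>W n \<omega> $ i\<bar>" for i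
  proof -
    have "0 \<le> W 0 \<omega> $ 2 * Pi n \<omega> $ i $ 2" "0 \<le> Pi n \<omega> $ i $ 1 * W 0 \<omega> $ 1" "0 \<le> rest n \<omega> $ i"
      using elim exhaust_2[of i] by auto
    moreover have "W n \<omega> $ i = Pi n \<omega> $ i $ 1 * W 0 \<omega> $ 1 + W 0 \<omega> $ 2 * Pi n \<omega> $ i $ 2 + rest n \<omega> $ i"
      using arg_cong[OF W_eq[of n \<omega>], of "\<lambda>w. w $ i"] by (simp add: matrix_vector_mult_def sum_2 mult.commute)
    ultimately show ?thesis by linarith
  qed
  show ?case by (rule norm_le_componentwise_cart) (use c in \<open>simp add: col_def\<close>)
qed

text \<open>Positivity makes \<kappa>^n a positive target, below which a term of order
  o(x^(-\<alpha>)) eventually falls after multiplication by x^\<alpha>.\<close>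

lemma A1_moment_pos: "0 < (\<integral>\<omega>. (A 1 \<omega> $ 1 $ 1) powr \<alpha> \<partial>M)"
proof -
  have "(\<integral>\<omega>. (A 1 \<omega> $ 1 $ 1) powr \<alpha> \<partial>M) \<noteq> 0"
  proof
    assume "(\<integral>\<omega>. (A 1 \<omega> $ 1 $ 1) powr \<alpha> \<partial>M) = 0"
    then have "AE \<omega> in M. (A 1 \<omega> $ 1 $ 1) powr \<alpha> = 0"
      by (subst (asm) integral_nonneg_eq_0_iff_AE[OF A1_int']) auto
    then have "AE \<omega> in M. False" using A_pos by eventually_elim simp
    then show False by simp
  qed
  moreover have "0 \<le> (\<integral>\<omega>. (A 1 \<omega> $ 1 $ 1) powr \<alpha> \<partial>M)" by simp
  ultimately show ?thesis by (metis less_le)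
qed

text \<open>The two parts of the error are small for different reasons. The diagonal part has tail
  constant K \<kappa>^n at order x^(-\<alpha>). The part \<open>rest n\<close> has a finite
  \<alpha>-moment, so its tail is of smaller order and is eventually covered by \<kappa>^n; how far
  out depends on \<open>n\<close>.\<close>

lemma err_tail:
  "\<exists>D. \<forall>n \<epsilon>. 0 < \<epsilon> \<longrightarrow> eventually (\<lambda>x. x powr \<alpha> * prob {\<omega>\<in>space M. \<epsilon> * x < norm (W n \<omega> - W 0 \<omega> $ 2 *\<^sub>R col n \<omega>)}
     \<le> D * \<epsilon> powr (- \<alpha>) * (\<integral>\<omega>. (A 1 \<omega> $ 1 $ 1) powr \<alpha> \<partial>M) ^ n) at_top"
proof -
  obtain K where K: "tail_bd (\<lambda>\<omega>. W 0 \<omega> $ 1) K \<alpha>" using W1_tail by blast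
  define \<kappa> where "\<kappa> = (\<integral>\<omega>. (A 1 \<omega> $ 1 $ 1) powr \<alpha> \<partial>M)"
  have \<kappa>: "0 < \<kappa>" using A1_moment_pos by (simp add: \<kappa>_def)
  have K0: "0 \<le> K" using K by (rule tail_bd_nonneg)
  have p1_pos': "AE \<omega> in M. 0 < p1 n \<omega>" for n
  proof (induction n)
    case (Suc n)
    then show ?case using entries[of n] by eventually_elim simp
  qed simp
  have tb: "tail_bd (\<lambda>\<omega>. Pi n \<omega> $ 1 $ 1 * W 0 \<omega> $ 1) (K * \<kappa> ^ n) \<alpha>" for n
  proof -
    have "indep_pair (borel \<Otimes>\<^sub>M borel) (\<lambda>\<omega>. (Pi n \<omega>, rest n \<omega>)) borel (W 0)"
      by (rule indep_pair_sym[OF W0_indep_Pi])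
    then have "indep_pair borel (\<lambda>\<omega>. fst (Pi n \<omega>, rest n \<omega>) $ 1 $ 1) borel (\<lambda>\<omega>. W 0 \<omega> $ 1)"
      by (rule indep_pair_compose[where f="\<lambda>z. fst z $ 1 $ 1" and g="\<lambda>w. w $ 1"]) measurable
    then have i: "indep_pair borel (\<lambda>\<omega>. Pi n \<omega> $ 1 $ 1) borel (\<lambda>\<omega>. W 0 \<omega> $ 1)" by simp
    have p: "AE \<omega> in M. 0 < Pi n \<omega> $ 1 $ 1" using Pi_entries[of n] p1_pos'[of n] by eventually_elim simp
    have e: "AE \<omega> in M. p1 n \<omega> powr \<alpha> = (Pi n \<omega> $ 1 $ 1) powr \<alpha>" using Pi_entries[of n] by eventually_elim simp
    have int: "integrable M (\<lambda>\<omega>. (Pi n \<omega> $ 1 $ 1) powr \<alpha>)"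
      by (rule integrable_cong_AE_imp[OF p1_moment[THEN conjunct1]]) (use e in auto)
    have "(\<integral>\<omega>. (Pi n \<omega> $ 1 $ 1) powr \<alpha> \<partial>M) = (\<integral>\<omega>. p1 n \<omega> powr \<alpha> \<partial>M)"
      by (rule integral_cong_AE) (use e in \<open>auto elim: eventually_mono\<close>)
    then have "(\<integral>\<omega>. (Pi n \<omega> $ 1 $ 1) powr \<alpha> \<partial>M) = \<kappa> ^ n" using p1_moment[of n] by (simp add: \<kappa>_def)
    then show ?thesis using tail_bd_mult[OF i K p int] by simp
  qed
  have "\<forall>n \<epsilon>. 0 < \<epsilon> \<longrightarrow> eventually (\<lambda>x. x powr \<alpha> * prob {\<omega>\<in>space M. \<epsilon> * x < norm (W n \<omega> - W 0 \<omega> $ 2 *\<^sub>R col n \<omega>)}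
     \<le> ((K + 1) * 2 powr \<alpha>) * \<epsilon> powr (- \<alpha>) * \<kappa> ^ n) at_top"
  proof (intro allI impI)
    fix n and \<epsilon> :: real assume \<epsilon>: "0 < \<epsilon>"
    have "((\<lambda>x. x powr \<alpha> * prob {\<omega>\<in>space M. x < norm (rest n \<omega>)}) \<longlongrightarrow> 0) at_top"
      by (rule tail_o_of_moment[OF _ _ \<alpha> rest_norm_int]) auto
    then have "eventually (\<lambda>x. x powr \<alpha> * prob {\<omega>\<in>space M. x < norm (rest n \<omega>)} < \<kappa> ^ n) at_top"
      using \<kappa> by (intro order_tendstoD) auto
    moreover have "filterlim (\<lambda>x. \<epsilon> / 2 * x) at_top at_top"
      using \<epsilon> by (intro filterlim_mult_pos_at_top filterlim_ident) auto
    ultimately have "eventually (\<lambda>x. (\<epsilon> / 2 * x) powr \<alpha> * prob {\<omega>\<in>space M. \<epsilon> / 2 * x < norm (rest n \<omega>)} < \<kappa> ^ n) at_top"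
      by (rule eventually_compose_filterlim)
    then show "eventually (\<lambda>x. x powr \<alpha> * prob {\<omega>\<in>space M. \<epsilon> * x < norm (W n \<omega> - W 0 \<omega> $ 2 *\<^sub>R col n \<omega>)}
     \<le> ((K + 1) * 2 powr \<alpha>) * \<epsilon> powr (- \<alpha>) * \<kappa> ^ n) at_top"
      using eventually_gt_at_top[of 0]
    proof eventually_elim
      case (elim x)
      define z where "z = \<epsilon> / 2 * x"
      have z: "0 < z" using \<epsilon> elim by (simp add: z_def)
      have "prob {\<omega>\<in>space M. \<epsilon> * x < norm (W n \<omega> - W 0 \<omega> $ 2 *\<^sub>R col n \<omega>)} \<le> prob {\<omega>\<in>space M. z + z < Pi n \<omega> $ 1 $ 1 * W 0 \<omega> $ 1 + norm (rest n \<omega>)}"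
        by (rule finite_measure_mono_AE) (use err_norm[of n] in \<open>auto elim!: eventually_mono simp: z_def\<close>)
      also have "\<dots> \<le> prob {\<omega>\<in>space M. z < Pi n \<omega> $ 1 $ 1 * W 0 \<omega> $ 1} + prob {\<omega>\<in>space M. z < norm (rest n \<omega>)}"
        by (rule prob_add_gt_le) measurable
      also have "\<dots> \<le> K * \<kappa> ^ n * z powr (- \<alpha>) + \<kappa> ^ n * z powr (- \<alpha>)"
      proof (intro add_mono tail_bdD[OF tb] z)
        show "prob {\<omega>\<in>space M. z < norm (rest n \<omega>)} \<le> \<kappa> ^ n * z powr (- \<alpha>)"
        proof -
          have "z powr \<alpha> * prob {\<omega>\<in>space M. z < norm (rest n \<omega>)} \<le> \<kappa> ^ n"
            using elim(1) unfolding z_def by linarith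
          then show ?thesis using z by (simp add: powr_minus field_simps)
        qed
      qed
      finally have "x powr \<alpha> * prob {\<omega>\<in>space M. \<epsilon> * x < norm (W n \<omega> - W 0 \<omega> $ 2 *\<^sub>R col n \<omega>)} \<le> x powr \<alpha> * (K * \<kappa> ^ n * z powr (- \<alpha>) + \<kappa> ^ n * z powr (- \<alpha>))"
        by (rule mult_left_mono) simp
      also have "\<dots> = (K + 1) * \<kappa> ^ n * (x powr \<alpha> * z powr (- \<alpha>))" by (simp add: algebra_simps)
      also have "x powr \<alpha> * z powr (- \<alpha>) = 2 powr \<alpha> * \<epsilon> powr (- \<alpha>)"
        using elim \<epsilon> by (simp add: z_def powr_mult powr_divide powr_minus_divide)
      finally show ?case by (simp add: algebra_simps)
    qed
  qed
  then show ?thesis unfolding \<kappa>_def by blast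
qed

theorem W0_spectral:
  "\<exists>\<sigma> L. 0 < L \<and> prob_space \<sigma> \<and> sets \<sigma> = sets borel \<and> (AE \<theta> in \<sigma>. norm \<theta> = 1) \<and>
    ((\<lambda>x. x powr \<alpha> * prob {\<omega>\<in>space M. x < norm (W 0 \<omega>)}) \<longlongrightarrow> L) at_top \<and>
    (\<forall>f :: real^2 \<Rightarrow> real. continuous_on UNIV f \<longrightarrow> (\<exists>B. \<forall>w. \<bar>f w\<bar> \<le> B) \<longrightarrow>
      ((\<lambda>x. x powr \<alpha> * (\<integral>\<omega>. f (inverse x *\<^sub>R W 0 \<omega>) * indicator {\<omega>\<in>space M. x < norm (W 0 \<omega>)} \<omega> \<partial>M)) \<longlongrightarrow>
        L * (\<integral>\<theta>. (\<integral>y. f (y *\<^sub>R \<theta>) \<partial>pareto \<alpha>) \<partial>\<sigma>)) at_top)"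
proof -
  obtain c where c: "0 < c" "((\<lambda>x. x powr \<alpha> * prob {\<omega>\<in>space M. x < W 0 \<omega> $ 2}) \<longlongrightarrow> c) at_top" using W2_tail by blast
  obtain K where K: "tail_bd (\<lambda>\<omega>. norm (W 0 \<omega>)) K \<alpha>" using W0_norm_tail by blast
  obtain D where D: "\<forall>n \<epsilon>. 0 < \<epsilon> \<longrightarrow> eventually (\<lambda>x. x powr \<alpha> * prob {\<omega>\<in>space M. \<epsilon> * x < norm (W n \<omega> - W 0 \<omega> $ 2 *\<^sub>R col n \<omega>)}
     \<le> D * \<epsilon> powr (- \<alpha>) * (\<integral>\<omega>. (A 1 \<omega> $ 1 $ 1) powr \<alpha> \<partial>M) ^ n) at_top" using err_tail by blast
  have v0: "AE \<omega> in M. 0 \<le> col n \<omega> $ 1 \<and> 0 < col n \<omega> $ 2" for n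
    using Pi_entries[of n] by eventually_elim (simp add: col_def)
  show ?thesis
    by (rule spectral_limit[where V=W and v=col and E="\<lambda>n \<omega>. W n \<omega> - W 0 \<omega> $ 2 *\<^sub>R col n \<omega>" and R="\<lambda>\<omega>. W 0 \<omega> $ 2"
        and \<kappa>="\<integral>\<omega>. (A 1 \<omega> $ 1 $ 1) powr \<alpha> \<partial>M" and D=D,
        OF Wm Wm _ W_law _ dominated col_indep v0 col_norm_int col_norm_ge K D[rule_format] _ A1_less \<alpha> c(1) c(2) W2_nonneg]) auto
qed

end

section \<open>Extension to future values\<close>

abbreviation (in prob_space) exceedance_mean :: "('a \<Rightarrow> 'v::real_normed_vector) \<Rightarrow> ('v \<Rightarrow> real) \<Rightarrow> real \<Rightarrow> real" where
  "exceedance_mean Y g x \<equiv>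
    (\<integral>\<omega>. g (inverse x *\<^sub>R Y \<omega>) * indicator {\<omega>\<in>space M. x < norm (Y \<omega>)} \<omega> \<partial>M) / prob {\<omega>\<in>space M. x < norm (Y \<omega>)}"

text \<open>On a ball the perturbation 1 / x is controlled by uniform continuity. The mass outside
  the ball is controlled by testing the assumed convergence with a continuous cutoff, which is how
  tightness of the family is obtained.\<close>

lemma slutsky:
  fixes \<mu> :: "real \<Rightarrow> 'b::euclidean_space measure" and k :: "'b \<Rightarrow> real \<Rightarrow> real"
  assumes \<mu>: "eventually (\<lambda>x. prob_space (\<mu> x)) at_top" and s\<mu>: "\<And>x. sets (\<mu> x) = sets borel"
    and \<nu>: "prob_space \<nu>" and s\<nu>: "sets \<nu> = sets borel"
    and H: "\<And>(g :: 'b \<Rightarrow> real) B. continuous_on UNIV g \<Longrightarrow> (\<And>w. \<bar>g w\<bar> \<le> B) \<Longrightarrow> ((\<lambda>x. \<integral>w. g w \<partial>\<mu> x) \<longlongrightarrow> (\<integral>w. g w \<partial>\<nu>)) at_top"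
    and k: "continuous_on UNIV (\<lambda>z. k (fst z) (snd z))" and B: "\<And>w e. \<bar>k w e\<bar> \<le> B"
  shows "((\<lambda>x. \<integral>w. k w (inverse x) \<partial>\<mu> x) \<longlongrightarrow> (\<integral>w. k w 0 \<partial>\<nu>)) at_top"
proof -
  interpret N: prob_space \<nu> by (rule \<nu>)
  note s\<mu> [measurable_cong, simp] s\<nu> [measurable_cong, simp]
  have B0: "0 \<le> B" using B[of undefined undefined] by simp
  have kc: "continuous_on UNIV (\<lambda>w. k w e)" for e
  proof -
    have "continuous_on UNIV (\<lambda>w :: 'b. (w, e))" by (intro continuous_intros)
    from continuous_on_compose2[OF k this] show ?thesis by simp
  qed
  have km [measurable]: "(\<lambda>w. k w e) \<in> borel_measurable borel" for e
    by (rule borel_measurable_continuous_onI[OF kc])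
  have lim0: "((\<lambda>x. \<integral>w. k w 0 \<partial>\<mu> x) \<longlongrightarrow> (\<integral>w. k w 0 \<partial>\<nu>)) at_top"
    by (rule H[OF kc B])
  have "((\<lambda>x. (\<integral>w. k w (inverse x) \<partial>\<mu> x) - (\<integral>w. k w 0 \<partial>\<mu> x)) \<longlongrightarrow> 0) at_top"
  proof (rule tendstoI)
    fix e :: real assume e: "0 < e"
    define e1 where "e1 = e / (4 * (B + 1))"
    have e1: "0 < e1" "2 * B * e1 \<le> e / 2" using e B0 by (auto simp: e1_def field_simps)
    have "eventually (\<lambda>t. N.prob {w\<in>space \<nu>. t < norm w} < e1) at_top"
      using e1 by (intro order_tendstoD(2)[OF N.prob_gt_tendsto_0]) auto
    then obtain T where T: "N.prob {w\<in>space \<nu>. T < norm w} < e1"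
      using eventually_happens'[OF trivial_limit_at_top_linorder] by blast
    \<comment> \<open>\<open>g\<close> vanishes on the ball of radius \<open>T\<close> and equals 1
      beyond radius T + 1. Its limit mean is therefore below the mass outside the former, and its
      mean bounds the mass outside the latter.\<close>
    define g where "g w = max 0 (min 1 (norm w - T))" for w :: 'b
    have gc: "continuous_on UNIV g" unfolding g_def by (intro continuous_intros)
    have gm [measurable]: "g \<in> borel_measurable borel" by (rule borel_measurable_continuous_onI[OF gc])
    have gb: "0 \<le> g w" "g w \<le> 1" for w by (auto simp: g_def)
    have "(\<integral>w. g w \<partial>\<nu>) \<le> (\<integral>w. indicator {w\<in>space \<nu>. T < norm w} w \<partial>\<nu>)"
    proof (rule integral_mono)
      show "integrable \<nu> g" by (rule N.integrable_const_bound[of _ 1]) (use gb in auto)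
      show "g w \<le> indicator {w\<in>space \<nu>. T < norm w} w" if "w \<in> space \<nu>" for w
        using that by (auto simp: g_def indicator_def)
    qed (auto intro!: integrable_real_indicator simp: N.emeasure_eq_measure)
    also have "\<dots> < e1" using T by simp
    finally have "eventually (\<lambda>x. (\<integral>w. g w \<partial>\<mu> x) < e1) at_top"
      using gb by (intro order_tendstoD(2)[OF H[OF gc, of 1]]) auto
    moreover have "uniformly_continuous_on (cball 0 (T + 1) \<times> cball 0 1) (\<lambda>z. k (fst z) (snd z))"
      by (intro compact_uniformly_continuous compact_Times) (auto intro: continuous_on_subset[OF k])
    then obtain d where d: "0 < d" "\<And>z z'. z \<in> cball 0 (T + 1) \<times> cball 0 1 \<Longrightarrow> z' \<in> cball 0 (T + 1) \<times> cball 0 1 \<Longrightarrow> dist z' z < d \<Longrightarrow>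
        dist (k (fst z') (snd z')) (k (fst z) (snd z)) < e / 2"
      unfolding uniformly_continuous_on_def using e by (metis half_gt_zero)
    have "eventually (\<lambda>x. inverse x < min d 1 \<and> 0 < x) (at_top :: real filter)"
      using d by (intro eventually_conj eventually_gt_at_top order_tendstoD(2)[OF tendsto_inverse_0_at_top[OF filterlim_ident]]) auto
    ultimately show "eventually (\<lambda>x. dist ((\<integral>w. k w (inverse x) \<partial>\<mu> x) - (\<integral>w. k w 0 \<partial>\<mu> x)) 0 < e) at_top"
      using \<mu>
    proof eventually_elim
      case (elim x)
      interpret m: prob_space "\<mu> x" by (rule elim)
      have i: "integrable (\<mu> x) (\<lambda>w. k w e)" for e by (rule m.integrable_const_bound[of _ B]) (use B in auto)
      have ig: "integrable (\<mu> x) g" by (rule m.integrable_const_bound[of _ 1]) (use gb in auto)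
      have "\<bar>(\<integral>w. k w (inverse x) \<partial>\<mu> x) - (\<integral>w. k w 0 \<partial>\<mu> x)\<bar> = \<bar>\<integral>w. k w (inverse x) - k w 0 \<partial>\<mu> x\<bar>"
        by (subst Bochner_Integration.integral_diff[OF i i]) simp
      also have "\<dots> \<le> (\<integral>w. \<bar>k w (inverse x) - k w 0\<bar> \<partial>\<mu> x)" by (rule integral_abs_bound)
      also have "\<dots> \<le> (\<integral>w. e / 2 + 2 * B * g w \<partial>\<mu> x)"
      proof (rule integral_mono)
        fix w
        show "\<bar>k w (inverse x) - k w 0\<bar> \<le> e / 2 + 2 * B * g w"
        proof (cases "norm w \<le> T + 1")
          case True
          have "dist (k (fst (w, inverse x)) (snd (w, inverse x))) (k (fst (w, 0 :: real)) (snd (w, 0 :: real))) < e / 2"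
            using True elim by (intro d(2)) (auto simp: dist_Pair_Pair)
          then have "\<bar>k w (inverse x) - k w 0\<bar> < e / 2" by (simp add: dist_real_def)
          moreover have "0 \<le> 2 * B * g w" using B0 gb by simp
          ultimately show ?thesis by linarith
        next
          case False
          then have "g w = 1" by (auto simp: g_def)
          moreover have "\<bar>k w (inverse x) - k w 0\<bar> \<le> 2 * B" using B[of w "inverse x"] B[of w 0] by linarith
          ultimately show ?thesis using e by simp
        qed
      qed (use i ig in auto)
      also have "\<dots> = e / 2 + 2 * B * (\<integral>w. g w \<partial>\<mu> x)"
        using ig m.prob_space by (subst Bochner_Integration.integral_add) auto
      also have "\<dots> < e"
      proof (cases "B = 0")
        case True then show ?thesis using e by simp
      next
        case False
        then have "2 * B * (\<integral>w. g w \<partial>\<mu> x) < 2 * B * e1" using elim B0 by simp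
        then show ?thesis using e1 by linarith
      qed
      finally show ?case by (simp add: dist_real_def)
    qed
  qed
  from tendsto_add[OF this lim0] show ?thesis by simp
qed

lemma continuous_on_funI:
  fixes h :: "'c::topological_space \<Rightarrow> nat \<Rightarrow> 'b::topological_space"
  assumes "\<And>i. continuous_on S (\<lambda>x. h x i)"
  shows "continuous_on S h"
  using assms by (rule continuous_on_coordinatewise_then_product)

context triangular_recursion
begin

definition data :: "nat \<Rightarrow> 'a \<Rightarrow> nat \<Rightarrow> (real^2^2) \<times> (real^2)" where
  "data h \<omega> = (\<lambda>i\<in>{..h}. (Pi i \<omega>, rest i \<omega>))"

lemma data_indep: "indep_pair (PiM {..h} (\<lambda>_. borel \<Otimes>\<^sub>M borel)) (data h) borel (W 0)"
proof -
  have "\<forall>n\<in>{..h}. \<exists>\<psi>. \<psi> \<in> measurable (PiM {1..h} (\<lambda>_. borel)) (borel \<Otimes>\<^sub>M borel) \<and> (\<forall>\<omega>. (Pi n \<omega>, rest n \<omega>) = \<psi> (\<lambda>i\<in>{1..h}. C i \<omega>))"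
    using Pi_rest_factor[of _ h] by blast
  then obtain \<psi> where \<psi>: "\<And>n. n \<in> {..h} \<Longrightarrow> \<psi> n \<in> measurable (PiM {1..h} (\<lambda>_. borel)) (borel \<Otimes>\<^sub>M borel)"
    and eq: "\<And>n \<omega>. n \<in> {..h} \<Longrightarrow> (Pi n \<omega>, rest n \<omega>) = \<psi> n (\<lambda>i\<in>{1..h}. C i \<omega>)" by (subst (asm) bchoice_iff) blast
  have m: "(\<lambda>c. \<lambda>i\<in>{..h}. \<psi> i c) \<in> measurable (PiM {1..h} (\<lambda>_. borel)) (PiM {..h} (\<lambda>_. borel \<Otimes>\<^sub>M borel))"
    by (rule measurable_restrict) (rule \<psi>)
  have "indep_pair borel (\<lambda>\<omega>. W 0 \<omega>) (PiM {..h} (\<lambda>_. borel \<Otimes>\<^sub>M borel)) (\<lambda>\<omega>. \<lambda>i\<in>{..h}. \<psi> i (\<lambda>i\<in>{1..h}. C i \<omega>))"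
    by (rule indep_pair_compose[OF W0_indep _ m, where f="\<lambda>x. x"]) simp
  moreover have "(\<lambda>\<omega>. \<lambda>i\<in>{..h}. \<psi> i (\<lambda>i\<in>{1..h}. C i \<omega>)) = data h"
  proof (intro ext)
    fix \<omega> i
    show "(\<lambda>i\<in>{..h}. \<psi> i (\<lambda>i\<in>{1..h}. C i \<omega>)) i = data h \<omega> i"
    proof (cases "i \<in> {..h}")
      case True
      then show ?thesis by (simp only: data_def restrict_apply' eq[OF True])
    next
      case False
      then show ?thesis by (simp only: data_def restrict_def if_False)
    qed
  qed
  ultimately have "indep_pair borel (W 0) (PiM {..h} (\<lambda>_. borel \<Otimes>\<^sub>M borel)) (data h)" by (simp only:)
  then show ?thesis by (rule indep_pair_sym)
qed

text \<open>Dividing the affine recursion by x turns the path into the linear image of the scaled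
  initial state plus \<open>rest\<close> times e = 1 / x, and the second part disappears with e.
  Independence lets the coefficients be held fixed during this limit. Indices outside
  \<open>I\<close> are filled with 0 so that \<open>f\<close> can be taken continuous on the whole
  function space.\<close>

lemma extension:
  fixes f :: "(nat \<Rightarrow> real^2) \<Rightarrow> real"
  assumes \<nu>: "prob_space \<nu>" and s\<nu>: "sets \<nu> = sets borel"
    and pos: "\<And>x. 0 < prob {\<omega>\<in>space M. x < norm (W 0 \<omega>)}"
    and H: "\<And>(g :: real^2 \<Rightarrow> real) b. continuous_on UNIV g \<Longrightarrow> (\<And>w. \<bar>g w\<bar> \<le> b) \<Longrightarrow>
      ((\<lambda>x. exceedance_mean (W 0) g x) \<longlongrightarrow> (\<integral>w. g w \<partial>\<nu>)) at_top"
    and f: "continuous_on UNIV f" and b: "\<And>z. \<bar>f z\<bar> \<le> b" and I: "I \<subseteq> {..h}"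
  shows "((\<lambda>x. (\<integral>\<omega>. f (\<lambda>i. if i \<in> I then inverse x *\<^sub>R W i \<omega> else 0) * indicator {\<omega>\<in>space M. x < norm (W 0 \<omega>)} \<omega> \<partial>M) / prob {\<omega>\<in>space M. x < norm (W 0 \<omega>)})
      \<longlongrightarrow> (\<integral>\<omega>. (\<integral>w. f (\<lambda>i. if i \<in> I then Pi i \<omega> *v w else 0) \<partial>\<nu>) \<partial>M)) at_top"
proof -
  interpret N: prob_space \<nu> by (rule \<nu>)
  note s\<nu> [measurable_cong, simp]
  have fm [measurable]: "f \<in> borel_measurable borel" by (rule borel_measurable_continuous_onI[OF f])
  have b0: "0 \<le> b" using b[of undefined] by simp
  define Ax where "Ax x = {\<omega>\<in>space M. x < norm (W 0 \<omega>)}" for x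
  have Axm [measurable]: "Ax x \<in> events" for x unfolding Ax_def by measurable
  have Axp: "0 < prob (Ax x)" for x using pos by (simp add: Ax_def)
  define \<mu> where "\<mu> x = distr (uniform_measure M (Ax x)) borel (\<lambda>\<omega>. inverse x *\<^sub>R W 0 \<omega>)" for x
  have Um [measurable]: "(\<lambda>\<omega>. inverse x *\<^sub>R W 0 \<omega>) \<in> borel_measurable (uniform_measure M (Ax x))" for x by simp
  have Up: "prob_space (uniform_measure M (Ax x))" for x
    by (rule prob_space_uniform_measure) (use Axp[of x] in \<open>simp_all add: emeasure_eq_measure ennreal_eq_0_iff not_le\<close>)
  have \<mu>p: "prob_space (\<mu> x)" for x unfolding \<mu>_def by (rule prob_space.prob_space_distr[OF Up Um])
  have \<mu>int: "(\<integral>w. g w \<partial>\<mu> x) = (\<integral>\<omega>. g (inverse x *\<^sub>R W 0 \<omega>) * indicator (Ax x) \<omega> \<partial>M) / prob (Ax x)"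
    if [measurable]: "g \<in> borel_measurable borel" for g :: "real^2 \<Rightarrow> real" and x
  proof -
    have "(\<integral>w. g w \<partial>\<mu> x) = (\<integral>\<omega>. g (inverse x *\<^sub>R W 0 \<omega>) \<partial>uniform_measure M (Ax x))"
      unfolding \<mu>_def by (rule integral_distr[OF Um that])
    also have "\<dots> = (\<integral>\<omega>. g (inverse x *\<^sub>R W 0 \<omega>) * indicator (Ax x) \<omega> \<partial>M) / prob (Ax x)"
      by (rule uniform_measure_integral[OF Axm Axp]) measurable
    finally show ?thesis .
  qed
  have H': "((\<lambda>x. \<integral>w. g w \<partial>\<mu> x) \<longlongrightarrow> (\<integral>w. g w \<partial>\<nu>)) at_top" if "continuous_on UNIV g" "\<And>w. \<bar>g w\<bar> \<le> b'" for g :: "real^2 \<Rightarrow> real" and b'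
    using H[OF that] borel_measurable_continuous_onI[OF that(1)] by (simp add: \<mu>int Ax_def)
  define k where "k \<omega> w e = f (\<lambda>i. if i \<in> I then Pi i \<omega> *v w + e *\<^sub>R rest i \<omega> else 0)" for \<omega> w e
  have kb: "\<bar>k \<omega> w e\<bar> \<le> b" for \<omega> w e using b by (simp add: k_def)
  have kc: "continuous_on UNIV (\<lambda>z. k \<omega> (fst z) (snd z))" for \<omega>
    unfolding k_def
  proof (rule continuous_on_compose2[OF f continuous_on_funI])
    fix i
    show "continuous_on UNIV (\<lambda>z. if i \<in> I then Pi i \<omega> *v fst z + snd z *\<^sub>R rest i \<omega> else 0)"
      by (cases "i \<in> I") (auto intro!: continuous_intros)
  qed auto
  have pt: "((\<lambda>x. \<integral>w. k \<omega> w (inverse x) \<partial>\<mu> x) \<longlongrightarrow> (\<integral>w. k \<omega> w 0 \<partial>\<nu>)) at_top" for \<omega>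
    by (rule slutsky[OF _ _ \<nu> s\<nu> H' kc kb]) (use \<mu>p in \<open>auto simp: \<mu>_def\<close>)
  have kcw: "continuous_on UNIV (\<lambda>w. k \<omega> w e)" for \<omega> e
  proof -
    have "continuous_on UNIV (\<lambda>w :: real^2. (w, e))" by (intro continuous_intros)
    from continuous_on_compose2[OF kc this] show ?thesis by simp
  qed
  have kmw [measurable]: "(\<lambda>w. k \<omega> w e) \<in> borel_measurable borel" for \<omega> e by (rule borel_measurable_continuous_onI[OF kcw])
  have km: "(\<lambda>z. k (fst z) (snd z) e) \<in> borel_measurable (M \<Otimes>\<^sub>M N)" if [measurable_cong]: "sets N = sets borel" for e and N :: "(real^2) measure"
    unfolding k_def
  proof (rule measurable_compose[OF measurable_coordinatewise_then_product fm])
    fix i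
    show "(\<lambda>z. if i \<in> I then Pi i (fst z) *v snd z + e *\<^sub>R rest i (fst z) else 0) \<in> borel_measurable (M \<Otimes>\<^sub>M N)"
      by (cases "i \<in> I") (simp_all, measurable)
  qed
  have m2: "(\<lambda>\<omega>. \<integral>w. k \<omega> w 0 \<partial>\<nu>) \<in> borel_measurable M"
    using N.borel_measurable_lebesgue_integral[of "\<lambda>\<omega> w. k \<omega> w 0" M] km[OF s\<nu>, of 0] by (simp add: case_prod_beta')
  have m1: "(\<lambda>\<omega>. \<integral>w. k \<omega> w (inverse x) \<partial>\<mu> x) \<in> borel_measurable M" for x
  proof -
    interpret m: prob_space "\<mu> x" by (rule \<mu>p)
    show ?thesis
      using m.borel_measurable_lebesgue_integral[of "\<lambda>\<omega> w. k \<omega> w (inverse x)" M] km[of "\<mu> x" "inverse x"] by (simp add: case_prod_beta' \<mu>_def)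
  qed
  have bd: "\<bar>\<integral>w. k \<omega> w e \<partial>\<mu> x\<bar> \<le> b" for \<omega> e x
  proof -
    interpret m: prob_space "\<mu> x" by (rule \<mu>p)
    have "\<bar>\<integral>w. k \<omega> w e \<partial>\<mu> x\<bar> \<le> (\<integral>w. \<bar>k \<omega> w e\<bar> \<partial>\<mu> x)" by (rule integral_abs_bound)
    also have "\<dots> \<le> b"
    proof (rule m.integral_le_const)
      have [measurable_cong]: "sets (\<mu> x) = sets borel" by (simp add: \<mu>_def)
      show "integrable (\<mu> x) (\<lambda>w. \<bar>k \<omega> w e\<bar>)"
        by (rule m.integrable_const_bound[of _ b]) (use kb in simp, measurable)
    qed (use kb in simp)
    finally show ?thesis .
  qed
  have lim: "((\<lambda>x. \<integral>\<omega>. (\<integral>w. k \<omega> w (inverse x) \<partial>\<mu> x) \<partial>M) \<longlongrightarrow> (\<integral>\<omega>. (\<integral>w. k \<omega> w 0 \<partial>\<nu>) \<partial>M)) at_top"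
    by (rule integral_dominated_convergence_at_top[OF m2 m1, where w="\<lambda>_. b"]) (use pt bd in auto)
  \<comment> \<open>Fubini with the coefficients outside: the conditioning event involves
    \<open>W 0\<close> alone, so the inner mean is taken under the conditional law of the scaled
    initial state.\<close>
  have eq: "(\<integral>\<omega>. f (\<lambda>i. if i \<in> I then inverse x *\<^sub>R W i \<omega> else 0) * indicator (Ax x) \<omega> \<partial>M) / prob (Ax x) = (\<integral>\<omega>. (\<integral>w. k \<omega> w (inverse x) \<partial>\<mu> x) \<partial>M)" for x
  proof -
    define F where "F z = f (\<lambda>i. if i \<in> I then fst (fst z i) *v (inverse x *\<^sub>R snd z) + inverse x *\<^sub>R snd (fst z i) else 0) * indicator {w. x < norm w} (snd z)"
      for z :: "(nat \<Rightarrow> (real^2^2) \<times> (real^2)) \<times> (real^2)"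
    have Fm: "F \<in> borel_measurable (PiM {..h} (\<lambda>_. borel \<Otimes>\<^sub>M borel) \<Otimes>\<^sub>M borel)"
      unfolding F_def
    proof (intro borel_measurable_times measurable_compose[OF measurable_coordinatewise_then_product fm])
      fix i
      show "(\<lambda>z. if i \<in> I then fst (fst z i) *v (inverse x *\<^sub>R snd z) + inverse x *\<^sub>R snd (fst z i) else 0) \<in> borel_measurable (PiM {..h} (\<lambda>_. borel \<Otimes>\<^sub>M borel) \<Otimes>\<^sub>M (borel :: (real^2) measure))"
      proof (cases "i \<in> I")
        case True
        then have "i \<in> {..h}" using I by auto
        then have [measurable]: "(\<lambda>z. fst z i) \<in> measurable (PiM {..h} (\<lambda>_. borel \<Otimes>\<^sub>M borel) \<Otimes>\<^sub>M (borel :: (real^2) measure)) (borel \<Otimes>\<^sub>M borel)"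
          by (intro measurable_compose[OF measurable_fst] measurable_component_singleton)
        show ?thesis using True by simp
      qed simp
    next
      show "(\<lambda>z. indicator {w. x < norm w} (snd z)) \<in> borel_measurable (PiM {..h} (\<lambda>_. borel \<Otimes>\<^sub>M borel) \<Otimes>\<^sub>M (borel :: (real^2) measure))"
        by (rule measurable_compose[OF measurable_snd]) measurable
    qed
    have Fb: "\<bar>F z\<bar> \<le> b" for z using b b0 by (auto simp: F_def indicator_def)
    have Fd: "F (data h \<omega>, W 0 \<omega>') = k \<omega> (inverse x *\<^sub>R W 0 \<omega>') (inverse x) * indicator {w. x < norm w} (W 0 \<omega>')" for \<omega> \<omega>'
    proof -
      have "(\<lambda>i. if i \<in> I then fst (data h \<omega> i) *v (inverse x *\<^sub>R W 0 \<omega>') + inverse x *\<^sub>R snd (data h \<omega> i) else 0) =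
          (\<lambda>i. if i \<in> I then Pi i \<omega> *v (inverse x *\<^sub>R W 0 \<omega>') + inverse x *\<^sub>R rest i \<omega> else 0)"
        using I by (auto simp: data_def fun_eq_iff)
      then show ?thesis unfolding F_def k_def fst_conv snd_conv by simp
    qed
    have Wk: "(\<lambda>i. if i \<in> I then inverse x *\<^sub>R W i \<omega> else 0) = (\<lambda>i. if i \<in> I then Pi i \<omega> *v (inverse x *\<^sub>R W 0 \<omega>) + inverse x *\<^sub>R rest i \<omega> else 0)" for \<omega>
    proof
      fix i
      have "inverse x *\<^sub>R W i \<omega> = Pi i \<omega> *v (inverse x *\<^sub>R W 0 \<omega>) + inverse x *\<^sub>R rest i \<omega>"
        by (subst W_eq) (simp add: scaleR_add_right matrix_vector_mult_scaleR)
      then show "(if i \<in> I then inverse x *\<^sub>R W i \<omega> else 0) = (if i \<in> I then Pi i \<omega> *v (inverse x *\<^sub>R W 0 \<omega>) + inverse x *\<^sub>R rest i \<omega> else 0)" by simp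
    qed
    have "(\<integral>\<omega>. f (\<lambda>i. if i \<in> I then inverse x *\<^sub>R W i \<omega> else 0) * indicator (Ax x) \<omega> \<partial>M) = (\<integral>\<omega>. F (data h \<omega>, W 0 \<omega>) \<partial>M)"
      by (rule Bochner_Integration.integral_cong) (auto simp: Fd Wk k_def Ax_def indicator_def)
    also have "\<dots> = (\<integral>\<omega>. (\<integral>\<omega>'. F (data h \<omega>, W 0 \<omega>') \<partial>M) \<partial>M)"
      by (rule indep_integral[OF data_indep Fm Fb])
    also have "\<dots> = (\<integral>\<omega>. prob (Ax x) * (\<integral>w. k \<omega> w (inverse x) \<partial>\<mu> x) \<partial>M)"
    proof (rule Bochner_Integration.integral_cong[OF refl])
      fix \<omega>
      have "(\<integral>\<omega>'. F (data h \<omega>, W 0 \<omega>') \<partial>M) = (\<integral>\<omega>'. k \<omega> (inverse x *\<^sub>R W 0 \<omega>') (inverse x) * indicator (Ax x) \<omega>' \<partial>M)"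
        by (rule Bochner_Integration.integral_cong) (auto simp: Fd Ax_def indicator_def)
      then show "(\<integral>\<omega>'. F (data h \<omega>, W 0 \<omega>') \<partial>M) = prob (Ax x) * (\<integral>w. k \<omega> w (inverse x) \<partial>\<mu> x)"
        using Axp[of x] by (simp add: \<mu>int)
    qed
    finally show ?thesis using Axp[of x] by simp
  qed
  show ?thesis
    using lim[folded eq] unfolding Ax_def k_def scaleR_zero_left add_0_right .
qed

end

section \<open>The stationary process\<close>

lemma upto_shift: "map (\<lambda>i. i + k) [s..t] = [s + k..t + k]"
  by (rule nth_equalityI) auto

lemma matprod_shift: "matprod A (t + k) (s + k) = matprod (\<lambda>i. A (i + k)) t s"
  unfolding matprod_def upto_shift[symmetric] rev_map foldr_map by (simp add: comp_def)

lemma matprod_cong: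
  assumes "\<And>i. s \<le> i \<Longrightarrow> i \<le> t \<Longrightarrow> A i = A' i"
  shows "matprod A t s = matprod A' t s"
  unfolding matprod_def by (rule foldr_cong) (auto simp: assms)

lemma matprod_Suc: "matprod A (int (Suc n)) 1 = A (int (Suc n)) ** matprod A (int n) 1"
proof -
  have "[1..int (Suc n)] = [1..int n] @ [int (Suc n)]" using upto_rec2[of 1 "int (Suc n)"] by simp
  then show ?thesis by (simp add: matprod_def)
qed

lemma matprod_0: "matprod A 0 1 = mat 1"
  by (simp add: matprod_def)

lemma matprod_measurable:
  fixes J :: "int set"
  assumes "{s..t} \<subseteq> J"
  shows "(\<lambda>f. matprod (\<lambda>i. fst (f i)) t s) \<in> borel_measurable (PiM J (\<lambda>_. borel :: ((real^'n^'n) \<times> (real^'n)) measure))"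
proof -
  have "(\<lambda>f. foldr (\<lambda>i P. fst (f i) ** P) xs (mat 1)) \<in> borel_measurable (PiM J (\<lambda>_. borel :: ((real^'n^'n) \<times> (real^'n)) measure))"
    if "set xs \<subseteq> J" for xs
    using that
  proof (induction xs)
    case (Cons a xs)
    have "(\<lambda>f. f a) \<in> measurable (PiM J (\<lambda>_. borel :: ((real^'n^'n) \<times> (real^'n)) measure)) (borel \<Otimes>\<^sub>M borel)"
      unfolding borel_prod using Cons.prems by (intro measurable_component_singleton) auto
    from measurable_compose[OF this measurable_fst]
    show ?case using Cons by (simp add: measurable_matrix_mult)
  qed simp
  then show ?thesis unfolding matprod_def using assms by simp
qed

text \<open>The causal series at time 0 as one measurable functional of the coefficient path. The
  solution at time t is the same functional of the shifted path, which reduces stationarity to shift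
  invariance of the law of the coefficients.\<close>

definition causal_map :: "(int \<Rightarrow> (real^'n^'n) \<times> (real^'n)) \<Rightarrow> real^'n" where
  "causal_map f = (\<Sum>n. matprod (\<lambda>i. fst (f i)) 0 (- int n + 1) *v snd (f (- int n)))"

lemma causal_map_measurable:
  assumes "{..0} \<subseteq> J"
  shows "causal_map \<in> borel_measurable (PiM J (\<lambda>_. borel))"
  unfolding causal_map_def[abs_def]
proof (intro borel_measurable_suminf measurable_matrix_vector_mult matprod_measurable)
  fix n
  show "{- int n + 1..0} \<subseteq> J" using assms by auto
  have "(\<lambda>f. f (- int n)) \<in> measurable (PiM J (\<lambda>_. borel :: ((real^'n^'n) \<times> (real^'n)) measure)) (borel \<Otimes>\<^sub>M borel)"
    unfolding borel_prod using assms by (intro measurable_component_singleton) auto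
  from measurable_compose[OF this measurable_snd]
  show "(\<lambda>f. snd (f (- int n))) \<in> borel_measurable (PiM J (\<lambda>_. borel :: ((real^'n^'n) \<times> (real^'n)) measure))" by simp
qed

text \<open>Only coefficients at times up to 0 enter. This causality is what makes the initial state
  independent of all later coefficients.\<close>

lemma causal_map_restrict: "causal_map (restrict f {..0}) = causal_map f"
proof -
  have "matprod (\<lambda>i. fst (restrict f {..0} i)) 0 (- int n + 1) = matprod (\<lambda>i. fst (f i)) 0 (- int n + 1)" for n
    by (rule matprod_cong) simp
  then show ?thesis by (simp add: causal_map_def)
qed

lemma (in prob_space) indep_blocks:
  fixes J :: "'l \<Rightarrow> 'i set" and X :: "'i \<Rightarrow> 'a \<Rightarrow> 'b::topological_space"
  assumes ind: "indep_vars (\<lambda>_. borel) X UNIV" and J: "disjoint_family J"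
    and Y: "\<And>j. Y j \<in> measurable (PiM (J j) (\<lambda>_. borel)) (borel :: 'c::topological_space measure)"
  shows "indep_vars (\<lambda>_. borel) (\<lambda>j \<omega>. Y j (restrict (\<lambda>i. X i \<omega>) (J j))) UNIV"
proof -
  have "indep_vars (\<lambda>j. PiM (J j) (\<lambda>_. borel)) (\<lambda>j \<omega>. restrict (\<lambda>i. X i \<omega>) (J j)) UNIV"
    by (rule indep_vars_restrict[OF ind]) (use J in auto)
  from indep_vars_compose2[OF this Y] show ?thesis .
qed

locale triangular_process =
  fixes M :: "'a measure"
    and A :: "int \<Rightarrow> 'a \<Rightarrow> real^2^2"
    and B W :: "int \<Rightarrow> 'a \<Rightarrow> real^2"
    and \<alpha>1 \<alpha>2 :: real
  assumes prob: "prob_space M"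
    and iid: "iid M (\<lambda>t \<omega>. (A t \<omega>, B t \<omega>))"
    and tri: "\<And>t. AE \<omega> in M. A t \<omega> $ 2 $ 1 = 0"
    and A_pos: "\<And>t. AE \<omega> in M. A t \<omega> $ 1 $ 1 > 0 \<and> A t \<omega> $ 1 $ 2 > 0 \<and> A t \<omega> $ 2 $ 2 > 0"
    and B_pos: "\<And>t. AE \<omega> in M. B t \<omega> $ 1 > 0 \<and> B t \<omega> $ 2 > 0"
    and na1: "non_arithmetic M (\<lambda>\<omega>. ln (A 0 \<omega> $ 1 $ 1))"
    and na4: "non_arithmetic M (\<lambda>\<omega>. ln (A 0 \<omega> $ 2 $ 2))"
    and \<alpha>12: "\<alpha>1 > \<alpha>2" and \<alpha>2: "\<alpha>2 > 0"
    and A1_int: "integrable M (\<lambda>\<omega>. (A 0 \<omega> $ 1 $ 1) powr \<alpha>1)"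
    and A1_one: "(\<integral>\<omega>. (A 0 \<omega> $ 1 $ 1) powr \<alpha>1 \<partial>M) = 1"
    and B1_int: "integrable M (\<lambda>\<omega>. (B 0 \<omega> $ 1) powr \<alpha>1)"
    and A4_int: "integrable M (\<lambda>\<omega>. (A 0 \<omega> $ 2 $ 2) powr \<alpha>2)"
    and A4_one: "(\<integral>\<omega>. (A 0 \<omega> $ 2 $ 2) powr \<alpha>2 \<partial>M) = 1"
    and A4_log: "integrable M (\<lambda>\<omega>. (A 0 \<omega> $ 2 $ 2) powr \<alpha>2 * max (ln (A 0 \<omega> $ 2 $ 2)) 0)"
    and B2_int: "integrable M (\<lambda>\<omega>. (B 0 \<omega> $ 2) powr \<alpha>2)"
    and A2_int: "integrable M (\<lambda>\<omega>. (A 0 \<omega> $ 1 $ 2) powr \<alpha>2)"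
    and causal: "causal_solution M A B W"
begin

sublocale prob_space M by (rule prob)

definition X where "X t \<omega> = (A t \<omega>, B t \<omega>)"

lemma X_indep: "indep_vars (\<lambda>_. borel) X UNIV" and X_law: "distr M borel (X s) = distr M borel (X t)"
  using iid by (auto simp: iid_def X_def[abs_def])

lemma Xm [measurable]: "X t \<in> borel_measurable M"
  using X_indep by (auto simp: indep_vars_def)

lemma Wm [measurable]: "W t \<in> borel_measurable M"
  using causal by (simp add: causal_solution_def)

lemma W_rec: "AE \<omega> in M. W t \<omega> = A t \<omega> *v W (t - 1) \<omega> + B t \<omega>"
  using causal by (simp add: causal_solution_def)

lemma W_causal: "AE \<omega> in M. W t \<omega> = causal_map (\<lambda>i. X (i + t) \<omega>)"
proof -
  have "(\<Sum>n. matprod (\<lambda>i. A i \<omega>) t (t - int n + 1) *v B (t - int n) \<omega>) = causal_map (\<lambda>i. X (i + t) \<omega>)" for \<omega>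
  proof -
    have "matprod (\<lambda>i. A i \<omega>) t (t - int n + 1) = matprod (\<lambda>i. A (i + t) \<omega>) 0 (- int n + 1)" for n
      using matprod_shift[of "\<lambda>i. A i \<omega>" 0 t "- int n + 1"] by (simp add: algebra_simps)
    then show ?thesis by (simp add: causal_map_def X_def)
  qed
  moreover have "AE \<omega> in M. W t \<omega> = (\<Sum>n. matprod (\<lambda>i. A i \<omega>) t (t - int n + 1) *v B (t - int n) \<omega>)"
    using causal by (simp add: causal_solution_def)
  ultimately show ?thesis by simp
qed

lemma shift_law: "distr M (PiM UNIV (\<lambda>_. borel)) (\<lambda>\<omega>. \<lambda>i\<in>UNIV. X (i + k) \<omega>) = PiM UNIV (\<lambda>_. distr M borel (X 0))"
proof -
  have m: "(\<lambda>f. f (j + k)) \<in> measurable (PiM {j + k} (\<lambda>_. borel :: ((real^2^2) \<times> (real^2)) measure)) borel" for j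
    by (rule measurable_component_singleton) simp
  have "disjoint_family (\<lambda>j. {j + k})" by (auto simp: disjoint_family_on_def)
  from indep_blocks[OF X_indep this m]
  have "indep_vars (\<lambda>_. borel) (\<lambda>j. X (j + k)) UNIV" by simp
  then have "distr M (PiM UNIV (\<lambda>_. borel)) (\<lambda>\<omega>. \<lambda>i\<in>UNIV. X (i + k) \<omega>) = PiM UNIV (\<lambda>i. distr M borel (X (i + k)))"
    by (subst (asm) indep_vars_iff_distr_eq_PiM) auto
  also have "\<dots> = PiM UNIV (\<lambda>_. distr M borel (X 0))" by (intro PiM_cong refl X_law)
  finally show ?thesis .
qed

lemma stationary: "strictly_stationary M W"
  unfolding strictly_stationary_def
proof (intro conjI allI impI Wm)
  fix I :: "int set" and k assume I: "finite I"
  define \<Psi> where "\<Psi> f = (\<lambda>i\<in>I. causal_map (\<lambda>j. f (j + i)))" for f :: "int \<Rightarrow> (real^2^2) \<times> (real^2)"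
  have \<Psi>m: "\<Psi> \<in> measurable (PiM UNIV (\<lambda>_. borel)) (PiM I (\<lambda>_. borel))"
    unfolding \<Psi>_def[abs_def]
  proof (rule measurable_restrict)
    fix i :: int
    have "(\<lambda>f j. f (j + i)) \<in> measurable (PiM UNIV (\<lambda>_. borel :: ((real^2^2) \<times> (real^2)) measure)) (PiM UNIV (\<lambda>_. borel))"
      by (rule measurable_PiM_single') auto
    moreover have "causal_map \<in> borel_measurable (PiM UNIV (\<lambda>_. borel :: ((real^2^2) \<times> (real^2)) measure))"
      by (rule causal_map_measurable) simp
    ultimately show "(\<lambda>f. causal_map (\<lambda>j. f (j + i))) \<in> measurable (PiM UNIV (\<lambda>_. borel :: ((real^2^2) \<times> (real^2)) measure)) borel"
      by (rule measurable_compose)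
  qed
  have Sm: "(\<lambda>\<omega>. \<lambda>i\<in>UNIV. X (i + k) \<omega>) \<in> measurable M (PiM UNIV (\<lambda>_. borel))" for k
    by (rule measurable_restrict) measurable
  have law: "distr M (PiM I (\<lambda>_. borel)) (\<lambda>\<omega>. \<lambda>i\<in>I. W (i + k) \<omega>) = distr (PiM UNIV (\<lambda>_. distr M borel (X 0))) (PiM I (\<lambda>_. borel)) \<Psi>" for k
  proof -
    have "distr M (PiM I (\<lambda>_. borel)) (\<lambda>\<omega>. \<lambda>i\<in>I. W (i + k) \<omega>) = distr M (PiM I (\<lambda>_. borel)) (\<lambda>\<omega>. \<Psi> (\<lambda>i\<in>UNIV. X (i + k) \<omega>))"
    proof (rule distr_cong_AE)
      have "AE \<omega> in M. \<forall>i\<in>I. W (i + k) \<omega> = causal_map (\<lambda>j. X (j + (i + k)) \<omega>)"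
        using I by (intro AE_finite_allI W_causal)
      then show "AE \<omega> in M. (\<lambda>i\<in>I. W (i + k) \<omega>) = \<Psi> (\<lambda>i\<in>UNIV. X (i + k) \<omega>)"
        by eventually_elim (auto simp: \<Psi>_def add.assoc intro!: restrict_ext)
      show "(\<lambda>\<omega>. \<lambda>i\<in>I. W (i + k) \<omega>) \<in> measurable M (PiM I (\<lambda>_. borel))" by (rule measurable_restrict) measurable
      show "(\<lambda>\<omega>. \<Psi> (\<lambda>i\<in>UNIV. X (i + k) \<omega>)) \<in> measurable M (PiM I (\<lambda>_. borel))" by (rule measurable_compose[OF Sm \<Psi>m])
    qed auto
    also have "\<dots> = distr (distr M (PiM UNIV (\<lambda>_. borel)) (\<lambda>\<omega>. \<lambda>i\<in>UNIV. X (i + k) \<omega>)) (PiM I (\<lambda>_. borel)) \<Psi>"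
      by (subst distr_distr[OF \<Psi>m Sm]) (simp add: comp_def)
    finally show ?thesis by (simp only: shift_law)
  qed
  show "distr M (PiM I (\<lambda>_. borel)) (\<lambda>\<omega>. \<lambda>i\<in>I. W (i + k) \<omega>) = distr M (PiM I (\<lambda>_. borel)) (\<lambda>\<omega>. \<lambda>i\<in>I. W i \<omega>)"
    using law[of k] law[of 0] by simp
qed

lemma W_law: "distr M borel (W t) = distr M borel (W 0)"
proof -
  have e: "distr M borel (W k) = distr (distr M (PiM {0} (\<lambda>_. borel)) (\<lambda>\<omega>. \<lambda>i\<in>{0}. W (i + k) \<omega>)) borel (\<lambda>f. f 0)" for k
  proof -
    have "(\<lambda>\<omega>. \<lambda>i\<in>{0}. W (i + k) \<omega>) \<in> measurable M (PiM {0} (\<lambda>_. borel))" by (rule measurable_restrict) measurable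
    moreover have "(\<lambda>f. f 0) \<in> measurable (PiM {0 :: int} (\<lambda>_. borel :: (real^2) measure)) borel" by (rule measurable_component_singleton) simp
    ultimately show ?thesis by (subst distr_distr) (auto simp: comp_def)
  qed
  have "distr M (PiM {0} (\<lambda>_. borel)) (\<lambda>\<omega>. \<lambda>i\<in>{0}. W (i + t) \<omega>) = distr M (PiM {0} (\<lambda>_. borel)) (\<lambda>\<omega>. \<lambda>i\<in>{0}. W i \<omega>)"
    using stationary unfolding strictly_stationary_def by blast
  then show ?thesis using e[of t] e[of 0] by (simp only: add_0_right)
qed

text \<open>The initial state and the innovations at positive times, as one independent sequence; the zero matrix is a
  placeholder.\<close>

definition C where
  "C n \<omega> = (case n of 0 \<Rightarrow> (0, causal_map (\<lambda>i. X i \<omega>)) | Suc m \<Rightarrow> X (int n) \<omega>)"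

text \<open>A version of the solution that obeys the recursion for every \<omega>, as the pathwise
  identities of \<open>triangular_recursion\<close> demand, whereas \<open>W\<close> is only known
  to do so almost surely.\<close>

primrec V :: "nat \<Rightarrow> 'a \<Rightarrow> real^2" where
  "V 0 \<omega> = snd (C 0 \<omega>)"
| "V (Suc n) \<omega> = fst (C (Suc n) \<omega>) *v V n \<omega> + snd (C (Suc n) \<omega>)"

lemma C_Suc: "C (Suc n) = X (int (Suc n))"
  by (simp add: C_def fun_eq_iff)

lemma C_indep: "indep_vars (\<lambda>_. borel) C UNIV"
proof -
  define J where "J n = (if n = 0 then {..0} else {int n})" for n :: nat
  define Y where "Y n f = (if n = 0 then (0, causal_map f) else f (int n))" for n :: nat and f :: "int \<Rightarrow> (real^2^2) \<times> (real^2)"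
  have J: "disjoint_family J" by (auto simp: disjoint_family_on_def J_def)
  have Y: "Y n \<in> measurable (PiM (J n) (\<lambda>_. borel)) borel" for n
  proof (cases "n = 0")
    case True
    have "(\<lambda>f. (0, causal_map f)) \<in> measurable (PiM {..0} (\<lambda>_. borel)) (borel \<Otimes>\<^sub>M borel :: ((real^2^2) \<times> (real^2)) measure)"
      by (intro measurable_Pair measurable_const causal_map_measurable) auto
    then show ?thesis using True by (simp add: Y_def[abs_def] J_def borel_prod)
  next
    case False
    then show ?thesis unfolding Y_def J_def by (simp add: measurable_component_singleton)
  qed
  have "C = (\<lambda>j \<omega>. Y j (restrict (\<lambda>i. X i \<omega>) (J j)))"
    by (auto simp: fun_eq_iff C_def Y_def J_def causal_map_restrict split: nat.split)
  then show ?thesis using indep_blocks[OF X_indep J Y] by simp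
qed

lemma V_eq: "AE \<omega> in M. V n \<omega> = W (int n) \<omega>"
proof (induction n)
  case 0
  show ?case using W_causal[of 0] by eventually_elim (simp add: C_def)
next
  case (Suc n)
  then show ?case using W_rec[of "int (Suc n)"] by eventually_elim (simp add: C_Suc X_def)
qed

lemma Cm: "C n \<in> borel_measurable M"
  using C_indep by (auto simp: indep_vars_def)

lemma Vm [measurable]: "V n \<in> borel_measurable M"
proof (induction n)
  have fs: "(\<lambda>\<omega>. fst (C n \<omega>)) \<in> borel_measurable M" "(\<lambda>\<omega>. snd (C n \<omega>)) \<in> borel_measurable M" for n
    using measurable_compose[OF Cm[of n, unfolded borel_prod[symmetric]] measurable_fst] measurable_compose[OF Cm[of n, unfolded borel_prod[symmetric]] measurable_snd]
    by simp_all
  case 0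
  have "V 0 = (\<lambda>\<omega>. snd (C 0 \<omega>))" by (simp add: fun_eq_iff)
  then show ?case using fs by simp
  case (Suc n)
  have "V (Suc n) = (\<lambda>\<omega>. fst (C (Suc n) \<omega>) *v V n \<omega> + snd (C (Suc n) \<omega>))" by (simp add: fun_eq_iff)
  then show ?case using fs[of "Suc n"] Suc by (simp add: measurable_matrix_vector_mult)
qed

lemma V_law: "distr M borel (V n) = distr M borel (V 0)"
proof -
  have "distr M borel (V n) = distr M borel (W (int n))" for n
    by (rule distr_cong_AE) (use V_eq[of n] in auto)
  from this[of n] this[of 0] show ?thesis using W_law[of "int n"] by simp
qed

text \<open>The moment hypotheses are stated at time 0, while index 0 of the recursion holds the
  initial state. Identical distribution moves them to the first genuine input, at time 1.\<close>

lemma transfer_int: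
  fixes f :: "_ \<Rightarrow> real"
  assumes f: "f \<in> borel_measurable borel"
  shows "integrable M (\<lambda>\<omega>. f (X 0 \<omega>)) \<Longrightarrow> integrable M (\<lambda>\<omega>. f (C 1 \<omega>))" "(\<integral>\<omega>. f (C 1 \<omega>) \<partial>M) = (\<integral>\<omega>. f (X 0 \<omega>) \<partial>M)"
proof -
  have C1: "C 1 = X 1" using C_Suc[of 0] by simp
  show "integrable M (\<lambda>\<omega>. f (C 1 \<omega>))" if "integrable M (\<lambda>\<omega>. f (X 0 \<omega>))"
    using that unfolding C1 integrable_distr_eq[OF Xm f, symmetric] by (simp only: X_law[of 1 0])
  show "(\<integral>\<omega>. f (C 1 \<omega>) \<partial>M) = (\<integral>\<omega>. f (X 0 \<omega>) \<partial>M)"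
    unfolding C1 integral_distr[OF Xm f, symmetric] by (simp only: X_law[of 1 0])
qed

lemma transfer_AE:
  assumes P: "Measurable.pred borel P" and "AE \<omega> in M. P (C 1 \<omega>)"
  shows "AE \<omega> in M. P (X 0 \<omega>)"
proof -
  have set: "{x \<in> space borel. P x} \<in> sets borel" using P by (simp add: pred_def)
  have C1: "C 1 = X 1" using C_Suc[of 0] by simp
  have "AE x in distr M borel (X 1). P x" using assms(2) unfolding C1 by (subst AE_distr_iff[OF Xm set])
  then have "AE x in distr M borel (X 0). P x" by (simp only: X_law[of 1 0])
  then show ?thesis by (subst (asm) AE_distr_iff[OF Xm set])
qed

lemma non_arith:
  assumes na: "non_arithmetic M (\<lambda>\<omega>. ln (A 0 \<omega> $ i $ i))" and h: "0 \<le> h"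
  shows "\<not> (AE \<omega> in M. ln (fst (C 1 \<omega>) $ i $ i) \<in> range (\<lambda>k::int. h * of_int k))"
proof
  define N where "N = range (\<lambda>k::int. h * of_int k)"
  have [measurable]: "N \<in> sets borel" unfolding N_def by (rule sets.countable) auto
  assume "AE \<omega> in M. ln (fst (C 1 \<omega>) $ i $ i) \<in> range (\<lambda>k::int. h * of_int k)"
  then have 1: "AE \<omega> in M. ln (fst (C 1 \<omega>) $ i $ i) \<in> N" by (simp only: N_def)
  have "AE \<omega> in M. ln (fst (X 0 \<omega>) $ i $ i) \<in> N"
    by (rule transfer_AE[OF _ 1]) measurable
  then have 2: "AE \<omega> in M. ln (A 0 \<omega> $ i $ i) \<in> N" by (simp add: X_def)
  have "(\<lambda>\<omega>. fst (X 0 \<omega>)) \<in> borel_measurable M" by measurable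
  then have [measurable]: "A 0 \<in> borel_measurable M" by (simp add: X_def)
  have "AE x in distr M borel (\<lambda>\<omega>. ln (A 0 \<omega> $ i $ i)). x \<in> N"
    using 2 by (subst AE_distr_iff) auto
  then show False using na h unfolding non_arithmetic_def N_def by blast
qed

lemma C1: "C 1 \<omega> = (A 1 \<omega>, B 1 \<omega>)"
  using C_Suc[of 0] by (simp add: X_def)

sublocale T: triangular_recursion M C V \<alpha>1 \<alpha>2
proof (unfold_locales, goal_cases)
  case 1 show ?case by (rule C_indep)
next
  case (2 n)
  have "C 1 = X 1" using C_Suc[of 0] by simp
  then show ?case unfolding C_Suc by (simp only: X_law[of "int (Suc n)" 1])
next
  case 3 show ?case by simp
next
  case 4 show ?case by simp
next
  case 5 show ?case by (rule V_law)
next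
  case 6 show ?case using tri[of 1] by (simp only: C1 fst_conv snd_conv)
next
  case 7 show ?case using A_pos[of 1] by (simp only: C1 fst_conv snd_conv)
next
  case 8 show ?case using B_pos[of 1] by (simp only: C1 fst_conv snd_conv)
next
  case 9
  show ?case
  proof
    assume "AE \<omega> in M. fst (C 1 \<omega>) $ 1 $ 1 = 1"
    then have "AE \<omega> in M. ln (fst (C 1 \<omega>) $ 1 $ 1) \<in> range (\<lambda>k::int. 0 * of_int k)" by eventually_elim auto
    then show False using non_arith[OF na1, of 0] by simp
  qed
next
  case (10 h) then show ?case by (intro non_arith[OF na4])
next
  case 11 show ?case by (rule \<alpha>12)
next
  case 12 show ?case by (rule \<alpha>2)
next
  case 13 show ?case by (rule transfer_int(1)[where f="\<lambda>c. (fst c $ 1 $ 1) powr \<alpha>1"]) (measurable, use A1_int in \<open>simp add: X_def\<close>)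
next
  case 14 show ?case using transfer_int(2)[where f="\<lambda>c. (fst c $ 1 $ 1) powr \<alpha>1"] A1_one by (simp add: X_def)
next
  case 15 show ?case by (rule transfer_int(1)[where f="\<lambda>c. (snd c $ 1) powr \<alpha>1"]) (measurable, use B1_int in \<open>simp add: X_def\<close>)
next
  case 16 show ?case by (rule transfer_int(1)[where f="\<lambda>c. (fst c $ 2 $ 2) powr \<alpha>2"]) (measurable, use A4_int in \<open>simp add: X_def\<close>)
next
  case 17 show ?case using transfer_int(2)[where f="\<lambda>c. (fst c $ 2 $ 2) powr \<alpha>2"] A4_one by (simp add: X_def)
next
  case 18 show ?case by (rule transfer_int(1)[where f="\<lambda>c. (fst c $ 2 $ 2) powr \<alpha>2 * max (ln (fst c $ 2 $ 2)) 0"]) (measurable, use A4_log in \<open>simp add: X_def\<close>)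
next
  case 19 show ?case by (rule transfer_int(1)[where f="\<lambda>c. (snd c $ 2) powr \<alpha>2"]) (measurable, use B2_int in \<open>simp add: X_def\<close>)
next
  case 20 show ?case by (rule transfer_int(1)[where f="\<lambda>c. (fst c $ 1 $ 2) powr \<alpha>2"]) (measurable, use A2_int in \<open>simp add: X_def\<close>)
qed

lemma Pi_eq: "T.Pi n \<omega> = matprod (\<lambda>j. A j \<omega>) (int n) 1"
proof (induction n)
  case (Suc n)
  show ?case unfolding matprod_Suc T.Pi.simps Suc.IH by (simp add: C_Suc X_def)
qed (simp add: matprod_0)

end

text \<open>\<open>pareto_law\<close> prescribes the tail only above 1. As the level decreases to 1
  this tail tends to 1, so no mass remains at or below 1.\<close>

lemma pareto_law_unique:
  assumes \<alpha>: "0 < \<alpha>" and \<rho>: "pareto_law \<alpha> \<rho>"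
  shows "\<rho> = pareto \<alpha>"
proof -
  interpret R: real_distribution \<rho> using \<rho> by (simp add: pareto_law_def)
  have big: "cdf \<rho> y = cdf (pareto \<alpha>) y" if "1 < y" for y
  proof -
    have "measure \<rho> (space \<rho> - {y<..}) = 1 - measure \<rho> {y<..}" by (rule R.prob_compl) simp
    moreover have "space \<rho> - {y<..} = {..y}" by (auto simp: R.space_eq_univ)
    ultimately show ?thesis using \<rho> that by (simp add: cdf_def[of \<rho>] cdf_pareto[OF \<alpha>] pareto_law_def)
  qed
  have "cdf \<rho> y = cdf (pareto \<alpha>) y" for y
  proof (cases "1 < y")
    case True then show ?thesis by (rule big)
  next
    case False
    have "((\<lambda>z. 1 - z powr (- \<alpha>)) \<longlongrightarrow> 1 - 1 powr (- \<alpha>)) (at_right (1 :: real))" by (intro tendsto_intros) auto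
    moreover have "eventually (\<lambda>z. cdf \<rho> y \<le> 1 - z powr (- \<alpha>)) (at_right 1)"
      using eventually_at_right_less[of 1]
    proof eventually_elim
      case (elim z)
      have "cdf \<rho> y \<le> cdf \<rho> z" using elim False by (intro R.cdf_nondecreasing) auto
      then show ?case using big[OF elim] elim by (simp add: cdf_pareto[OF \<alpha>])
    qed
    ultimately have "cdf \<rho> y \<le> 1 - 1 powr (- \<alpha>)"
      by (intro tendsto_lowerbound[where F="at_right (1::real)"]) auto
    then have "cdf \<rho> y = 0" using R.cdf_nonneg[of y] by simp
    then show ?thesis using False by (simp add: cdf_pareto[OF \<alpha>])
  qed
  then show ?thesis by (intro cdf_unique R.real_distribution_axioms real_distribution_pareto[OF \<alpha>]) auto
qed

text \<open>Test functions for weak convergence are continuous only on the extensional functions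
  over \<open>I\<close>. Composition with restriction extends them continuously to all functions,
  where continuity yields Borel measurability.\<close>

lemma continuous_on_space_PiM_measurable:
  fixes f :: "(nat \<Rightarrow> real^2) \<Rightarrow> real"
  assumes f: "continuous_on (space (PiM I (\<lambda>_. borel))) f"
  shows "continuous_on UNIV (\<lambda>z. f (restrict z I))" and "f \<in> borel_measurable (PiM I (\<lambda>_. borel))"
proof -
  show c: "continuous_on UNIV (\<lambda>z. f (restrict z I))"
  proof (rule continuous_on_compose2[OF f continuous_on_funI])
    show "continuous_on UNIV (\<lambda>z :: nat \<Rightarrow> real^2. restrict z I i)" for i
      by (cases "i \<in> I") (auto intro!: continuous_on_product_coordinates)
  qed (auto simp: space_PiM)
  have "(\<lambda>z. z) \<in> measurable (PiM I (\<lambda>_. borel :: (real^2) measure)) borel"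
  proof (rule measurable_coordinatewise_then_product)
    fix i
    show "(\<lambda>z. z i) \<in> borel_measurable (PiM I (\<lambda>_. borel :: (real^2) measure))"
    proof (cases "i \<in> I")
      case True then show ?thesis by (rule measurable_component_singleton)
    next
      case False
      have "(\<lambda>_. undefined) \<in> borel_measurable (PiM I (\<lambda>_. borel :: (real^2) measure))" by simp
      then show ?thesis
        by (rule measurable_cong[THEN iffD1, rotated]) (use False in \<open>auto simp: space_PiM PiE_def extensional_def\<close>)
    qed
  qed
  from measurable_compose[OF this borel_measurable_continuous_onI[OF c]]
  show "f \<in> borel_measurable (PiM I (\<lambda>_. borel))"
    by (rule measurable_cong[THEN iffD1, rotated]) (auto simp: space_PiM PiE_restrict)
qed

lemma triple_integral:
  fixes F :: "_ \<Rightarrow> real"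
  assumes "prob_space P1" "prob_space P2" "prob_space P3"
    and F [measurable]: "F \<in> borel_measurable (P1 \<Otimes>\<^sub>M (P2 \<Otimes>\<^sub>M P3))" and b: "\<And>z. \<bar>F z\<bar> \<le> b"
  shows "(\<integral>z. F z \<partial>(P1 \<Otimes>\<^sub>M (P2 \<Otimes>\<^sub>M P3))) = (\<integral>z. (\<integral>y. (\<integral>x. F (x, (y, z)) \<partial>P1) \<partial>P2) \<partial>P3)"
proof -
  interpret P1: prob_space P1 by fact
  interpret P2: prob_space P2 by fact
  interpret P3: prob_space P3 by fact
  interpret P23: pair_prob_space P2 P3 ..
  interpret P123: pair_prob_space P1 "P2 \<Otimes>\<^sub>M P3" ..
  have i: "integrable (P1 \<Otimes>\<^sub>M (P2 \<Otimes>\<^sub>M P3)) F"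
    by (rule P123.P.integrable_const_bound[of _ b]) (use b in auto)
  have "(\<integral>z. F z \<partial>(P1 \<Otimes>\<^sub>M (P2 \<Otimes>\<^sub>M P3))) = (\<integral>w. (\<integral>x. F (x, w) \<partial>P1) \<partial>(P2 \<Otimes>\<^sub>M P3))"
    using P123.integral_snd[of "\<lambda>x w. F (x, w)"] i by (simp add: case_prod_beta')
  also have "\<dots> = (\<integral>z. (\<integral>y. (\<integral>x. F (x, (y, z)) \<partial>P1) \<partial>P2) \<partial>P3)"
  proof -
    have m: "(\<lambda>w. \<integral>x. F (x, w) \<partial>P1) \<in> borel_measurable (P2 \<Otimes>\<^sub>M P3)" by measurable
    have bd: "\<bar>\<integral>x. F (x, w) \<partial>P1\<bar> \<le> b" if "w \<in> space (P2 \<Otimes>\<^sub>M P3)" for w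
    proof -
      have m1: "(\<lambda>x. F (x, w)) \<in> borel_measurable P1" using that by measurable
      have "\<bar>\<integral>x. F (x, w) \<partial>P1\<bar> \<le> (\<integral>x. \<bar>F (x, w)\<bar> \<partial>P1)" by (rule integral_abs_bound)
      also have "\<dots> \<le> b"
      proof (rule P1.integral_le_const)
        show "integrable P1 (\<lambda>x. \<bar>F (x, w)\<bar>)"
          by (rule integrable_abs, rule P1.integrable_const_bound[OF _ m1, of b]) (use b in auto)
      qed (use b in auto)
      finally show ?thesis .
    qed
    have "integrable (P2 \<Otimes>\<^sub>M P3) (\<lambda>w. \<integral>x. F (x, w) \<partial>P1)"
      by (rule P23.P.integrable_const_bound[OF _ m, of b]) (use bd in auto)
    then show ?thesis using P23.integral_snd[of "\<lambda>y z. \<integral>x. F (x, (y, z)) \<partial>P1"] by (simp add: case_prod_beta')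
  qed
  finally show ?thesis .
qed

context triangular_process
begin

text \<open>The positive limit constant gives positivity at all large levels, and monotonicity
  passes it down to every smaller one. Conditioning on an exceedance is therefore always
  meaningful.\<close>

lemma tail_pos: "0 < prob {\<omega>\<in>space M. x < norm (V 0 \<omega>)}"
proof -
  obtain L where L: "0 < L" "((\<lambda>x. x powr \<alpha>2 * prob {\<omega>\<in>space M. x < norm (V 0 \<omega>)}) \<longlongrightarrow> L) at_top"
    using T.W0_spectral by blast
  have "eventually (\<lambda>y. 0 < y powr \<alpha>2 * prob {\<omega>\<in>space M. y < norm (V 0 \<omega>)} \<and> x \<le> y) at_top"
    by (intro eventually_conj eventually_ge_at_top order_tendstoD(1)[OF L(2) L(1)])
  then obtain y where y: "0 < y powr \<alpha>2 * prob {\<omega>\<in>space M. y < norm (V 0 \<omega>)}" "x \<le> y"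
    using eventually_happens'[OF trivial_limit_at_top_linorder] by blast
  have "0 < prob {\<omega>\<in>space M. y < norm (V 0 \<omega>)}" using y(1) by (simp add: zero_less_mult_iff)
  also have "\<dots> \<le> prob {\<omega>\<in>space M. x < norm (V 0 \<omega>)}"
    using y(2) by (intro finite_measure_mono) auto
  finally show ?thesis .
qed

lemma exceedance_integral:
  fixes f :: "(nat \<Rightarrow> real^2) \<Rightarrow> real"
  assumes f: "f \<in> borel_measurable (PiM I (\<lambda>_. borel))" and I: "finite I"
  shows "(\<integral>y. f y \<partial>exceedance_law M W I x) =
    (\<integral>\<omega>. f (\<lambda>i\<in>I. inverse x *\<^sub>R V i \<omega>) * indicator {\<omega>\<in>space M. x < norm (V 0 \<omega>)} \<omega> \<partial>M) / prob {\<omega>\<in>space M. x < norm (V 0 \<omega>)}"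
proof -
  define U where "U = {\<omega> \<in> space M. norm (W 0 \<omega>) > x}"
  have [measurable]: "U \<in> events" unfolding U_def by measurable
  have Ue: "prob U = prob {\<omega>\<in>space M. x < norm (V 0 \<omega>)}"
    unfolding U_def by (rule finite_measure_eq_AE) (use V_eq[of 0] in auto)
  then have Up: "0 < prob U" using tail_pos by simp
  have vm: "(\<lambda>\<omega>. \<lambda>i\<in>I. inverse x *\<^sub>R W (int i) \<omega>) \<in> measurable M (PiM I (\<lambda>_. borel))"
    and vm': "(\<lambda>\<omega>. \<lambda>i\<in>I. inverse x *\<^sub>R V i \<omega>) \<in> measurable M (PiM I (\<lambda>_. borel))"
    by (rule measurable_restrict, measurable)+
  have fm: "(\<lambda>\<omega>. f (\<lambda>i\<in>I. inverse x *\<^sub>R W (int i) \<omega>)) \<in> borel_measurable M"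
    and fm': "(\<lambda>\<omega>. f (\<lambda>i\<in>I. inverse x *\<^sub>R V i \<omega>)) \<in> borel_measurable M"
    by (rule measurable_compose[OF vm f], rule measurable_compose[OF vm' f])
  have "(\<integral>y. f y \<partial>exceedance_law M W I x) = (\<integral>\<omega>. f (\<lambda>i\<in>I. inverse x *\<^sub>R W (int i) \<omega>) \<partial>uniform_measure M U)"
    unfolding exceedance_law_def U_def by (rule integral_distr[OF _ f]) (use vm in simp)
  also have "\<dots> = (\<integral>\<omega>. f (\<lambda>i\<in>I. inverse x *\<^sub>R W (int i) \<omega>) * indicator U \<omega> \<partial>M) / prob U"
    by (rule uniform_measure_integral[OF _ Up fm]) measurable
  also have "(\<integral>\<omega>. f (\<lambda>i\<in>I. inverse x *\<^sub>R W (int i) \<omega>) * indicator U \<omega> \<partial>M) =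
      (\<integral>\<omega>. f (\<lambda>i\<in>I. inverse x *\<^sub>R V i \<omega>) * indicator {\<omega>\<in>space M. x < norm (V 0 \<omega>)} \<omega> \<partial>M)"
  proof (rule integral_cong_AE)
    have "AE \<omega> in M. \<forall>i\<in>I. V i \<omega> = W (int i) \<omega>" using I by (intro AE_finite_allI V_eq)
    then show "AE \<omega> in M. f (\<lambda>i\<in>I. inverse x *\<^sub>R W (int i) \<omega>) * indicator U \<omega> = f (\<lambda>i\<in>I. inverse x *\<^sub>R V i \<omega>) * indicator {\<omega>\<in>space M. x < norm (V 0 \<omega>)} \<omega>"
      using V_eq[of 0]
    proof eventually_elim
      case (elim \<omega>)
      have "(\<lambda>i\<in>I. inverse x *\<^sub>R W (int i) \<omega>) = (\<lambda>i\<in>I. inverse x *\<^sub>R V i \<omega>)" using elim by (auto simp: restrict_def fun_eq_iff)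
      then show ?case using elim by (simp add: U_def indicator_def)
    qed
  qed (use fm fm' in \<open>auto intro!: borel_measurable_times\<close>)
  finally show ?thesis by (simp only: Ue)
qed

text \<open>\<open>H\<close> concerns the scaled initial state alone, with limit a radius times a
  direction, and \<open>extension\<close> carries it along the coefficients. A general
  \<open>I\<close> serves both {..h} for regular variation and {1..h} for the limit at positive
  times.\<close>

lemma exceedance_weak_limit:
  assumes \<rho>: "prob_space \<rho>" "sets \<rho> = sets borel" and \<sigma>: "prob_space \<sigma>" "sets \<sigma> = sets borel"
    and H: "\<And>(g :: real^2 \<Rightarrow> real) b. continuous_on UNIV g \<Longrightarrow> (\<And>w. \<bar>g w\<bar> \<le> b) \<Longrightarrow>
      ((\<lambda>x. exceedance_mean (V 0) g x) \<longlongrightarrow>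
        (\<integral>\<theta>. (\<integral>y. g (y *\<^sub>R \<theta>) \<partial>\<rho>) \<partial>\<sigma>)) at_top"
    and I: "I \<subseteq> {..h}"
  shows "weakly_converges (exceedance_law M W I)
    (distr (\<rho> \<Otimes>\<^sub>M (\<sigma> \<Otimes>\<^sub>M M)) (PiM I (\<lambda>_. borel)) (\<lambda>(y, \<theta>, \<omega>). \<lambda>i\<in>I. y *\<^sub>R (matprod (\<lambda>j. A j \<omega>) (int i) 1 *v \<theta>))) at_top"
  unfolding weakly_converges_def
proof (intro allI impI, elim conjE)
  fix f :: "(nat \<Rightarrow> real^2) \<Rightarrow> real"
  define \<T> where "\<T> = (\<lambda>(y :: real, \<theta>, \<omega>). \<lambda>i\<in>I. y *\<^sub>R (matprod (\<lambda>j. A j \<omega>) (int i) 1 *v \<theta>))"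
  assume "continuous_on (space (distr (\<rho> \<Otimes>\<^sub>M (\<sigma> \<Otimes>\<^sub>M M)) (PiM I (\<lambda>_. borel)) (\<lambda>(y, \<theta>, \<omega>). \<lambda>i\<in>I. y *\<^sub>R (matprod (\<lambda>j. A j \<omega>) (int i) 1 *v \<theta>)))) f"
    and "bounded (f ` space (distr (\<rho> \<Otimes>\<^sub>M (\<sigma> \<Otimes>\<^sub>M M)) (PiM I (\<lambda>_. borel)) (\<lambda>(y, \<theta>, \<omega>). \<lambda>i\<in>I. y *\<^sub>R (matprod (\<lambda>j. A j \<omega>) (int i) 1 *v \<theta>))))"
  then have fc: "continuous_on (space (PiM I (\<lambda>_. borel))) f" and fb: "bounded (f ` space (PiM I (\<lambda>_. borel)))" by simp_all
  obtain b where b: "\<And>z. z \<in> space (PiM I (\<lambda>_. borel)) \<Longrightarrow> \<bar>f z\<bar> \<le> b"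
    using fb unfolding bounded_iff by auto
  note fm = continuous_on_space_PiM_measurable(2)[OF fc]
  define f' where "f' z = f (restrict z I)" for z
  have f'c: "continuous_on UNIV f'" unfolding f'_def by (rule continuous_on_space_PiM_measurable(1)[OF fc])
  have f'b: "\<bar>f' z\<bar> \<le> b" for z unfolding f'_def by (rule b) (simp add: space_PiM)
  have f'm: "f' \<in> borel_measurable borel" by (rule borel_measurable_continuous_onI[OF f'c])
  have rI: "f (\<lambda>i\<in>I. u i) = f' (\<lambda>i. if i \<in> I then u i else 0)" for u
    unfolding f'_def by (rule arg_cong[where f=f]) (auto simp: restrict_def fun_eq_iff)
  have fI: "finite I" using I finite_subset by blast
  interpret R: prob_space \<rho> by (rule \<rho>)
  interpret S: prob_space \<sigma> by (rule \<sigma>)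
  interpret SR: pair_prob_space \<sigma> \<rho> ..
  note \<rho>(2) [measurable_cong, simp] \<sigma>(2) [measurable_cong, simp]
  define \<nu> where "\<nu> = distr (\<sigma> \<Otimes>\<^sub>M \<rho>) borel (\<lambda>(\<theta>, y). y *\<^sub>R \<theta>)"
  have sm [measurable]: "(\<lambda>(\<theta>, y). y *\<^sub>R \<theta>) \<in> measurable (\<sigma> \<Otimes>\<^sub>M \<rho>) (borel :: (real^2) measure)" by measurable
  have \<nu>: "prob_space \<nu>" unfolding \<nu>_def by (rule SR.P.prob_space_distr[OF sm])
  have \<nu>int: "(\<integral>w. g w \<partial>\<nu>) = (\<integral>\<theta>. (\<integral>y. g (y *\<^sub>R \<theta>) \<partial>\<rho>) \<partial>\<sigma>)"
    if [measurable]: "g \<in> borel_measurable borel" and gb: "\<And>w. \<bar>g w\<bar> \<le> c" for g :: "real^2 \<Rightarrow> real" and c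
  proof -
    have "(\<integral>w. g w \<partial>\<nu>) = (\<integral>z. g (case z of (\<theta>, y) \<Rightarrow> y *\<^sub>R \<theta>) \<partial>(\<sigma> \<Otimes>\<^sub>M \<rho>))"
      unfolding \<nu>_def by (rule integral_distr[OF sm that(1)])
    also have "\<dots> = (\<integral>\<theta>. (\<integral>y. g (case (\<theta>, y) of (\<theta>, y) \<Rightarrow> y *\<^sub>R \<theta>) \<partial>\<rho>) \<partial>\<sigma>)"
      by (rule SR.integral_fst'[symmetric]) (rule SR.P.integrable_const_bound[of _ c], use gb in auto)
    finally show ?thesis by simp
  qed
  have H': "((\<lambda>x. exceedance_mean (V 0) g x) \<longlongrightarrow> (\<integral>w. g w \<partial>\<nu>)) at_top"
    if "continuous_on UNIV g" "\<And>w. \<bar>g w\<bar> \<le> c" for g :: "real^2 \<Rightarrow> real" and c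
    using H[OF that] \<nu>int[OF borel_measurable_continuous_onI[OF that(1)] that(2)] by simp
  have lim: "((\<lambda>x. \<integral>y. f y \<partial>exceedance_law M W I x) \<longlongrightarrow> (\<integral>\<omega>. (\<integral>w. f' (\<lambda>i. if i \<in> I then T.Pi i \<omega> *v w else 0) \<partial>\<nu>) \<partial>M)) at_top"
    unfolding exceedance_integral[OF fm fI] rI
    by (rule T.extension[OF \<nu> _ tail_pos H' f'c f'b I]) (simp_all add: \<nu>_def)
  have Pm: "(\<lambda>\<omega>. matprod (\<lambda>j. A j \<omega>) (int i) 1) \<in> borel_measurable M" for i
    using T.Pim[of i] unfolding Pi_eq[symmetric] by simp
  have km: "(\<lambda>w. f' (\<lambda>i. if i \<in> I then T.Pi i \<omega> *v w else 0)) \<in> borel_measurable borel" for \<omega>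
  proof (rule measurable_compose[OF measurable_coordinatewise_then_product f'm])
    show "(\<lambda>w. if i \<in> I then T.Pi i \<omega> *v w else 0) \<in> borel_measurable borel" for i
      by (cases "i \<in> I") simp_all
  qed
  have Tm: "\<T> \<in> measurable (\<rho> \<Otimes>\<^sub>M (\<sigma> \<Otimes>\<^sub>M M)) (PiM I (\<lambda>_. borel))"
    unfolding \<T>_def case_prod_beta
  proof (rule measurable_restrict)
    fix i
    note Pm[measurable]
    show "(\<lambda>z. fst z *\<^sub>R (matprod (\<lambda>j. A j (snd (snd z))) (int i) 1 *v fst (snd z))) \<in> measurable (\<rho> \<Otimes>\<^sub>M (\<sigma> \<Otimes>\<^sub>M M)) borel"
      using measurable_compose[OF measurable_compose[OF measurable_snd measurable_snd] Pm[of i], of \<rho> \<sigma>]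
      by (intro borel_measurable_scaleR measurable_matrix_vector_mult) measurable
  qed
  have f\<T>: "f (\<T> z) = f' (\<T> z)" for z
    by (auto simp: f'_def \<T>_def restrict_def fun_eq_iff split: prod.splits intro!: arg_cong[where f=f])
  have "(\<integral>y. f y \<partial>distr (\<rho> \<Otimes>\<^sub>M (\<sigma> \<Otimes>\<^sub>M M)) (PiM I (\<lambda>_. borel)) \<T>) = (\<integral>z. f (\<T> z) \<partial>(\<rho> \<Otimes>\<^sub>M (\<sigma> \<Otimes>\<^sub>M M)))"
    by (rule integral_distr[OF Tm fm])
  also have "\<dots> = (\<integral>\<omega>. (\<integral>\<theta>. (\<integral>y. f (\<T> (y, (\<theta>, \<omega>))) \<partial>\<rho>) \<partial>\<sigma>) \<partial>M)"
    by (rule triple_integral[OF \<rho>(1) \<sigma>(1) prob_space_axioms measurable_compose[OF Tm fm], of b]) (simp add: f\<T> f'b)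
  also have "\<dots> = (\<integral>\<omega>. (\<integral>w. f' (\<lambda>i. if i \<in> I then T.Pi i \<omega> *v w else 0) \<partial>\<nu>) \<partial>M)"
  proof (rule Bochner_Integration.integral_cong[OF refl])
    fix \<omega>
    have "f (\<T> (y, (\<theta>, \<omega>))) = f' (\<lambda>i. if i \<in> I then T.Pi i \<omega> *v (y *\<^sub>R \<theta>) else 0)" for y \<theta>
      unfolding \<T>_def by (simp only: prod.case rI Pi_eq matrix_vector_mult_scaleR)
    then show "(\<integral>\<theta>. (\<integral>y. f (\<T> (y, (\<theta>, \<omega>))) \<partial>\<rho>) \<partial>\<sigma>) = (\<integral>w. f' (\<lambda>i. if i \<in> I then T.Pi i \<omega> *v w else 0) \<partial>\<nu>)"
      by (subst \<nu>int[OF km, of _ b]) (simp_all add: f'b)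
  qed
  finally show "((\<lambda>x. \<integral>y. f y \<partial>exceedance_law M W I x) \<longlongrightarrow> (\<integral>y. f y \<partial>distr (\<rho> \<Otimes>\<^sub>M (\<sigma> \<Otimes>\<^sub>M M)) (PiM I (\<lambda>_. borel)) (\<lambda>(y, \<theta>, \<omega>). \<lambda>i\<in>I. y *\<^sub>R (matprod (\<lambda>j. A j \<omega>) (int i) 1 *v \<theta>)))) at_top"
    using lim by (simp only: \<T>_def)
qed


text \<open>Dividing the limit at scale x^\<alpha>2 by that of the tail of the norm turns it into a
  conditional statement; the positivity of \<open>L\<close> permits the division.\<close>

lemma spectral_angle:
  "\<exists>\<sigma>. prob_space \<sigma> \<and> sets \<sigma> = sets borel \<and> (AE \<theta> in \<sigma>. norm \<theta> = 1) \<and>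
    (\<forall>(g :: real^2 \<Rightarrow> real) b. continuous_on UNIV g \<longrightarrow> (\<forall>w. \<bar>g w\<bar> \<le> b) \<longrightarrow>
      ((\<lambda>x. exceedance_mean (V 0) g x) \<longlongrightarrow>
        (\<integral>\<theta>. (\<integral>y. g (y *\<^sub>R \<theta>) \<partial>pareto \<alpha>2) \<partial>\<sigma>)) at_top)"
proof -
  obtain \<sigma> L where L: "0 < L" and \<sigma>: "prob_space \<sigma>" "sets \<sigma> = sets borel" "AE \<theta> in \<sigma>. norm \<theta> = 1"
    and P: "((\<lambda>x. x powr \<alpha>2 * prob {\<omega>\<in>space M. x < norm (V 0 \<omega>)}) \<longlongrightarrow> L) at_top"
    and H: "\<forall>f :: real^2 \<Rightarrow> real. continuous_on UNIV f \<longrightarrow> (\<exists>B. \<forall>w. \<bar>f w\<bar> \<le> B) \<longrightarrow>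
      ((\<lambda>x. x powr \<alpha>2 * (\<integral>\<omega>. f (inverse x *\<^sub>R V 0 \<omega>) * indicator {\<omega>\<in>space M. x < norm (V 0 \<omega>)} \<omega> \<partial>M)) \<longlongrightarrow>
        L * (\<integral>\<theta>. (\<integral>y. f (y *\<^sub>R \<theta>) \<partial>pareto \<alpha>2) \<partial>\<sigma>)) at_top"
    using T.W0_spectral by blast
  show ?thesis
  proof (intro exI[of _ \<sigma>] conjI \<sigma> allI impI)
    fix g :: "real^2 \<Rightarrow> real" and b assume g: "continuous_on UNIV g" "\<forall>w. \<bar>g w\<bar> \<le> b"
    have 1: "((\<lambda>x. x powr \<alpha>2 * (\<integral>\<omega>. g (inverse x *\<^sub>R V 0 \<omega>) * indicator {\<omega>\<in>space M. x < norm (V 0 \<omega>)} \<omega> \<partial>M)) \<longlongrightarrow>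
        L * (\<integral>\<theta>. (\<integral>y. g (y *\<^sub>R \<theta>) \<partial>pareto \<alpha>2) \<partial>\<sigma>)) at_top"
      using H g by blast
    have "((\<lambda>x. (x powr \<alpha>2 * (\<integral>\<omega>. g (inverse x *\<^sub>R V 0 \<omega>) * indicator {\<omega>\<in>space M. x < norm (V 0 \<omega>)} \<omega> \<partial>M)) / (x powr \<alpha>2 * prob {\<omega>\<in>space M. x < norm (V 0 \<omega>)})) \<longlongrightarrow>
        (L * (\<integral>\<theta>. (\<integral>y. g (y *\<^sub>R \<theta>) \<partial>pareto \<alpha>2) \<partial>\<sigma>)) / L) at_top"
      using L by (intro tendsto_divide 1 P) simp
    then have 2: "((\<lambda>x. (x powr \<alpha>2 * (\<integral>\<omega>. g (inverse x *\<^sub>R V 0 \<omega>) * indicator {\<omega>\<in>space M. x < norm (V 0 \<omega>)} \<omega> \<partial>M)) / (x powr \<alpha>2 * prob {\<omega>\<in>space M. x < norm (V 0 \<omega>)})) \<longlongrightarrow>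
        (\<integral>\<theta>. (\<integral>y. g (y *\<^sub>R \<theta>) \<partial>pareto \<alpha>2) \<partial>\<sigma>)) at_top"
      using L by simp
    show "((\<lambda>x. exceedance_mean (V 0) g x) \<longlongrightarrow>
        (\<integral>\<theta>. (\<integral>y. g (y *\<^sub>R \<theta>) \<partial>pareto \<alpha>2) \<partial>\<sigma>)) at_top"
      by (rule Lim_transform_eventually[OF 2]) (use eventually_gt_at_top[of "0::real"] in \<open>eventually_elim, simp\<close>)
  qed
qed

text \<open>The candidate \<open>\<tau>\<close> is the law of the matrix products applied to an
  independent direction \<theta>, and \<open>\<nu>\<close> attaches an independent Pareto radius.
  The product at index 0 is the identity, so the first component is \<theta> itself and has norm
  1.\<close>

lemma spectral_process_exists: "\<exists>\<tau>. spectral_process_law M W \<alpha>2 h \<tau>"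
proof -
  obtain \<sigma> where \<sigma>: "prob_space \<sigma>" "sets \<sigma> = sets borel" "AE \<theta> in \<sigma>. norm \<theta> = 1"
    and H': "\<forall>(g :: real^2 \<Rightarrow> real) b. continuous_on UNIV g \<longrightarrow> (\<forall>w. \<bar>g w\<bar> \<le> b) \<longrightarrow>
      ((\<lambda>x. exceedance_mean (V 0) g x) \<longlongrightarrow>
        (\<integral>\<theta>. (\<integral>y. g (y *\<^sub>R \<theta>) \<partial>pareto \<alpha>2) \<partial>\<sigma>)) at_top"
    using spectral_angle by blast
  have H: "((\<lambda>x. exceedance_mean (V 0) g x) \<longlongrightarrow>
        (\<integral>\<theta>. (\<integral>y. g (y *\<^sub>R \<theta>) \<partial>pareto \<alpha>2) \<partial>\<sigma>)) at_top"
    if "continuous_on UNIV g" "\<And>w. \<bar>g w\<bar> \<le> b" for g :: "real^2 \<Rightarrow> real" and b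
    using H' that by blast
  interpret S: prob_space \<sigma> by (rule \<sigma>)
  interpret R: prob_space "pareto \<alpha>2" by (rule prob_space_pareto[OF \<alpha>2])
  interpret SM: pair_prob_space \<sigma> M ..
  note \<sigma>(2) [measurable_cong, simp]
  define N where "N = (PiM {..h} (\<lambda>_. borel) :: (nat \<Rightarrow> real^2) measure)"
  define \<T> where "\<T> = (\<lambda>(\<theta>, \<omega>). \<lambda>i\<in>{..h}. matprod (\<lambda>j. A j \<omega>) (int i) 1 *v \<theta>)"
  define \<S> where "\<S> = (\<lambda>(r :: real, \<theta> :: nat \<Rightarrow> real^2). \<lambda>i\<in>{..h}. r *\<^sub>R \<theta> i)"
  define \<tau> where "\<tau> = distr (\<sigma> \<Otimes>\<^sub>M M) N \<T>"
  define \<nu> where "\<nu> = distr (pareto \<alpha>2 \<Otimes>\<^sub>M \<tau>) N \<S>"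
  have Pm: "(\<lambda>\<omega>. matprod (\<lambda>j. A j \<omega>) (int i) 1) \<in> borel_measurable M" for i
    using T.Pim[of i] unfolding Pi_eq[symmetric] by simp
  have Tm [measurable]: "\<T> \<in> measurable (\<sigma> \<Otimes>\<^sub>M M) N"
    unfolding \<T>_def N_def case_prod_beta
  proof (rule measurable_restrict)
    fix i
    show "(\<lambda>z. matprod (\<lambda>j. A j (snd z)) (int i) 1 *v fst z) \<in> measurable (\<sigma> \<Otimes>\<^sub>M M) borel"
    proof (rule measurable_matrix_vector_mult[OF measurable_compose[OF measurable_snd Pm]])
      show "fst \<in> borel_measurable (\<sigma> \<Otimes>\<^sub>M M)"
        using measurable_fst[of \<sigma> M] by (simp cong: measurable_cong_sets)
    qed
  qed
  have \<tau>p: "prob_space \<tau>" unfolding \<tau>_def by (rule SM.P.prob_space_distr[OF Tm])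
  interpret T': prob_space \<tau> by (rule \<tau>p)
  interpret RT: pair_prob_space "pareto \<alpha>2" \<tau> ..
  have \<tau>s [measurable_cong, simp]: "sets \<tau> = sets N" by (simp add: \<tau>_def)
  have comp: "(\<lambda>\<theta>. \<theta> i) \<in> borel_measurable N" if "i \<in> {..h}" for i
    unfolding N_def using that by (rule measurable_component_singleton)
  have Sm [measurable]: "\<S> \<in> measurable (pareto \<alpha>2 \<Otimes>\<^sub>M \<tau>) N"
    unfolding \<S>_def N_def case_prod_beta
  proof (rule measurable_restrict)
    fix i assume i: "i \<in> {..h}"
    have "(\<lambda>z. snd z i) \<in> measurable (pareto \<alpha>2 \<Otimes>\<^sub>M \<tau>) borel"
      by (rule measurable_compose[OF measurable_snd]) (use comp[OF i] in \<open>simp cong: measurable_cong_sets\<close>)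
    then show "(\<lambda>z. fst z *\<^sub>R snd z i) \<in> measurable (pareto \<alpha>2 \<Otimes>\<^sub>M \<tau>) borel" by measurable
  qed
  have \<nu>p: "prob_space \<nu>" unfolding \<nu>_def by (rule RT.P.prob_space_distr[OF Sm])
  have n0: "(\<lambda>\<theta>. norm (\<theta> 0)) \<in> borel_measurable N"
  proof -
    have [measurable]: "(\<lambda>\<theta>. \<theta> 0) \<in> borel_measurable N" by (rule comp) simp
    show ?thesis by measurable
  qed
  have \<tau>1: "AE \<theta> in \<tau>. norm (\<theta> 0) = 1"
  proof -
    have set: "{\<theta> \<in> space N. norm (\<theta> 0) = 1} \<in> sets N"
      using n0 by (rule borel_measurable_eq) simp
    have a: "AE z in \<sigma> \<Otimes>\<^sub>M M. norm (fst z) = 1"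
    proof (rule SM.AE_pair_measure)
      show "{z \<in> space (\<sigma> \<Otimes>\<^sub>M M). norm (fst z) = 1} \<in> sets (\<sigma> \<Otimes>\<^sub>M M)" by measurable
      show "AE \<theta> in \<sigma>. AE \<omega> in M. norm (fst (\<theta>, \<omega>)) = 1" using \<sigma>(3) by simp
    qed
    have "AE z in \<sigma> \<Otimes>\<^sub>M M. norm (\<T> z 0) = 1"
      using a by eventually_elim (simp add: \<T>_def case_prod_beta matprod_0)
    then show ?thesis unfolding \<tau>_def by (subst AE_distr_iff[OF Tm set])
  qed
  \<comment> \<open>With r > 1 and norm 1 at index 0, the norm of the scaled component is r, so the
    radius can be read off from \<open>\<nu>\<close>.\<close>
  have radial: "distr \<nu> borel (\<lambda>y. norm (y 0)) = pareto \<alpha>2"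
  proof -
    have "distr \<nu> borel (\<lambda>y. norm (y 0)) = distr (pareto \<alpha>2 \<Otimes>\<^sub>M \<tau>) borel (\<lambda>z. norm (\<S> z 0))"
      unfolding \<nu>_def by (subst distr_distr[OF n0 Sm]) (simp add: comp_def)
    also have "\<dots> = distr (pareto \<alpha>2 \<Otimes>\<^sub>M \<tau>) borel fst"
    proof (rule distr_cong_AE)
      have nm: "(\<lambda>z. norm (snd z 0)) \<in> borel_measurable (pareto \<alpha>2 \<Otimes>\<^sub>M \<tau>)"
        by (rule measurable_compose[OF measurable_snd]) (use n0 in \<open>simp cong: measurable_cong_sets\<close>)
      have "AE z in pareto \<alpha>2 \<Otimes>\<^sub>M \<tau>. 1 < fst z \<and> norm (snd z 0) = 1"
      proof (rule RT.AE_pair_measure)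
        note nm[measurable]
        show "{z \<in> space (pareto \<alpha>2 \<Otimes>\<^sub>M \<tau>). 1 < fst z \<and> norm (snd z 0) = 1} \<in> sets (pareto \<alpha>2 \<Otimes>\<^sub>M \<tau>)" by measurable
        show "AE r in pareto \<alpha>2. AE \<theta> in \<tau>. 1 < fst (r, \<theta>) \<and> norm (snd (r, \<theta>) 0) = 1"
          using AE_pareto[OF \<alpha>2] by eventually_elim (use \<tau>1 in simp)
      qed
      then show "AE z in pareto \<alpha>2 \<Otimes>\<^sub>M \<tau>. norm (\<S> z 0) = fst z"
        by eventually_elim (simp add: \<S>_def case_prod_beta)
      show "(\<lambda>z. norm (\<S> z 0)) \<in> borel_measurable (pareto \<alpha>2 \<Otimes>\<^sub>M \<tau>)" by (rule measurable_compose[OF Sm n0])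
      show "fst \<in> borel_measurable (pareto \<alpha>2 \<Otimes>\<^sub>M \<tau>)" using measurable_fst[of "pareto \<alpha>2" \<tau>] by (simp cong: measurable_cong_sets)
    qed simp_all
    also have "\<dots> = distr (pareto \<alpha>2 \<Otimes>\<^sub>M \<tau>) (pareto \<alpha>2) fst" by (rule distr_cong) simp_all
    also have "\<dots> = pareto \<alpha>2" by (rule T'.distr_pair_fst)
    finally show ?thesis .
  qed
  have \<nu>_eq: "\<nu> = distr (pareto \<alpha>2 \<Otimes>\<^sub>M (\<sigma> \<Otimes>\<^sub>M M)) N (\<lambda>(y, \<theta>, \<omega>). \<lambda>i\<in>{..h}. y *\<^sub>R (matprod (\<lambda>j. A j \<omega>) (int i) 1 *v \<theta>))"
  proof -
    interpret D: prob_space "distr (\<sigma> \<Otimes>\<^sub>M M) N \<T>" using \<tau>p by (simp add: \<tau>_def)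
    have "pareto \<alpha>2 \<Otimes>\<^sub>M \<tau> = distr (pareto \<alpha>2) (pareto \<alpha>2) (\<lambda>y. y) \<Otimes>\<^sub>M distr (\<sigma> \<Otimes>\<^sub>M M) N \<T>"
      by (simp add: \<tau>_def)
    also have "\<dots> = distr (pareto \<alpha>2 \<Otimes>\<^sub>M (\<sigma> \<Otimes>\<^sub>M M)) (pareto \<alpha>2 \<Otimes>\<^sub>M N) (\<lambda>(x, y). (x, \<T> y))"
      by (rule pair_measure_distr) (auto intro: D.sigma_finite_measure_axioms)
    finally have 1: "pareto \<alpha>2 \<Otimes>\<^sub>M \<tau> = distr (pareto \<alpha>2 \<Otimes>\<^sub>M (\<sigma> \<Otimes>\<^sub>M M)) (pareto \<alpha>2 \<Otimes>\<^sub>M N) (\<lambda>(x, y). (x, \<T> y))" .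
    have Sm': "\<S> \<in> measurable (pareto \<alpha>2 \<Otimes>\<^sub>M N) N"
      using Sm by (simp add: measurable_cong_sets[OF sets_pair_measure_cong[OF refl \<tau>s] refl])
    have "\<nu> = distr (distr (pareto \<alpha>2 \<Otimes>\<^sub>M (\<sigma> \<Otimes>\<^sub>M M)) (pareto \<alpha>2 \<Otimes>\<^sub>M N) (\<lambda>(x, y). (x, \<T> y))) N \<S>"
      unfolding \<nu>_def 1 ..
    also have "\<dots> = distr (pareto \<alpha>2 \<Otimes>\<^sub>M (\<sigma> \<Otimes>\<^sub>M M)) N (\<S> \<circ> (\<lambda>(x, y). (x, \<T> y)))"
      by (rule distr_distr[OF Sm']) measurable
    also have "\<S> \<circ> (\<lambda>(x, y). (x, \<T> y)) = (\<lambda>(y, \<theta>, \<omega>). \<lambda>i\<in>{..h}. y *\<^sub>R (matprod (\<lambda>j. A j \<omega>) (int i) 1 *v \<theta>))"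
      by (auto simp: \<S>_def \<T>_def fun_eq_iff restrict_def)
    finally show ?thesis .
  qed
  have "spectral_process_law M W \<alpha>2 h \<tau>"
    unfolding spectral_process_law_def
  proof (intro conjI exI[of _ \<nu>])
    show "sets \<tau> = sets (PiM {..h} (\<lambda>_. borel))" by (simp add: N_def)
    show "sets \<nu> = sets (PiM {..h} (\<lambda>_. borel))" by (simp add: \<nu>_def N_def)
    show "weakly_converges (exceedance_law M W {..h}) \<nu> at_top"
      unfolding \<nu>_eq N_def by (rule exceedance_weak_limit[OF prob_space_pareto[OF \<alpha>2] sets_pareto \<sigma>(1,2) H order_refl])
    show "pareto_law \<alpha>2 (distr \<nu> borel (\<lambda>y. norm (y 0)))"
      unfolding radial pareto_law_def using measure_pareto[OF \<alpha>2] real_distribution_pareto[OF \<alpha>2] by simp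
    show "\<nu> = distr (distr \<nu> borel (\<lambda>y. norm (y 0)) \<Otimes>\<^sub>M \<tau>) (PiM {..h} (\<lambda>_. borel)) (\<lambda>(r, \<theta>). \<lambda>i\<in>{..h}. r *\<^sub>R \<theta> i)"
      unfolding radial by (simp only: \<nu>_def N_def \<S>_def)
  qed (fact \<tau>p \<tau>1 \<nu>p)+
  then show ?thesis ..
qed

text \<open>The spectral measure is given only through its defining property. The joint limit of
  radius and direction for the initial state is therefore read off first from the law at h = 0, and
  is then extended to positive times.\<close>

lemma forward_limit:
  assumes \<rho>: "pareto_law \<alpha>2 \<rho>" and \<sigma>: "spectral_measure M W \<alpha>2 \<sigma>"
  shows "weakly_converges (exceedance_law M W {1..h})
    (distr (\<rho> \<Otimes>\<^sub>M (\<sigma> \<Otimes>\<^sub>M M)) (PiM {1..h} (\<lambda>_. borel)) (\<lambda>(y, \<theta>, \<omega>). \<lambda>i\<in>{1..h}. y *\<^sub>R (matprod (\<lambda>j. A j \<omega>) (int i) 1 *v \<theta>))) at_top"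
proof -
  obtain \<tau> \<nu> where \<tau>: "prob_space \<tau>" "sets \<tau> = sets (PiM {..0} (\<lambda>_. borel))" and \<sigma>_eq: "\<sigma> = distr \<tau> borel (\<lambda>\<theta>. \<theta> 0)"
    and \<nu>: "prob_space \<nu>" "sets \<nu> = sets (PiM {..0} (\<lambda>_. borel))"
    and wc: "weakly_converges (exceedance_law M W {..0}) \<nu> at_top"
    and pl: "pareto_law \<alpha>2 (distr \<nu> borel (\<lambda>y. norm (y 0)))"
    and \<nu>_eq: "\<nu> = distr (distr \<nu> borel (\<lambda>y. norm (y 0)) \<Otimes>\<^sub>M \<tau>) (PiM {..0} (\<lambda>_. borel)) (\<lambda>(r, \<theta>). \<lambda>i\<in>{..0}. r *\<^sub>R \<theta> i)"
    using \<sigma> unfolding spectral_measure_def spectral_process_law_def by (elim exE conjE) blast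
  \<comment> \<open>The given radial law and the one hidden in the spectral measure both equal
    \<open>pareto \<alpha>2\<close>, so they can be identified with each other.\<close>
  have \<rho>p: "\<rho> = pareto \<alpha>2" by (rule pareto_law_unique[OF \<alpha>2 \<rho>])
  have rad: "distr \<nu> borel (\<lambda>y. norm (y 0)) = \<rho>" using pareto_law_unique[OF \<alpha>2 pl] \<rho>p by simp
  interpret R: prob_space \<rho> unfolding \<rho>p by (rule prob_space_pareto[OF \<alpha>2])
  interpret T': prob_space \<tau> by (rule \<tau>)
  interpret TR: pair_prob_space \<rho> \<tau> ..
  have \<rho>s [measurable_cong, simp]: "sets \<rho> = sets borel" by (simp add: \<rho>p)
  note \<tau>(2) [measurable_cong, simp]
  have c0: "(\<lambda>\<theta>. \<theta> 0) \<in> borel_measurable (PiM {..0::nat} (\<lambda>_. borel :: (real^2) measure))"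
    by (rule measurable_component_singleton) simp
  then have c\<tau> [measurable]: "(\<lambda>\<theta>. \<theta> 0) \<in> borel_measurable \<tau>" by (simp cong: measurable_cong_sets)
  have \<sigma>p: "prob_space \<sigma>" "sets \<sigma> = sets borel" unfolding \<sigma>_eq by (rule T'.prob_space_distr[OF c\<tau>]) simp
  have Sm: "(\<lambda>(r, \<theta>). \<lambda>i\<in>{..0::nat}. r *\<^sub>R (\<theta> i :: real^2)) \<in> measurable (\<rho> \<Otimes>\<^sub>M \<tau>) (PiM {..0} (\<lambda>_. borel))"
    unfolding case_prod_beta
  proof (rule measurable_restrict)
    fix i :: nat assume "i \<in> {..0}"
    then show "(\<lambda>z. fst z *\<^sub>R snd z i) \<in> measurable (\<rho> \<Otimes>\<^sub>M \<tau>) borel"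
      using measurable_compose[OF measurable_snd c\<tau>, of \<rho>] by simp
  qed
  have H: "((\<lambda>x. exceedance_mean (V 0) g x) \<longlongrightarrow>
        (\<integral>\<theta>. (\<integral>y. g (y *\<^sub>R \<theta>) \<partial>\<rho>) \<partial>\<sigma>)) at_top"
    if g: "continuous_on UNIV g" and b: "\<And>w. \<bar>g w\<bar> \<le> b" for g :: "real^2 \<Rightarrow> real" and b
  proof -
    have gm [measurable]: "g \<in> borel_measurable borel" by (rule borel_measurable_continuous_onI[OF g])
    have fm: "(\<lambda>y. g (y 0)) \<in> borel_measurable (PiM {..0::nat} (\<lambda>_. borel))" by (rule measurable_compose[OF c0 gm])
    have "continuous_on (space \<nu>) (\<lambda>y. g (y 0))"
      using continuous_on_compose2[OF g continuous_on_product_coordinates[of 0]]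
      by (rule continuous_on_subset[of UNIV]) simp_all
    moreover have "bounded ((\<lambda>y. g (y 0)) ` space \<nu>)"
      unfolding bounded_iff using b by auto
    ultimately have "((\<lambda>x. \<integral>y. g (y 0) \<partial>exceedance_law M W {..0} x) \<longlongrightarrow> (\<integral>y. g (y 0) \<partial>\<nu>)) at_top"
      using wc unfolding weakly_converges_def by blast
    moreover have "(\<integral>y. g (y 0) \<partial>exceedance_law M W {..0} x) =
        exceedance_mean (V 0) g x" for x
      by (subst exceedance_integral[OF fm]) simp_all
    moreover have "(\<integral>y. g (y 0) \<partial>\<nu>) = (\<integral>\<theta>. (\<integral>y. g (y *\<^sub>R \<theta>) \<partial>\<rho>) \<partial>\<sigma>)"
    proof -
      have "(\<integral>y. g (y 0) \<partial>\<nu>) = (\<integral>z. g ((case z of (r, \<theta>) \<Rightarrow> \<lambda>i\<in>{..0}. r *\<^sub>R \<theta> i) 0) \<partial>(\<rho> \<Otimes>\<^sub>M \<tau>))"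
        by (subst \<nu>_eq, subst rad, rule integral_distr[OF Sm fm])
      also have "\<dots> = (\<integral>z. g (fst z *\<^sub>R snd z 0) \<partial>(\<rho> \<Otimes>\<^sub>M \<tau>))"
        by (rule Bochner_Integration.integral_cong) (auto simp: case_prod_beta)
      also have "\<dots> = (\<integral>\<theta>. (\<integral>r. g (r *\<^sub>R \<theta> 0) \<partial>\<rho>) \<partial>\<tau>)"
      proof -
        have [measurable]: "(\<lambda>z. snd z 0) \<in> borel_measurable (\<rho> \<Otimes>\<^sub>M \<tau>)" by (rule measurable_compose[OF measurable_snd c\<tau>])
        have "integrable (\<rho> \<Otimes>\<^sub>M \<tau>) (\<lambda>z. g (fst z *\<^sub>R snd z 0))"
          by (rule TR.P.integrable_const_bound[of _ b]) (use b in auto)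
        then show ?thesis using TR.integral_snd[of "\<lambda>r \<theta>. g (r *\<^sub>R \<theta> 0)"] by (simp add: case_prod_beta')
      qed
      also have "\<dots> = (\<integral>\<theta>. (\<integral>y. g (y *\<^sub>R \<theta>) \<partial>\<rho>) \<partial>\<sigma>)"
        unfolding \<sigma>_eq by (rule integral_distr[OF c\<tau>, symmetric]) measurable
      finally show ?thesis .
    qed
    ultimately show ?thesis by simp
  qed
  show ?thesis
    by (rule exceedance_weak_limit[OF R.prob_space_axioms \<rho>s \<sigma>p H, where h=h]) auto
qed

end

theorem proposition3p4:
  fixes M :: "'a measure"
    and A :: "int \<Rightarrow> 'a \<Rightarrow> real^2^2"
    and B W :: "int \<Rightarrow> 'a \<Rightarrow> real^2"
    and \<alpha>1 \<alpha>2 :: real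
  assumes "prob_space M"
    and "iid M (\<lambda>t \<omega>. (A t \<omega>, B t \<omega>))"
    and "\<And>t. AE \<omega> in M. A t \<omega> $ 2 $ 1 = 0"
    and "\<And>t. AE \<omega> in M. A t \<omega> $ 1 $ 1 > 0 \<and> A t \<omega> $ 1 $ 2 > 0 \<and> A t \<omega> $ 2 $ 2 > 0"
    and "\<And>t. AE \<omega> in M. B t \<omega> $ 1 > 0 \<and> B t \<omega> $ 2 > 0"
    and "non_arithmetic M (\<lambda>\<omega>. ln (A 0 \<omega> $ 1 $ 1))"
    and "non_arithmetic M (\<lambda>\<omega>. ln (A 0 \<omega> $ 2 $ 2))"
    and "\<alpha>1 > \<alpha>2" and "\<alpha>2 > 0"
    and "integrable M (\<lambda>\<omega>. (A 0 \<omega> $ 1 $ 1) powr \<alpha>1)"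
    and "(\<integral>\<omega>. (A 0 \<omega> $ 1 $ 1) powr \<alpha>1 \<partial>M) = 1"
    and "integrable M (\<lambda>\<omega>. (A 0 \<omega> $ 1 $ 1) powr \<alpha>1 * max (ln (A 0 \<omega> $ 1 $ 1)) 0)"
    and "integrable M (\<lambda>\<omega>. (B 0 \<omega> $ 1) powr \<alpha>1)"
    and "integrable M (\<lambda>\<omega>. (A 0 \<omega> $ 2 $ 2) powr \<alpha>2)"
    and "(\<integral>\<omega>. (A 0 \<omega> $ 2 $ 2) powr \<alpha>2 \<partial>M) = 1"
    and "integrable M (\<lambda>\<omega>. (A 0 \<omega> $ 2 $ 2) powr \<alpha>2 * max (ln (A 0 \<omega> $ 2 $ 2)) 0)"
    and "integrable M (\<lambda>\<omega>. (B 0 \<omega> $ 2) powr \<alpha>2)"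
    and "integrable M (\<lambda>\<omega>. (A 0 \<omega> $ 1 $ 2) powr \<alpha>2)"
    and "causal_solution M A B W"
  shows "regularly_varying M W \<alpha>2 \<and>
    (\<forall>\<rho> \<sigma>. pareto_law \<alpha>2 \<rho> \<and> spectral_measure M W \<alpha>2 \<sigma> \<longrightarrow>
      (\<forall>h::nat. h \<ge> 1 \<longrightarrow>
        weakly_converges (exceedance_law M W {1..h})
          (distr (\<rho> \<Otimes>\<^sub>M (\<sigma> \<Otimes>\<^sub>M M)) (\<Pi>\<^sub>M i\<in>{1..h}. borel)
            (\<lambda>(y, \<theta>, \<omega>). \<lambda>i\<in>{1..h}. y *\<^sub>R (matprod (\<lambda>j. A j \<omega>) (int i) 1 *v \<theta>)))
          at_top))"
proof -
  interpret triangular_process M A B W \<alpha>1 \<alpha>2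
    by (rule triangular_process.intro) (fact assms)+
  show ?thesis
    unfolding regularly_varying_def
    using stationary \<alpha>2 spectral_process_exists forward_limit by blast
qed

end
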